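(* Let $D\subset\mathbb{R}^d$ be a Lipschitz domain, let $f\in L_\infty(D)$ with $f\ge c_f>0$, and let $a,b\in\mathcal{A}_s$ for some $\frac12<s\le 1$. Let $u_a,u_b\in H^1_0(D)$ be the corresponding weak solutions with right side $f$. Suppose that for some $\theta$ with $\frac{1-s}{s}<\theta\le 1$ and some constant $M$, $$\|\nabla u_a\|_{L_{2/(1-\theta)}(D)}\le M\quad\text{and}\quad \|\nabla u_b\|_{L_{2/(1-\theta)}(D)}\le M$$ (with $L_{2/(1-\theta)}=L_\infty$ when $\theta=1$). Then $$\|a-b\|_{L_2(D)}\le C\sqrt{1+\bigl(\|a\|_{H^s(D)}+\|b\|_{H^s(D)}\bigr)^{\frac{1}{3s}}}\;\|u_a-u_b\|_{H^1_0(D)}^{\frac16-\frac{1-s}{6s\theta}},$$ where $C$ is a constant depending only on $D,d,\theta,\lambda,\Lambda$, the minimum $c_f$ of $f$, $\|f\|_{L_\infty(D)}$, and $M$.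
   Context: $D\subset\mathbb{R}^d$, $d\ge 2$, is a bounded domain (open, connected). $\lambda,\Lambda$ are fixed positive constants and $\mathcal{A}:=\{a\in L_\infty(D):\lambda\le a\le\Lambda\}$. For $s>0$, $\mathcal{A}_s:=\{a\in\mathcal{A}:\|a\|_{H^s(D)}\le N\}$, where $N>0$ is arbitrary but fixed. $H^1_0(D)$ is equipped with the norm $\|v\|_{H^1_0(D)}=\|\nabla v\|_{L_2(D)}$. For $a\in\mathcal{A}$ and the fixed right side $f$, $u_a\in H^1_0(D)$ is the unique weak solution of $-\mathrm{div}(a\nabla u_a)=f$ on $D$, $u_a=0$ on $\partial D$, i.e. $\int_D a\nabla u_a\cdot\nabla v=\int_D fv$ for all $v\in H^1_0(D)$. *)

theory Defs
  imports "HOL-Analysis.Analysis" "HOL-Probability.Essential_Supremum"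
begin

text \<open>Functions on an open set \<open>D\<close> are represented by total functions on the ambient Euclidean space;
only their values almost everywhere on \<open>D\<close> (Lebesgue measure) matter.\<close>

text \<open>In the orthogonal decomposition of \<open>x\<close> into its \<open>e\<close>-component \<open>x \<bullet> e\<close> and its projection
\<open>x - (x \<bullet> e) *\<^sub>R e\<close> onto the hyperplane orthogonal to the unit vector \<open>e\<close>, the set \<open>D\<close> is, near every
boundary point, the region strictly above the graph of a Lipschitz function on that hyperplane.\<close>

definition lipschitz_boundary :: "'a::euclidean_space set \<Rightarrow> bool" where
  "lipschitz_boundary D \<longleftrightarrow>
     (\<forall>p \<in> frontier D. \<exists>e \<gamma> L U.
        norm e = 1 \<and> L-lipschitz_on {y. y \<bullet> e = 0} (\<gamma> :: 'a \<Rightarrow> real) \<and> open U \<and> p \<in> U \<and>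
        D \<inter> U = {x \<in> U. \<gamma> (x - (x \<bullet> e) *\<^sub>R e) < x \<bullet> e})"

definition bounded_lipschitz_domain :: "'a::euclidean_space set \<Rightarrow> bool" where
  "bounded_lipschitz_domain D \<longleftrightarrow>
     D \<noteq> {} \<and> open D \<and> connected D \<and> bounded D \<and> lipschitz_boundary D"

text \<open>The norm with values in \<open>[0, \<infinity>]\<close>, for exponents in \<open>[1, \<infinity>]\<close>.\<close>

definition Lp_enorm :: "'a::euclidean_space set \<Rightarrow> ennreal \<Rightarrow> ('a \<Rightarrow> 'b::real_normed_vector) \<Rightarrow> ennreal" where
  "Lp_enorm D p f =
     (if p = \<infinity> then esssup (lebesgue_on D) (\<lambda>x. ennreal (norm (f x)))
      else (let I = (\<integral>\<^sup>+ x. ennreal (norm (f x) powr enn2real p) \<partial>lebesgue_on D)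
            in if I = \<infinity> then \<infinity> else ennreal (enn2real I powr (1 / enn2real p))))"

definition Lp_space :: "'a::euclidean_space set \<Rightarrow> ennreal \<Rightarrow> ('a \<Rightarrow> 'b::real_normed_vector) set" where
  "Lp_space D p = {f \<in> borel_measurable (lebesgue_on D). Lp_enorm D p f < \<infinity>}"

definition Lp_norm :: "'a::euclidean_space set \<Rightarrow> ennreal \<Rightarrow> ('a \<Rightarrow> 'b::real_normed_vector) \<Rightarrow> real" where
  "Lp_norm D p f = enn2real (Lp_enorm D p f)"

primrec times_cont_diff :: "nat \<Rightarrow> ('a::euclidean_space \<Rightarrow> real) \<Rightarrow> bool" where
  "times_cont_diff 0 \<phi> \<longleftrightarrow> continuous_on UNIV \<phi>"
| "times_cont_diff (Suc k) \<phi> \<longleftrightarrow>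
     (\<forall>x. \<phi> differentiable (at x)) \<and>
     (\<forall>i\<in>Basis. times_cont_diff k (\<lambda>x. frechet_derivative \<phi> (at x) i))"

definition test_function :: "'a::euclidean_space set \<Rightarrow> ('a \<Rightarrow> real) \<Rightarrow> bool" where
  "test_function D \<phi> \<longleftrightarrow>
     (\<forall>k. times_cont_diff k \<phi>) \<and> compact (closure {x. \<phi> x \<noteq> 0}) \<and> closure {x. \<phi> x \<noteq> 0} \<subseteq> D"

definition grad :: "('a::euclidean_space \<Rightarrow> real) \<Rightarrow> 'a \<Rightarrow> 'a" where
  "grad \<phi> x = (\<Sum>i\<in>Basis. frechet_derivative \<phi> (at x) i *\<^sub>R i)"

definition locally_integrable :: "'a::euclidean_space set \<Rightarrow> ('a \<Rightarrow> 'b::euclidean_space) \<Rightarrow> bool" where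
  "locally_integrable D f \<longleftrightarrow> (\<forall>K. compact K \<and> K \<subseteq> D \<longrightarrow> integrable (lebesgue_on K) f)"

definition has_weak_gradient ::
    "'a::euclidean_space set \<Rightarrow> ('a \<Rightarrow> real) \<Rightarrow> ('a \<Rightarrow> 'a) \<Rightarrow> bool" where
  "has_weak_gradient D u g \<longleftrightarrow>
     locally_integrable D u \<and> locally_integrable D g \<and>
     (\<forall>\<phi>. test_function D \<phi> \<longrightarrow>
        (\<forall>i\<in>Basis. integral\<^sup>L (lebesgue_on D) (\<lambda>x. u x * (grad \<phi> x \<bullet> i)) =
                  - integral\<^sup>L (lebesgue_on D) (\<lambda>x. (g x \<bullet> i) * \<phi> x)))"

text \<open>A weak gradient is unique up to null sets; an arbitrary representative is chosen. It is used
only for functions that have a weak gradient.\<close>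

definition weak_grad :: "'a::euclidean_space set \<Rightarrow> ('a \<Rightarrow> real) \<Rightarrow> 'a \<Rightarrow> 'a" where
  "weak_grad D u = (SOME g. has_weak_gradient D u g)"

definition H1_space :: "'a::euclidean_space set \<Rightarrow> ('a \<Rightarrow> real) set" where
  "H1_space D = {u \<in> Lp_space D 2. \<exists>g \<in> Lp_space D 2. has_weak_gradient D u g}"

definition H10_space :: "'a::euclidean_space set \<Rightarrow> ('a \<Rightarrow> real) set" where
  "H10_space D = {u \<in> H1_space D. \<forall>\<epsilon>>0. \<exists>\<phi>. test_function D \<phi> \<and>
       Lp_enorm D 2 (\<lambda>x. u x - \<phi> x) < ennreal \<epsilon> \<and>
       Lp_enorm D 2 (\<lambda>x. weak_grad D u x - grad \<phi> x) < ennreal \<epsilon>}"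

definition H10_norm :: "'a::euclidean_space set \<Rightarrow> ('a \<Rightarrow> real) \<Rightarrow> real" where
  "H10_norm D u = Lp_norm D 2 (weak_grad D u)"

text \<open>The square of the Gagliardo (Sobolev--Slobodeckij) seminorm. The integrand on the null set
\<open>x = y\<close> is \<open>0 / 0 = 0\<close>.\<close>

definition gagliardo_energy :: "'a::euclidean_space set \<Rightarrow> real \<Rightarrow> ('a \<Rightarrow> real) \<Rightarrow> ennreal" where
  "gagliardo_energy D s a =
     (\<integral>\<^sup>+ x. (\<integral>\<^sup>+ y. ennreal (\<bar>a x - a y\<bar>\<^sup>2 / dist x y powr (real DIM('a) + 2 * s))
        \<partial>lebesgue_on D) \<partial>lebesgue_on D)"

text \<open>\<open>H\<^sup>s\<close> for \<open>0 < s \<le> 1\<close>: the Sobolev--Slobodeckij space for \<open>s < 1\<close>, and \<open>H\<^sup>1\<close> for \<open>s = 1\<close>.\<close>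

definition Hs_space :: "'a::euclidean_space set \<Rightarrow> real \<Rightarrow> ('a \<Rightarrow> real) set" where
  "Hs_space D s =
     (if s = 1 then H1_space D else {a \<in> Lp_space D 2. gagliardo_energy D s a < \<infinity>})"

definition Hs_norm :: "'a::euclidean_space set \<Rightarrow> real \<Rightarrow> ('a \<Rightarrow> real) \<Rightarrow> real" where
  "Hs_norm D s a =
     sqrt ((Lp_norm D 2 a)\<^sup>2 +
           (if s = 1 then (Lp_norm D 2 (weak_grad D a))\<^sup>2 else enn2real (gagliardo_energy D s a)))"

definition coeff_class :: "'a::euclidean_space set \<Rightarrow> real \<Rightarrow> real \<Rightarrow> ('a \<Rightarrow> real) set" where
  "coeff_class D l L = {a \<in> Lp_space D \<infinity>. AE x in lebesgue_on D. l \<le> a x \<and> a x \<le> L}"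

definition Hs_coeff_class ::
    "'a::euclidean_space set \<Rightarrow> real \<Rightarrow> real \<Rightarrow> real \<Rightarrow> real \<Rightarrow> ('a \<Rightarrow> real) set" where
  "Hs_coeff_class D l L s N = {a \<in> coeff_class D l L. a \<in> Hs_space D s \<and> Hs_norm D s a \<le> N}"

text \<open>\<open>u\<close> is the weak solution of \<open>-div (a \<nabla>u) = f\<close> on \<open>D\<close> with zero boundary values.\<close>

definition weak_solution ::
    "'a::euclidean_space set \<Rightarrow> ('a \<Rightarrow> real) \<Rightarrow> ('a \<Rightarrow> real) \<Rightarrow> ('a \<Rightarrow> real) \<Rightarrow> bool" where
  "weak_solution D a f u \<longleftrightarrow>
     u \<in> H10_space D \<and>
     (\<forall>v \<in> H10_space D.
        integral\<^sup>L (lebesgue_on D) (\<lambda>x. a x * (weak_grad D u x \<bullet> weak_grad D v x)) =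
        integral\<^sup>L (lebesgue_on D) (\<lambda>x. f x * v x))"

text \<open>The exponent \<open>2 / (1 - \<theta>)\<close> for \<open>\<theta> \<le> 1\<close>; for \<open>\<theta> = 1\<close> the quotient \<open>2 / 0\<close> in \<open>ennreal\<close> is \<open>\<infinity>\<close>.\<close>

definition grad_exponent :: "real \<Rightarrow> ennreal" where
  "grad_exponent \<theta> = 2 / ennreal (1 - \<theta>)"

lemma grad_exponent_1: "grad_exponent 1 = \<infinity>"
  by (simp add: grad_exponent_def ennreal_divide_zero)

end

theory Submission
  imports Defs "HOL-Probability.Distributions"
begin

text \<open>
Write \<open>\<psi> = (a - b) / a\<close> and \<open>E = \<parallel>u\<^sub>a - u\<^sub>b\<parallel>\<close>. Subtracting the two weak equations gives
\<open>div ((a - b) \<nabla>u\<^sub>a) = - div (b \<nabla>(u\<^sub>a - u\<^sub>b))\<close>. Since \<open>-div (a \<nabla>u\<^sub>a) = f\<close>, testing with \<open>w h(u\<^sub>a)\<close>,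
where \<open>w\<close> is an \<open>H\<^sup>1\<close> approximation of \<open>\<psi>\<close> and \<open>h = 1 - 2 logistic (\<cdot>/\<epsilon>)\<close> is an increasing bounded function with \<open>h 0 = 0\<close>,
yields a bound for \<open>\<integral> f w\<^sup>2 h(u\<^sub>a)\<close> in terms of \<open>E\<close>, \<open>\<parallel>(\<psi> - w) \<nabla>u\<^sub>a\<parallel>\<close> and \<open>1/\<epsilon> + \<parallel>\<nabla>w\<parallel>\<close>.
No lower bound for \<open>u\<^sub>a\<close> near the boundary is needed: the measure of \<open>{u\<^sub>a \<le> \<epsilon>}\<close> is \<open>O(sqrt \<epsilon>)\<close>, which
follows by testing the equation for \<open>u\<^sub>a\<close> with \<open>\<eta>\<^sup>2 logistic (u\<^sub>a/\<epsilon>)\<close> for a cutoff \<open>\<eta>\<close> that vanishes near \<open>\<partial>D\<close>.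

For \<open>s = 1\<close> one takes \<open>w = \<psi>\<close>. For \<open>s < 1\<close>, \<open>w\<close> is a Gaussian average of \<open>\<psi>\<close> over \<open>D\<close> at scale \<open>r\<close>, normalised by the
Gaussian mass of \<open>D\<close>; this avoids extension operators, as a Lipschitz domain has at least a fixed fraction of its
mass in every small ball centred in it. The gradient bound in \<open>L\<^sub>p\<close>, \<open>p = 2/(1-\<theta>)\<close>, turns \<open>\<parallel>\<psi> - w\<parallel> \<le> C E\<^bsup>1/\<theta>\<^esup>\<close>
into \<open>\<parallel>(\<psi> - w) \<nabla>u\<^sub>a\<parallel> \<le> C E\<close>, and \<open>\<epsilon>\<close> is chosen as the \<open>2/3\<close> power of the resulting right-hand side.
\<close>

subsection \<open>Smooth functions and mollification\<close>

text \<open>The obstacle is that \<open>\<psi>\<close> lies only in H^s, so its product with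
  \<open>h(u\<^sub>a)\<close> cannot be tested, while every H1 substitute \<open>w\<close> has a
  gradient that blows up with the quality of the approximation. If \<open>w\<close> is within
  E^(1/\<theta>) of \<open>\<psi>\<close>, its gradient is of order E^(-g) P with g = (1-s)/(s
  \<theta>) and P = 1 + (|a| + |b|)^(1/s). The tested identity then has a right-hand side
  Q/\<epsilon> with Q = E^(1-g) P, and g < 1 is the assumption (1-s)/s < \<theta>. Balanced against
  sqrt \<epsilon>, this bounds the square of the norm of \<open>\<psi>\<close> by a multiple of
  Q^(1/3): hence the factor 1/6 in the exponent of E and the power 1/(3s) of the norms.

  Nonlinear functions of \<open>u\<close> are smooth, vanish at 0 and are bounded together with
  their first derivative. Composed with a test function they give a test function, which avoids the
  chain rule for truncations. Products with \<open>w\<close> are not tested as such either: the rule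
  -div (w A) = w F - A . grad w moves \<open>w\<close> into the vector field, and only functions of
  \<open>u\<close> alone remain to be tested.\<close>

definition smooth_fun :: "('a::euclidean_space \<Rightarrow> real) \<Rightarrow> bool" where
  "smooth_fun f \<longleftrightarrow> (\<forall>k. times_cont_diff k f)"

lemma frechet_derivative_eqI:
  "(f has_derivative f') (at x) \<Longrightarrow> frechet_derivative f (at x) = f'"
  using frechet_derivative_at by metis

lemma times_cont_diff_SucD: "times_cont_diff (Suc k) f \<Longrightarrow> times_cont_diff k f"
proof (induction k arbitrary: f)
  case 0
  then show ?case
    by (auto simp: continuous_on_eq_continuous_at intro: differentiable_imp_continuous_within)
next
  case (Suc k)
  have 1: "\<forall>x. f differentiable (at x)"
    and 2: "\<forall>i\<in>Basis. times_cont_diff (Suc k) (\<lambda>x. frechet_derivative f (at x) i)"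
    using Suc.prems unfolding times_cont_diff.simps(2)[of "Suc k" f] by blast+
  have "\<forall>i\<in>Basis. times_cont_diff k (\<lambda>x. frechet_derivative f (at x) i)"
    using 2 Suc.IH by blast
  then show ?case using 1 unfolding times_cont_diff.simps(2)[of k f] by blast
qed

text \<open>Coinduction in place of formulas for higher derivatives: constants, linear forms, affine
  pullbacks and convolutions are each treated by naming one class that differentiation does not
  leave.\<close>

lemma smooth_fun_class:
  assumes "f \<in> S"
    and d: "\<And>f x. f \<in> S \<Longrightarrow> f differentiable (at x)"
    and S: "\<And>f i. f \<in> S \<Longrightarrow> i \<in> Basis \<Longrightarrow> (\<lambda>x. frechet_derivative f (at x) i) \<in> S"
  shows "smooth_fun f"
proof -
  have "times_cont_diff k f" if "f \<in> S" for k f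
    using that
  proof (induction k arbitrary: f)
    case 0
    then show ?case using d
      by (auto simp: continuous_on_eq_continuous_at intro: differentiable_imp_continuous_within)
  next
    case (Suc k)
    then show ?case using d S by auto
  qed
  then show ?thesis using assms(1) by (simp add: smooth_fun_def)
qed

lemma smooth_fun_differentiable: "smooth_fun f \<Longrightarrow> f differentiable (at x)"
  unfolding smooth_fun_def using times_cont_diff.simps(2) by blast

lemma smooth_fun_continuous: "smooth_fun f \<Longrightarrow> continuous_on UNIV f"
  unfolding smooth_fun_def using times_cont_diff.simps(1) by blast

lemma smooth_fun_partial:
  "smooth_fun f \<Longrightarrow> i \<in> Basis \<Longrightarrow> smooth_fun (\<lambda>x. frechet_derivative f (at x) i)"
  unfolding smooth_fun_def using times_cont_diff.simps(2) by blast

lemma has_derivative_grad: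
  assumes "f differentiable (at x)"
  shows "(f has_derivative (\<lambda>v. grad f x \<bullet> v)) (at x)"
proof -
  let ?f' = "frechet_derivative f (at x)"
  have d: "(f has_derivative ?f') (at x)" using assms frechet_derivative_works by blast
  have "?f' v = grad f x \<bullet> v" for v
  proof -
    have "?f' v = ?f' (\<Sum>i\<in>Basis. (v \<bullet> i) *\<^sub>R i)" by (simp add: euclidean_representation)
    also have "\<dots> = (\<Sum>i\<in>Basis. (v \<bullet> i) *\<^sub>R ?f' i)"
      using linear_frechet_derivative[OF assms] by (simp add: linear_sum linear_cmul)
    also have "\<dots> = grad f x \<bullet> v"
      by (simp add: grad_def inner_sum_left inner_sum_right inner_commute mult.commute)
    finally show ?thesis .
  qed
  then have "?f' = (\<lambda>v. grad f x \<bullet> v)" by blast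
  then show ?thesis using d by simp
qed

lemma grad_eqI:
  assumes "(f has_derivative (\<lambda>v. g \<bullet> v)) (at x)"
  shows "grad f x = g"
  unfolding grad_def frechet_derivative_eqI[OF assms]
  by (simp add: euclidean_representation)

lemma grad_inner_Basis: "i \<in> Basis \<Longrightarrow> grad f x \<bullet> i = frechet_derivative f (at x) i"
  by (simp add: grad_def inner_sum_left_Basis)

lemma smooth_fun_has_grad:
  "smooth_fun f \<Longrightarrow> (f has_derivative (\<lambda>v. grad f x \<bullet> v)) (at x)"
  by (simp add: has_derivative_grad smooth_fun_differentiable)

lemma continuous_on_grad:
  assumes "smooth_fun f"
  shows "continuous_on UNIV (grad f)"
  unfolding grad_def[abs_def]
  using assms by (intro continuous_on_sum continuous_on_scaleR continuous_on_const
      smooth_fun_continuous[OF smooth_fun_partial]) auto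

lemma smooth_fun_const [intro, simp]: "smooth_fun (\<lambda>x. c)"
proof (rule smooth_fun_class[where S = "range (\<lambda>c x. c)"])
  show "(\<lambda>x. c) \<in> range (\<lambda>c x. c)" by blast
qed (auto simp: frechet_derivative_const)

lemma smooth_fun_inner [intro, simp]: "smooth_fun (\<lambda>x. x \<bullet> v)"
proof (rule smooth_fun_class[where S = "range (\<lambda>c x. c) \<union> {\<lambda>x. x \<bullet> v}"])
  fix f :: "'a \<Rightarrow> real" and i :: 'a
  have "frechet_derivative (\<lambda>x. x \<bullet> v) (at x) = (\<lambda>h. h \<bullet> v)" for x
    by (rule frechet_derivative_eqI) (auto intro!: derivative_eq_intros)
  then show "f \<in> range (\<lambda>c x. c) \<union> {\<lambda>x. x \<bullet> v} \<Longrightarrow>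
     (\<lambda>x. frechet_derivative f (at x) i) \<in> range (\<lambda>c x. c) \<union> {\<lambda>x. x \<bullet> v}"
    by (auto simp: frechet_derivative_const)
qed (auto intro!: derivative_intros)

lemma times_cont_diff_add:
  "times_cont_diff k f \<Longrightarrow> times_cont_diff k g \<Longrightarrow> times_cont_diff k (\<lambda>x. f x + g x)"
proof (induction k arbitrary: f g)
  case 0
  then show ?case by (auto intro: continuous_intros)
next
  case (Suc k)
  have d: "f differentiable (at x)" "g differentiable (at x)" for x using Suc.prems by auto
  have "frechet_derivative (\<lambda>x. f x + g x) (at x) =
      (\<lambda>h. frechet_derivative f (at x) h + frechet_derivative g (at x) h)" for x
    by (rule frechet_derivative_eqI) (intro has_derivative_add frechet_derivative_works[THEN iffD1] d)
  then show ?case using Suc by (auto intro!: derivative_intros Suc.IH)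
qed

lemma times_cont_diff_mult:
  "times_cont_diff k f \<Longrightarrow> times_cont_diff k g \<Longrightarrow> times_cont_diff k (\<lambda>x. f x * g x)"
proof (induction k arbitrary: f g)
  case 0
  then show ?case by (auto intro: continuous_intros)
next
  case (Suc k)
  have d: "f differentiable (at x)" "g differentiable (at x)" for x using Suc.prems by auto
  have *: "frechet_derivative (\<lambda>x. f x * g x) (at x) =
      (\<lambda>h. f x * frechet_derivative g (at x) h + frechet_derivative f (at x) h * g x)" for x
    by (rule frechet_derivative_eqI) (intro has_derivative_mult frechet_derivative_works[THEN iffD1] d)
  show ?case unfolding times_cont_diff.simps(2) *
    using Suc.prems d times_cont_diff_SucD[OF Suc.prems(1)] times_cont_diff_SucD[OF Suc.prems(2)]
    by (auto intro!: times_cont_diff_add Suc.IH)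
qed

text \<open>Differentiating \<open>H n (f x)\<close> produces \<open>H (Suc n) (f x)\<close>, so the
  induction has to speak about all \<open>n\<close> and the family \<open>H\<close> lists every
  derivative of \<open>H 0\<close> in advance. For \<open>exp\<close> the family is constant; for
  \<open>flat_exp\<close> and \<open>logistic\<close> it comes from iterating an operation on
  polynomials.\<close>

lemma times_cont_diff_compose:
  assumes H: "\<And>n t. (H n has_real_derivative H (Suc n) t) (at t)"
  shows "times_cont_diff k f \<Longrightarrow> times_cont_diff k (\<lambda>x. H n (f x))"
proof (induction k arbitrary: n)
  case 0
  have "continuous_on UNIV (H n)"
    using H DERIV_continuous continuous_at_imp_continuous_on by blast
  then show ?case using 0 continuous_on_compose2[of UNIV "H n" UNIV f] by auto
next
  case (Suc k)
  have d: "f differentiable (at x)" for x using Suc.prems by auto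
  have d': "((\<lambda>x. H n (f x)) has_derivative (\<lambda>h. frechet_derivative f (at x) h * H (Suc n) (f x))) (at x)" for x
  proof -
    have "(H n has_derivative (\<lambda>t. t * H (Suc n) (f x))) (at (f x))"
      using H[of n "f x"] by (simp add: has_field_derivative_def mult.commute[of "H _ _"] mult_commute_abs)
    from has_derivative_compose[OF frechet_derivative_works[THEN iffD1, OF d[of x]] this]
    show ?thesis by simp
  qed
  have *: "frechet_derivative (\<lambda>x. H n (f x)) (at x) =
      (\<lambda>h. frechet_derivative f (at x) h * H (Suc n) (f x))" for x
    by (rule frechet_derivative_eqI[OF d'])
  have "(\<lambda>x. H n (f x)) differentiable (at x)" for x using d' differentiableI by blast
  then show ?case unfolding times_cont_diff.simps(2) *
    using Suc.prems Suc.IH times_cont_diff_SucD[OF Suc.prems]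
    by (auto intro!: times_cont_diff_mult)
qed

lemma smooth_fun_add [intro]: "smooth_fun f \<Longrightarrow> smooth_fun g \<Longrightarrow> smooth_fun (\<lambda>x. f x + g x)"
  by (simp add: smooth_fun_def times_cont_diff_add)

lemma smooth_fun_mult [intro]: "smooth_fun f \<Longrightarrow> smooth_fun g \<Longrightarrow> smooth_fun (\<lambda>x. f x * g x)"
  by (simp add: smooth_fun_def times_cont_diff_mult)

lemma smooth_fun_minus [intro]: "smooth_fun f \<Longrightarrow> smooth_fun (\<lambda>x. - f x)"
  using smooth_fun_mult[OF smooth_fun_const[of "-1"], of f] by simp

lemma smooth_fun_diff [intro]: "smooth_fun f \<Longrightarrow> smooth_fun g \<Longrightarrow> smooth_fun (\<lambda>x. f x - g x)"
  using smooth_fun_add[OF _ smooth_fun_minus, of f g] by simp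

lemma smooth_fun_sum:
  "finite I \<Longrightarrow> (\<And>i. i \<in> I \<Longrightarrow> smooth_fun (f i)) \<Longrightarrow> smooth_fun (\<lambda>x. \<Sum>i\<in>I. f i x)"
  by (induction I rule: finite_induct) auto

lemma smooth_fun_compose:
  assumes "\<And>n t. (H n has_real_derivative H (Suc n) t) (at t)" "smooth_fun f"
  shows "smooth_fun (\<lambda>x. H n (f x))"
  using assms by (simp add: smooth_fun_def times_cont_diff_compose)

lemma smooth_fun_exp [intro]: "smooth_fun f \<Longrightarrow> smooth_fun (\<lambda>x. exp (f x))"
  using smooth_fun_compose[of "\<lambda>_. exp" f 0] by (simp add: DERIV_exp)

text \<open>The reciprocal is not differentiable on the whole line, so
  \<open>smooth_fun_compose\<close> does not cover it. The induction works because the derivative is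
  again built from two reciprocals and a partial derivative of \<open>f\<close>.\<close>

lemma smooth_fun_inverse:
  assumes "smooth_fun f" "\<And>x. f x \<noteq> 0"
  shows "smooth_fun (\<lambda>x. inverse (f x))"
proof -
  have d: "f differentiable (at x)" for x using assms(1) by (rule smooth_fun_differentiable)
  have d': "((\<lambda>x. inverse (f x)) has_derivative
      (\<lambda>h. - (inverse (f x) * frechet_derivative f (at x) h * inverse (f x)))) (at x)" for x
    using Deriv.has_derivative_inverse[OF assms(2) frechet_derivative_works[THEN iffD1, OF d]] .
  have *: "frechet_derivative (\<lambda>x. inverse (f x)) (at x) =
      (\<lambda>h. - (inverse (f x) * frechet_derivative f (at x) h * inverse (f x)))" for x
    by (rule frechet_derivative_eqI[OF d'])
  have "times_cont_diff k (\<lambda>x. inverse (f x))" for k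
  proof (induction k)
    case 0
    then show ?case using assms smooth_fun_continuous[OF assms(1)]
      by (auto intro: continuous_intros)
  next
    case (Suc k)
    have "times_cont_diff k (\<lambda>x. (-1) * (inverse (f x) * frechet_derivative f (at x) i * inverse (f x)))"
      if "i \<in> Basis" for i
      using that Suc smooth_fun_partial[OF assms(1) that] smooth_fun_const[of "-1"]
      unfolding smooth_fun_def by (intro times_cont_diff_mult) blast+
    moreover have "(\<lambda>x. inverse (f x)) differentiable (at x)" for x using d' differentiableI by blast
    ultimately show ?case unfolding times_cont_diff.simps(2) * by simp
  qed
  then show ?thesis by (simp add: smooth_fun_def)
qed

lemma smooth_fun_divide:
  assumes "smooth_fun f" "smooth_fun g" "\<And>x. g x \<noteq> 0"
  shows "smooth_fun (\<lambda>x. f x / g x)"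
  using smooth_fun_mult[OF assms(1) smooth_fun_inverse[OF assms(2,3)]]
  by (simp add: divide_inverse)

text \<open>The scalar \<open>b\<close> makes the class closed: each partial derivative brings out
  one factor \<open>c\<close>.\<close>

lemma smooth_fun_affine_compose:
  assumes "smooth_fun f"
  shows "smooth_fun (\<lambda>x. f (c *\<^sub>R x + v))"
proof (rule smooth_fun_class[where S = "{\<lambda>x. b * g (c *\<^sub>R x + v) |b g. smooth_fun g}"])
  show "(\<lambda>x. f (c *\<^sub>R x + v)) \<in> {\<lambda>x. b * g (c *\<^sub>R x + v) |b g. smooth_fun g}"
    using assms by (auto intro!: exI[of _ 1] exI[of _ f])
next
  have d: "((\<lambda>x. b * g (c *\<^sub>R x + v)) has_derivative
      (\<lambda>h. b * frechet_derivative g (at (c *\<^sub>R x + v)) (c *\<^sub>R h))) (at x)"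
    if "smooth_fun g" for b x and g :: "'a \<Rightarrow> real"
  proof -
    have "(g has_derivative frechet_derivative g (at (c *\<^sub>R x + v))) (at (c *\<^sub>R x + v))"
      using smooth_fun_differentiable[OF that] frechet_derivative_works by blast
    moreover have "((\<lambda>x. c *\<^sub>R x + v) has_derivative (\<lambda>h. c *\<^sub>R h)) (at x)"
      by (auto intro!: derivative_eq_intros)
    ultimately show ?thesis using has_derivative_compose by (intro has_derivative_mult_right) blast
  qed
  show "f differentiable (at x)" if "f \<in> {\<lambda>x. b * g (c *\<^sub>R x + v) |b g. smooth_fun g}" for f x
    using that d unfolding differentiable_def by blast
  show "(\<lambda>x. frechet_derivative f (at x) i) \<in> {\<lambda>x. b * g (c *\<^sub>R x + v) |b g. smooth_fun g}"
    if "f \<in> {\<lambda>x. b * g (c *\<^sub>R x + v) |b g. smooth_fun g}" "i \<in> Basis" for f i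
  proof -
    from that(1) obtain b g where f: "f = (\<lambda>x. b * g (c *\<^sub>R x + v))" and g: "smooth_fun g" by blast
    have "(\<lambda>x. frechet_derivative f (at x) i) =
        (\<lambda>x. (b * c) * frechet_derivative g (at (c *\<^sub>R x + v)) i)"
      unfolding f frechet_derivative_eqI[OF d[OF g]]
      using linear_frechet_derivative[OF smooth_fun_differentiable[OF g]] by (simp add: linear_cmul mult.assoc)
    then show ?thesis using smooth_fun_partial[OF g that(2)]
      by (intro CollectI exI[of _ "b * c"] exI[of _ "\<lambda>x. frechet_derivative g (at x) i"]) simp
  qed
qed

lemma grad_add: "smooth_fun f \<Longrightarrow> smooth_fun g \<Longrightarrow> grad (\<lambda>x. f x + g x) x = grad f x + grad g x"
  by (rule grad_eqI) (auto intro!: derivative_eq_intros smooth_fun_has_grad simp: inner_add_left)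

lemma grad_mult:
  "smooth_fun f \<Longrightarrow> smooth_fun g \<Longrightarrow> grad (\<lambda>x. f x * g x) x = f x *\<^sub>R grad g x + g x *\<^sub>R grad f x"
  by (rule grad_eqI)
    (auto intro!: derivative_eq_intros smooth_fun_has_grad simp: inner_add_left algebra_simps)

lemma grad_compose:
  assumes "(h has_real_derivative h') (at (f x))" "smooth_fun f"
  shows "grad (\<lambda>x. h (f x)) x = h' *\<^sub>R grad f x"
proof (rule grad_eqI)
  have "(h has_derivative (\<lambda>t. h' * t)) (at (f x))"
    using assms(1) by (simp add: has_field_derivative_def)
  from has_derivative_compose[OF smooth_fun_has_grad[OF assms(2)] this]
  show "((\<lambda>x. h (f x)) has_derivative (\<lambda>v. (h' *\<^sub>R grad f x) \<bullet> v)) (at x)" by simp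
qed

text \<open>Up to polynomial factors in \<open>1 / t\<close>, the derivatives of \<open>exp (- 1 / t)\<close> are of the same form;
this gives all of them at once.\<close>

definition flat_exp :: "real poly \<Rightarrow> real \<Rightarrow> real" where
  "flat_exp p t = (if t > 0 then poly p (1 / t) * exp (- (1 / t)) else 0)"

text \<open>In the variable x = 1/t, where dx/dt = - x^2, the derivative of p(x) exp(-x) is x^2
  (p(x) - p'(x)) exp(-x); the polynomial \<open>[:0, 0, 1:]\<close> is x^2.\<close>

definition flat_exp_deriv :: "real poly \<Rightarrow> real poly" where
  "flat_exp_deriv p = [:0, 0, 1:] * (p - pderiv p)"

lemma poly_times_exp_tendsto_0: "((\<lambda>x::real. poly p x * exp (- x)) \<longlongrightarrow> 0) at_top"
proof -
  have "((\<lambda>x::real. \<Sum>i\<le>degree p. coeff p i * (x ^ i / exp x)) \<longlongrightarrow> (\<Sum>i\<le>degree p. coeff p i * 0)) at_top"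
    by (intro tendsto_intros tendsto_power_div_exp_0)
  moreover have "(\<Sum>i\<le>degree p. coeff p i * (x ^ i / exp x)) = poly p x * exp (- x)" for x :: real
    by (simp add: poly_altdef sum_distrib_right exp_minus divide_inverse mult.assoc)
  ultimately show ?thesis by simp
qed

lemma flat_exp_DERIV: "(flat_exp p has_real_derivative flat_exp (flat_exp_deriv p) t) (at t)"
proof -
  consider "t > 0" | "t < 0" | "t = 0" by linarith
  then show ?thesis
  proof cases
    case 1
    have "((\<lambda>t. poly p (1 / t) * exp (- (1 / t))) has_real_derivative flat_exp (flat_exp_deriv p) t) (at t)"
      using 1 by (auto intro!: derivative_eq_intros
          simp: flat_exp_def flat_exp_deriv_def field_simps power2_eq_square)
    then show ?thesis
      by (rule DERIV_cong_ev[THEN iffD1, OF refl _ refl, rotated])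
        (use 1 eventually_at_right_field in \<open>auto simp: flat_exp_def eventually_nhds intro!: exI[of _ "{0<..}"]\<close>)
  next
    case 2
    have "((\<lambda>t. 0) has_real_derivative flat_exp (flat_exp_deriv p) t) (at t)"
      using 2 by (auto simp: flat_exp_def)
    then show ?thesis
      by (rule DERIV_cong_ev[THEN iffD1, OF refl _ refl, rotated])
        (use 2 in \<open>auto simp: flat_exp_def eventually_nhds intro!: exI[of _ "{..<0}"]\<close>)
  next
    case 3
    have "((\<lambda>h. flat_exp p h / h) \<longlongrightarrow> 0) (at 0)"
    proof (rule filterlim_split_at)
      have "\<forall>\<^sub>F h in at_left 0. flat_exp p h / h = 0"
        by (simp add: eventually_at_filter flat_exp_def)
      then show "((\<lambda>h. flat_exp p h / h) \<longlongrightarrow> 0) (at_left 0)"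
        by (rule tendsto_eventually)
      \<comment> \<open>With x = 1/h the difference quotient is x p(x) exp(-x), and
        \<open>pCons 0 p\<close> is the polynomial x p(x).\<close>
      have "((\<lambda>h::real. poly (pCons 0 p) (inverse h) * exp (- inverse h)) \<longlongrightarrow> 0) (at_right 0)"
        using filterlim_compose[OF poly_times_exp_tendsto_0 filterlim_inverse_at_top_right] .
      then show "((\<lambda>h. flat_exp p h / h) \<longlongrightarrow> 0) (at_right 0)"
        by (rule Lim_transform_eventually)
          (auto simp: eventually_at_filter flat_exp_def field_simps)
    qed
    then show ?thesis using 3 by (simp add: DERIV_def flat_exp_def)
  qed
qed

abbreviation bump1 :: "real \<Rightarrow> real" where
  "bump1 \<equiv> flat_exp [:1:]"

lemma bump1_eq: "bump1 t = (if t > 0 then exp (- (1 / t)) else 0)"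
  by (simp add: flat_exp_def)

lemma bump1_pos_iff: "bump1 t > 0 \<longleftrightarrow> t > 0" and bump1_nonneg: "bump1 t \<ge> 0"
  and bump1_le_1: "bump1 t \<le> 1"
  by (auto simp: bump1_eq)

text \<open>The derivative is x^2 exp(-x) at x = 1/t, and 1 + x + x^2/2 <= exp x bounds it by 2. A
  bounded, monotone and smooth function that vanishes on a half line is the substitute for the
  negative part in \<open>weak_supersolution_nonneg\<close>.\<close>

lemma bump1_deriv_bounds:
  "0 \<le> flat_exp (flat_exp_deriv [:1:]) t" "flat_exp (flat_exp_deriv [:1:]) t \<le> 2"
proof -
  show "0 \<le> flat_exp (flat_exp_deriv [:1:]) t" by (simp add: flat_exp_def flat_exp_deriv_def)
  have "x\<^sup>2 * exp (- x) \<le> 2" if "x > 0" for x :: real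
  proof -
    have "1 + x + x\<^sup>2 / 2 \<le> exp x" using exp_lower_Taylor_quadratic[of x] that by simp
    then have "x\<^sup>2 \<le> 2 * exp x" using that by simp
    then show ?thesis by (simp add: exp_minus field_simps)
  qed
  from this[of "1 / t"] show "flat_exp (flat_exp_deriv [:1:]) t \<le> 2"
    by (simp add: flat_exp_def flat_exp_deriv_def power2_eq_square)
qed

lemma smooth_fun_flat_exp:
  assumes "smooth_fun f" shows "smooth_fun (\<lambda>x. flat_exp p (f x))"
proof -
  have "smooth_fun (\<lambda>x. flat_exp ((flat_exp_deriv ^^ n) p) (f x))" for n
    by (rule smooth_fun_compose[where H = "\<lambda>n. flat_exp ((flat_exp_deriv ^^ n) p)", OF _ assms])
      (simp add: flat_exp_DERIV)
  from this[of 0] show ?thesis by simp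
qed

section \<open>Convolution with smooth kernels\<close>

definition conv :: "('a::euclidean_space \<Rightarrow> real) \<Rightarrow> ('a \<Rightarrow> real) \<Rightarrow> 'a \<Rightarrow> real" where
  "conv g \<kappa> x = (\<integral>y. g y * \<kappa> (x - y) \<partial>lborel)"

lemma continuous_bounded_on_cball:
  fixes f :: "'a::euclidean_space \<Rightarrow> 'b::real_normed_vector"
  assumes "continuous_on UNIV f"
  obtains B where "B > 0" "\<And>x. norm x \<le> R \<Longrightarrow> norm (f x) \<le> B"
proof -
  have "compact (f ` cball 0 R)"
    using assms by (intro compact_continuous_image) (auto intro: continuous_on_subset)
  then obtain B where "B > 0" "\<forall>y\<in>f ` cball 0 R. norm y \<le> B"
    using compact_imp_bounded bounded_pos by metis
  then show thesis using that by (auto simp: dist_norm)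
qed


lemma integrable_conv:
  fixes g :: "'a::euclidean_space \<Rightarrow> real"
  assumes g: "integrable lborel g" and supp: "\<And>y. norm y > R \<Longrightarrow> g y = 0"
    and k: "continuous_on UNIV \<kappa>"
  shows "integrable lborel (\<lambda>y. g y * \<kappa> (x - y))"
proof -
  obtain B where B: "\<And>z. norm z \<le> norm x + R \<Longrightarrow> norm (\<kappa> z) \<le> B"
    using continuous_bounded_on_cball[OF k] by metis
  have [measurable]: "g \<in> borel_measurable borel" "\<kappa> \<in> borel_measurable borel"
    using borel_measurable_integrable[OF g] borel_measurable_continuous_onI[OF k] by simp_all
  show ?thesis
  proof (rule Bochner_Integration.integrable_bound[of _ "\<lambda>y. B * g y"])
    show "AE y in lborel. norm (g y * \<kappa> (x - y)) \<le> norm (B * g y)"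
    proof (rule AE_I2)
      fix y show "norm (g y * \<kappa> (x - y)) \<le> norm (B * g y)"
      proof (cases "norm y > R")
        case False
        then have "norm (x - y) \<le> norm x + R" using norm_triangle_ineq4[of x y] by linarith
        then have "\<bar>\<kappa> (x - y)\<bar> \<le> \<bar>B\<bar>" using B[of "x - y"] by simp
        then show ?thesis by (simp add: abs_mult mult.commute[of "\<bar>B\<bar>"] mult_left_mono)
      qed (simp add: supp)
    qed
  qed (use g in auto)
qed

text \<open>Differentiation under the integral sign, by dominated convergence along sequences. A
  null sequence \<open>X\<close> is bounded by some \<open>B0\<close>, so for \<open>y\<close> in
  the support of \<open>g\<close> all arguments of the kernel lie in one ball; there the mean value
  inequality bounds the remainder quotient by \<open>2 * Lc\<close>.\<close>

lemma has_derivative_conv: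
  fixes g :: "'a::euclidean_space \<Rightarrow> real"
  assumes g: "integrable lborel g" and supp: "\<And>y. norm y > R \<Longrightarrow> g y = 0"
    and k: "smooth_fun \<kappa>"
  shows "(conv g \<kappa> has_derivative
    (\<lambda>h. \<Sum>i\<in>Basis. (h \<bullet> i) * conv g (\<lambda>z. frechet_derivative \<kappa> (at z) i) x)) (at x)"
proof -
  define f' where "f' h = (\<Sum>i\<in>Basis. (h \<bullet> i) * conv g (\<lambda>z. frechet_derivative \<kappa> (at z) i) x)" for h
  note kc = smooth_fun_continuous[OF k]
  have gc: "continuous_on UNIV (grad \<kappa>)" using k by (rule continuous_on_grad)
  have [measurable]: "g \<in> borel_measurable borel" "\<kappa> \<in> borel_measurable borel"
     "grad \<kappa> \<in> borel_measurable borel"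
    using borel_measurable_integrable[OF g] borel_measurable_continuous_onI[OF kc]
      borel_measurable_continuous_onI[OF gc] by simp_all
  have I1: "integrable lborel (\<lambda>y. g y * \<kappa> (z - y))" for z
    by (rule integrable_conv[OF g supp kc])
  have I2: "integrable lborel (\<lambda>y. g y * frechet_derivative \<kappa> (at (x - y)) i)" if "i \<in> Basis" for i
    by (rule integrable_conv[OF g supp smooth_fun_continuous[OF smooth_fun_partial[OF k that]]])
  have gi: "g y * (grad \<kappa> (x - y) \<bullet> h) =
      (\<Sum>i\<in>Basis. (h \<bullet> i) * (g y * frechet_derivative \<kappa> (at (x - y)) i))" for y h
    by (simp add: grad_def inner_sum_left inner_sum_right inner_commute sum_distrib_left mult_ac)
  have I3: "integrable lborel (\<lambda>y. g y * (grad \<kappa> (x - y) \<bullet> h))" for h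
    unfolding gi by (intro Bochner_Integration.integrable_sum integrable_mult_right I2)
  have f'_eq: "f' h = (\<integral>y. g y * (grad \<kappa> (x - y) \<bullet> h) \<partial>lborel)" for h
  proof -
    have "(\<integral>y. g y * (grad \<kappa> (x - y) \<bullet> h) \<partial>lborel) =
        (\<Sum>i\<in>Basis. \<integral>y. (h \<bullet> i) * (g y * frechet_derivative \<kappa> (at (x - y)) i) \<partial>lborel)"
      unfolding gi by (intro Bochner_Integration.integral_sum integrable_mult_right I2)
    then show ?thesis by (simp add: f'_def conv_def)
  qed
  have "((\<lambda>h. norm (conv g \<kappa> (x + h) - conv g \<kappa> x - f' h) / norm h) \<longlongrightarrow> 0) (at 0)"
    unfolding tendsto_at_iff_sequentially
  proof (intro allI impI)
    fix X :: "nat \<Rightarrow> 'a" assume X0: "\<forall>i. X i \<in> UNIV - {0}" and X: "X \<longlonglongrightarrow> 0"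
    have "Bseq X" using X convergent_imp_Bseq convergentI by metis
    then obtain B0 where B0: "\<And>n. norm (X n) \<le> B0" unfolding Bseq_def by metis
    obtain Lc where Lc: "Lc > 0" "\<And>z. norm z \<le> norm x + R + B0 \<Longrightarrow> norm (grad \<kappa> z) \<le> Lc"
      using continuous_bounded_on_cball[OF gc] by metis
    define q where "q n y = g y * ((\<kappa> (x + X n - y) - \<kappa> (x - y) - grad \<kappa> (x - y) \<bullet> X n) / norm (X n))" for n y
    have q: "norm (q n y) \<le> 2 * Lc * norm (g y)" for n y
    proof (cases "norm y > R")
      case False
      let ?S = "cball 0 (norm x + R + B0) :: 'a set"
      have n: "norm (x - y) \<le> norm x + R" using norm_triangle_ineq4[of x y] False by linarith
      have "norm (x - y + X n) \<le> norm x + R + B0"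
        using n norm_triangle_ineq[of "x - y" "X n"] B0[of n] by linarith
      moreover have "norm (x - y) \<le> norm x + R + B0" using n B0[of n] norm_ge_zero[of "X n"] by linarith
      ultimately have m: "x - y + X n \<in> ?S" "x - y \<in> ?S" by (simp_all only: mem_cball_0)
      have cs: "\<bar>grad \<kappa> z \<bullet> v\<bar> \<le> Lc * norm v" if "z \<in> ?S" for z v
      proof -
        have "\<bar>grad \<kappa> z \<bullet> v\<bar> \<le> norm (grad \<kappa> z) * norm v" by (rule Cauchy_Schwarz_ineq2)
        also have "\<dots> \<le> Lc * norm v" using Lc(2) that by (intro mult_right_mono) simp_all
        finally show ?thesis .
      qed
      have "norm (\<kappa> (x - y + X n) - \<kappa> (x - y)) \<le> Lc * norm (x - y + X n - (x - y))"
      proof (rule differentiable_bound[OF convex_cball _ _ m])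
        fix z assume "z \<in> ?S"
        show "(\<kappa> has_derivative (\<lambda>v. grad \<kappa> z \<bullet> v)) (at z within ?S)"
          using smooth_fun_has_grad[OF k] has_derivative_at_withinI by blast
        show "onorm (\<lambda>v. grad \<kappa> z \<bullet> v) \<le> Lc"
          using cs[OF \<open>z \<in> ?S\<close>] by (intro onorm_le) simp
      qed
      moreover have "\<bar>grad \<kappa> (x - y) \<bullet> X n\<bar> \<le> Lc * norm (X n)"
        by (rule cs[OF m(2)])
      ultimately have "\<bar>\<kappa> (x - y + X n) - \<kappa> (x - y) - grad \<kappa> (x - y) \<bullet> X n\<bar> \<le> 2 * Lc * norm (X n)"
        by simp
      then have "\<bar>(\<kappa> (x + X n - y) - \<kappa> (x - y) - grad \<kappa> (x - y) \<bullet> X n) / norm (X n)\<bar> \<le> 2 * Lc"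
        using X0 by (simp add: field_simps algebra_simps)
      from mult_left_mono[OF this abs_ge_zero[of "g y"]] show ?thesis unfolding q_def
        by (simp add: abs_mult mult_ac)
    qed (simp add: q_def supp)
    have lim: "(\<lambda>n. q n y) \<longlonglongrightarrow> 0" for y
    proof -
      have "((\<lambda>h. norm (\<kappa> ((x - y) + h) - \<kappa> (x - y) - grad \<kappa> (x - y) \<bullet> h) / norm h) \<longlongrightarrow> 0) (at 0)"
        using smooth_fun_has_grad[OF k, of "x - y"] by (simp only: has_derivative_at)
      from this[unfolded tendsto_at_iff_sequentially, THEN spec[of _ X]]
      have "(\<lambda>n. norm (\<kappa> ((x - y) + X n) - \<kappa> (x - y) - grad \<kappa> (x - y) \<bullet> X n) / norm (X n)) \<longlonglongrightarrow> 0"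
        using X X0 by (simp add: comp_def)
      then have "(\<lambda>n. norm ((\<kappa> (x + X n - y) - \<kappa> (x - y) - grad \<kappa> (x - y) \<bullet> X n) / norm (X n))) \<longlonglongrightarrow> 0"
        by (simp add: algebra_simps)
      then have "(\<lambda>n. (\<kappa> (x + X n - y) - \<kappa> (x - y) - grad \<kappa> (x - y) \<bullet> X n) / norm (X n)) \<longlonglongrightarrow> 0"
        by (rule tendsto_norm_zero_cancel)
      from tendsto_mult_left[OF this, of "g y"] show ?thesis by (simp add: q_def)
    qed
    have "(\<lambda>n. \<integral>y. q n y \<partial>lborel) \<longlonglongrightarrow> (\<integral>y. 0 \<partial>(lborel :: 'a measure))"
      by (rule integral_dominated_convergence[where w = "\<lambda>y. 2 * Lc * norm (g y)"])
        (use g lim q in \<open>auto simp: q_def[abs_def]\<close>)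
    moreover have "(\<integral>y. q n y \<partial>lborel) = (conv g \<kappa> (x + X n) - conv g \<kappa> x - f' (X n)) / norm (X n)" for n
    proof -
      have "(\<integral>y. q n y \<partial>lborel) = (\<integral>y. (g y * \<kappa> (x + X n - y) - g y * \<kappa> (x - y) - g y * (grad \<kappa> (x - y) \<bullet> X n)) / norm (X n) \<partial>lborel)"
        unfolding q_def by (simp add: algebra_simps diff_divide_distrib)
      also have "\<dots> = (conv g \<kappa> (x + X n) - conv g \<kappa> x - f' (X n)) / norm (X n)"
        unfolding f'_eq conv_def using I1 I3
        by (subst integral_divide_zero) (simp add: Bochner_Integration.integral_diff)
      finally show ?thesis .
    qed
    ultimately have "(\<lambda>n. (conv g \<kappa> (x + X n) - conv g \<kappa> x - f' (X n)) / norm (X n)) \<longlonglongrightarrow> 0" by simp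
    from tendsto_norm_zero[OF this]
    show "((\<lambda>h. norm (conv g \<kappa> (x + h) - conv g \<kappa> x - f' h) / norm h) \<circ> X) \<longlonglongrightarrow> 0"
      by (simp add: comp_def)
  qed
  moreover have "bounded_linear f'"
    unfolding f'_def[abs_def]
    by (intro bounded_linear_sum bounded_linear_mult_left[THEN bounded_linear_compose] bounded_linear_inner_left)
  ultimately show ?thesis unfolding has_derivative_at f'_def[abs_def] by (intro conjI)
qed

lemma partial_conv:
  assumes "integrable lborel g" "\<And>y. norm y > R \<Longrightarrow> g y = 0" "smooth_fun \<kappa>" "i \<in> Basis"
  shows "frechet_derivative (conv g \<kappa>) (at x) i = conv g (\<lambda>z. frechet_derivative \<kappa> (at z) i) x"
proof -
  have "(\<Sum>j\<in>Basis. (i \<bullet> j) * c j) = c i" for c :: "'a \<Rightarrow> real"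
  proof -
    have "(\<Sum>j\<in>Basis. (i \<bullet> j) * c j) = (\<Sum>j\<in>Basis. if j = i then c j else 0)"
      using assms(4) by (intro sum.cong) (auto simp: inner_Basis)
    then show ?thesis using assms(4) by simp
  qed
  from this[of "\<lambda>i. conv g (\<lambda>z. frechet_derivative \<kappa> (at z) i) x"] show ?thesis
    by (simp only: frechet_derivative_eqI[OF has_derivative_conv[OF assms(1,2,3), where x = x]])
qed

lemma smooth_fun_conv:
  assumes g: "integrable lborel g" "\<And>y. norm y > R \<Longrightarrow> g y = 0" and k: "smooth_fun \<kappa>"
  shows "smooth_fun (conv g \<kappa>)"
proof (rule smooth_fun_class[where S = "{conv g \<kappa> |\<kappa>. smooth_fun \<kappa>}"])
  show "f differentiable at x" if "f \<in> {conv g \<kappa> |\<kappa>. smooth_fun \<kappa>}" for f x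
  proof -
    obtain \<kappa> where k: "smooth_fun \<kappa>" "f = conv g \<kappa>" using \<open>f \<in> _\<close> by blast
    show ?thesis unfolding k(2) using has_derivative_conv[OF g k(1)] by (rule differentiableI)
  qed
  show "(\<lambda>x. frechet_derivative f (at x) i) \<in> {conv g \<kappa> |\<kappa>. smooth_fun \<kappa>}"
    if f: "f \<in> {conv g \<kappa> |\<kappa>. smooth_fun \<kappa>}" and i: "i \<in> Basis" for f i
  proof -
    obtain \<kappa> where k: "smooth_fun \<kappa>" "f = conv g \<kappa>" using f by blast
    then have "(\<lambda>x. frechet_derivative f (at x) i) = conv g (\<lambda>z. frechet_derivative \<kappa> (at z) i)"
      using partial_conv[OF g k(1) i] by auto
    then show ?thesis using smooth_fun_partial[OF k(1) i]
      by (intro CollectI exI[of _ "\<lambda>z. frechet_derivative \<kappa> (at z) i"] conjI)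
  qed
qed (use k in blast)

lemma nn_integral_lborel_affine:
  fixes f :: "'a::euclidean_space \<Rightarrow> ennreal"
  assumes [measurable]: "f \<in> borel_measurable borel" and c: "c \<noteq> 0"
  shows "(\<integral>\<^sup>+x. f x \<partial>lborel) = ennreal (\<bar>c\<bar> ^ DIM('a)) * (\<integral>\<^sup>+x. f (t + c *\<^sub>R x) \<partial>lborel)"
  by (subst lborel_affine[OF c, of t]) (simp add: nn_integral_density nn_integral_distr nn_integral_cmult)

lemma nn_integral_lborel_reflect:
  fixes f :: "'a::euclidean_space \<Rightarrow> ennreal"
  assumes "f \<in> borel_measurable borel"
  shows "(\<integral>\<^sup>+y. f (x - y) \<partial>lborel) = (\<integral>\<^sup>+y. f y \<partial>lborel)"
    and "(\<integral>\<^sup>+y. f (y - x) \<partial>lborel) = (\<integral>\<^sup>+y. f y \<partial>lborel)"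
  using nn_integral_lborel_affine[OF assms, of "-1" x] nn_integral_lborel_affine[OF assms, of 1 "-x"]
  by simp_all

section \<open>The mollifier \<open>moll\<close>: mass, support and gradient\<close>

definition base_bump :: "'a::euclidean_space \<Rightarrow> real" where
  "base_bump x = bump1 (1 - x \<bullet> x)"

lemma smooth_fun_inner_self: "smooth_fun (\<lambda>x. x \<bullet> x)"
proof -
  have "(\<lambda>x::'a. x \<bullet> x) = (\<lambda>x. \<Sum>i\<in>Basis. (x \<bullet> i) * (x \<bullet> i))"
    by (rule ext) (rule euclidean_inner)
  then show ?thesis by (simp only:) (intro smooth_fun_sum smooth_fun_mult smooth_fun_inner finite_Basis)
qed

lemma smooth_fun_base_bump: "smooth_fun base_bump"
  unfolding base_bump_def[abs_def]
  by (intro smooth_fun_flat_exp smooth_fun_diff smooth_fun_const smooth_fun_inner_self)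

lemma base_bump_nonneg: "0 \<le> base_bump x" and base_bump_le_1: "base_bump x \<le> 1"
  and base_bump_zero: "norm x \<ge> 1 \<Longrightarrow> base_bump x = 0"
  and base_bump_half: "norm x \<le> 1/2 \<Longrightarrow> exp (-2) \<le> base_bump x"
proof -
  show "0 \<le> base_bump x" "base_bump x \<le> 1" by (simp_all add: base_bump_def bump1_nonneg bump1_le_1)
  show "base_bump x = 0" if "norm x \<ge> 1"
    using one_le_power[OF that, of 2]
    by (simp add: base_bump_def bump1_eq dot_square_norm)
  show "exp (-2) \<le> base_bump x" if "norm x \<le> 1/2"
  proof -
    have "(norm x)\<^sup>2 \<le> (1/2)\<^sup>2" using that by (intro power_mono) auto
    then have "1/2 \<le> 1 - (norm x)\<^sup>2" by (simp add: power2_eq_square)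
    then have "1 / (1 - (norm x)\<^sup>2) \<le> 2" "0 < 1 - (norm x)\<^sup>2" by (auto simp: field_simps)
    then show ?thesis by (simp add: base_bump_def bump1_eq dot_square_norm)
  qed
qed

lemma base_bump_measurable [measurable]: "base_bump \<in> borel_measurable borel"
  using smooth_fun_continuous[OF smooth_fun_base_bump] borel_measurable_continuous_onI by blast

definition base_mass :: "'a::euclidean_space itself \<Rightarrow> real" where
  "base_mass _ = enn2real (\<integral>\<^sup>+x. ennreal (base_bump (x::'a)) \<partial>lborel)"

text \<open>The bump is at least exp(-2) on the ball of radius 1/2, which makes its mass positive
  and the normalisation of \<open>moll\<close> meaningful.\<close>

lemma base_mass:
  "(\<integral>\<^sup>+x. ennreal (base_bump (x::'a::euclidean_space)) \<partial>lborel) = ennreal (base_mass TYPE('a))"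
  "base_mass TYPE('a) > 0"
proof -
  let ?I = "\<integral>\<^sup>+x. ennreal (base_bump (x::'a)) \<partial>lborel"
  have "?I \<le> (\<integral>\<^sup>+x. indicator (cball (0::'a) 1) x \<partial>lborel)"
  proof (rule nn_integral_mono)
    show "ennreal (base_bump x) \<le> indicator (cball 0 1) x" for x :: 'a
      using base_bump_le_1[of x] base_bump_zero[of x]
      by (cases "norm x \<le> 1") (auto simp: indicator_def)
  qed
  also have "\<dots> < \<infinity>" using emeasure_lborel_cball_finite[of "0::'a" 1] by simp
  finally have fin: "?I < \<infinity>" .
  then show eq: "?I = ennreal (base_mass TYPE('a))" by (simp add: base_mass_def)
  have "0 < ennreal (exp (-2)) * emeasure lborel (cball (0::'a) (1/2))"
    by (simp add: emeasure_cball ennreal_zero_less_mult_iff unit_ball_vol_pos)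
  also have "\<dots> = (\<integral>\<^sup>+x. ennreal (exp (-2)) * indicator (cball (0::'a) (1/2)) x \<partial>lborel)"
    by (subst nn_integral_cmult_indicator) auto
  also have "\<dots> \<le> ?I"
    by (rule nn_integral_mono) (use base_bump_half in \<open>auto simp: indicator_def dist_norm intro!: ennreal_leI\<close>)
  finally show "base_mass TYPE('a) > 0" using eq by simp
qed

definition moll :: "real \<Rightarrow> 'a::euclidean_space \<Rightarrow> real" where
  "moll \<rho> z = base_bump ((1/\<rho>) *\<^sub>R z) / (\<rho> ^ DIM('a) * base_mass TYPE('a))"

lemma smooth_fun_moll: "smooth_fun (moll \<rho>)"
proof -
  have "smooth_fun (\<lambda>z. (1 / (\<rho> ^ DIM('a) * base_mass TYPE('a))) * base_bump ((1/\<rho>) *\<^sub>R z + (0::'a)))"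
    by (intro smooth_fun_mult smooth_fun_const smooth_fun_affine_compose smooth_fun_base_bump)
  then show ?thesis unfolding moll_def[abs_def] by simp
qed

lemma moll_measurable [measurable]: "moll \<rho> \<in> borel_measurable borel"
  using smooth_fun_continuous[OF smooth_fun_moll] borel_measurable_continuous_onI by blast

lemma moll_nonneg: "\<rho> > 0 \<Longrightarrow> 0 \<le> moll \<rho> z"
  for z :: "'a::euclidean_space"
  unfolding moll_def using base_mass(2)[where 'a = 'a] base_bump_nonneg[of "(1 / \<rho>) *\<^sub>R z"]
  by (intro divide_nonneg_pos mult_pos_pos) auto

lemma moll_zero: "\<rho> > 0 \<Longrightarrow> norm z \<ge> \<rho> \<Longrightarrow> moll \<rho> z = 0"
  unfolding moll_def by (simp add: base_bump_zero)

lemma nn_integral_moll: "\<rho> > 0 \<Longrightarrow> (\<integral>\<^sup>+z. ennreal (moll \<rho> (z::'a::euclidean_space)) \<partial>lborel) = 1"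
proof -
  assume r: "\<rho> > 0"
  let ?c = "\<rho> ^ DIM('a) * base_mass TYPE('a)"
  have c: "?c > 0" using r base_mass(2)[where 'a = 'a] by simp
  have "(\<integral>\<^sup>+z. ennreal (moll \<rho> (z::'a)) \<partial>lborel) =
      ennreal (\<rho> ^ DIM('a)) * (\<integral>\<^sup>+z. ennreal (base_bump (z::'a) / ?c) \<partial>lborel)"
    using r by (subst nn_integral_lborel_affine[of _ \<rho> 0]) (auto simp: moll_def)
  also have "(\<integral>\<^sup>+z. ennreal (base_bump (z::'a) / ?c) \<partial>lborel) = (\<integral>\<^sup>+z. ennreal (base_bump (z::'a)) * ennreal (1 / ?c) \<partial>lborel)"
    using c by (intro nn_integral_cong) (simp add: ennreal_mult''[symmetric] base_bump_nonneg)
  also have "\<dots> = ennreal (base_mass TYPE('a)) * ennreal (1 / ?c)"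
    by (subst nn_integral_multc) (auto simp: base_mass(1))
  also have "ennreal (\<rho> ^ DIM('a)) * \<dots> = 1"
    using r c base_mass(2)[where 'a='a] by (simp add: ennreal_mult''[symmetric])
  finally show ?thesis .
qed

lemma nn_integral_moll_shift:
  "\<rho> > 0 \<Longrightarrow> (\<integral>\<^sup>+y. ennreal (moll \<rho> (x - y)) \<partial>lborel) = 1"
  "\<rho> > 0 \<Longrightarrow> (\<integral>\<^sup>+y. ennreal (moll \<rho> (y - x)) \<partial>lborel) = 1"
  using nn_integral_lborel_reflect[of "\<lambda>z. ennreal (moll \<rho> z)" x] by (simp_all add: nn_integral_moll)

lemma integral_moll: 
  assumes "\<rho> > 0" shows "integrable lborel (\<lambda>y. moll \<rho> (x - y))" "(\<integral>y. moll \<rho> (x - y) \<partial>lborel) = 1"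
proof -
  show "integrable lborel (\<lambda>y. moll \<rho> (x - y))"
    using nn_integral_moll_shift(1)[OF assms, of x] moll_nonneg[OF assms]
    by (intro integrableI_nonneg) auto
  show "(\<integral>y. moll \<rho> (x - y) \<partial>lborel) = 1"
    using nn_integral_moll_shift(1)[OF assms, of x] moll_nonneg[OF assms]
    by (subst integral_eq_nn_integral) auto
qed

text \<open>By scaling, the gradient costs one factor 1/\<open>\<rho>\<close> more than the kernel
  itself. \<open>C\<close> is the maximum of the gradient of the unscaled bump divided by its mass,
  hence independent of \<open>\<rho>\<close>, as \<open>cutoff_exists\<close> requires.\<close>

lemma grad_moll_bound:
  obtains C where "C > 0"
    "\<And>\<rho> z. \<rho> > 0 \<Longrightarrow> norm (grad (moll \<rho>) (z::'a::euclidean_space)) \<le> C / \<rho> ^ (DIM('a) + 1)"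
    "\<And>\<rho> z. \<rho> > 0 \<Longrightarrow> norm z > \<rho> \<Longrightarrow> grad (moll \<rho>) (z::'a::euclidean_space) = 0"
proof -
  let ?m = "base_mass TYPE('a)"
  have z0: "grad f z = 0" if "\<rho> > 0" "norm z > \<rho>" "\<And>y. norm y > \<rho> \<Longrightarrow> f y = 0" for f \<rho> and z :: 'a
  proof (rule grad_eqI)
    have "((\<lambda>x. 0) has_derivative (\<lambda>v. 0 \<bullet> v)) (at z)" by simp
    moreover have "open {y::'a. norm y > \<rho>}" by (intro open_Collect_less continuous_intros)
    ultimately show "(f has_derivative (\<lambda>v. 0 \<bullet> v)) (at z)"
      by (rule has_derivative_transform_within_open) (use that in auto)
  qed
  obtain B where B: "B > 0" "\<And>x. norm (x::'a) \<le> 1 \<Longrightarrow> norm (grad base_bump x) \<le> B"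
    using continuous_bounded_on_cball[OF continuous_on_grad[OF smooth_fun_base_bump]] by metis
  have B': "norm (grad base_bump x) \<le> B" for x :: 'a
  proof (cases "norm x \<le> 1")
    case False
    then have "grad base_bump x = 0"
      by (intro z0[of 1 x base_bump]) (auto simp: base_bump_zero)
    then show ?thesis using B by simp
  qed (use B in simp)
  have m: "?m > 0" by (rule base_mass(2))
  have g: "grad (moll \<rho>) z = (1 / (\<rho> ^ (DIM('a)+1) * ?m)) *\<^sub>R grad base_bump ((1/\<rho>) *\<^sub>R z)" for \<rho> and z :: 'a
  proof (rule grad_eqI)
    have "((\<lambda>z. base_bump ((1/\<rho>) *\<^sub>R z)) has_derivative (\<lambda>v. grad base_bump ((1/\<rho>) *\<^sub>R z) \<bullet> ((1/\<rho>) *\<^sub>R v))) (at z)"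
      by (rule has_derivative_compose[OF _ smooth_fun_has_grad[OF smooth_fun_base_bump]])
        (auto intro!: derivative_eq_intros)
    from has_derivative_mult_right[OF this, of "1 / (\<rho> ^ DIM('a) * ?m)"]
    show "(moll \<rho> has_derivative (\<lambda>v. (1 / (\<rho> ^ (DIM('a)+1) * ?m)) *\<^sub>R grad base_bump ((1/\<rho>) *\<^sub>R z) \<bullet> v)) (at z)"
      by (simp add: moll_def[abs_def] divide_simps mult_ac)
  qed
  show thesis
  proof
    show "B / ?m > 0" using B m by simp
    show "norm (grad (moll \<rho>) z) \<le> B / ?m / \<rho> ^ (DIM('a)+1)" if "\<rho> > 0" for \<rho> and z :: 'a
      using that B'[of "(1/\<rho>) *\<^sub>R z"] m by (simp add: g field_simps)
    show "grad (moll \<rho>) z = 0" if "\<rho> > 0" "norm z > \<rho>" for \<rho> and z :: 'a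
      by (intro z0[OF that] moll_zero[OF that(1)] less_imp_le)
  qed
qed

text \<open>Translation invariance and Tonelli's theorem are applied to Borel functions with respect
  to \<open>lborel\<close> on the whole space. This lemma leads there from functions that are only
  Lebesgue measurable on \<open>D\<close>.\<close>

lemma borel_representative:
  fixes g :: "'a::euclidean_space \<Rightarrow> real"
  assumes D: "D \<in> sets borel" and g: "g \<in> borel_measurable (lebesgue_on D)"
  obtains g' where "g' \<in> borel_measurable borel" "\<And>x. x \<notin> D \<Longrightarrow> g' x = 0"
    "AE x in lebesgue_on D. g x = g' x"
proof -
  have D': "D \<in> sets lebesgue" "D \<in> sets borel" using D by auto
  have "(\<lambda>x. if x \<in> D then g x else 0) \<in> borel_measurable lebesgue"
    using g D' by (simp add: borel_measurable_if)
  from completion_ex_borel_measurable_real[OF this]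
  obtain h where h: "h \<in> borel_measurable lborel" "AE x in lborel. (if x \<in> D then g x else 0) = h x" by blast
  show thesis
  proof
    show "(\<lambda>x. indicator D x * h x) \<in> borel_measurable borel" using h D' by simp
    have "AE x in lebesgue. (if x \<in> D then g x else 0) = h x" using h(2) by (rule AE_completion)
    then show "AE x in lebesgue_on D. g x = indicator D x * h x"
      using D' by (subst AE_restrict_space_iff) (auto elim!: eventually_mono)
  qed simp
qed

lemma nn_integral_lebesgue_on_open:
  assumes "open D"
  shows "(\<integral>\<^sup>+x. f x \<partial>lebesgue_on D) = (\<integral>\<^sup>+x. f x * indicator D x \<partial>lborel)"
  using assms by (subst nn_integral_restrict_space) (auto simp: nn_integral_completion intro: lmeasurable_open)

section \<open>Mollification in L1 and L2\<close>

lemma abs_power_add_le: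
  assumes "q = 1 \<or> q = (2::nat)"
  shows "\<bar>a + b\<bar> ^ q \<le> 2 * (\<bar>a\<bar> ^ q + \<bar>b\<bar> ^ q :: real)"
proof -
  have "(a + b)\<^sup>2 \<le> 2 * (a\<^sup>2 + b\<^sup>2)"
    using sum_squares_ge_zero[of "a - b" 0] by (simp add: power2_eq_square algebra_simps)
  then show ?thesis using assms by auto
qed

lemma nn_integral_abs_power_add_le:
  fixes f g :: "'a \<Rightarrow> real"
  assumes q: "q = 1 \<or> q = (2::nat)" and [measurable]: "f \<in> borel_measurable M" "g \<in> borel_measurable M"
  shows "(\<integral>\<^sup>+x. ennreal (\<bar>f x + g x\<bar> ^ q) \<partial>M) \<le>
    2 * ((\<integral>\<^sup>+x. ennreal (\<bar>f x\<bar> ^ q) \<partial>M) + (\<integral>\<^sup>+x. ennreal (\<bar>g x\<bar> ^ q) \<partial>M))"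
proof -
  have "(\<integral>\<^sup>+x. ennreal (\<bar>f x + g x\<bar> ^ q) \<partial>M) \<le> (\<integral>\<^sup>+x. 2 * (ennreal (\<bar>f x\<bar> ^ q) + ennreal (\<bar>g x\<bar> ^ q)) \<partial>M)"
  proof (rule nn_integral_mono)
    fix x
    have "ennreal (\<bar>f x + g x\<bar> ^ q) \<le> ennreal (2 * (\<bar>f x\<bar> ^ q + \<bar>g x\<bar> ^ q))"
      by (rule ennreal_leI[OF abs_power_add_le[OF q]])
    then show "ennreal (\<bar>f x + g x\<bar> ^ q) \<le> 2 * (ennreal (\<bar>f x\<bar> ^ q) + ennreal (\<bar>g x\<bar> ^ q))"
      by (simp add: ennreal_mult)
  qed
  then show ?thesis by (simp add: nn_integral_cmult nn_integral_add)
qed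

text \<open>Jensen's inequality for the probability density \<open>moll\<close>. For q = 2 it is
  Cauchy-Schwarz after writing the kernel as a product of two square roots; Tonelli then integrates
  the kernel to 1 in the other variable. Where the convolution integral does not exist, its value is
  0 and the pointwise bound is trivial.\<close>

lemma conv_moll_contract:
  fixes g :: "'a::euclidean_space \<Rightarrow> real"
  assumes q: "q = 1 \<or> q = (2::nat)" and g [measurable]: "g \<in> borel_measurable borel" and r: "\<rho> > 0"
  shows "(\<integral>\<^sup>+x. ennreal (\<bar>conv g (moll \<rho>) x\<bar> ^ q) \<partial>lborel) \<le> (\<integral>\<^sup>+x. ennreal (\<bar>g x\<bar> ^ q) \<partial>lborel)"
proof -
  let ?m = "\<lambda>x y. ennreal (moll \<rho> (x - y :: 'a))"
  have 1: "ennreal \<bar>conv g (moll \<rho>) x\<bar> \<le> (\<integral>\<^sup>+y. ennreal \<bar>g y\<bar> * ?m x y \<partial>lborel)" for x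
  proof (cases "integrable lborel (\<lambda>y. g y * moll \<rho> (x - y))")
    case True
    have "ennreal (norm (conv g (moll \<rho>) x)) \<le> (\<integral>\<^sup>+y. ennreal (norm (g y * moll \<rho> (x - y))) \<partial>lborel)"
      unfolding conv_def by (rule integral_norm_bound_ennreal[OF True])
    then show ?thesis using moll_nonneg[OF r, where 'a = 'a]
      by (simp add: abs_mult ennreal_mult'')
  qed (simp add: conv_def not_integrable_integral_eq)
  have 2: "ennreal (\<bar>conv g (moll \<rho>) x\<bar> ^ q) \<le> (\<integral>\<^sup>+y. ennreal (\<bar>g y\<bar> ^ q) * ?m x y \<partial>lborel)" for x
  proof (cases "q = 1")
    case False
    then have q2: "q = 2" using q by simp
    let ?s = "\<lambda>y. ennreal (sqrt (moll \<rho> (x - y)))"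
    have s: "?s y * ?s y = ?m x y" for y
      using moll_nonneg[OF r, of "x - y"] by (simp add: ennreal_mult''[symmetric])
    have "ennreal (\<bar>conv g (moll \<rho>) x\<bar> ^ q) = (ennreal \<bar>conv g (moll \<rho>) x\<bar>)\<^sup>2"
      by (simp add: q2 power2_eq_square ennreal_mult''[symmetric])
    also have "\<dots> \<le> (\<integral>\<^sup>+y. ennreal \<bar>g y\<bar> * ?m x y \<partial>lborel)\<^sup>2"
      by (rule power_mono[OF 1]) simp
    also have "\<dots> = (\<integral>\<^sup>+y. (ennreal \<bar>g y\<bar> * ?s y) * ?s y \<partial>lborel)\<^sup>2"
      by (simp add: s mult.assoc)
    also have "\<dots> \<le> (\<integral>\<^sup>+y. (ennreal \<bar>g y\<bar> * ?s y)\<^sup>2 \<partial>lborel) * (\<integral>\<^sup>+y. (?s y)\<^sup>2 \<partial>lborel)"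
      by (rule Cauchy_Schwarz_nn_integral) measurable
    also have "(\<integral>\<^sup>+y. (?s y)\<^sup>2 \<partial>lborel) = 1"
      unfolding power2_eq_square s by (rule nn_integral_moll_shift(1)[OF r])
    also have "(\<integral>\<^sup>+y. (ennreal \<bar>g y\<bar> * ?s y)\<^sup>2 \<partial>lborel) = (\<integral>\<^sup>+y. ennreal (\<bar>g y\<bar> ^ q) * ?m x y \<partial>lborel)"
    proof (rule nn_integral_cong)
      fix y
      have "(ennreal \<bar>g y\<bar> * ?s y)\<^sup>2 = (ennreal \<bar>g y\<bar> * ennreal \<bar>g y\<bar>) * (?s y * ?s y)"
        by (simp only: power2_eq_square mult_ac)
      also have "ennreal \<bar>g y\<bar> * ennreal \<bar>g y\<bar> = ennreal (\<bar>g y\<bar> ^ q)"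
        by (simp add: ennreal_mult''[symmetric] power2_eq_square q2)
      finally show "(ennreal \<bar>g y\<bar> * ?s y)\<^sup>2 = ennreal (\<bar>g y\<bar> ^ q) * ?m x y" by (simp only: s)
    qed
    finally show ?thesis by simp
  qed (use 1 in simp)
  have "(\<integral>\<^sup>+x. ennreal (\<bar>conv g (moll \<rho>) x\<bar> ^ q) \<partial>lborel) \<le>
      (\<integral>\<^sup>+x. \<integral>\<^sup>+y. ennreal (\<bar>g y\<bar> ^ q) * ?m x y \<partial>lborel \<partial>lborel)"
    by (rule nn_integral_mono[OF 2])
  also have "\<dots> = (\<integral>\<^sup>+y. \<integral>\<^sup>+x. ennreal (\<bar>g y\<bar> ^ q) * ?m x y \<partial>lborel \<partial>lborel)"
    by (rule lborel_pair.Fubini'[symmetric]) measurable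
  also have "\<dots> = (\<integral>\<^sup>+y. ennreal (\<bar>g y\<bar> ^ q) \<partial>lborel)"
    by (intro nn_integral_cong) (simp add: nn_integral_cmult nn_integral_moll_shift[OF r])
  finally show ?thesis .
qed

text \<open>A Lebesgue measurable function is an almost everywhere limit of continuous functions.
  Clamping these to the range of \<open>g\<close> and multiplying by a tent function in
  \<open>norm x\<close> keeps them continuous and gives an integrable majorant for dominated
  convergence.\<close>

lemma Lq_dense_bounded:
  fixes g :: "'a::euclidean_space \<Rightarrow> real" and n :: nat
  assumes q: "q = 1 \<or> q = (2::nat)" and g [measurable]: "g \<in> borel_measurable borel"
    and gb: "\<And>x. \<bar>g x\<bar> \<le> real n" and g0': "\<forall>x. norm x > real n \<longrightarrow> g x = 0" and e: "\<epsilon> > 0"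
  shows "\<exists>c. continuous_on UNIV c \<and> (\<forall>x. norm x > real n + 1 \<longrightarrow> c x = 0) \<and>
    (\<integral>\<^sup>+x. ennreal (\<bar>g x - c x\<bar> ^ q) \<partial>lborel) < \<epsilon>"
proof -
  have g0: "g x = 0" if "norm x > real n" for x using g0' that by blast
  have "g measurable_on UNIV"
    by (rule lebesgue_measurable_imp_measurable_on) (auto intro: measurable_completion)
  then obtain N f where N: "negligible N" and f: "\<And>k. continuous_on UNIV (f k)"
    and lim: "\<And>x. x \<notin> N \<Longrightarrow> (\<lambda>k. f k x) \<longlonglongrightarrow> g x"
    unfolding measurable_on_def by auto
  define c where "c k x = max (- real n) (min (real n) (f k x)) * max 0 (min 1 (real n + 1 - norm x))" for k x
  have c: "continuous_on UNIV (c k)" for k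
    unfolding c_def[abs_def] by (intro continuous_intros f)
  have [measurable]: "c k \<in> borel_measurable borel" for k
    by (rule borel_measurable_continuous_onI[OF c])
  have c0: "c k x = 0" if "norm x > real n + 1" for k x using that by (simp add: c_def)
  have cb: "\<bar>c k x\<bar> \<le> real n" for k x
  proof -
    have "\<bar>c k x\<bar> \<le> real n * 1" unfolding c_def abs_mult by (intro mult_mono) auto
    then show ?thesis by simp
  qed
  have clim: "(\<lambda>k. c k x) \<longlonglongrightarrow> g x" if "x \<notin> N" for x
  proof -
    have "(\<lambda>k. c k x) \<longlonglongrightarrow> max (- real n) (min (real n) (g x)) * max 0 (min 1 (real n + 1 - norm x))"
      unfolding c_def by (intro tendsto_intros lim that)
    moreover have "max (- real n) (min (real n) (g x)) * max 0 (min 1 (real n + 1 - norm x)) = g x"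
      using gb[of x] g0[of x] by (cases "norm x > real n") (auto simp: max_def min_def)
    ultimately show ?thesis by simp
  qed
  have [measurable]: "cball (0::'a) (real n + 1) \<in> sets borel" by simp
  let ?w = "\<lambda>x::'a. ennreal ((2 * real n) ^ q) * indicator (cball 0 (real n + 1)) x"
  have "(\<lambda>k. \<integral>\<^sup>+x. ennreal (\<bar>g x - c k x\<bar> ^ q) \<partial>lborel) \<longlonglongrightarrow> (\<integral>\<^sup>+x. 0 \<partial>(lborel :: 'a measure))"
  proof (rule nn_integral_dominated_convergence[where w = ?w])
    show "AE x in lborel. ennreal (\<bar>g x - c k x\<bar> ^ q) \<le> ?w x" for k
    proof (rule AE_I2)
      fix x :: 'a
      show "ennreal (\<bar>g x - c k x\<bar> ^ q) \<le> ?w x"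
      proof (cases "norm x > real n + 1")
        case True
        then show ?thesis using c0[of x k] g0[of x] q by auto
      next
        case False
        have "\<bar>g x - c k x\<bar> \<le> 2 * real n" using gb[of x] cb[of k x] by linarith
        then have "\<bar>g x - c k x\<bar> ^ q \<le> (2 * real n) ^ q" by (intro power_mono) auto
        then show ?thesis using False by (simp add: ennreal_leI)
      qed
    qed
    show "(\<integral>\<^sup>+x. ?w x \<partial>lborel) < \<infinity>"
      using emeasure_lborel_cball_finite[of "0::'a" "real n + 1"]
      by (subst nn_integral_cmult_indicator) (auto simp: ennreal_mult_less_top)
    have "AE x in lborel. x \<notin> N"
    proof -
      have "N \<in> null_sets lebesgue" using N by (simp add: negligible_iff_null_sets)
      then have "AE x in lebesgue. x \<notin> N" by (rule AE_not_in)
      then show ?thesis by (simp add: AE_completion_iff)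
    qed
    then show "AE x in lborel. (\<lambda>k. ennreal (\<bar>g x - c k x\<bar> ^ q)) \<longlonglongrightarrow> 0"
    proof eventually_elim
      case (elim x)
      have "(\<lambda>k. \<bar>g x - c k x\<bar> ^ q) \<longlonglongrightarrow> \<bar>g x - g x\<bar> ^ q" by (intro tendsto_intros clim elim)
      then have "(\<lambda>k. ennreal (\<bar>g x - c k x\<bar> ^ q)) \<longlonglongrightarrow> ennreal (\<bar>g x - g x\<bar> ^ q)" by (rule tendsto_ennrealI)
      moreover have "ennreal (\<bar>g x - g x\<bar> ^ q) = 0" using q by auto
      ultimately show ?case by (simp only:)
    qed
  qed measurable
  then have "\<forall>\<^sub>F k in sequentially. (\<integral>\<^sup>+x. ennreal (\<bar>g x - c k x\<bar> ^ q) \<partial>lborel) < \<epsilon>"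
    using e by (intro order_tendstoD) auto
  then obtain k where "(\<integral>\<^sup>+x. ennreal (\<bar>g x - c k x\<bar> ^ q) \<partial>lborel) < \<epsilon>"
    by (auto simp: eventually_sequentially)
  then show ?thesis using c c0 by blast
qed

text \<open>Truncation at level \<open>n\<close>, in height and in space at once, reduces to
  \<open>Lq_dense_bounded\<close>. Since \<open>abs_power_add_le\<close> has the constant 2, each of
  the two errors must stay below \<open>\<epsilon> / 4\<close>.\<close>

lemma Lq_dense:
  fixes g :: "'a::euclidean_space \<Rightarrow> real" and \<epsilon> :: ennreal
  assumes q: "q = 1 \<or> q = (2::nat)" and g [measurable]: "g \<in> borel_measurable borel"
    and fin: "(\<integral>\<^sup>+x. ennreal (\<bar>g x\<bar> ^ q) \<partial>lborel) < \<infinity>" and e: "\<epsilon> > 0"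
  obtains c R where "continuous_on UNIV c" "\<forall>x. norm x > R \<longrightarrow> c x = 0"
    "(\<integral>\<^sup>+x. ennreal (\<bar>g x - c x\<bar> ^ q) \<partial>lborel) < \<epsilon>"
proof -
  define h where "h n x = (if norm x \<le> real n then max (- real n) (min (real n) (g x)) else 0)" for n x
  have [measurable]: "h n \<in> borel_measurable borel" for n unfolding h_def[abs_def] by measurable
  have "(\<lambda>n. \<integral>\<^sup>+x. ennreal (\<bar>g x - h n x\<bar> ^ q) \<partial>lborel) \<longlonglongrightarrow> (\<integral>\<^sup>+x. 0 \<partial>(lborel :: 'a measure))"
  proof (rule nn_integral_dominated_convergence[where w = "\<lambda>x. ennreal (\<bar>g x\<bar> ^ q)"])
    show "AE x in lborel. ennreal (\<bar>g x - h n x\<bar> ^ q) \<le> ennreal (\<bar>g x\<bar> ^ q)" for n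
      by (intro AE_I2 ennreal_leI power_mono) (auto simp: h_def)
    show "AE x in lborel. (\<lambda>n. ennreal (\<bar>g x - h n x\<bar> ^ q)) \<longlonglongrightarrow> 0"
    proof (rule AE_I2)
      fix x :: 'a
      obtain m :: nat where m: "norm x + \<bar>g x\<bar> \<le> real m" using real_arch_simple by blast
      have "\<forall>\<^sub>F n in sequentially. ennreal (\<bar>g x - h n x\<bar> ^ q) = 0"
        unfolding eventually_sequentially
      proof (intro exI[of _ m] allI impI)
        fix n assume "n \<ge> m"
        then have "norm x + \<bar>g x\<bar> \<le> real n" using m by linarith
        then have "norm x \<le> real n" "\<bar>g x\<bar> \<le> real n" using norm_ge_zero[of x] abs_ge_zero[of "g x"] by linarith+
        then have "h n x = g x" unfolding h_def by auto
        then show "ennreal (\<bar>g x - h n x\<bar> ^ q) = 0" using q by auto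
      qed
      then show "(\<lambda>n. ennreal (\<bar>g x - h n x\<bar> ^ q)) \<longlonglongrightarrow> 0" by (rule tendsto_eventually)
    qed
  qed (use fin in auto)
  then have "\<forall>\<^sub>F n in sequentially. (\<integral>\<^sup>+x. ennreal (\<bar>g x - h n x\<bar> ^ q) \<partial>lborel) < \<epsilon> / 4"
    using e by (intro order_tendstoD) (auto simp: ennreal_zero_less_divide)
  then obtain n where n: "(\<integral>\<^sup>+x. ennreal (\<bar>g x - h n x\<bar> ^ q) \<partial>lborel) < \<epsilon> / 4"
    by (auto simp: eventually_sequentially)
  have e4: "\<epsilon> / 4 > 0" using e by (simp add: ennreal_zero_less_divide)
  have hm: "h n \<in> borel_measurable borel" and hb: "\<bar>h n x\<bar> \<le> real n" and h0: "\<forall>x. norm x > real n \<longrightarrow> h n x = 0" for x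
    by (simp, auto simp: h_def)
  obtain c where *: "continuous_on UNIV c \<and> (\<forall>x. norm x > real n + 1 \<longrightarrow> c x = 0) \<and>
    (\<integral>\<^sup>+x. ennreal (\<bar>h n x - c x\<bar> ^ q) \<partial>lborel) < \<epsilon> / 4"
    using Lq_dense_bounded[OF q hm hb h0 e4] by (rule exE)
  then have c: "continuous_on UNIV c" "\<forall>x. norm x > real n + 1 \<longrightarrow> c x = 0"
    "(\<integral>\<^sup>+x. ennreal (\<bar>h n x - c x\<bar> ^ q) \<partial>lborel) < \<epsilon> / 4"
    by simp_all
  have [measurable]: "c \<in> borel_measurable borel" by (rule borel_measurable_continuous_onI[OF c(1)])
  have "(\<integral>\<^sup>+x. ennreal (\<bar>g x - c x\<bar> ^ q) \<partial>lborel) = (\<integral>\<^sup>+x. ennreal (\<bar>(g x - h n x) + (h n x - c x)\<bar> ^ q) \<partial>lborel)"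
    by simp
  also have "\<dots> \<le> 2 * ((\<integral>\<^sup>+x. ennreal (\<bar>g x - h n x\<bar> ^ q) \<partial>lborel) + (\<integral>\<^sup>+x. ennreal (\<bar>h n x - c x\<bar> ^ q) \<partial>lborel))"
    by (rule nn_integral_abs_power_add_le[OF q]) measurable
  also have "\<dots> < 2 * (\<epsilon> / 4 + \<epsilon> / 4)"
    using n c(3) by (intro ennreal_mult_strict_left_mono add_strict_mono) auto
  also have "\<dots> = \<epsilon>"
  proof (cases \<epsilon>)
    case (real r)
    then have "2 * (\<epsilon> / 4 + \<epsilon> / 4) = 2 * ennreal (r / 2)"
      by (simp add: ennreal_divide_numeral ennreal_plus[symmetric] del: ennreal_plus)
    also have "\<dots> = ennreal (2 * (r / 2))" using ennreal_mult'[of 2 "r / 2"] by simp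
    finally show ?thesis using real by simp
  qed (simp add: ennreal_top_divide ennreal_mult_top)
  finally have "(\<integral>\<^sup>+x. ennreal (\<bar>g x - c x\<bar> ^ q) \<partial>lborel) < \<epsilon>" .
  with c(1,2) show thesis by (rule that)
qed

text \<open>By uniform continuity the error is at most \<open>d\<close>, and for scales below 1 it
  lives in the ball of radius |R| + 1. Outside the ball of radius |R| the function is 0, so
  compactness of a slightly larger ball is enough.\<close>

lemma conv_moll_continuous:
  fixes c :: "'a::euclidean_space \<Rightarrow> real"
  assumes q: "q = 1 \<or> q = (2::nat)" and c: "continuous_on UNIV c" and R': "\<forall>x. norm x > R \<longrightarrow> c x = 0"
    and e: "\<epsilon> > (0::ennreal)"
  shows "\<exists>\<rho>0>0. \<forall>\<rho>. 0 < \<rho> \<and> \<rho> < \<rho>0 \<longrightarrow>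
    (\<integral>\<^sup>+x. ennreal (\<bar>conv c (moll \<rho>) x - c x\<bar> ^ q) \<partial>lborel) < \<epsilon>"
proof -
  have R: "c x = 0" if "norm x > R" for x using R' that by blast
  define V where "V = measure lborel (cball (0::'a) (\<bar>R\<bar> + 1)) + 1"
  have V: "V > 0" unfolding V_def using measure_nonneg[of lborel "cball (0::'a) (\<bar>R\<bar> + 1)"] by linarith
  obtain e1 :: real where e1: "e1 > 0" "ennreal e1 < \<epsilon>"
  proof (cases \<epsilon>)
    case (real r)
    then show ?thesis using e that[of "r / 2"] by (auto simp: ennreal_less_iff)
  next
    case top
    then show ?thesis using that[of 1] by simp
  qed
  \<comment> \<open>As d <= 1 and q >= 1, d^q <= d, so one choice serves both exponents;
    \<open>V\<close> exceeds the volume of the ball that carries the error.\<close>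
  define d where "d = min 1 (e1 / V)"
  have d: "d > 0" "d ^ q * V \<le> e1"
  proof -
    show "d > 0" using e1 V by (simp add: d_def)
    have "d ^ q \<le> d ^ 1" using q \<open>d > 0\<close> by (intro power_decreasing) (auto simp: d_def)
    also have "\<dots> \<le> e1 / V" by (simp add: d_def)
    finally show "d ^ q * V \<le> e1" using V by (simp add: field_simps)
  qed
  have "uniformly_continuous_on (cball 0 (\<bar>R\<bar> + 2)) c"
    using c by (intro compact_uniformly_continuous) (auto intro: continuous_on_subset)
  from this[unfolded uniformly_continuous_on_def, THEN spec[of _ d], THEN mp, OF d(1)]
  obtain r where *: "r > 0 \<and> (\<forall>x\<in>cball 0 (\<bar>R\<bar> + 2). \<forall>y\<in>cball 0 (\<bar>R\<bar> + 2). dist y x < r \<longrightarrow> dist (c y) (c x) < d)"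
    by (rule exE)
  then have r: "r > 0" "\<And>x y. x \<in> cball 0 (\<bar>R\<bar> + 2) \<Longrightarrow> y \<in> cball 0 (\<bar>R\<bar> + 2) \<Longrightarrow> dist y x < r \<Longrightarrow> dist (c y) (c x) < d"
    using *[THEN conjunct1] *[THEN conjunct2, rule_format] by simp_all
  have ci: "integrable lborel c"
  proof -
    obtain B where B: "B > 0" "\<And>x. norm x \<le> \<bar>R\<bar> \<Longrightarrow> norm (c x) \<le> B"
      using continuous_bounded_on_cball[OF c, of "\<bar>R\<bar>"] by metis
    show ?thesis
    proof (rule Bochner_Integration.integrable_bound[of _ "\<lambda>x. indicator (cball 0 \<bar>R\<bar>) x * B"])
      show "integrable lborel (\<lambda>x::'a. indicator (cball 0 \<bar>R\<bar>) x * B)"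
        using emeasure_lborel_cball_finite[of "0::'a" "\<bar>R\<bar>"] by (intro integrable_mult_left integrable_real_indicator) auto
      show "AE x in lborel. norm (c x) \<le> norm (indicator (cball 0 \<bar>R\<bar>) x * B)"
      proof (rule AE_I2)
        fix x show "norm (c x) \<le> norm (indicator (cball 0 \<bar>R\<bar>) x * B)"
          using B(1) B(2)[of x] R[of x] by (cases "norm x \<le> \<bar>R\<bar>") auto
      qed
    qed (use borel_measurable_continuous_onI[OF c] in auto)
  qed
  show ?thesis
  proof (intro exI[of _ "min 1 r"] conjI allI impI; (elim conjE)?)
    show "min 1 r > 0" using r by simp
    fix \<rho> :: real assume rho: "0 < \<rho>" "\<rho> < min 1 r"
    have I: "integrable lborel (\<lambda>y. c y * moll \<rho> (x - y))" for x
      by (rule integrable_conv[OF ci R smooth_fun_continuous[OF smooth_fun_moll]])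
    have b: "\<bar>conv c (moll \<rho>) x - c x\<bar> \<le> d * indicator (cball 0 (\<bar>R\<bar> + 1)) x" for x
    proof -
      have "conv c (moll \<rho>) x - c x = (\<integral>y. c y * moll \<rho> (x - y) \<partial>lborel) - (\<integral>y. c x * moll \<rho> (x - y) \<partial>lborel)"
        using integral_moll[OF rho(1), of x] by (simp add: conv_def)
      also have "\<dots> = (\<integral>y. (c y - c x) * moll \<rho> (x - y) \<partial>lborel)"
        using I[of x] integral_moll(1)[OF rho(1), of x]
        by (subst Bochner_Integration.integral_diff[symmetric]) (auto simp: left_diff_distrib)
      also have "\<bar>\<dots>\<bar> \<le> (\<integral>y. (d * indicator (cball 0 (\<bar>R\<bar> + 1)) x) * moll \<rho> (x - y) \<partial>lborel)"
      proof (rule integral_abs_bound[THEN order_trans], rule integral_mono)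
        have "integrable lborel (\<lambda>y. (c y - c x) * moll \<rho> (x - y))"
          using I[of x] integral_moll(1)[OF rho(1), of x] by (simp add: left_diff_distrib)
        then show "integrable lborel (\<lambda>y. \<bar>(c y - c x) * moll \<rho> (x - y)\<bar>)" by (rule integrable_abs)
        show "integrable lborel (\<lambda>y. d * indicat_real (cball 0 (\<bar>R\<bar> + 1)) x * moll \<rho> (x - y))"
          using integral_moll(1)[OF rho(1), of x] by simp
        fix y
        have "\<bar>c y - c x\<bar> * moll \<rho> (x - y) \<le> (d * indicator (cball 0 (\<bar>R\<bar> + 1)) x) * moll \<rho> (x - y)"
        proof (cases "norm (x - y) \<ge> \<rho>")
          case False
          then have xy: "norm (x - y) < 1" "dist y x < r" using rho by (auto simp: dist_norm norm_minus_commute)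
          show ?thesis
          proof (cases "norm x \<le> \<bar>R\<bar> + 1")
            case True
            have "norm y \<le> norm x + norm (x - y)" using norm_triangle_ineq4[of x "x - y"] by simp
            then have "dist (c y) (c x) < d" using True xy by (intro r) auto
            then show ?thesis using True moll_nonneg[OF rho(1), of "x - y"] by (intro mult_right_mono) (auto simp: dist_real_def)
          next
            case False
            have "norm x \<le> norm y + norm (x - y)" using norm_triangle_ineq[of y "x - y"] by simp
            then have "norm y > R" "norm x > R" using False xy by linarith+
            then show ?thesis using R d(1) moll_nonneg[OF rho(1), of "x - y"] by simp
          qed
        qed (simp add: moll_zero[OF rho(1)])
        then show "\<bar>(c y - c x) * moll \<rho> (x - y)\<bar> \<le> d * indicat_real (cball 0 (\<bar>R\<bar> + 1)) x * moll \<rho> (x - y)"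
          using moll_nonneg[OF rho(1), of "x - y"] by (simp add: abs_mult)
      qed
      also have "\<dots> = d * indicator (cball 0 (\<bar>R\<bar> + 1)) x"
        using integral_moll[OF rho(1), of x] by simp
      finally show ?thesis .
    qed
    have "(\<integral>\<^sup>+x. ennreal (\<bar>conv c (moll \<rho>) x - c x\<bar> ^ q) \<partial>lborel) \<le> (\<integral>\<^sup>+x. ennreal (d ^ q) * indicator (cball (0::'a) (\<bar>R\<bar> + 1)) x \<partial>lborel)"
    proof (rule nn_integral_mono)
      fix x :: 'a
      have "\<bar>conv c (moll \<rho>) x - c x\<bar> ^ q \<le> (d * indicator (cball 0 (\<bar>R\<bar> + 1)) x) ^ q"
        by (rule power_mono[OF b]) simp
      then show "ennreal (\<bar>conv c (moll \<rho>) x - c x\<bar> ^ q) \<le> ennreal (d ^ q) * indicator (cball (0::'a) (\<bar>R\<bar> + 1)) x"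
        using q by (auto simp: indicator_def intro!: ennreal_leI split: if_splits)
    qed
    also have "\<dots> = ennreal (d ^ q) * emeasure lborel (cball (0::'a) (\<bar>R\<bar> + 1))"
      by (subst nn_integral_cmult_indicator) auto
    also have "\<dots> \<le> ennreal (d ^ q) * ennreal V"
      using emeasure_lborel_cball_finite[of "0::'a" "\<bar>R\<bar> + 1"]
      by (intro mult_left_mono) (auto simp: V_def emeasure_eq_ennreal_measure intro!: ennreal_leI)
    also have "\<dots> \<le> ennreal e1"
      using d V by (simp add: ennreal_mult''[symmetric] ennreal_leI)
    also have "\<dots> < \<epsilon>" by (rule e1)
    finally show "(\<integral>\<^sup>+x. ennreal (\<bar>conv c (moll \<rho>) x - c x\<bar> ^ q) \<partial>lborel) < \<epsilon>" .
  qed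
qed

text \<open>The bound |g| <= 1 + |g|^q splits the integrand into the kernel, of mass 1, and |g|^q
  times the maximum \<open>B\<close> of the kernel. Integrability is what makes \<open>conv\<close>
  additive in its first argument in the next lemma.\<close>

lemma integrable_Lq_moll:
  fixes g :: "'a::euclidean_space \<Rightarrow> real"
  assumes q: "q = 1 \<or> q = (2::nat)" and g [measurable]: "g \<in> borel_measurable borel"
    and fin: "(\<integral>\<^sup>+x. ennreal (\<bar>g x\<bar> ^ q) \<partial>lborel) < \<infinity>" and r: "\<rho> > 0"
  shows "integrable lborel (\<lambda>y. g y * moll \<rho> (x - y))"
proof -
  have i: "integrable lborel (\<lambda>y. \<bar>g y\<bar> ^ q)"
    using fin by (intro integrableI_bounded) auto
  define B where "B = 1 / (\<rho> ^ DIM('a) * base_mass TYPE('a))"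
  have B: "moll \<rho> z \<le> B" for z :: 'a
    unfolding B_def moll_def using r base_mass(2)[where 'a = 'a] base_bump_le_1
    by (intro divide_right_mono) auto
  have B0: "B \<ge> 0" using B[of 0] moll_nonneg[OF r, of 0] by (rule order_trans[rotated])
  show ?thesis
  proof (rule Bochner_Integration.integrable_bound[of _ "\<lambda>y. moll \<rho> (x - y) + \<bar>g y\<bar> ^ q * B"])
    show "integrable lborel (\<lambda>y. moll \<rho> (x - y) + \<bar>g y\<bar> ^ q * B)"
      using i integral_moll(1)[OF r, of x] by auto
    show "AE y in lborel. norm (g y * moll \<rho> (x - y)) \<le> norm (moll \<rho> (x - y) + \<bar>g y\<bar> ^ q * B)"
    proof (rule AE_I2)
      fix y
      have "\<bar>g y\<bar> \<le> 1 + \<bar>g y\<bar> ^ q"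
      proof (cases "\<bar>g y\<bar> \<le> 1")
        case False
        then have "\<bar>g y\<bar> ^ 1 \<le> \<bar>g y\<bar> ^ q" using q by (intro power_increasing) auto
        then show ?thesis by simp
      qed (simp add: add_increasing2)
      then have "\<bar>g y\<bar> * moll \<rho> (x - y) \<le> (1 + \<bar>g y\<bar> ^ q) * moll \<rho> (x - y)"
        by (rule mult_right_mono) (rule moll_nonneg[OF r])
      also have "\<dots> \<le> moll \<rho> (x - y) + \<bar>g y\<bar> ^ q * B"
        using B[of "x - y"] by (simp add: distrib_right mult_left_mono)
      finally show "norm (g y * moll \<rho> (x - y)) \<le> norm (moll \<rho> (x - y) + \<bar>g y\<bar> ^ q * B)"
        using moll_nonneg[OF r, of "x - y"] by (simp add: abs_mult)
    qed
  qed measurable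
qed

text \<open>The usual comparison with a continuous function \<open>c\<close> of compact support; the
  contraction property disposes of the mollified difference. Two applications of an inequality with
  constant 2 put a factor 4 on three terms, each below \<open>\<epsilon> / 16\<close>.\<close>

lemma conv_moll_tendsto:
  fixes g :: "'a::euclidean_space \<Rightarrow> real"
  assumes q: "q = 1 \<or> q = (2::nat)" and g [measurable]: "g \<in> borel_measurable borel"
    and fin: "(\<integral>\<^sup>+x. ennreal (\<bar>g x\<bar> ^ q) \<partial>lborel) < \<infinity>"
  shows "(\<lambda>n. \<integral>\<^sup>+x. ennreal (\<bar>conv g (moll (1 / real (Suc n))) x - g x\<bar> ^ q) \<partial>lborel) \<longlonglongrightarrow> 0"
proof (rule order_tendstoI)
  fix \<epsilon> :: ennreal assume "0 < \<epsilon>"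
  then have e: "\<epsilon> / 16 > 0" by (simp add: ennreal_zero_less_divide)
  obtain c R where c: "continuous_on UNIV c" "\<forall>x. norm x > R \<longrightarrow> c x = 0"
    "(\<integral>\<^sup>+x. ennreal (\<bar>g x - c x\<bar> ^ q) \<partial>lborel) < \<epsilon> / 16" by (rule Lq_dense[OF q g fin e])
  obtain \<rho>0 where *: "\<rho>0 > 0 \<and> (\<forall>\<rho>. 0 < \<rho> \<and> \<rho> < \<rho>0 \<longrightarrow>
      (\<integral>\<^sup>+x. ennreal (\<bar>conv c (moll \<rho>) x - c x\<bar> ^ q) \<partial>lborel) < \<epsilon> / 16)"
    using conv_moll_continuous[OF q c(1,2) e] by (rule exE)
  note r0 = *[THEN conjunct1] *[THEN conjunct2, rule_format, OF conjI]
  have cm [measurable]: "c \<in> borel_measurable borel" by (rule borel_measurable_continuous_onI[OF c(1)])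
  have cfin: "(\<integral>\<^sup>+x. ennreal (\<bar>c x\<bar> ^ q) \<partial>lborel) < \<infinity>"
  proof -
    have "(\<integral>\<^sup>+x. ennreal (\<bar>c x\<bar> ^ q) \<partial>lborel) = (\<integral>\<^sup>+x. ennreal (\<bar>g x + - (g x - c x)\<bar> ^ q) \<partial>lborel)" by simp
    also have "\<dots> \<le> 2 * ((\<integral>\<^sup>+x. ennreal (\<bar>g x\<bar> ^ q) \<partial>lborel) + (\<integral>\<^sup>+x. ennreal (\<bar>- (g x - c x)\<bar> ^ q) \<partial>lborel))"
      by (rule nn_integral_abs_power_add_le[OF q]) measurable
    also have "\<dots> < \<infinity>"
      using fin less_le_trans[OF c(3) top_greatest]
      by (simp only: abs_minus_cancel ennreal_mult_less_top infinity_ennreal_def ennreal_add_less_top) simp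
    finally show ?thesis .
  qed
  have main: "(\<integral>\<^sup>+x. ennreal (\<bar>conv g (moll \<rho>) x - g x\<bar> ^ q) \<partial>lborel) < \<epsilon>" if r: "0 < \<rho>" "\<rho> < \<rho>0" for \<rho>
  proof -
    have [measurable]: "(\<lambda>x. conv f (moll \<rho>) x) \<in> borel_measurable borel" if [measurable]: "f \<in> borel_measurable borel" for f
      unfolding conv_def by measurable
    have eq: "conv g (moll \<rho>) x - g x = conv (\<lambda>x. g x - c x) (moll \<rho>) x + ((conv c (moll \<rho>) x - c x) + (c x - g x))" for x
    proof -
      have "conv (\<lambda>x. g x - c x) (moll \<rho>) x = conv g (moll \<rho>) x - conv c (moll \<rho>) x"
        unfolding conv_def left_diff_distrib
        by (rule Bochner_Integration.integral_diff integrable_Lq_moll[OF q g fin r(1)] integrable_Lq_moll[OF q cm cfin r(1)])+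
      then show ?thesis by simp
    qed
    let ?I = "\<lambda>f. \<integral>\<^sup>+x. ennreal (\<bar>f x\<bar> ^ q) \<partial>(lborel :: 'a measure)"
    have "?I (\<lambda>x. conv g (moll \<rho>) x - g x) \<le> 2 * (?I (conv (\<lambda>x. g x - c x) (moll \<rho>)) + ?I (\<lambda>x. (conv c (moll \<rho>) x - c x) + (c x - g x)))"
      unfolding eq by (rule nn_integral_abs_power_add_le[OF q]) measurable
    also have "\<dots> \<le> 2 * (?I (\<lambda>x. g x - c x) + 2 * (?I (\<lambda>x. conv c (moll \<rho>) x - c x) + ?I (\<lambda>x. c x - g x)))"
      by (intro mult_left_mono add_mono conv_moll_contract[OF q] nn_integral_abs_power_add_le[OF q] r) measurable
    also have "\<dots> \<le> 2 * (2 * (?I (\<lambda>x. g x - c x)) + 2 * (?I (\<lambda>x. conv c (moll \<rho>) x - c x) + ?I (\<lambda>x. c x - g x)))"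
      by (intro mult_left_mono add_right_mono) (auto simp: mult_2)
    also have "\<dots> = 4 * (?I (\<lambda>x. g x - c x) + (?I (\<lambda>x. conv c (moll \<rho>) x - c x) + ?I (\<lambda>x. g x - c x)))"
      by (simp add: distrib_left mult.assoc[symmetric] abs_minus_commute)
    also have "\<dots> < 4 * (\<epsilon> / 16 + (\<epsilon> / 16 + \<epsilon> / 16))"
      using c(3) r0(2)[OF r] by (intro ennreal_mult_strict_left_mono add_strict_mono) auto
    also have "\<dots> \<le> \<epsilon>"
    proof (cases \<epsilon>)
      case (real r)
      then have "4 * (\<epsilon> / 16 + (\<epsilon> / 16 + \<epsilon> / 16)) = 4 * ennreal (3 * r / 16)"
        by (simp add: ennreal_divide_numeral ennreal_plus[symmetric] del: ennreal_plus)
      also have "\<dots> = ennreal (4 * (3 * r / 16))" using ennreal_mult'[of 4 "3 * r / 16"] by simp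
      also have "\<dots> \<le> \<epsilon>" using real by (auto intro!: ennreal_leI)
      finally show ?thesis .
    qed simp
    finally show ?thesis .
  qed
  have "\<forall>\<^sub>F n in sequentially. 1 / real (Suc n) < \<rho>0"
    using r0(1) lim_1_over_n order_tendstoD(2)[OF LIMSEQ_Suc[OF lim_1_over_n]] by simp
  then show "\<forall>\<^sub>F n in sequentially. (\<integral>\<^sup>+x. ennreal (\<bar>conv g (moll (1 / real (Suc n))) x - g x\<bar> ^ q) \<partial>lborel) < \<epsilon>"
    by eventually_elim (rule main, auto)
qed simp

text \<open>The first terms may have an infinite integral, so the known result on L1 convergence is
  applied to |f|^q from an index \<open>N\<close> on; a q-th root returns from |f|^q to f.\<close>

lemma AE_subseq_of_Lq:
  fixes f :: "nat \<Rightarrow> 'a \<Rightarrow> real"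
  assumes q: "q \<noteq> (0::nat)" and m [measurable]: "\<And>n. f n \<in> borel_measurable M"
    and lim: "(\<lambda>n. \<integral>\<^sup>+x. ennreal (\<bar>f n x\<bar> ^ q) \<partial>M) \<longlonglongrightarrow> 0"
  obtains r :: "nat \<Rightarrow> nat" where "strict_mono r" "AE x in M. (\<lambda>n. f (r n) x) \<longlonglongrightarrow> 0"
proof -
  have "\<forall>\<^sub>F n in sequentially. (\<integral>\<^sup>+x. ennreal (\<bar>f n x\<bar> ^ q) \<partial>M) < 1"
    using lim by (rule order_tendstoD) simp
  then obtain N where N: "\<And>n. n \<ge> N \<Longrightarrow> (\<integral>\<^sup>+x. ennreal (\<bar>f n x\<bar> ^ q) \<partial>M) < 1"
    unfolding eventually_sequentially by blast
  define u where "u n x = \<bar>f (n + N) x\<bar> ^ q" for n x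
  have u0: "0 \<le> u n x" for n x by (simp add: u_def)
  have ui: "integrable M (u n)" for n
    unfolding u_def[abs_def] using N[of "n + N"]
    by (intro integrableI_bounded) (auto intro: less_trans[where y = 1])
  have "(\<lambda>n. \<integral>\<^sup>+x. ennreal (u n x) \<partial>M) \<longlonglongrightarrow> 0"
    unfolding u_def using LIMSEQ_ignore_initial_segment[OF lim, of N] by simp
  then have "(\<lambda>n. ennreal (\<integral>x. u n x \<partial>M)) \<longlonglongrightarrow> ennreal 0"
    using nn_integral_eq_integral[OF ui AE_I2[OF u0]] by simp
  then have "(\<lambda>n. \<integral>x. u n x \<partial>M) \<longlonglongrightarrow> 0"
    by (subst (asm) tendsto_ennreal_iff) (auto simp: u0 intro!: integral_nonneg_AE)
  then have "(\<lambda>n. \<integral>x. norm (u n x) \<partial>M) \<longlonglongrightarrow> 0" using u0 by simp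
  from tendsto_L1_AE_subseq[OF ui this]
  obtain r where r: "strict_mono r" "AE x in M. (\<lambda>n. u (r n) x) \<longlonglongrightarrow> 0" by blast
  show thesis
  proof
    show "strict_mono (\<lambda>n. r n + N)" using r(1) by (simp add: strict_mono_def)
    show "AE x in M. (\<lambda>n. f (r n + N) x) \<longlonglongrightarrow> 0"
      using r(2)
    proof eventually_elim
      case (elim x)
      then have "(\<lambda>n. root q (\<bar>f (r n + N) x\<bar> ^ q)) \<longlonglongrightarrow> root q 0"
        unfolding u_def by (intro tendsto_intros)
      then have "(\<lambda>n. \<bar>f (r n + N) x\<bar>) \<longlonglongrightarrow> 0" using q by (simp add: real_root_power_cancel)
      then show ?case by (rule tendsto_rabs_zero_cancel)
    qed
  qed
qed

subsection \<open>Square integrable functions\<close>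

text \<open>Real-valued counterparts of \<open>Lp_space D 2\<close> and \<open>Lp_norm D 2\<close>,
  linked to them by \<open>Lp_space_2\<close> and \<open>Lp_norm_2\<close>; arguments with inner
  products and signs then stay within the Bochner integral.\<close>

definition L2 :: "'a::euclidean_space set \<Rightarrow> ('a \<Rightarrow> 'b::euclidean_space) \<Rightarrow> bool" where
  "L2 D f \<longleftrightarrow> f \<in> borel_measurable (lebesgue_on D) \<and> integrable (lebesgue_on D) (\<lambda>x. (norm (f x))\<^sup>2)"

definition l2 :: "'a::euclidean_space set \<Rightarrow> ('a \<Rightarrow> 'b::euclidean_space) \<Rightarrow> real" where
  "l2 D f = sqrt (\<integral>x. (norm (f x))\<^sup>2 \<partial>lebesgue_on D)"

lemma L2_measurable: "L2 D f \<Longrightarrow> f \<in> borel_measurable (lebesgue_on D)"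
  and L2_integrable: "L2 D f \<Longrightarrow> integrable (lebesgue_on D) (\<lambda>x. (norm (f x))\<^sup>2)"
  by (auto simp: L2_def)

lemma l2_nonneg: "0 \<le> l2 D f"
  by (simp add: l2_def)

lemma l2_square: "(l2 D f)\<^sup>2 = (\<integral>x. (norm (f x))\<^sup>2 \<partial>lebesgue_on D)"
  by (simp add: l2_def)

lemma L2_iff: "L2 D f \<longleftrightarrow> f \<in> borel_measurable (lebesgue_on D) \<and>
    (\<integral>\<^sup>+x. ennreal ((norm (f x))\<^sup>2) \<partial>lebesgue_on D) < \<infinity>"
  unfolding L2_def by (auto simp: integrable_iff_bounded)

lemma Lp_enorm_2_eq:
  "Lp_enorm D 2 f = (let I = (\<integral>\<^sup>+x. ennreal ((norm (f x))\<^sup>2) \<partial>lebesgue_on D)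
     in if I = \<infinity> then \<infinity> else ennreal (sqrt (enn2real I)))"
proof -
  have "norm (f x) powr enn2real 2 = (norm (f x))\<^sup>2" for x by simp
  then show ?thesis unfolding Lp_enorm_def by (simp add: powr_half_sqrt Let_def)
qed

lemma Lp_space_2: "f \<in> Lp_space D 2 \<longleftrightarrow> L2 D f"
  by (auto simp: Lp_space_def Lp_enorm_2_eq L2_iff Let_def less_top split: if_splits)

lemma L2_nn_integral: "L2 D f \<Longrightarrow> (\<integral>\<^sup>+x. ennreal ((norm (f x))\<^sup>2) \<partial>lebesgue_on D) = ennreal ((l2 D f)\<^sup>2)"
  unfolding l2_square by (intro nn_integral_eq_integral) (auto simp: L2_def)

lemma Lp_enorm_2: "L2 D f \<Longrightarrow> Lp_enorm D 2 f = ennreal (l2 D f)"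
  by (simp add: Lp_enorm_2_eq L2_nn_integral l2_nonneg)

lemma Lp_norm_2: "L2 D f \<Longrightarrow> Lp_norm D 2 f = l2 D f"
  by (simp add: Lp_norm_def Lp_enorm_2 l2_nonneg)

lemma L2_dominated:
  assumes "L2 D g" "f \<in> borel_measurable (lebesgue_on D)" "AE x in lebesgue_on D. norm (f x) \<le> C * norm (g x)"
  shows "L2 D f" "C \<ge> 0 \<Longrightarrow> l2 D f \<le> C * l2 D g"
proof -
  note [measurable] = assms(2) L2_measurable[OF assms(1)]
  have le: "AE x in lebesgue_on D. (norm (f x))\<^sup>2 \<le> C\<^sup>2 * (norm (g x))\<^sup>2"
    using assms(3)
  proof eventually_elim
    case (elim x)
    then show ?case using power_mono[of "norm (f x)" "C * norm (g x)" 2] by (simp add: power_mult_distrib)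
  qed
  have gi: "integrable (lebesgue_on D) (\<lambda>x. C\<^sup>2 * (norm (g x))\<^sup>2)" using L2_integrable[OF assms(1)] by simp
  have fi: "integrable (lebesgue_on D) (\<lambda>x. (norm (f x))\<^sup>2)"
    by (rule Bochner_Integration.integrable_bound[OF gi]) (use le in auto)
  then show "L2 D f" using assms(2) by (simp add: L2_def)
  assume C: "C \<ge> 0"
  have "(l2 D f)\<^sup>2 \<le> (C * l2 D g)\<^sup>2"
    unfolding power_mult_distrib l2_square
    using integral_mono_AE[OF fi gi le] by simp
  then show "l2 D f \<le> C * l2 D g" by (rule power2_le_imp_le) (simp add: C l2_nonneg)
qed

lemma L2_cong_AE:
  assumes "AE x in lebesgue_on D. f x = g x" "f \<in> borel_measurable (lebesgue_on D)" "g \<in> borel_measurable (lebesgue_on D)"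
  shows "L2 D f \<longleftrightarrow> L2 D g" "l2 D f = l2 D g"
proof -
  note [measurable] = assms(2,3)
  have "integrable (lebesgue_on D) (\<lambda>x. (norm (f x))\<^sup>2) \<longleftrightarrow> integrable (lebesgue_on D) (\<lambda>x. (norm (g x))\<^sup>2)"
    using assms(1) by (intro integrable_cong_AE) auto
  then show "L2 D f \<longleftrightarrow> L2 D g" using assms by (simp add: L2_def)
  show "l2 D f = l2 D g" unfolding l2_def
    using assms(1) by (intro arg_cong[where f = sqrt] integral_cong_AE) auto
qed

lemma L2_add:
  assumes "L2 D f" "L2 D g" shows "L2 D (\<lambda>x. f x + g x)"
proof -
  note [measurable] = L2_measurable[OF assms(1)] L2_measurable[OF assms(2)]
  have "integrable (lebesgue_on D) (\<lambda>x. (norm (f x + g x))\<^sup>2)"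
  proof (rule Bochner_Integration.integrable_bound[where f = "\<lambda>x. 2 * ((norm (f x))\<^sup>2 + (norm (g x))\<^sup>2)"])
    show "AE x in lebesgue_on D. norm ((norm (f x + g x))\<^sup>2) \<le> norm (2 * ((norm (f x))\<^sup>2 + (norm (g x))\<^sup>2))"
    proof (rule AE_I2)
      fix x
      have "(norm (f x + g x))\<^sup>2 \<le> (norm (f x) + norm (g x))\<^sup>2" by (intro power_mono norm_triangle_ineq) simp
      also have "\<dots> \<le> 2 * ((norm (f x))\<^sup>2 + (norm (g x))\<^sup>2)"
        using sum_squares_ge_zero[of "norm (f x) - norm (g x)" 0] by (simp add: power2_eq_square algebra_simps)
      finally show "norm ((norm (f x + g x))\<^sup>2) \<le> norm (2 * ((norm (f x))\<^sup>2 + (norm (g x))\<^sup>2))" by simp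
    qed
  qed (use assms in \<open>auto simp: L2_def\<close>)
  then show ?thesis by (simp add: L2_def)
qed

lemma L2_minus: "L2 D f \<Longrightarrow> L2 D (\<lambda>x. - f x)"
  by (auto simp: L2_def)

lemma L2_diff: "L2 D f \<Longrightarrow> L2 D g \<Longrightarrow> L2 D (\<lambda>x. f x - g x)"
  using L2_add[OF _ L2_minus, of D f g] by simp

lemma L2_scaleR_bounded:
  assumes "L2 D g" "c \<in> borel_measurable (lebesgue_on D)" "AE x in lebesgue_on D. \<bar>c x\<bar> \<le> C"
  shows "L2 D (\<lambda>x. c x *\<^sub>R g x)" "C \<ge> 0 \<Longrightarrow> l2 D (\<lambda>x. c x *\<^sub>R g x) \<le> C * l2 D g"
proof -
  note [measurable] = assms(2) L2_measurable[OF assms(1)]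
  have ae: "AE x in lebesgue_on D. norm (c x *\<^sub>R g x) \<le> C * norm (g x)"
    using assms(3) by eventually_elim (simp add: mult_right_mono)
  have m: "(\<lambda>x. c x *\<^sub>R g x) \<in> borel_measurable (lebesgue_on D)" by measurable
  from L2_dominated[OF assms(1) m ae]
  show "L2 D (\<lambda>x. c x *\<^sub>R g x)" "C \<ge> 0 \<Longrightarrow> l2 D (\<lambda>x. c x *\<^sub>R g x) \<le> C * l2 D g" by auto
qed

lemma L2_norm_mult_integrable:
  assumes "L2 D f" "L2 D g"
  shows "integrable (lebesgue_on D) (\<lambda>x. norm (f x) * norm (g x))"
proof (rule Bochner_Integration.integrable_bound[where f = "\<lambda>x. (norm (f x))\<^sup>2 + (norm (g x))\<^sup>2"])
  show "integrable (lebesgue_on D) (\<lambda>x. (norm (f x))\<^sup>2 + (norm (g x))\<^sup>2)" using assms by (auto simp: L2_def)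
  show "(\<lambda>x. norm (f x) * norm (g x)) \<in> borel_measurable (lebesgue_on D)"
    using L2_measurable[OF assms(1)] L2_measurable[OF assms(2)] by simp
  show "AE x in lebesgue_on D. norm (norm (f x) * norm (g x)) \<le> norm ((norm (f x))\<^sup>2 + (norm (g x))\<^sup>2)"
  proof (rule AE_I2)
    fix x
    have "2 * (norm (f x) * norm (g x)) \<le> (norm (f x))\<^sup>2 + (norm (g x))\<^sup>2"
      using sum_squares_bound[of "norm (f x)" "norm (g x)"] by simp
    moreover have "0 \<le> norm (f x) * norm (g x)" by simp
    ultimately have "norm (f x) * norm (g x) \<le> (norm (f x))\<^sup>2 + (norm (g x))\<^sup>2" by linarith
    then show "norm (norm (f x) * norm (g x)) \<le> norm ((norm (f x))\<^sup>2 + (norm (g x))\<^sup>2)" by simp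
  qed
qed

lemma L2_norm_mult_le:
  assumes "L2 D f" "L2 D g"
  shows "(\<integral>x. norm (f x) * norm (g x) \<partial>lebesgue_on D) \<le> l2 D f * l2 D g"
proof -
  note [measurable] = L2_measurable[OF assms(1)] L2_measurable[OF assms(2)]
  let ?P = "\<integral>x. norm (f x) * norm (g x) \<partial>lebesgue_on D"
  have P: "?P \<ge> 0" by (rule integral_nonneg_AE) simp
  have P_eq: "ennreal ?P = (\<integral>\<^sup>+x. ennreal (norm (f x)) * ennreal (norm (g x)) \<partial>lebesgue_on D)"
    by (subst nn_integral_eq_integral[symmetric, OF L2_norm_mult_integrable[OF assms]])
      (auto simp: ennreal_mult)
  have "ennreal (?P\<^sup>2) = (ennreal ?P)\<^sup>2" using P by (simp add: ennreal_power)
  also have "\<dots> \<le> (\<integral>\<^sup>+x. (ennreal (norm (f x)))\<^sup>2 \<partial>lebesgue_on D) * (\<integral>\<^sup>+x. (ennreal (norm (g x)))\<^sup>2 \<partial>lebesgue_on D)"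
    unfolding P_eq by (rule Cauchy_Schwarz_nn_integral) measurable
  also have "\<dots> = ennreal ((l2 D f * l2 D g)\<^sup>2)"
    using L2_nn_integral[OF assms(1)] L2_nn_integral[OF assms(2)]
    by (simp add: ennreal_power power_mult_distrib ennreal_mult)
  finally have "?P\<^sup>2 \<le> (l2 D f * l2 D g)\<^sup>2" by (subst (asm) ennreal_le_iff) auto
  then show ?thesis by (rule power2_le_imp_le) (simp add: l2_nonneg)
qed

lemma L2_inner_integrable:
  assumes "L2 D f" "L2 D g"
  shows "integrable (lebesgue_on D) (\<lambda>x. f x \<bullet> g x)"
  by (rule Bochner_Integration.integrable_bound[OF L2_norm_mult_integrable[OF assms]])
    (use L2_measurable[OF assms(1)] L2_measurable[OF assms(2)] in \<open>auto intro: Cauchy_Schwarz_ineq2\<close>)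

lemma L2_inner_le:
  assumes "L2 D f" "L2 D g"
  shows "\<bar>\<integral>x. f x \<bullet> g x \<partial>lebesgue_on D\<bar> \<le> l2 D f * l2 D g"
proof -
  have "\<bar>\<integral>x. f x \<bullet> g x \<partial>lebesgue_on D\<bar> \<le> (\<integral>x. \<bar>f x \<bullet> g x\<bar> \<partial>lebesgue_on D)"
    by (rule integral_abs_bound)
  also have "\<dots> \<le> (\<integral>x. norm (f x) * norm (g x) \<partial>lebesgue_on D)"
    by (rule integral_mono[OF integrable_abs[OF L2_inner_integrable[OF assms]] L2_norm_mult_integrable[OF assms]])
      (rule Cauchy_Schwarz_ineq2)
  finally show ?thesis using L2_norm_mult_le[OF assms] by linarith
qed

lemma l2_triangle:
  assumes "L2 D f" "L2 D g"
  shows "l2 D (\<lambda>x. f x + g x) \<le> l2 D f + l2 D g"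
proof (rule power2_le_imp_le)
  have "(l2 D (\<lambda>x. f x + g x))\<^sup>2 = (\<integral>x. ((norm (f x))\<^sup>2 + (norm (g x))\<^sup>2) + 2 * (f x \<bullet> g x) \<partial>lebesgue_on D)"
    unfolding l2_square
    by (intro Bochner_Integration.integral_cong) (auto simp: power2_norm_eq_inner inner_add inner_commute)
  also have "\<dots> = (l2 D f)\<^sup>2 + (l2 D g)\<^sup>2 + 2 * (\<integral>x. f x \<bullet> g x \<partial>lebesgue_on D)"
    unfolding l2_square using L2_inner_integrable[OF assms] L2_integrable[OF assms(1)] L2_integrable[OF assms(2)]
    by simp
  also have "\<dots> \<le> (l2 D f)\<^sup>2 + (l2 D g)\<^sup>2 + 2 * (l2 D f * l2 D g)"
    using L2_inner_le[OF assms] by linarith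
  also have "\<dots> = (l2 D f + l2 D g)\<^sup>2" by (simp add: power2_sum)
  finally show "(l2 D (\<lambda>x. f x + g x))\<^sup>2 \<le> (l2 D f + l2 D g)\<^sup>2" .
qed (simp add: l2_nonneg)

lemma finite_measure_lebesgue_on_bounded: "bounded D \<Longrightarrow> D \<in> sets lebesgue \<Longrightarrow> finite_measure (lebesgue_on D)"
  by (intro finite_measure_lebesgue_on bounded_set_imp_lmeasurable)

lemma integrable_bounded_lebesgue_on:
  fixes f :: "'a::euclidean_space \<Rightarrow> 'b::euclidean_space"
  assumes "bounded D" "open D" "f \<in> borel_measurable (lebesgue_on D)" "AE x in lebesgue_on D. norm (f x) \<le> B"
  shows "integrable (lebesgue_on D) f"
proof -
  interpret finite_measure "lebesgue_on D"
    using assms by (intro finite_measure_lebesgue_on_bounded) auto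
  show ?thesis using integrable_const_bound[OF assms(4,3)] .
qed

lemma L2_bounded:
  fixes f :: "'a::euclidean_space \<Rightarrow> 'b::euclidean_space"
  assumes "bounded D" "open D" "f \<in> borel_measurable (lebesgue_on D)" "AE x in lebesgue_on D. norm (f x) \<le> B"
  shows "L2 D f"
proof -
  have "AE x in lebesgue_on D. norm ((norm (f x))\<^sup>2) \<le> B\<^sup>2"
    using assms(4) by eventually_elim (auto intro: power_mono)
  then show ?thesis using integrable_bounded_lebesgue_on[OF assms(1,2), of "\<lambda>x. (norm (f x))\<^sup>2" "B\<^sup>2"] assms(3)
    by (simp add: L2_def)
qed

lemma continuous_measurable_lebesgue_on:
  "continuous_on UNIV (f :: 'a::euclidean_space \<Rightarrow> 'b::euclidean_space) \<Longrightarrow> f \<in> borel_measurable (lebesgue_on D)"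
  by (intro measurable_restrict_space1 measurable_completion) (simp add: borel_measurable_continuous_onI)

lemma continuous_bounded_on_bounded:
  assumes "continuous_on UNIV (f :: 'a::euclidean_space \<Rightarrow> 'b::euclidean_space)" "bounded D"
  obtains B where "B > 0" "\<And>x. x \<in> D \<Longrightarrow> norm (f x) \<le> B"
proof -
  obtain R where R: "\<And>x. x \<in> D \<Longrightarrow> norm x \<le> R" using assms(2) by (auto simp: bounded_iff)
  obtain B where "B > 0" "\<And>x. norm x \<le> R \<Longrightarrow> norm (f x) \<le> B"
    using continuous_bounded_on_cball[OF assms(1)] by metis
  then show thesis using that R by blast
qed

lemma AE_lebesgue_on_I: "(\<And>x. x \<in> D \<Longrightarrow> P x) \<Longrightarrow> AE x in lebesgue_on D. P x"
  by (rule AE_I2) (simp add: space_restrict_space)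

lemma integral_lebesgue_on_eq_lborel:
  fixes f :: "'a::euclidean_space \<Rightarrow> real"
  assumes D: "D \<in> sets borel" and f: "f \<in> borel_measurable borel" and 0: "\<And>x. x \<notin> D \<Longrightarrow> f x = 0"
  shows "integral\<^sup>L (lebesgue_on D) f = integral\<^sup>L lborel f"
    "integrable (lebesgue_on D) f \<longleftrightarrow> integrable lborel f"
proof -
  have D': "D \<inter> space lebesgue \<in> sets lebesgue" using D by auto
  have e: "(\<lambda>x. indicator D x *\<^sub>R f x) = f" 
  proof (rule ext)
    fix x show "indicator D x *\<^sub>R f x = f x" by (cases "x \<in> D") (auto simp: 0)
  qed
  show "integral\<^sup>L (lebesgue_on D) f = integral\<^sup>L lborel f"
    using f by (subst integral_restrict_space[OF D']) (simp only: e, simp add: integral_completion)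
  show "integrable (lebesgue_on D) f \<longleftrightarrow> integrable lborel f"
    using f by (subst integrable_restrict_space[OF D']) (simp only: e, simp add: integrable_completion)
qed

subsection \<open>Test functions and weak gradients\<close>

lemma grad_zero_open:
  assumes "open U" "x \<in> U" "\<And>y. y \<in> U \<Longrightarrow> f y = 0"
  shows "grad f x = 0"
proof (rule grad_eqI)
  have "((\<lambda>x. 0) has_derivative (\<lambda>v. 0 \<bullet> v)) (at x)" by simp
  then show "(f has_derivative (\<lambda>v. 0 \<bullet> v)) (at x)"
    by (rule has_derivative_transform_within_open[OF _ assms(1,2)]) (simp add: assms(3))
qed

lemma test_functionI:
  assumes "smooth_fun \<phi>" "compact K" "K \<subseteq> D" "\<And>x. x \<notin> K \<Longrightarrow> \<phi> x = 0"
  shows "test_function D \<phi>"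
proof -
  have sub: "closure {x. \<phi> x \<noteq> 0} \<subseteq> K"
    using assms by (intro closure_minimal) (auto intro: compact_imp_closed)
  then have "compact (closure {x. \<phi> x \<noteq> 0})"
    using assms(2) closed_Int_compact[of "closure {x. \<phi> x \<noteq> 0}" K] by (simp add: Int_absorb2)
  then show ?thesis using assms sub by (auto simp: test_function_def smooth_fun_def)
qed

lemma test_functionE:
  assumes "test_function D \<phi>"
  obtains K where "smooth_fun \<phi>" "compact K" "K \<subseteq> D" "\<And>x. x \<notin> K \<Longrightarrow> \<phi> x = 0" "\<And>x. x \<notin> K \<Longrightarrow> grad \<phi> x = 0"
proof
  let ?K = "closure {x. \<phi> x \<noteq> 0}"
  show "smooth_fun \<phi>" "compact ?K" "?K \<subseteq> D"
    using assms by (auto simp: test_function_def smooth_fun_def)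
  show 0: "\<phi> x = 0" if "x \<notin> ?K" for x using that closure_subset[of "{x. \<phi> x \<noteq> 0}"] by auto
  have "open (- ?K)" by (intro open_Compl closed_closure)
  then show "grad \<phi> x = 0" if "x \<notin> ?K" for x
    by (rule grad_zero_open) (use that in simp, rule 0, simp)
qed

lemma test_function_mult:
  assumes "test_function D \<phi>" "smooth_fun w" shows "test_function D (\<lambda>x. w x * \<phi> x)"
  using assms(1)
proof (rule test_functionE)
  fix K assume "smooth_fun \<phi>" "compact K" "K \<subseteq> D" "\<And>x. x \<notin> K \<Longrightarrow> \<phi> x = 0"
  then show ?thesis using assms(2) by (intro test_functionI[of _ K] smooth_fun_mult) simp_all
qed

lemma test_function_compose:
  assumes H: "\<And>n t. (H n has_real_derivative H (Suc n) t) (at t)" "H 0 0 = 0" and "test_function D \<phi>"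
  shows "test_function D (\<lambda>x. H 0 (\<phi> x))"
  using assms(3)
proof (rule test_functionE)
  fix K assume K: "smooth_fun \<phi>" "compact K" "K \<subseteq> D" "\<And>x. x \<notin> K \<Longrightarrow> \<phi> x = 0"
  show ?thesis by (rule test_functionI[OF smooth_fun_compose[where H = H and n = 0 and f = \<phi>, OF H(1) K(1)] K(2,3)])
      (simp add: K(4) H(2))
qed

text \<open>Convolve \<open>\<phi>\<close> with the indicator of a ball whose radius exceeds that of
  the support by 1. Near 0 the result is constant, equal to the integral of \<open>\<phi>\<close>,
  while its partial derivative at 0 is, up to a reflection, the integral of the partial derivative
  of \<open>\<phi>\<close>.\<close>

lemma integral_partial_zero:
  fixes \<phi> :: "'a::euclidean_space \<Rightarrow> real"
  assumes \<phi>: "smooth_fun \<phi>" and R: "\<And>x. norm x > R \<Longrightarrow> \<phi> x = 0" and i: "i \<in> Basis"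
  shows "(\<integral>x. frechet_derivative \<phi> (at x) i \<partial>lborel) = 0"
proof -
  let ?g = "indicat_real (cball (0::'a) (\<bar>R\<bar> + 1))"
  have gi: "integrable lborel ?g"
    using emeasure_lborel_cball_finite[of "0::'a" "\<bar>R\<bar> + 1"] by (intro integrable_real_indicator) auto
  have g0: "?g y = 0" if "norm y > \<bar>R\<bar> + 1" for y using that by (simp add: indicator_def)
  have reflect: "(\<integral>y. f (x - y) \<partial>lborel) = (\<integral>y. f y \<partial>lborel)"
    if [measurable]: "f \<in> borel_measurable borel" for f :: "'a \<Rightarrow> real" and x :: 'a
  proof -
    have "(\<integral>y. f y \<partial>lborel) = (\<integral>y. f y \<partial>density (distr lborel borel (\<lambda>y. x + (-1) *\<^sub>R y)) (\<lambda>_. ennreal (\<bar>-1\<bar> ^ DIM('a))))"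
      by (subst lborel_affine[of "-1" x]) simp_all
    also have "\<dots> = (\<integral>y. f (x - y) \<partial>lborel)"
      by (subst integral_density) (auto simp: integral_distr)
    finally show ?thesis by simp
  qed
  have \<phi>m: "\<phi> \<in> borel_measurable borel" by (rule borel_measurable_continuous_onI[OF smooth_fun_continuous[OF \<phi>]])
  have const: "conv ?g \<phi> x = (\<integral>y. \<phi> y \<partial>lborel)" if "x \<in> ball 0 1" for x
  proof -
    have "conv ?g \<phi> x = (\<integral>y. \<phi> (x - y) \<partial>lborel)"
      unfolding conv_def
    proof (rule Bochner_Integration.integral_cong[OF refl])
      fix y
      show "?g y * \<phi> (x - y) = \<phi> (x - y)"
      proof (cases "norm y \<le> \<bar>R\<bar> + 1")
        case False
        have "norm y \<le> norm x + norm (x - y)" using norm_triangle_ineq4[of x "x - y"] by simp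
        then have "norm (x - y) > R" using False that by simp
        then show ?thesis by (simp add: R)
      qed simp
    qed
    also have "\<dots> = (\<integral>y. \<phi> y \<partial>lborel)" by (rule reflect[OF \<phi>m])
    finally show ?thesis .
  qed
  have "frechet_derivative (conv ?g \<phi>) (at 0) = (\<lambda>h. 0)"
  proof (rule frechet_derivative_eqI)
    have "((\<lambda>x. \<integral>y. \<phi> y \<partial>lborel) has_derivative (\<lambda>h. 0)) (at 0)" by simp
    then show "(conv ?g \<phi> has_derivative (\<lambda>h. 0)) (at 0)"
      by (rule has_derivative_transform_within_open[OF _ open_ball[of 0 1]]) (simp, simp only: const)
  qed
  moreover have "frechet_derivative (conv ?g \<phi>) (at 0) i = conv ?g (\<lambda>z. frechet_derivative \<phi> (at z) i) 0"
    by (rule partial_conv[OF gi g0 \<phi> i])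
  ultimately have "conv ?g (\<lambda>z. frechet_derivative \<phi> (at z) i) 0 = 0" by simp
  moreover have "conv ?g (\<lambda>z. frechet_derivative \<phi> (at z) i) 0 = (\<integral>y. frechet_derivative \<phi> (at (0 - y)) i \<partial>lborel)"
    unfolding conv_def
  proof (rule Bochner_Integration.integral_cong[OF refl])
    fix y
    show "?g y * frechet_derivative \<phi> (at (0 - y)) i = frechet_derivative \<phi> (at (0 - y)) i"
    proof (cases "norm y \<le> \<bar>R\<bar> + 1")
      case False
      have "grad \<phi> (0 - y) = 0"
        by (rule grad_zero_open[of "{z. norm z > R}"]) (use False in \<open>auto simp: R intro: open_Collect_less continuous_intros\<close>)
      then show ?thesis using grad_inner_Basis[OF i, of \<phi> "0 - y"] by simp
    qed simp
  qed
  moreover have "(\<integral>y. frechet_derivative \<phi> (at (0 - y)) i \<partial>lborel) = (\<integral>y. frechet_derivative \<phi> (at y) i \<partial>lborel)"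
    by (rule reflect) (rule borel_measurable_continuous_onI[OF smooth_fun_continuous[OF smooth_fun_partial[OF \<phi> i]]])
  ultimately show ?thesis by simp
qed

lemma lebesgue_on_subset_eq:
  fixes f :: "'a::euclidean_space \<Rightarrow> real"
  assumes "K \<in> sets lebesgue" "D \<in> sets lebesgue" "K \<subseteq> D" and 0: "\<And>x. x \<notin> K \<Longrightarrow> f x = 0"
  shows "integrable (lebesgue_on D) f \<longleftrightarrow> integrable (lebesgue_on K) f"
    "integral\<^sup>L (lebesgue_on D) f = integral\<^sup>L (lebesgue_on K) f"
proof -
  have e: "(\<lambda>x. indicator D x *\<^sub>R f x) = f" "(\<lambda>x. indicator K x *\<^sub>R f x) = f"
  proof (rule_tac[!] ext)
    fix x show "indicator D x *\<^sub>R f x = f x" using assms(3) by (cases "x \<in> K") (auto simp: 0)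
    show "indicator K x *\<^sub>R f x = f x" by (cases "x \<in> K") (auto simp: 0)
  qed
  have s: "D \<inter> space lebesgue \<in> sets lebesgue" "K \<inter> space lebesgue \<in> sets lebesgue" using assms by auto
  show "integrable (lebesgue_on D) f \<longleftrightarrow> integrable (lebesgue_on K) f"
    unfolding integrable_restrict_space[OF s(1)] integrable_restrict_space[OF s(2)] e ..
  show "integral\<^sup>L (lebesgue_on D) f = integral\<^sup>L (lebesgue_on K) f"
    unfolding integral_restrict_space[OF s(1)] integral_restrict_space[OF s(2)] e ..
qed

lemma compact_in_lebesgue: "compact K \<Longrightarrow> K \<in> sets lebesgue"
  by (simp add: fmeasurableD lmeasurable_compact)

lemma conv_measurable [measurable]:
  assumes [measurable]: "g \<in> borel_measurable borel" "\<kappa> \<in> borel_measurable borel"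
  shows "conv g \<kappa> \<in> borel_measurable borel"
  unfolding conv_def[abs_def] by measurable

lemma integrable_continuous_compact_support:
  fixes f :: "'a::euclidean_space \<Rightarrow> real"
  assumes f: "continuous_on UNIV f" and R: "\<And>x. norm x > R \<Longrightarrow> f x = 0"
  shows "integrable lborel f"
proof -
  have i: "integrable lborel (indicat_real (cball (0::'a) R))"
    using emeasure_lborel_cball_finite[of "0::'a" R] by (intro integrable_real_indicator) auto
  have c: "continuous_on UNIV (\<lambda>z. f (- z))"
    by (rule continuous_on_compose2[OF f]) (auto intro: continuous_intros)
  have "integrable lborel (\<lambda>y. indicat_real (cball (0::'a) R) y * f (- (0 - y)))"
    by (rule integrable_conv[OF i _ c, of R]) (auto simp: indicator_def)
  moreover have "(\<lambda>y. indicat_real (cball (0::'a) R) y * f (- (0 - y))) = f"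
  proof
    fix y show "indicat_real (cball (0::'a) R) y * f (- (0 - y)) = f y"
      by (cases "norm y > R") (auto simp: R)
  qed
  ultimately show ?thesis by (simp only:)
qed

lemma integrable_continuous_lebesgue_on_bounded:
  fixes f :: "'a::euclidean_space \<Rightarrow> 'b::euclidean_space"
  assumes "continuous_on UNIV f" "bounded K" "K \<in> sets lebesgue"
  shows "integrable (lebesgue_on K) f"
proof -
  interpret finite_measure "lebesgue_on K" using assms(2,3) by (rule finite_measure_lebesgue_on_bounded)
  obtain B where B: "B > 0" "\<And>x. x \<in> K \<Longrightarrow> norm (f x) \<le> B"
    using continuous_bounded_on_bounded[OF assms(1,2)] by metis
  show ?thesis
    by (rule integrable_const_bound[OF AE_lebesgue_on_I[OF B(2)] continuous_measurable_lebesgue_on[OF assms(1)]])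
qed

lemma loc_integrable_test:
  fixes f :: "'a::euclidean_space \<Rightarrow> real"
  assumes D: "open D" and f: "locally_integrable D f" and t: "test_function D \<phi>"
  shows "integrable (lebesgue_on D) (\<lambda>x. f x * \<phi> x)"
  using t
proof (rule test_functionE)
  fix K assume K: "smooth_fun \<phi>" "compact K" "K \<subseteq> D" "\<And>x. x \<notin> K \<Longrightarrow> \<phi> x = 0"
  have fK: "integrable (lebesgue_on K) f" using f K by (simp add: locally_integrable_def)
  have c: "continuous_on UNIV \<phi>" by (rule smooth_fun_continuous[OF K(1)])
  obtain B where B: "B > 0" "\<And>x. x \<in> K \<Longrightarrow> norm (\<phi> x) \<le> B"
    using continuous_bounded_on_bounded[OF c compact_imp_bounded[OF K(2)]] by metis
  have "integrable (lebesgue_on K) (\<lambda>x. f x * \<phi> x)"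
  proof (rule Bochner_Integration.integrable_bound[where f = "\<lambda>x. B * f x"])
    show "AE x in lebesgue_on K. norm (f x * \<phi> x) \<le> norm (B * f x)"
    proof (rule AE_lebesgue_on_I)
      fix x assume "x \<in> K"
      from mult_left_mono[OF B(2)[OF this] abs_ge_zero[of "f x"]]
      show "norm (f x * \<phi> x) \<le> norm (B * f x)" using B(1) by (simp add: abs_mult mult.commute)
    qed
    show "(\<lambda>x. f x * \<phi> x) \<in> borel_measurable (lebesgue_on K)"
      using borel_measurable_integrable[OF fK] continuous_measurable_lebesgue_on[OF c] by simp
  qed (use fK in simp)
  then show ?thesis
    by (subst lebesgue_on_subset_eq(1)[of K]) (use K D compact_in_lebesgue in auto)
qed

text \<open>Inside a box contained in \<open>D\<close> the shifted mollifiers are test functions, so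
  the mollifications of \<open>w\<close> vanish at each interior point once the scale is small;
  along a subsequence they also converge to \<open>w\<close> almost everywhere. Countably many boxes
  exhaust \<open>D\<close>.\<close>

lemma fundamental_lemma:
  fixes w :: "'a::euclidean_space \<Rightarrow> real"
  assumes D: "open D" and loc: "locally_integrable D w"
    and z: "\<And>\<phi>. test_function D \<phi> \<Longrightarrow> (\<integral>x. w x * \<phi> x \<partial>lebesgue_on D) = 0"
  shows "AE x in lebesgue_on D. w x = 0"
proof -
  have K: "AE x in lebesgue. x \<in> cbox a b \<longrightarrow> w x = 0" if ab: "cbox a b \<subseteq> D" for a b
  proof -
    let ?K = "cbox a b"
    have wi: "integrable (lebesgue_on ?K) w" using loc ab by (simp add: locally_integrable_def)
    obtain g where g [measurable]: "g \<in> borel_measurable borel" and g0: "\<And>x. x \<notin> ?K \<Longrightarrow> g x = 0"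
      and gw: "AE x in lebesgue_on ?K. w x = g x"
      using borel_representative[OF _ borel_measurable_integrable[OF wi]] by auto
    have gm: "g \<in> borel_measurable (lebesgue_on ?K)"
      by (intro measurable_restrict_space1 measurable_completion) simp
    have "integrable (lebesgue_on ?K) g"
      using integrable_cong_AE[OF borel_measurable_integrable[OF wi] gm gw] wi by simp
    then have gi: "integrable lborel g"
      by (subst (asm) integral_lebesgue_on_eq_lborel(2)) (auto simp: g0)
    have fin: "(\<integral>\<^sup>+x. ennreal (\<bar>g x\<bar> ^ 1) \<partial>lborel) < \<infinity>"
      using gi by (simp add: integrable_iff_bounded)
    have lim: "(\<lambda>n. \<integral>\<^sup>+x. ennreal (\<bar>conv g (moll (1 / real (Suc n))) x - g x\<bar> ^ 1) \<partial>lborel) \<longlonglongrightarrow> 0"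
      by (rule conv_moll_tendsto[OF _ g fin]) simp
    obtain r :: "nat \<Rightarrow> nat" where r: "strict_mono r"
      and ae: "AE x in lborel. (\<lambda>n. conv g (moll (1 / real (Suc (r n)))) x - g x) \<longlonglongrightarrow> 0"
      by (rule AE_subseq_of_Lq[OF _ _ lim]) auto
    have zero: "g x = 0" if x: "x \<in> box a b"
      and l: "(\<lambda>n. conv g (moll (1 / real (Suc (r n)))) x - g x) \<longlonglongrightarrow> 0" for x
    proof -
      obtain e where e: "e > 0" "cball x e \<subseteq> box a b"
        using open_contains_cball[of "box a b"] x open_box by auto
      have c0: "conv g (moll \<rho>) x = 0" if rho: "0 < \<rho>" "\<rho> < e" for \<rho>
      proof -
        let ?\<phi> = "\<lambda>y. moll \<rho> (x - y)"
        have sub: "cball x \<rho> \<subseteq> cbox a b" using e(2) rho box_subset_cbox[of a b] by (auto simp: subset_eq)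
        have out: "?\<phi> y = 0" if "y \<notin> cball x \<rho>" for y
          using that moll_zero[OF rho(1), of "x - y"] by (simp add: dist_norm)
        have sm: "smooth_fun ?\<phi>"
          using smooth_fun_affine_compose[OF smooth_fun_moll[of \<rho>], of "-1" x] by simp
        have t: "test_function D ?\<phi>"
          by (rule test_functionI[OF sm compact_cball _ out]) (use sub ab in auto)
        have mm: "(\<lambda>y. g y * ?\<phi> y) \<in> borel_measurable borel" by measurable
        have mw: "w \<in> borel_measurable (lebesgue_on ?K)" using wi by auto
        have m\<phi>: "?\<phi> \<in> borel_measurable (lebesgue_on ?K)"
          by (rule continuous_measurable_lebesgue_on[OF smooth_fun_continuous[OF sm]])
        have "conv g (moll \<rho>) x = (\<integral>y. g y * ?\<phi> y \<partial>lebesgue_on ?K)"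
          unfolding conv_def by (rule integral_lebesgue_on_eq_lborel(1)[symmetric, OF _ mm]) (auto simp: g0)
        also have "\<dots> = (\<integral>y. w y * ?\<phi> y \<partial>lebesgue_on ?K)"
          using gw by (intro integral_cong_AE borel_measurable_times gm mw m\<phi>) auto
        also have "\<dots> = (\<integral>y. w y * ?\<phi> y \<partial>lebesgue_on D)"
        proof (rule lebesgue_on_subset_eq(2)[symmetric])
          fix y assume "y \<notin> cbox a b"
          then have "y \<notin> cball x \<rho>" using sub by blast
          then show "w y * ?\<phi> y = 0" by (simp add: out)
        qed (use ab D in auto)
        also have "\<dots> = 0" by (rule z[OF t])
        finally show ?thesis .
      qed
      have "\<forall>\<^sub>F n in sequentially. 1 / real (Suc n) < e"
        using e(1) order_tendstoD(2)[OF LIMSEQ_Suc[OF lim_1_over_n]] by simp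
      then have "\<forall>\<^sub>F n in sequentially. 1 / real (Suc (r n)) < e"
        using filterlim_subseq[OF r] unfolding filterlim_iff by blast
      then have "\<forall>\<^sub>F n in sequentially. conv g (moll (1 / real (Suc (r n)))) x - g x = - g x"
        by eventually_elim (simp add: c0)
      then have "(\<lambda>n. conv g (moll (1 / real (Suc (r n)))) x - g x) \<longlonglongrightarrow> - g x"
        by (rule tendsto_eventually)
      with l have "- g x = 0" using LIMSEQ_unique by blast
      then show ?thesis by simp
    qed
    have "AE x in lebesgue. x \<in> ?K \<longrightarrow> w x = g x"
      using gw by (subst (asm) AE_restrict_space_iff) auto
    moreover have "AE x in lebesgue. x \<in> box a b \<longrightarrow> g x = 0"
    proof (rule AE_completion)
      show "AE x in lborel. x \<in> box a b \<longrightarrow> g x = 0" using ae by eventually_elim (use zero in blast)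
    qed
    \<comment> \<open>No mollifier centred at a face of the box fits into it, but the faces form a
      null set.\<close>
    moreover have "AE x in lebesgue. x \<notin> cbox a b - box a b"
      using negligible_frontier_interval[of a b] by (intro AE_not_in) (simp add: negligible_iff_null_sets)
    ultimately show ?thesis by eventually_elim auto
  qed
  obtain \<D> where \<D>: "countable \<D>" "\<D> \<subseteq> Pow D" "\<And>X. X \<in> \<D> \<Longrightarrow> \<exists>a b. X = cbox a b" "\<Union>\<D> = D"
    using open_countable_Union_open_cbox[OF D] by auto
  have "AE x in lebesgue. \<forall>X\<in>\<D>. x \<in> X \<longrightarrow> w x = 0"
  proof (subst AE_ball_countable[OF \<D>(1)], intro ballI)
    fix X assume X: "X \<in> \<D>"
    obtain a b where "X = cbox a b" using \<D>(3)[OF X] by auto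
    then show "AE x in lebesgue. x \<in> X \<longrightarrow> w x = 0" using K[of a b] X \<D>(2) by auto
  qed
  then have "AE x in lebesgue. x \<in> D \<longrightarrow> w x = 0"
    by eventually_elim (use \<D>(4) in blast)
  then show ?thesis using D by (subst AE_restrict_space_iff) auto
qed

lemma has_weak_gradient_diff:
  assumes D: "open D" and u: "has_weak_gradient D u g" and v: "has_weak_gradient D v h"
  shows "has_weak_gradient D (\<lambda>x. u x - v x) (\<lambda>x. g x - h x)"
proof -
  have lu: "locally_integrable D u" "locally_integrable D v" "locally_integrable D g" "locally_integrable D h"
    using u v by (auto simp: has_weak_gradient_def)
  have lg: "locally_integrable D (\<lambda>x. g x \<bullet> i)" "locally_integrable D (\<lambda>x. h x \<bullet> i)" for i
    using lu by (auto simp: locally_integrable_def)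
  have "(\<integral>x. (u x - v x) * (grad \<phi> x \<bullet> i) \<partial>lebesgue_on D) = - (\<integral>x. ((g x - h x) \<bullet> i) * \<phi> x \<partial>lebesgue_on D)"
    if t: "test_function D \<phi>" and i: "i \<in> Basis" for \<phi> i
  proof -
    have t': "test_function D (\<lambda>x. grad \<phi> x \<bullet> i)"
      using t
    proof (rule test_functionE)
      fix K assume K: "smooth_fun \<phi>" "compact K" "K \<subseteq> D" "\<And>x. x \<notin> K \<Longrightarrow> grad \<phi> x = 0"
      show ?thesis
        by (rule test_functionI[OF _ K(2,3)])
          (use K i smooth_fun_partial[OF K(1) i] in \<open>simp_all add: grad_inner_Basis\<close>)
    qed
    have eu: "(\<integral>x. u x * (grad \<phi> x \<bullet> i) \<partial>lebesgue_on D) = - (\<integral>x. (g x \<bullet> i) * \<phi> x \<partial>lebesgue_on D)"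
      using u t i by (auto simp: has_weak_gradient_def)
    have ev: "(\<integral>x. v x * (grad \<phi> x \<bullet> i) \<partial>lebesgue_on D) = - (\<integral>x. (h x \<bullet> i) * \<phi> x \<partial>lebesgue_on D)"
      using v t i by (auto simp: has_weak_gradient_def)
    show ?thesis
      unfolding left_diff_distrib inner_diff_left
      using eu ev loc_integrable_test[OF D lu(1) t'] loc_integrable_test[OF D lu(2) t']
        loc_integrable_test[OF D lg(1) t] loc_integrable_test[OF D lg(2) t]
      by simp
  qed
  then show ?thesis using lu by (auto simp: has_weak_gradient_def locally_integrable_def)
qed

text \<open>The field \<open>g - h\<close> is a weak gradient of the zero function
  \<open>u - u\<close>, so \<open>fundamental_lemma\<close> applies in each coordinate. The function
  chosen by \<open>weak_grad\<close> is thereby determined almost everywhere.\<close>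

lemma weak_gradient_unique:
  assumes D: "open D" and u: "has_weak_gradient D u g" "has_weak_gradient D u h"
  shows "AE x in lebesgue_on D. g x = h x"
proof -
  have wd: "has_weak_gradient D (\<lambda>x. u x - u x) (\<lambda>x. g x - h x)"
    by (rule has_weak_gradient_diff[OF D u])
  have "AE x in lebesgue_on D. (g x - h x) \<bullet> i = 0" if i: "i \<in> Basis" for i
  proof (rule fundamental_lemma[OF D])
    show "locally_integrable D (\<lambda>x. (g x - h x) \<bullet> i)"
      using wd by (auto simp: has_weak_gradient_def locally_integrable_def)
    fix \<phi> :: "'a \<Rightarrow> real" assume "test_function D \<phi>"
    then have "(\<integral>x. (u x - u x) * (grad \<phi> x \<bullet> i) \<partial>lebesgue_on D) = - (\<integral>x. ((g x - h x) \<bullet> i) * \<phi> x \<partial>lebesgue_on D)"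
      using wd i unfolding has_weak_gradient_def by blast
    then show "(\<integral>x. ((g x - h x) \<bullet> i) * \<phi> x \<partial>lebesgue_on D) = 0" by simp
  qed
  then have "AE x in lebesgue_on D. \<forall>i\<in>Basis. (g x - h x) \<bullet> i = 0"
    by (subst AE_ball_countable) (auto intro: countable_finite)
  then show ?thesis
  proof eventually_elim
    case (elim x)
    then show ?case by (simp add: euclidean_eq_iff[of "g x" "h x"] inner_diff_left)
  qed
qed

text \<open>Integration by parts is \<open>integral_partial_zero\<close> for the product of the two
  functions, which has compact support because one factor does.\<close>

lemma test_has_weak_gradient:
  assumes D: "open D" and t: "test_function D \<phi>"
  shows "has_weak_gradient D \<phi> (grad \<phi>)"
  using t
proof (rule test_functionE)
  fix K assume K: "smooth_fun \<phi>" "compact K" "K \<subseteq> D" "\<And>x. x \<notin> K \<Longrightarrow> \<phi> x = 0" "\<And>x. x \<notin> K \<Longrightarrow> grad \<phi> x = 0"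
  have l: "locally_integrable D \<phi>" "locally_integrable D (grad \<phi>)"
    unfolding locally_integrable_def
    using integrable_continuous_lebesgue_on_bounded[OF smooth_fun_continuous[OF K(1)]]
      integrable_continuous_lebesgue_on_bounded[OF continuous_on_grad[OF K(1)]]
    by (auto intro: compact_imp_bounded compact_in_lebesgue)
  obtain R where R: "\<And>x. x \<in> K \<Longrightarrow> norm x \<le> R"
    using compact_imp_bounded[OF K(2)] by (auto simp: bounded_iff)
  have "(\<integral>x. \<phi> x * (grad \<psi> x \<bullet> i) \<partial>lebesgue_on D) = - (\<integral>x. (grad \<phi> x \<bullet> i) * \<psi> x \<partial>lebesgue_on D)"
    if t': "test_function D \<psi>" and i: "i \<in> Basis" for \<psi> i
  proof -
    have \<psi>: "smooth_fun \<psi>" using t' by (auto simp: test_function_def smooth_fun_def)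
    have D': "D \<in> sets borel" using D by simp
    let ?f = "\<lambda>x. \<phi> x * (grad \<psi> x \<bullet> i)" and ?g = "\<lambda>x. (grad \<phi> x \<bullet> i) * \<psi> x"
    have c: "continuous_on UNIV ?f" "continuous_on UNIV ?g"
      using continuous_on_grad[OF K(1)] continuous_on_grad[OF \<psi>] smooth_fun_continuous[OF K(1)] smooth_fun_continuous[OF \<psi>]
      by (auto intro!: continuous_intros)
    have m: "?f \<in> borel_measurable borel" "?g \<in> borel_measurable borel"
      by (rule borel_measurable_continuous_onI[OF c(1)], rule borel_measurable_continuous_onI[OF c(2)])
    have z: "?f x = 0" "?g x = 0" if "x \<notin> D" for x
    proof -
      have "x \<notin> K" using that K(3) by auto
      then show "?f x = 0" "?g x = 0" by (simp_all add: K(4,5))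
    qed
    have zR: "?f x = 0" "?g x = 0" "\<phi> x * \<psi> x = 0" if "norm x > R" for x
    proof -
      have "x \<notin> K" using R[of x] that by auto
      then show "?f x = 0" "?g x = 0" "\<phi> x * \<psi> x = 0" by (simp_all add: K(4,5))
    qed
    have int: "integrable lborel ?f" "integrable lborel ?g"
      by (rule integrable_continuous_compact_support[OF c(1)], rule zR(1), assumption)
        (rule integrable_continuous_compact_support[OF c(2)], rule zR(2))
    have "0 = (\<integral>x. frechet_derivative (\<lambda>x. \<phi> x * \<psi> x) (at x) i \<partial>lborel)"
      by (rule integral_partial_zero[symmetric, OF smooth_fun_mult[OF K(1) \<psi>] zR(3) i])
    also have "\<dots> = (\<integral>x. ?f x + ?g x \<partial>lborel)"
      using grad_mult[OF K(1) \<psi>] i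
      by (intro Bochner_Integration.integral_cong)
        (auto simp: grad_inner_Basis[symmetric] inner_add_left mult.commute)
    also have "\<dots> = (\<integral>x. ?f x \<partial>lborel) + (\<integral>x. ?g x \<partial>lborel)"
      by (rule Bochner_Integration.integral_add[OF int])
    finally show ?thesis
      using integral_lebesgue_on_eq_lborel(1)[OF D' m(1) z(1)] integral_lebesgue_on_eq_lborel(1)[OF D' m(2) z(2)]
      by simp
  qed
  with l show ?thesis by (auto simp: has_weak_gradient_def)
qed

text \<open>A weak gradient is by definition only locally integrable. Its measurability on all of
  \<open>D\<close> is inherited from a measurable field with which it agrees almost everywhere, by
  completeness of Lebesgue measure.\<close>

lemma measurable_lebesgue_on_cong_AE:
  fixes f g :: "'a::euclidean_space \<Rightarrow> 'b::euclidean_space"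
  assumes D: "D \<in> sets lebesgue" and f: "f \<in> borel_measurable (lebesgue_on D)"
    and ae: "AE x in lebesgue_on D. f x = g x"
  shows "g \<in> borel_measurable (lebesgue_on D)"
proof -
  have "AE x in lebesgue. x \<in> D \<longrightarrow> f x = g x"
    using ae D by (subst (asm) AE_restrict_space_iff) auto
  then obtain N where N: "N \<in> null_sets lebesgue" "{x. \<not> (x \<in> D \<longrightarrow> f x = g x)} \<subseteq> N"
    by (auto simp: eventually_ae_filter)
  have "f measurable_on D" using measurable_on_iff_borel_measurable[OF D] f by blast
  then have "g measurable_on D"
    by (rule measurable_on_spike[where S = N]) (use N in \<open>auto simp: negligible_iff_null_sets\<close>)
  then show ?thesis using measurable_on_iff_borel_measurable[OF D] by blast
qed

text \<open>Gradients converge in L2, but the functions themselves only almost everywhere: this is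
  the mode of convergence under which bounded continuous functions of \<open>\<phi> n\<close> pass
  to the limit by dominated convergence.\<close>

definition H10_seq :: "'a::euclidean_space set \<Rightarrow> ('a \<Rightarrow> real) \<Rightarrow> ('a \<Rightarrow> 'a) \<Rightarrow> (nat \<Rightarrow> 'a \<Rightarrow> real) \<Rightarrow> bool" where
  "H10_seq D u g \<phi> \<longleftrightarrow> L2 D u \<and> L2 D g \<and> (\<forall>n. test_function D (\<phi> n)) \<and>
     (\<lambda>n. l2 D (\<lambda>x. g x - grad (\<phi> n) x)) \<longlonglongrightarrow> 0 \<and> (AE x in lebesgue_on D. (\<lambda>n. \<phi> n x) \<longlonglongrightarrow> u x)"

text \<open>The gradient selected by \<open>SOME\<close> need not be the square integrable one whose
  existence defines \<open>H1_space\<close>; uniqueness carries integrability over to it.\<close>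

lemma weak_grad_props:
  assumes D: "open D" and u: "u \<in> H1_space D"
  shows "L2 D u" "has_weak_gradient D u (weak_grad D u)" "L2 D (weak_grad D u)"
proof -
  obtain g where g: "L2 D g" "has_weak_gradient D u g"
    using u by (auto simp: H1_space_def Lp_space_2)
  show "L2 D u" using u by (auto simp: H1_space_def Lp_space_2)
  show w: "has_weak_gradient D u (weak_grad D u)"
    unfolding weak_grad_def by (rule someI[of "has_weak_gradient D u", OF g(2)])
  have ae: "AE x in lebesgue_on D. g x = weak_grad D u x"
    by (rule weak_gradient_unique[OF D g(2) w])
  have m: "weak_grad D u \<in> borel_measurable (lebesgue_on D)"
    by (rule measurable_lebesgue_on_cong_AE[OF _ L2_measurable[OF g(1)] ae]) (use D in auto)
  show "L2 D (weak_grad D u)" using L2_cong_AE(1)[OF ae L2_measurable[OF g(1)] m] g(1) by simp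
qed

lemma weak_grad_eq_AE:
  assumes D: "open D" and u: "has_weak_gradient D u g" and g: "g \<in> borel_measurable (lebesgue_on D)"
  shows "AE x in lebesgue_on D. weak_grad D u x = g x" "weak_grad D u \<in> borel_measurable (lebesgue_on D)"
proof -
  have w: "has_weak_gradient D u (weak_grad D u)"
    unfolding weak_grad_def by (rule someI[of "has_weak_gradient D u", OF u])
  show "AE x in lebesgue_on D. weak_grad D u x = g x" by (rule weak_gradient_unique[OF D w u])
  show "weak_grad D u \<in> borel_measurable (lebesgue_on D)"
    by (rule measurable_lebesgue_on_cong_AE[OF _ g weak_gradient_unique[OF D u w]]) (use D in auto)
qed

lemma test_L2:
  assumes D: "open D" "bounded D" and t: "test_function D \<phi>"
  shows "L2 D \<phi>" "L2 D (grad \<phi>)"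
proof -
  have s: "smooth_fun \<phi>" using t by (auto simp: test_function_def smooth_fun_def)
  note c0 = smooth_fun_continuous[OF s]
  obtain B0 where B0: "B0 > 0" "\<And>x. x \<in> D \<Longrightarrow> norm (\<phi> x) \<le> B0"
    using continuous_bounded_on_bounded[OF c0 D(2)] by metis
  show "L2 D \<phi>"
    by (rule L2_bounded[OF D(2,1) continuous_measurable_lebesgue_on[OF c0] AE_lebesgue_on_I[OF B0(2)]])
  have c: "continuous_on UNIV (grad \<phi>)" by (rule continuous_on_grad[OF s])
  obtain B where B: "B > 0" "\<And>x. x \<in> D \<Longrightarrow> norm (grad \<phi> x) \<le> B"
    using continuous_bounded_on_bounded[OF c D(2)] by metis
  show "L2 D (grad \<phi>)"
    by (rule L2_bounded[OF D(2,1) continuous_measurable_lebesgue_on[OF c] AE_lebesgue_on_I[OF B(2)]])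
qed

lemma test_H10:
  assumes D: "open D" "bounded D" and t: "test_function D \<phi>"
  shows "\<phi> \<in> H10_space D" "AE x in lebesgue_on D. weak_grad D \<phi> x = grad \<phi> x"
proof -
  note l = test_L2[OF D t]
  note w = test_has_weak_gradient[OF D(1) t]
  show ae: "AE x in lebesgue_on D. weak_grad D \<phi> x = grad \<phi> x"
    by (rule weak_grad_eq_AE[OF D(1) w L2_measurable[OF l(2)]])
  have H1: "\<phi> \<in> H1_space D" using l w by (auto simp: H1_space_def Lp_space_2)
  have e1: "Lp_enorm D 2 (\<lambda>x. \<phi> x - \<phi> x) = 0"
    by (simp add: Lp_enorm_2_eq)
  have "(\<integral>\<^sup>+x. ennreal ((norm (weak_grad D \<phi> x - grad \<phi> x))\<^sup>2) \<partial>lebesgue_on D) = (\<integral>\<^sup>+x. 0 \<partial>lebesgue_on D)"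
    by (rule nn_integral_cong_AE) (use ae in \<open>eventually_elim, simp\<close>)
  then have e2: "Lp_enorm D 2 (\<lambda>x. weak_grad D \<phi> x - grad \<phi> x) = 0"
    by (simp add: Lp_enorm_2_eq)
  show "\<phi> \<in> H10_space D"
    unfolding H10_space_def using H1 t e1 e2 by (auto intro!: exI[of _ \<phi>])
qed

text \<open>Approximations with error 1/(n+1) converge in both norms, and a subsequence of them
  converges almost everywhere.\<close>

lemma H10_seq_exists:
  assumes D: "open D" "bounded D" and u: "u \<in> H10_space D"
  obtains \<phi> where "H10_seq D u (weak_grad D u) \<phi>"
proof -
  have H1: "u \<in> H1_space D" using u by (simp add: H10_space_def)
  note w = weak_grad_props[OF D(1) H1]
  have "\<exists>\<phi>. test_function D \<phi> \<and> Lp_enorm D 2 (\<lambda>x. u x - \<phi> x) < ennreal (1 / real (Suc n)) \<and>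
       Lp_enorm D 2 (\<lambda>x. weak_grad D u x - grad \<phi> x) < ennreal (1 / real (Suc n))" for n
    using u unfolding H10_space_def by simp
  then obtain \<phi> where t: "\<And>n. test_function D (\<phi> n)"
    and e1: "\<And>n. Lp_enorm D 2 (\<lambda>x. u x - \<phi> n x) < ennreal (1 / real (Suc n))"
    and e2: "\<And>n. Lp_enorm D 2 (\<lambda>x. weak_grad D u x - grad (\<phi> n) x) < ennreal (1 / real (Suc n))"
    by metis
  have L: "L2 D (\<lambda>x. u x - \<phi> n x)" "L2 D (\<lambda>x. weak_grad D u x - grad (\<phi> n) x)" for n
    by (rule L2_diff w test_L2[OF D t])+
  have b: "l2 D (\<lambda>x. u x - \<phi> n x) \<le> 1 / real (Suc n)" "l2 D (\<lambda>x. weak_grad D u x - grad (\<phi> n) x) \<le> 1 / real (Suc n)" for n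
    using e1[of n] e2[of n] unfolding Lp_enorm_2[OF L(1)] Lp_enorm_2[OF L(2)]
    by (auto simp: ennreal_less_iff l2_nonneg)
  have l: "(\<lambda>n. 1 / real (Suc n)) \<longlonglongrightarrow> 0" using LIMSEQ_Suc[OF lim_1_over_n] by simp
  have l1: "(\<lambda>n. l2 D (\<lambda>x. u x - \<phi> n x)) \<longlonglongrightarrow> 0"
    by (rule tendsto_sandwich[OF always_eventually[OF allI[OF l2_nonneg]] always_eventually[OF allI[OF b(1)]] tendsto_const l])
  have l2: "(\<lambda>n. l2 D (\<lambda>x. weak_grad D u x - grad (\<phi> n) x)) \<longlonglongrightarrow> 0"
    by (rule tendsto_sandwich[OF always_eventually[OF allI[OF l2_nonneg]] always_eventually[OF allI[OF b(2)]] tendsto_const l])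
  have "(\<lambda>n. ennreal ((l2 D (\<lambda>x. u x - \<phi> n x))\<^sup>2)) \<longlonglongrightarrow> ennreal (0\<^sup>2)"
    by (intro tendsto_ennrealI tendsto_power l1)
  then have lim: "(\<lambda>n. \<integral>\<^sup>+x. ennreal (\<bar>u x - \<phi> n x\<bar> ^ 2) \<partial>lebesgue_on D) \<longlonglongrightarrow> 0"
    using L2_nn_integral[OF L(1)] by simp
  obtain r :: "nat \<Rightarrow> nat" where r: "strict_mono r" "AE x in lebesgue_on D. (\<lambda>n. u x - \<phi> (r n) x) \<longlonglongrightarrow> 0"
    by (rule AE_subseq_of_Lq[OF _ L2_measurable[OF L(1)] lim]) auto
  have "H10_seq D u (weak_grad D u) (\<lambda>n. \<phi> (r n))"
    unfolding H10_seq_def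
  proof (intro conjI allI w t)
    show "(\<lambda>n. l2 D (\<lambda>x. weak_grad D u x - grad (\<phi> (r n)) x)) \<longlonglongrightarrow> 0"
      using LIMSEQ_subseq_LIMSEQ[OF l2 r(1)] by (simp add: comp_def)
    show "AE x in lebesgue_on D. (\<lambda>n. \<phi> (r n) x) \<longlonglongrightarrow> u x"
      using r(2)
    proof eventually_elim
      case (elim x)
      from tendsto_diff[OF tendsto_const[of "u x"] this] show ?case by simp
    qed
  qed
  then show thesis by (rule that)
qed

text \<open>The definition tests with \<open>weak_grad D \<phi>\<close>, a chosen representative;
  for a test function it agrees almost everywhere with the classical gradient.\<close>

lemma weak_solution_test:
  assumes D: "open D" "bounded D" and a: "a \<in> borel_measurable (lebesgue_on D)"
    and u: "weak_solution D a f u" and t: "test_function D \<phi>"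
  shows "(\<integral>x. (a x *\<^sub>R weak_grad D u x) \<bullet> grad \<phi> x \<partial>lebesgue_on D) = (\<integral>x. f x * \<phi> x \<partial>lebesgue_on D)"
proof -
  note w = test_H10[OF D t]
  have H1: "u \<in> H1_space D" using u by (simp add: weak_solution_def H10_space_def)
  have m: "weak_grad D u \<in> borel_measurable (lebesgue_on D)" "weak_grad D \<phi> \<in> borel_measurable (lebesgue_on D)"
      "grad \<phi> \<in> borel_measurable (lebesgue_on D)"
    using L2_measurable[OF weak_grad_props(3)[OF D(1) H1]] L2_measurable[OF test_L2(2)[OF D t]]
      weak_grad_eq_AE(2)[OF D(1) test_has_weak_gradient[OF D(1) t] L2_measurable[OF test_L2(2)[OF D t]]] by auto
  have "(\<integral>x. (a x *\<^sub>R weak_grad D u x) \<bullet> grad \<phi> x \<partial>lebesgue_on D) =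
      (\<integral>x. a x * (weak_grad D u x \<bullet> weak_grad D \<phi> x) \<partial>lebesgue_on D)"
    by (rule integral_cong_AE) (use a m w(2) in \<open>auto elim!: eventually_mono\<close>)
  also have "\<dots> = (\<integral>x. f x * \<phi> x \<partial>lebesgue_on D)"
    using u w(1) by (simp add: weak_solution_def)
  finally show ?thesis .
qed

text \<open>Because of the choice in \<open>weak_grad\<close>, linearity of the weak gradient holds
  only almost everywhere; the norms do not see the difference.\<close>

lemma H10_norm_diff:
  assumes D: "open D" and u: "u \<in> H1_space D" and v: "v \<in> H1_space D"
  shows "H10_norm D (\<lambda>x. u x - v x) = l2 D (\<lambda>x. weak_grad D u x - weak_grad D v x)"
proof -
  note pu = weak_grad_props[OF D u] and pv = weak_grad_props[OF D v]
  have L: "L2 D (\<lambda>x. weak_grad D u x - weak_grad D v x)" by (rule L2_diff[OF pu(3) pv(3)])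
  note w = weak_grad_eq_AE[OF D has_weak_gradient_diff[OF D pu(2) pv(2)] L2_measurable[OF L]]
  have "L2 D (weak_grad D (\<lambda>x. u x - v x))"
    using L2_cong_AE(1)[OF w L2_measurable[OF L]] L by simp
  then show ?thesis
    unfolding H10_norm_def using Lp_norm_2 L2_cong_AE(2)[OF w L2_measurable[OF L]] by metis
qed

subsection \<open>Nonlinear test functions\<close>

text \<open>The equation -div A = F in the sense of distributions. The source is merely integrable,
  since inner products of two square integrable fields occur as sources in
  \<open>weak_div_multiplier\<close>.\<close>

definition weak_div :: "'a::euclidean_space set \<Rightarrow> ('a \<Rightarrow> 'a) \<Rightarrow> ('a \<Rightarrow> real) \<Rightarrow> bool" where
  "weak_div D A F \<longleftrightarrow> L2 D A \<and> integrable (lebesgue_on D) F \<and>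
     (\<forall>\<phi>. test_function D \<phi> \<longrightarrow> (\<integral>x. A x \<bullet> grad \<phi> x \<partial>lebesgue_on D) = (\<integral>x. F x * \<phi> x \<partial>lebesgue_on D))"

text \<open>A bounded function \<open>w\<close> with gradient \<open>p\<close>, given by what the
  product rule uses. The gradients of the smooth \<open>W m\<close> are asked to converge on compact
  subsets of \<open>D\<close> only; test functions do not see more, and plain mollification provides
  it without any approximation up to the boundary.\<close>

definition multiplier :: "'a::euclidean_space set \<Rightarrow> ('a \<Rightarrow> real) \<Rightarrow> ('a \<Rightarrow> 'a) \<Rightarrow> bool" where
  "multiplier D w p \<longleftrightarrow> w \<in> borel_measurable (lebesgue_on D) \<and> L2 D p \<and>
     (\<exists>W B. (\<forall>m::nat. smooth_fun (W m)) \<and> (\<forall>m. \<forall>x\<in>D. \<bar>W m x\<bar> \<le> B) \<and>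
        (AE x in lebesgue_on D. (\<lambda>m. W m x) \<longlonglongrightarrow> w x) \<and>
        (\<forall>K. compact K \<and> K \<subseteq> D \<longrightarrow> (\<lambda>m. l2 K (\<lambda>x. grad (W m) x - p x)) \<longlonglongrightarrow> 0))"

lemma L2_subset:
  assumes "L2 D f" "K \<subseteq> D" "K \<in> sets lebesgue" "D \<in> sets lebesgue"
  shows "L2 K f"
proof -
  have e: "lebesgue_on K = restrict_space (lebesgue_on D) K"
    using assms by (simp add: restrict_restrict_space Int_absorb1)
  have s: "K \<in> sets (lebesgue_on D)" using assms by (simp add: sets_restrict_space_iff)
  have s': "K \<inter> space (lebesgue_on D) \<in> sets (lebesgue_on D)" by (rule sets.Int[OF s sets.top])
  show ?thesis
    unfolding L2_def e integrable_restrict_space[OF s']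
    by (intro conjI measurable_restrict_space1[OF L2_measurable[OF assms(1)]]
        integrable_mult_indicator[OF s L2_integrable[OF assms(1)]])
qed

text \<open>The product rule -div (w A) = w F - A . grad w. For smooth \<open>W m\<close> it is the
  given equation tested with \<open>W m\<close> times \<open>\<phi>\<close>; the uniform bound on
  \<open>W m\<close> permits dominated convergence in the terms without a gradient of
  \<open>W m\<close>.\<close>

lemma weak_div_multiplier:
  assumes D: "open D" "bounded D" and A: "weak_div D A F" and w: "multiplier D w p"
  shows "weak_div D (\<lambda>x. w x *\<^sub>R A x) (\<lambda>x. w x * F x - A x \<bullet> p x)"
proof -
  have LA: "L2 D A" and iF: "integrable (lebesgue_on D) F"
    and eq: "\<And>\<phi>. test_function D \<phi> \<Longrightarrow> (\<integral>x. A x \<bullet> grad \<phi> x \<partial>lebesgue_on D) = (\<integral>x. F x * \<phi> x \<partial>lebesgue_on D)"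
    using A by (auto simp: weak_div_def)
  have wm: "w \<in> borel_measurable (lebesgue_on D)" and Lp: "L2 D p"
    using w by (auto simp: multiplier_def)
  have "\<exists>W B. (\<forall>m::nat. smooth_fun (W m)) \<and> (\<forall>m. \<forall>x\<in>D. \<bar>W m x\<bar> \<le> B) \<and>
        (AE x in lebesgue_on D. (\<lambda>m. W m x) \<longlonglongrightarrow> w x) \<and>
        (\<forall>K. compact K \<and> K \<subseteq> D \<longrightarrow> (\<lambda>m. l2 K (\<lambda>x. grad (W m) x - p x)) \<longlonglongrightarrow> 0)"
    using w unfolding multiplier_def by (elim conjE)
  then obtain W :: "nat \<Rightarrow> 'a \<Rightarrow> real" where "\<exists>B. (\<forall>m. smooth_fun (W m)) \<and> (\<forall>m. \<forall>x\<in>D. \<bar>W m x\<bar> \<le> B) \<and>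
        (AE x in lebesgue_on D. (\<lambda>m. W m x) \<longlonglongrightarrow> w x) \<and>
        (\<forall>K. compact K \<and> K \<subseteq> D \<longrightarrow> (\<lambda>m. l2 K (\<lambda>x. grad (W m) x - p x)) \<longlonglongrightarrow> 0)"
    by (rule exE)
  then obtain B where "(\<forall>m. smooth_fun (W m)) \<and> (\<forall>m. \<forall>x\<in>D. \<bar>W m x\<bar> \<le> B) \<and>
        (AE x in lebesgue_on D. (\<lambda>m. W m x) \<longlonglongrightarrow> w x) \<and>
        (\<forall>K. compact K \<and> K \<subseteq> D \<longrightarrow> (\<lambda>m. l2 K (\<lambda>x. grad (W m) x - p x)) \<longlonglongrightarrow> 0)"
    by (rule exE)
  then have W: "\<And>m. smooth_fun (W m)" "\<And>m x. x \<in> D \<Longrightarrow> \<bar>W m x\<bar> \<le> B"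
    "AE x in lebesgue_on D. (\<lambda>m. W m x) \<longlonglongrightarrow> w x"
    "\<And>K. compact K \<Longrightarrow> K \<subseteq> D \<Longrightarrow> (\<lambda>m. l2 K (\<lambda>x. grad (W m) x - p x)) \<longlonglongrightarrow> 0"
    by simp_all
  note [measurable] = wm L2_measurable[OF LA] L2_measurable[OF Lp] borel_measurable_integrable[OF iF]
  have Wm [measurable]: "W m \<in> borel_measurable (lebesgue_on D)" for m
    by (rule continuous_measurable_lebesgue_on[OF smooth_fun_continuous[OF W(1)]])
  have inD: "AE x in lebesgue_on D. x \<in> D" by (rule AE_lebesgue_on_I)
  have wB: "AE x in lebesgue_on D. \<bar>w x\<bar> \<le> B"
    using W(3) inD
  proof eventually_elim
    case (elim x)
    show ?case
      by (rule LIMSEQ_le_const2[OF tendsto_rabs[OF elim(1)]]) (use W(2) elim(2) in auto)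
  qed
  have LwA: "L2 D (\<lambda>x. w x *\<^sub>R A x)" by (rule L2_scaleR_bounded(1)[OF LA wm wB])
  have iwF: "integrable (lebesgue_on D) (\<lambda>x. w x * F x)"
  proof (rule Bochner_Integration.integrable_bound[where f = "\<lambda>x. B * F x"])
    show "AE x in lebesgue_on D. norm (w x * F x) \<le> norm (B * F x)"
      using wB
    proof eventually_elim
      case (elim x)
      then have "\<bar>w x\<bar> \<le> \<bar>B\<bar>" by linarith
      then show ?case by (simp add: abs_mult mult_right_mono)
    qed
  qed (use iF in auto)
  have iAp: "integrable (lebesgue_on D) (\<lambda>x. A x \<bullet> p x)" by (rule L2_inner_integrable[OF LA Lp])
  have main: "(\<integral>x. (w x *\<^sub>R A x) \<bullet> grad \<phi> x \<partial>lebesgue_on D) = (\<integral>x. (w x * F x - A x \<bullet> p x) * \<phi> x \<partial>lebesgue_on D)"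
    if t: "test_function D \<phi>" for \<phi>
    using t
  proof (rule test_functionE)
    fix K assume K: "smooth_fun \<phi>" "compact K" "K \<subseteq> D" "\<And>x. x \<notin> K \<Longrightarrow> \<phi> x = 0" "\<And>x. x \<notin> K \<Longrightarrow> grad \<phi> x = 0"
    have K': "K \<in> sets lebesgue" "D \<in> sets lebesgue" using compact_in_lebesgue[OF K(2)] D by auto
    have c: "continuous_on UNIV \<phi>" by (rule smooth_fun_continuous[OF K(1)])
    have \<phi>m [measurable]: "\<phi> \<in> borel_measurable (lebesgue_on D)" by (rule continuous_measurable_lebesgue_on[OF c])
    have gm [measurable]: "grad \<phi> \<in> borel_measurable (lebesgue_on D)" by (rule continuous_measurable_lebesgue_on[OF continuous_on_grad[OF K(1)]])
    obtain C where C: "C > 0" "\<And>x. x \<in> D \<Longrightarrow> norm (\<phi> x) \<le> C" using continuous_bounded_on_bounded[OF c D(2)] by metis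
    have CA: "AE x in lebesgue_on D. \<bar>\<phi> x\<bar> \<le> C" using C(2) by (intro AE_lebesgue_on_I) simp
    have Lg: "L2 D (grad \<phi>)" by (rule test_L2(2)[OF D t])
    have L\<phi>A: "L2 D (\<lambda>x. \<phi> x *\<^sub>R A x)" by (rule L2_scaleR_bounded(1)[OF LA \<phi>m CA])
    have iAg: "integrable (lebesgue_on D) (\<lambda>x. A x \<bullet> grad \<phi> x)" by (rule L2_inner_integrable[OF LA Lg])
    have i1: "integrable (lebesgue_on D) (\<lambda>x. W m x * (A x \<bullet> grad \<phi> x))" for m
    proof (rule Bochner_Integration.integrable_bound[where f = "\<lambda>x. B * (A x \<bullet> grad \<phi> x)"])
      show "AE x in lebesgue_on D. norm (W m x * (A x \<bullet> grad \<phi> x)) \<le> norm (B * (A x \<bullet> grad \<phi> x))"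
      proof (rule AE_lebesgue_on_I)
        fix x assume "x \<in> D"
        then have "\<bar>W m x\<bar> \<le> \<bar>B\<bar>" using W(2)[of x m] by linarith
        then show "norm (W m x * (A x \<bullet> grad \<phi> x)) \<le> norm (B * (A x \<bullet> grad \<phi> x))"
          by (simp add: abs_mult mult_right_mono)
      qed
    qed (use iAg in auto)
    have Wg [measurable]: "grad (W m) \<in> borel_measurable (lebesgue_on D)" for m
      by (rule continuous_measurable_lebesgue_on[OF continuous_on_grad[OF W(1)]])
    have LWg: "L2 D (grad (W m))" for m
    proof -
      obtain b where "b > 0" "\<And>x. x \<in> D \<Longrightarrow> norm (grad (W m) x) \<le> b"
        using continuous_bounded_on_bounded[OF continuous_on_grad[OF W(1)] D(2)] by metis
      then show ?thesis by (intro L2_bounded[OF D(2,1) Wg AE_lebesgue_on_I])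
    qed
    have i2: "integrable (lebesgue_on D) (\<lambda>x. (\<phi> x *\<^sub>R A x) \<bullet> grad (W m) x)" for m
      by (rule L2_inner_integrable[OF L\<phi>A LWg])
    have step: "(\<integral>x. W m x * (A x \<bullet> grad \<phi> x) \<partial>lebesgue_on D) + (\<integral>x. (\<phi> x *\<^sub>R A x) \<bullet> grad (W m) x \<partial>lebesgue_on D)
       = (\<integral>x. F x * (W m x * \<phi> x) \<partial>lebesgue_on D)" for m
    proof -
      have "(\<integral>x. F x * (W m x * \<phi> x) \<partial>lebesgue_on D) = (\<integral>x. A x \<bullet> grad (\<lambda>x. W m x * \<phi> x) x \<partial>lebesgue_on D)"
        by (rule eq[symmetric, OF test_function_mult[OF t W(1)]])
      also have "\<dots> = (\<integral>x. W m x * (A x \<bullet> grad \<phi> x) + (\<phi> x *\<^sub>R A x) \<bullet> grad (W m) x \<partial>lebesgue_on D)"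
        by (simp add: grad_mult[OF W(1) K(1)] inner_add_right)
      also have "\<dots> = (\<integral>x. W m x * (A x \<bullet> grad \<phi> x) \<partial>lebesgue_on D) + (\<integral>x. (\<phi> x *\<^sub>R A x) \<bullet> grad (W m) x \<partial>lebesgue_on D)"
        by (rule Bochner_Integration.integral_add[OF i1 i2])
      finally show ?thesis by simp
    qed
    have lim1: "(\<lambda>m. \<integral>x. W m x * (A x \<bullet> grad \<phi> x) \<partial>lebesgue_on D) \<longlonglongrightarrow> (\<integral>x. w x * (A x \<bullet> grad \<phi> x) \<partial>lebesgue_on D)"
    proof (rule integral_dominated_convergence[where w = "\<lambda>x. \<bar>B\<bar> * \<bar>A x \<bullet> grad \<phi> x\<bar>"])
      show "AE x in lebesgue_on D. norm (W m x * (A x \<bullet> grad \<phi> x)) \<le> \<bar>B\<bar> * \<bar>A x \<bullet> grad \<phi> x\<bar>" for m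
      proof (rule AE_lebesgue_on_I)
        fix x assume "x \<in> D"
        then have "\<bar>W m x\<bar> \<le> \<bar>B\<bar>" using W(2)[of x m] by linarith
        then show "norm (W m x * (A x \<bullet> grad \<phi> x)) \<le> \<bar>B\<bar> * \<bar>A x \<bullet> grad \<phi> x\<bar>"
          by (simp add: abs_mult mult_right_mono)
      qed
      show "AE x in lebesgue_on D. (\<lambda>m. W m x * (A x \<bullet> grad \<phi> x)) \<longlonglongrightarrow> w x * (A x \<bullet> grad \<phi> x)"
        using W(3) by eventually_elim (intro tendsto_intros)
    qed (use iAg in auto)
    have lim2: "(\<lambda>m. \<integral>x. F x * (W m x * \<phi> x) \<partial>lebesgue_on D) \<longlonglongrightarrow> (\<integral>x. F x * (w x * \<phi> x) \<partial>lebesgue_on D)"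
    proof (rule integral_dominated_convergence[where w = "\<lambda>x. (\<bar>B\<bar> * C) * \<bar>F x\<bar>"])
      show "AE x in lebesgue_on D. norm (F x * (W m x * \<phi> x)) \<le> (\<bar>B\<bar> * C) * \<bar>F x\<bar>" for m
      proof (rule AE_lebesgue_on_I)
        fix x assume x: "x \<in> D"
        then have "\<bar>W m x\<bar> \<le> \<bar>B\<bar>" using W(2)[of x m] by linarith
        then have "\<bar>W m x\<bar> * \<bar>\<phi> x\<bar> \<le> \<bar>B\<bar> * C" using C(2)[OF x] by (intro mult_mono) auto
        from mult_left_mono[OF this abs_ge_zero[of "F x"]]
        show "norm (F x * (W m x * \<phi> x)) \<le> (\<bar>B\<bar> * C) * \<bar>F x\<bar>" by (simp add: abs_mult mult.commute)
      qed
      show "AE x in lebesgue_on D. (\<lambda>m. F x * (W m x * \<phi> x)) \<longlonglongrightarrow> F x * (w x * \<phi> x)"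
        using W(3) by eventually_elim (intro tendsto_intros)
    qed (use iF in auto)
    have i3: "integrable (lebesgue_on D) (\<lambda>x. (\<phi> x *\<^sub>R A x) \<bullet> p x)" by (rule L2_inner_integrable[OF L\<phi>A Lp])
    \<comment> \<open>The factor \<open>\<phi>\<close> vanishes off \<open>K\<close>, so convergence
      of the gradients in L2 on \<open>K\<close> is enough.\<close>
    have bnd: "\<bar>(\<integral>x. (\<phi> x *\<^sub>R A x) \<bullet> grad (W m) x \<partial>lebesgue_on D) - (\<integral>x. (\<phi> x *\<^sub>R A x) \<bullet> p x \<partial>lebesgue_on D)\<bar>
        \<le> l2 K (\<lambda>x. \<phi> x *\<^sub>R A x) * l2 K (\<lambda>x. grad (W m) x - p x)" for m
    proof -
      have "(\<integral>x. (\<phi> x *\<^sub>R A x) \<bullet> grad (W m) x \<partial>lebesgue_on D) - (\<integral>x. (\<phi> x *\<^sub>R A x) \<bullet> p x \<partial>lebesgue_on D)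
          = (\<integral>x. (\<phi> x *\<^sub>R A x) \<bullet> grad (W m) x - (\<phi> x *\<^sub>R A x) \<bullet> p x \<partial>lebesgue_on D)"
        by (rule Bochner_Integration.integral_diff[symmetric, OF i2 i3])
      also have "\<dots> = (\<integral>x. (\<phi> x *\<^sub>R A x) \<bullet> (grad (W m) x - p x) \<partial>lebesgue_on D)"
        by (simp only: inner_diff_right)
      also have "\<dots> = (\<integral>x. (\<phi> x *\<^sub>R A x) \<bullet> (grad (W m) x - p x) \<partial>lebesgue_on K)"
        by (rule lebesgue_on_subset_eq(2)[OF K' K(3)]) (simp add: K(4))
      finally show ?thesis
        using L2_inner_le[OF L2_subset[OF L\<phi>A K(3) K'] L2_subset[OF L2_diff[OF LWg Lp] K(3) K']] by simp
    qed
    have "(\<lambda>m. l2 K (\<lambda>x. \<phi> x *\<^sub>R A x) * l2 K (\<lambda>x. grad (W m) x - p x)) \<longlonglongrightarrow> 0"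
      by (rule tendsto_mult_right_zero[OF W(4)[OF K(2,3)]])
    then have "(\<lambda>m. (\<integral>x. (\<phi> x *\<^sub>R A x) \<bullet> grad (W m) x \<partial>lebesgue_on D) - (\<integral>x. (\<phi> x *\<^sub>R A x) \<bullet> p x \<partial>lebesgue_on D)) \<longlonglongrightarrow> 0"
      by (rule Lim_null_comparison[rotated]) (rule always_eventually, rule allI, unfold real_norm_def, rule bnd)
    then have lim3: "(\<lambda>m. \<integral>x. (\<phi> x *\<^sub>R A x) \<bullet> grad (W m) x \<partial>lebesgue_on D) \<longlonglongrightarrow> (\<integral>x. (\<phi> x *\<^sub>R A x) \<bullet> p x \<partial>lebesgue_on D)"
      by (rule LIM_zero_cancel)
    have "(\<integral>x. w x * (A x \<bullet> grad \<phi> x) \<partial>lebesgue_on D) + (\<integral>x. (\<phi> x *\<^sub>R A x) \<bullet> p x \<partial>lebesgue_on D)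
        = (\<integral>x. F x * (w x * \<phi> x) \<partial>lebesgue_on D)"
      using LIMSEQ_unique[OF tendsto_add[OF lim1 lim3, unfolded step] lim2] .
    moreover have "(\<integral>x. (w x * F x - A x \<bullet> p x) * \<phi> x \<partial>lebesgue_on D) =
        (\<integral>x. F x * (w x * \<phi> x) \<partial>lebesgue_on D) - (\<integral>x. (\<phi> x *\<^sub>R A x) \<bullet> p x \<partial>lebesgue_on D)"
    proof -
      have "integrable (lebesgue_on D) (\<lambda>x. F x * (w x * \<phi> x))"
      proof (rule Bochner_Integration.integrable_bound[where f = "\<lambda>x. C * (w x * F x)"])
        show "AE x in lebesgue_on D. norm (F x * (w x * \<phi> x)) \<le> norm (C * (w x * F x))"
        proof (rule AE_lebesgue_on_I)
          fix x assume x: "x \<in> D"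
          from mult_left_mono[OF C(2)[OF x] abs_ge_zero[of "w x * F x"]]
          show "norm (F x * (w x * \<phi> x)) \<le> norm (C * (w x * F x))" using C(1) by (simp add: abs_mult mult_ac)
        qed
      qed (use iwF in auto)
      from Bochner_Integration.integral_diff[OF this i3] show ?thesis
        by (simp add: algebra_simps)
    qed
    ultimately show ?thesis by simp
  qed
  show ?thesis unfolding weak_div_def using LwA iwF iAp main by auto
qed

text \<open>Each \<open>H 0 (\<phi> n x)\<close> is a test function because
  \<open>H 0 0 = 0\<close>. In the limit the gradient of \<open>\<phi> n\<close> is written as g -
  (g - grad \<phi>_n): the first part converges by domination, the second is small in L2 and
  multiplied by the bounded factor \<open>H 1\<close>.\<close>

lemma weak_div_compose:
  assumes D: "open D" "bounded D" and A: "weak_div D A F" and u: "H10_seq D u g \<phi>"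
    and H: "\<And>n t. (H n has_real_derivative H (Suc n) t) (at t)" "H 0 0 = 0"
    and Hb: "\<And>t. \<bar>H 0 t\<bar> \<le> B0" "\<And>t. \<bar>H 1 t\<bar> \<le> B1"
  shows "(\<integral>x. A x \<bullet> (H 1 (u x) *\<^sub>R g x) \<partial>lebesgue_on D) = (\<integral>x. F x * H 0 (u x) \<partial>lebesgue_on D)"
proof -
  have LA: "L2 D A" and iF: "integrable (lebesgue_on D) F"
    and eq: "\<And>\<phi>. test_function D \<phi> \<Longrightarrow> (\<integral>x. A x \<bullet> grad \<phi> x \<partial>lebesgue_on D) = (\<integral>x. F x * \<phi> x \<partial>lebesgue_on D)"
    using A by (auto simp: weak_div_def)
  have Lu: "L2 D u" and Lg: "L2 D g" and t: "\<And>n. test_function D (\<phi> n)"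
    and lg: "(\<lambda>n. l2 D (\<lambda>x. g x - grad (\<phi> n) x)) \<longlonglongrightarrow> 0" and lu: "AE x in lebesgue_on D. (\<lambda>n. \<phi> n x) \<longlonglongrightarrow> u x"
    using u by (auto simp: H10_seq_def)
  have s: "smooth_fun (\<phi> n)" for n using t[of n] by (auto simp: test_function_def smooth_fun_def)
  have Hc: "isCont (H n) t" for n t using H(1) by (rule DERIV_isCont)
  have Hm [measurable]: "H n \<in> borel_measurable borel" for n
    by (rule borel_measurable_continuous_onI) (use Hc continuous_at_imp_continuous_on in blast)
  have \<phi>m [measurable]: "\<phi> n \<in> borel_measurable (lebesgue_on D)" for n
    by (rule continuous_measurable_lebesgue_on[OF smooth_fun_continuous[OF s]])
  note [measurable] = L2_measurable[OF LA] L2_measurable[OF Lg] L2_measurable[OF Lu] borel_measurable_integrable[OF iF]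
  have L\<phi>: "L2 D (grad (\<phi> n))" for n by (rule test_L2(2)[OF D t])
  have lim: "AE x in lebesgue_on D. (\<lambda>n. H k (\<phi> n x)) \<longlonglongrightarrow> H k (u x)" for k
    using lu by eventually_elim (rule isCont_tendsto_compose[OF Hc])
  have iA: "integrable (lebesgue_on D) (\<lambda>x. A x \<bullet> g x)" by (rule L2_inner_integrable[OF LA Lg])
  have lim1: "(\<lambda>n. \<integral>x. F x * H 0 (\<phi> n x) \<partial>lebesgue_on D) \<longlonglongrightarrow> (\<integral>x. F x * H 0 (u x) \<partial>lebesgue_on D)"
  proof (rule integral_dominated_convergence[where w = "\<lambda>x. B0 * \<bar>F x\<bar>"])
    show "AE x in lebesgue_on D. norm (F x * H 0 (\<phi> n x)) \<le> B0 * \<bar>F x\<bar>" for n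
      by (rule AE_I2) (simp add: abs_mult mult.commute[of B0] mult_left_mono Hb)
    show "AE x in lebesgue_on D. (\<lambda>n. F x * H 0 (\<phi> n x)) \<longlonglongrightarrow> F x * H 0 (u x)"
      using lim[of 0] by eventually_elim (intro tendsto_intros)
  qed (use iF in auto)
  have lim2: "(\<lambda>n. \<integral>x. H 1 (\<phi> n x) * (A x \<bullet> g x) \<partial>lebesgue_on D) \<longlonglongrightarrow> (\<integral>x. H 1 (u x) * (A x \<bullet> g x) \<partial>lebesgue_on D)"
  proof (rule integral_dominated_convergence[where w = "\<lambda>x. B1 * \<bar>A x \<bullet> g x\<bar>"])
    show "AE x in lebesgue_on D. norm (H 1 (\<phi> n x) * (A x \<bullet> g x)) \<le> B1 * \<bar>A x \<bullet> g x\<bar>" for n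
      by (rule AE_I2) (simp only: real_norm_def abs_mult mult_right_mono Hb abs_ge_zero)
    show "AE x in lebesgue_on D. (\<lambda>n. H 1 (\<phi> n x) * (A x \<bullet> g x)) \<longlonglongrightarrow> H 1 (u x) * (A x \<bullet> g x)"
      using lim[of 1] by eventually_elim (intro tendsto_intros)
  qed (use iA in auto)
  have HB: "AE x in lebesgue_on D. \<bar>H 1 (\<phi> n x)\<bar> \<le> B1" for n by (rule AE_I2) (rule Hb(2))
  have B1: "B1 \<ge> 0" using Hb(2)[of 0] by linarith
  have LH: "L2 D (\<lambda>x. H 1 (\<phi> n x) *\<^sub>R (g x - grad (\<phi> n) x))"
    "l2 D (\<lambda>x. H 1 (\<phi> n x) *\<^sub>R (g x - grad (\<phi> n) x)) \<le> B1 * l2 D (\<lambda>x. g x - grad (\<phi> n) x)" for n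
    using L2_scaleR_bounded[OF L2_diff[OF Lg L\<phi>] _ HB] B1 by auto
  have lim3: "(\<lambda>n. \<integral>x. A x \<bullet> (H 1 (\<phi> n x) *\<^sub>R (g x - grad (\<phi> n) x)) \<partial>lebesgue_on D) \<longlonglongrightarrow> 0"
  proof (rule Lim_null_comparison[OF always_eventually[OF allI]])
    fix n
    have "norm (\<integral>x. A x \<bullet> (H 1 (\<phi> n x) *\<^sub>R (g x - grad (\<phi> n) x)) \<partial>lebesgue_on D) \<le>
        l2 D A * l2 D (\<lambda>x. H 1 (\<phi> n x) *\<^sub>R (g x - grad (\<phi> n) x))"
      using L2_inner_le[OF LA LH(1)] by simp
    also have "\<dots> \<le> l2 D A * (B1 * l2 D (\<lambda>x. g x - grad (\<phi> n) x))"
      by (rule mult_left_mono[OF LH(2) l2_nonneg])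
    finally show "norm (\<integral>x. A x \<bullet> (H 1 (\<phi> n x) *\<^sub>R (g x - grad (\<phi> n) x)) \<partial>lebesgue_on D) \<le>
        l2 D A * (B1 * l2 D (\<lambda>x. g x - grad (\<phi> n) x))" .
  next
    have "(\<lambda>n. l2 D A * (B1 * l2 D (\<lambda>x. g x - grad (\<phi> n) x))) \<longlonglongrightarrow> l2 D A * (B1 * 0)"
      by (intro tendsto_mult_left lg)
    then show "(\<lambda>n. l2 D A * (B1 * l2 D (\<lambda>x. g x - grad (\<phi> n) x))) \<longlonglongrightarrow> 0" by simp
  qed
  have iH: "integrable (lebesgue_on D) (\<lambda>x. H 1 (\<phi> n x) * (A x \<bullet> g x))" for n
  proof (rule Bochner_Integration.integrable_bound[where f = "\<lambda>x. B1 * (A x \<bullet> g x)"])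
    show "AE x in lebesgue_on D. norm (H 1 (\<phi> n x) * (A x \<bullet> g x)) \<le> norm (B1 * (A x \<bullet> g x))"
      using B1 Hb(2) by (intro AE_I2) (simp add: abs_mult mult_right_mono)
  qed (use iA in auto)
  have "(\<integral>x. F x * H 0 (\<phi> n x) \<partial>lebesgue_on D) = (\<integral>x. H 1 (\<phi> n x) * (A x \<bullet> g x) \<partial>lebesgue_on D) -
      (\<integral>x. A x \<bullet> (H 1 (\<phi> n x) *\<^sub>R (g x - grad (\<phi> n) x)) \<partial>lebesgue_on D)" for n
  proof -
    have "(\<integral>x. F x * H 0 (\<phi> n x) \<partial>lebesgue_on D) = (\<integral>x. A x \<bullet> grad (\<lambda>x. H 0 (\<phi> n x)) x \<partial>lebesgue_on D)"
      by (rule eq[symmetric, OF test_function_compose[OF H t]])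
    also have "\<dots> = (\<integral>x. A x \<bullet> (H 1 (\<phi> n x) *\<^sub>R grad (\<phi> n) x) \<partial>lebesgue_on D)"
      using grad_compose[OF H(1)[of 0] s] by simp
    also have "\<dots> = (\<integral>x. H 1 (\<phi> n x) * (A x \<bullet> g x) - A x \<bullet> (H 1 (\<phi> n x) *\<^sub>R (g x - grad (\<phi> n) x)) \<partial>lebesgue_on D)"
      by (simp add: inner_diff_right algebra_simps)
    also have "\<dots> = (\<integral>x. H 1 (\<phi> n x) * (A x \<bullet> g x) \<partial>lebesgue_on D) -
      (\<integral>x. A x \<bullet> (H 1 (\<phi> n x) *\<^sub>R (g x - grad (\<phi> n) x)) \<partial>lebesgue_on D)"
      by (rule Bochner_Integration.integral_diff[OF iH L2_inner_integrable[OF LA LH(1)]])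
    finally show ?thesis .
  qed
  with tendsto_diff[OF lim2 lim3]
  have "(\<lambda>n. \<integral>x. F x * H 0 (\<phi> n x) \<partial>lebesgue_on D) \<longlonglongrightarrow> (\<integral>x. H 1 (u x) * (A x \<bullet> g x) \<partial>lebesgue_on D)" by simp
  from LIMSEQ_unique[OF this lim1] show ?thesis by simp
qed

section \<open>The logistic function as a test function, and the sign of \<open>u\<close>\<close>

definition logistic :: "real \<Rightarrow> real \<Rightarrow> real" where
  "logistic \<epsilon> t = 1 / (1 + exp (t / \<epsilon>))"

text \<open>The logistic function satisfies the equation y' = - (1/\<epsilon>) (y - y^2), so all
  derivatives of a polynomial in y are polynomials in y; \<open>[:0, 1, -1:]\<close> is y - y^2.
  This is the form that \<open>weak_div_compose\<close> asks for.\<close>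

definition logistic_deriv :: "real \<Rightarrow> real poly \<Rightarrow> real poly" where
  "logistic_deriv \<epsilon> p = smult (- (1 / \<epsilon>)) ([:0, 1, -1:] * pderiv p)"

lemma logistic_pos: "0 < logistic \<epsilon> t" and logistic_less_1: "logistic \<epsilon> t < 1"
  by (auto simp: logistic_def add_pos_pos field_simps)

lemma logistic_le_half:
  assumes "\<epsilon> > 0" "t \<ge> 0" shows "logistic \<epsilon> t \<le> 1/2"
proof -
  have "1 \<le> exp (t / \<epsilon>)" using assms by simp
  then show ?thesis by (simp add: logistic_def divide_le_eq add_pos_pos)
qed

text \<open>This and the next lemma rest on 2 <= e <= 3. Above \<open>\<epsilon>\<close> the weight
  \<open>1 - 2 * logistic \<epsilon> t\<close> is at least 1/3; below \<open>\<epsilon>\<close> the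
  logistic function itself is at least 1/4.\<close>

lemma logistic_le_third:
  assumes "\<epsilon> > 0" "t \<ge> \<epsilon>" shows "logistic \<epsilon> t \<le> 1/3"
proof -
  have "2 \<le> exp (1::real)" using exp_ge_add_one_self[of 1] by simp
  also have "\<dots> \<le> exp (t / \<epsilon>)" using assms by (simp add: field_simps)
  finally show ?thesis by (simp add: logistic_def field_simps add_pos_pos)
qed

lemma logistic_ge_quarter:
  assumes "\<epsilon> > 0" "t \<le> \<epsilon>" shows "1/4 \<le> logistic \<epsilon> t"
proof -
  have "exp (t / \<epsilon>) \<le> exp 1" using assms by (simp add: field_simps)
  also have "\<dots> \<le> 3" by (rule exp_le)
  finally have "exp (t / \<epsilon>) \<le> 3" .
  then show ?thesis by (simp add: logistic_def field_simps add_pos_pos)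
qed

lemma logistic_DERIV:
  assumes "\<epsilon> > 0"
  shows "((\<lambda>t. poly p (logistic \<epsilon> t)) has_real_derivative poly (logistic_deriv \<epsilon> p) (logistic \<epsilon> t)) (at t)"
proof -
  have nz: "1 + exp (t / \<epsilon>) \<noteq> 0" using exp_gt_zero[of "t / \<epsilon>"] by linarith
  have "(logistic \<epsilon> has_real_derivative - (exp (t / \<epsilon>) * (1 / \<epsilon>)) / (1 + exp (t / \<epsilon>))\<^sup>2) (at t)"
    unfolding logistic_def[abs_def] using nz assms
    by (auto intro!: derivative_eq_intros simp: power2_eq_square)
  also have "- (exp (t / \<epsilon>) * (1 / \<epsilon>)) / (1 + exp (t / \<epsilon>))\<^sup>2 = - (1 / \<epsilon>) * (logistic \<epsilon> t - (logistic \<epsilon> t)\<^sup>2)"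
    using nz by (simp add: logistic_def power2_eq_square divide_simps)
  finally have "((\<lambda>t. poly p (logistic \<epsilon> t)) has_real_derivative
      poly (pderiv p) (logistic \<epsilon> t) * (- (1 / \<epsilon>) * (logistic \<epsilon> t - (logistic \<epsilon> t)\<^sup>2))) (at t)"
    by (rule DERIV_chain2[OF poly_DERIV])
  then show ?thesis by (simp add: logistic_deriv_def power2_eq_square algebra_simps)
qed

lemma logistic_DERIV_iter:
  "\<epsilon> > 0 \<Longrightarrow> ((\<lambda>t. poly ((logistic_deriv \<epsilon> ^^ n) p) (logistic \<epsilon> t)) has_real_derivative
     poly ((logistic_deriv \<epsilon> ^^ Suc n) p) (logistic \<epsilon> t)) (at t)"
  using logistic_DERIV by simp

lemma logistic_mult_bound: "0 \<le> logistic \<epsilon> t * (1 - logistic \<epsilon> t)" "logistic \<epsilon> t * (1 - logistic \<epsilon> t) \<le> 1/4"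
proof -
  show "0 \<le> logistic \<epsilon> t * (1 - logistic \<epsilon> t)" using logistic_pos[of \<epsilon> t] logistic_less_1[of \<epsilon> t] by simp
  have "0 \<le> (logistic \<epsilon> t - 1/2)\<^sup>2" by simp
  then show "logistic \<epsilon> t * (1 - logistic \<epsilon> t) \<le> 1/4" by (simp add: power2_eq_square algebra_simps)
qed

lemma logistic_measurable [measurable]: "logistic \<epsilon> \<in> borel_measurable borel"
  unfolding logistic_def[abs_def] by measurable

lemma weak_div_compose_logistic:
  assumes D: "open D" "bounded D" and A: "weak_div D A F" and u: "H10_seq D u g \<phi>" and e: "\<epsilon> > 0"
  shows "(\<integral>x. A x \<bullet> ((2 / \<epsilon> * (logistic \<epsilon> (u x) * (1 - logistic \<epsilon> (u x)))) *\<^sub>R g x) \<partial>lebesgue_on D) =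
    (\<integral>x. F x * (1 - 2 * logistic \<epsilon> (u x)) \<partial>lebesgue_on D)"
proof -
  \<comment> \<open>The polynomial 1 - 2 y vanishes at y = 1/2, the value of the logistic function
    at 0, so zero boundary values are preserved.\<close>
  let ?H = "\<lambda>n t. poly ((logistic_deriv \<epsilon> ^^ n) [:1, -2:]) (logistic \<epsilon> t)"
  have H0: "?H 0 t = 1 - 2 * logistic \<epsilon> t" for t by simp
  have H1: "?H 1 t = 2 / \<epsilon> * (logistic \<epsilon> t * (1 - logistic \<epsilon> t))" for t
    by (simp add: logistic_deriv_def pderiv_pCons algebra_simps)
  have b0: "\<bar>?H 0 t\<bar> \<le> 1" for t
    unfolding H0 using logistic_pos[of \<epsilon> t] logistic_less_1[of \<epsilon> t] by linarith
  have b1: "\<bar>?H 1 t\<bar> \<le> 2 / \<epsilon> * (1 / 4)" for t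
    unfolding H1 abs_mult using e logistic_mult_bound[of \<epsilon> t] by (intro mult_mono) (auto simp: abs_mult[symmetric])
  have "(\<integral>x. A x \<bullet> (?H 1 (u x) *\<^sub>R g x) \<partial>lebesgue_on D) = (\<integral>x. F x * ?H 0 (u x) \<partial>lebesgue_on D)"
    by (rule weak_div_compose[where H = ?H, OF D A u _ _ b0 b1])
      (rule logistic_DERIV_iter[OF e], simp add: logistic_def)
  then show ?thesis unfolding H0 H1 .
qed

text \<open>The weak maximum principle, tested with \<open>- bump1 (- u)\<close>, a smooth
  increasing function of \<open>u\<close> that is negative exactly where u < 0. The left side of the
  tested equation is nonnegative and the right side nonpositive, so \<open>F * bump1 (- u)\<close>
  vanishes, and F > 0.\<close>

lemma weak_supersolution_nonneg:
  assumes D: "open D" "bounded D" and A: "weak_div D (\<lambda>x. a x *\<^sub>R g x) F" and u: "H10_seq D u g \<phi>"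
    and a0: "AE x in lebesgue_on D. 0 \<le> a x" and F: "AE x in lebesgue_on D. 0 < F x"
  shows "AE x in lebesgue_on D. 0 \<le> u x"
proof -
  let ?H = "\<lambda>n t. - ((-1) ^ n) * flat_exp ((flat_exp_deriv ^^ n) [:1:]) (- t)"
  have H: "(?H n has_real_derivative ?H (Suc n) t) (at t)" for n t
  proof -
    have "((\<lambda>t. flat_exp ((flat_exp_deriv ^^ n) [:1:]) (- t)) has_real_derivative
        flat_exp ((flat_exp_deriv ^^ Suc n) [:1:]) (- t) * (- 1)) (at t)"
      by (rule DERIV_chain2[OF _ DERIV_minus[OF DERIV_ident]]) (simp add: flat_exp_DERIV)
    from DERIV_cmult[OF this, of "- ((-1) ^ n)"] show ?thesis by simp
  qed
  have b0: "\<bar>?H 0 t\<bar> \<le> 1" for t using bump1_nonneg[of "- t"] bump1_le_1[of "- t"] by simp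
  have b1: "\<bar>?H 1 t\<bar> \<le> 2" for t using bump1_deriv_bounds[of "- t"] by simp
  have eq: "(\<integral>x. (a x *\<^sub>R g x) \<bullet> (?H 1 (u x) *\<^sub>R g x) \<partial>lebesgue_on D) = (\<integral>x. F x * ?H 0 (u x) \<partial>lebesgue_on D)"
    by (rule weak_div_compose[where H = ?H, OF D A u H _ b0 b1]) (simp add: flat_exp_def)
  have iF: "integrable (lebesgue_on D) F" using A by (simp add: weak_div_def)
  have Lu: "L2 D u" using u by (simp add: H10_seq_def)
  have [measurable]: "flat_exp p \<in> borel_measurable borel" for p
    by (rule borel_measurable_continuous_onI) (use flat_exp_DERIV DERIV_isCont continuous_at_imp_continuous_on in blast)
  note [measurable] = borel_measurable_integrable[OF iF] L2_measurable[OF Lu]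
  have i: "integrable (lebesgue_on D) (\<lambda>x. F x * bump1 (- u x))"
  proof (rule Bochner_Integration.integrable_bound[OF iF])
    show "AE x in lebesgue_on D. norm (F x * bump1 (- u x)) \<le> norm (F x)"
      by (rule AE_I2) (simp add: abs_mult bump1_nonneg bump1_le_1 mult_left_le)
  qed measurable
  have "0 \<le> (\<integral>x. (a x *\<^sub>R g x) \<bullet> (?H 1 (u x) *\<^sub>R g x) \<partial>lebesgue_on D)"
    using a0 bump1_deriv_bounds(1) by (intro integral_nonneg_AE) (auto elim!: eventually_mono)
  also have "\<dots> = - (\<integral>x. F x * bump1 (- u x) \<partial>lebesgue_on D)" unfolding eq by simp
  finally have "(\<integral>x. F x * bump1 (- u x) \<partial>lebesgue_on D) \<le> 0" by simp
  moreover have nn: "AE x in lebesgue_on D. 0 \<le> F x * bump1 (- u x)"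
    using F by eventually_elim (simp add: bump1_nonneg)
  ultimately have "(\<integral>x. F x * bump1 (- u x) \<partial>lebesgue_on D) = 0"
    using integral_nonneg_AE[OF nn] by simp
  then have "AE x in lebesgue_on D. F x * bump1 (- u x) = 0"
    using integral_nonneg_eq_0_iff_AE[OF i nn] by simp
  then show ?thesis using F
  proof eventually_elim
    case (elim x)
    then have "bump1 (- u x) = 0" by simp
    then show ?case using bump1_pos_iff[of "- u x"] by linarith
  qed
qed

lemma multiplier_smooth:
  assumes D: "open D" "bounded D" and w: "smooth_fun w"
  shows "multiplier D w (grad w)"
proof -
  note c = smooth_fun_continuous[OF w] and g = continuous_on_grad[OF w]
  obtain B where B: "B > 0" "\<And>x. x \<in> D \<Longrightarrow> norm (w x) \<le> B" using continuous_bounded_on_bounded[OF c D(2)] by metis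
  obtain C where C: "C > 0" "\<And>x. x \<in> D \<Longrightarrow> norm (grad w x) \<le> C" using continuous_bounded_on_bounded[OF g D(2)] by metis
  have "L2 D (grad w)"
    by (rule L2_bounded[OF D(2,1) continuous_measurable_lebesgue_on[OF g] AE_lebesgue_on_I[OF C(2)]])
  then show ?thesis unfolding multiplier_def
    using continuous_measurable_lebesgue_on[OF c] w B
    by (auto intro!: exI[of _ "\<lambda>_. w"] exI[of _ B] simp: l2_def)
qed

text \<open>This replaces a lower bound on \<open>u\<close> by Harnack's inequality: the term with \<open>\<bar>\<nabla>u\<bar>\<^sup>2\<close> produced by the logistic function absorbs the cross term.\<close>

lemma sublevel_estimate:
  assumes D: "open D" "bounded D" and A: "weak_div D (\<lambda>x. a x *\<^sub>R g x) F" and u: "H10_seq D u g \<phi>"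
    and a0: "AE x in lebesgue_on D. 0 \<le> a x \<and> a x \<le> L" and F: "AE x in lebesgue_on D. c \<le> F x"
    and u0: "AE x in lebesgue_on D. 0 \<le> u x" and \<eta>: "test_function D \<eta>" and e: "\<epsilon> > 0"
  shows "c * (\<integral>x. (\<eta> x)\<^sup>2 * logistic \<epsilon> (u x) \<partial>lebesgue_on D) \<le> \<epsilon> * L * (l2 D (grad \<eta>))\<^sup>2"
proof -
  let ?A = "\<lambda>x. a x *\<^sub>R g x" and ?s = "\<lambda>x. logistic \<epsilon> (u x)"
  have s\<eta>: "smooth_fun \<eta>" using \<eta> by (auto simp: test_function_def smooth_fun_def)
  note m = multiplier_smooth[OF D s\<eta>]
  define A1 where "A1 x = \<eta> x *\<^sub>R ?A x" for x
  define F1 where "F1 x = \<eta> x * F x - ?A x \<bullet> grad \<eta> x" for x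
  define A2 where "A2 x = \<eta> x *\<^sub>R A1 x" for x
  define F2 where "F2 x = \<eta> x * F1 x - A1 x \<bullet> grad \<eta> x" for x
  have W1: "weak_div D A1 F1" unfolding A1_def[abs_def] F1_def[abs_def] by (rule weak_div_multiplier[OF D A m])
  have W2: "weak_div D A2 F2" unfolding A2_def[abs_def] F2_def[abs_def] by (rule weak_div_multiplier[OF D W1 m])
  have iF2: "integrable (lebesgue_on D) F2" and LA2: "L2 D A2" using W2 by (auto simp: weak_div_def)
  have Lg: "L2 D g" and Lu: "L2 D u" using u by (auto simp: H10_seq_def)
  note l\<eta> = test_L2[OF D \<eta>]
  note [measurable] = L2_measurable[OF Lg] L2_measurable[OF Lu] L2_measurable[OF l\<eta>(1)] L2_measurable[OF l\<eta>(2)]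
  have iF1: "integrable (lebesgue_on D) (\<lambda>x. F1 x * \<eta> x)" "integrable (lebesgue_on D) (\<lambda>x. A1 x \<bullet> grad \<eta> x)"
  proof -
    have LA1: "L2 D A1" and F1: "integrable (lebesgue_on D) F1" using W1 by (auto simp: weak_div_def)
    show i: "integrable (lebesgue_on D) (\<lambda>x. A1 x \<bullet> grad \<eta> x)" by (rule L2_inner_integrable[OF LA1 l\<eta>(2)])
    have "F1 x * \<eta> x = F2 x + A1 x \<bullet> grad \<eta> x" for x by (simp add: F2_def)
    then show "integrable (lebesgue_on D) (\<lambda>x. F1 x * \<eta> x)" using iF2 i by simp
  qed
  \<comment> \<open>The function \<open>\<eta>\<close> itself is admissible for the field
    \<open>A1\<close>. This removes the constant 1 from 1 - 2 logistic, so that in effect the test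
    function is \<open>\<eta>\<^sup>2\<close> times the logistic function, which does not vanish
    where u = 0.\<close>
  have F20: "(\<integral>x. F2 x \<partial>lebesgue_on D) = 0"
  proof -
    have "(\<integral>x. F2 x \<partial>lebesgue_on D) = (\<integral>x. F1 x * \<eta> x \<partial>lebesgue_on D) - (\<integral>x. A1 x \<bullet> grad \<eta> x \<partial>lebesgue_on D)"
      unfolding F2_def mult.commute[of "\<eta> _"] by (rule Bochner_Integration.integral_diff[OF iF1])
    then show ?thesis using W1 \<eta> by (simp add: weak_div_def)
  qed
  have iFs: "integrable (lebesgue_on D) (\<lambda>x. F2 x * ?s x)"
  proof (rule Bochner_Integration.integrable_bound[OF iF2])
    show "AE x in lebesgue_on D. norm (F2 x * ?s x) \<le> norm (F2 x)"
      using logistic_pos logistic_less_1 by (intro AE_I2) (simp add: abs_mult mult_left_le less_imp_le)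
  qed (use borel_measurable_integrable[OF iF2] in measurable)
  let ?k = "\<lambda>x. ?s x * (1 - ?s x) / \<epsilon>"
  have Lk: "L2 D (\<lambda>x. ?k x *\<^sub>R g x)"
  proof (rule L2_scaleR_bounded(1)[OF Lg])
    show "AE x in lebesgue_on D. \<bar>?k x\<bar> \<le> (1/4) / \<epsilon>"
    proof (rule AE_I2)
      fix x
      have "0 \<le> ?k x" using logistic_mult_bound(1)[of \<epsilon> "u x"] e by simp
      moreover have "?k x \<le> (1/4) / \<epsilon>" using logistic_mult_bound(2)[of \<epsilon> "u x"] e by (intro divide_right_mono) auto
      ultimately show "\<bar>?k x\<bar> \<le> (1/4) / \<epsilon>" by simp
    qed
  qed measurable
  have iA: "integrable (lebesgue_on D) (\<lambda>x. A2 x \<bullet> (?k x *\<^sub>R g x))" by (rule L2_inner_integrable[OF LA2 Lk])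
  have "2 * (\<integral>x. A2 x \<bullet> (?k x *\<^sub>R g x) \<partial>lebesgue_on D) = (\<integral>x. A2 x \<bullet> ((2 / \<epsilon> * (?s x * (1 - ?s x))) *\<^sub>R g x) \<partial>lebesgue_on D)"
  proof (subst integral_mult_right_zero[symmetric], rule Bochner_Integration.integral_cong[OF refl])
    fix x show "2 * (A2 x \<bullet> (?k x *\<^sub>R g x)) = A2 x \<bullet> ((2 / \<epsilon> * (?s x * (1 - ?s x))) *\<^sub>R g x)"
      by (simp only: inner_scaleR_right) simp
  qed
  also have "\<dots> = (\<integral>x. F2 x * (1 - 2 * ?s x) \<partial>lebesgue_on D)"
    by (rule weak_div_compose_logistic[OF D W2 u e])
  also have "\<dots> = (\<integral>x. F2 x - 2 * (F2 x * ?s x) \<partial>lebesgue_on D)" by (simp add: algebra_simps)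
  also have "\<dots> = - 2 * (\<integral>x. F2 x * ?s x \<partial>lebesgue_on D)"
    using iF2 iFs F20 by simp
  finally have eq: "(\<integral>x. A2 x \<bullet> (?k x *\<^sub>R g x) \<partial>lebesgue_on D) + (\<integral>x. F2 x * ?s x \<partial>lebesgue_on D) = 0" by simp
  have i1: "integrable (lebesgue_on D) (\<lambda>x. c * ((\<eta> x)\<^sup>2 * ?s x))"
  proof (rule Bochner_Integration.integrable_bound[where f = "\<lambda>x. c * (norm (\<eta> x))\<^sup>2"])
    show "AE x in lebesgue_on D. norm (c * ((\<eta> x)\<^sup>2 * ?s x)) \<le> norm (c * (norm (\<eta> x))\<^sup>2)"
      using logistic_pos logistic_less_1
      by (intro AE_I2) (simp add: abs_mult mult_left_le less_imp_le mult_left_mono)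
  qed (use L2_integrable[OF l\<eta>(1)] in auto)
  have i2: "integrable (lebesgue_on D) (\<lambda>x. \<epsilon> * L * (norm (grad \<eta> x))\<^sup>2)" using L2_integrable[OF l\<eta>(2)] by simp
  have le: "AE x in lebesgue_on D. c * ((\<eta> x)\<^sup>2 * ?s x) - \<epsilon> * L * (norm (grad \<eta> x))\<^sup>2 \<le> A2 x \<bullet> (?k x *\<^sub>R g x) + F2 x * ?s x"
    using a0 F u0
  proof eventually_elim
    case (elim x)
    define s where "s = ?s x"
    have s: "0 < s" "s \<le> 1/2" using logistic_pos logistic_le_half[OF e elim(3)] by (auto simp: s_def)
    define P where "P = \<bar>\<eta> x\<bar> * s * norm (g x)"
    define Q where "Q = norm (grad \<eta> x)"
    have PQ: "P \<ge> 0" "Q \<ge> 0" using s by (auto simp: P_def Q_def)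
    have "2 * \<eta> x * s * (g x \<bullet> grad \<eta> x) \<le> 2 * (\<bar>\<eta> x\<bar> * s * (norm (g x) * norm (grad \<eta> x)))"
    proof -
      have "\<eta> x * s * (g x \<bullet> grad \<eta> x) \<le> \<bar>\<eta> x * s * (g x \<bullet> grad \<eta> x)\<bar>" by (rule abs_ge_self)
      also have "\<dots> = \<bar>\<eta> x\<bar> * s * \<bar>g x \<bullet> grad \<eta> x\<bar>" using s by (simp add: abs_mult)
      also have "\<dots> \<le> \<bar>\<eta> x\<bar> * s * (norm (g x) * norm (grad \<eta> x))"
        using s by (intro mult_left_mono Cauchy_Schwarz_ineq2) auto
      finally show ?thesis by simp
    qed
    also have "\<dots> = 2 * (P * Q)" by (simp add: P_def Q_def)
    also have "\<dots> \<le> P\<^sup>2 / \<epsilon> + \<epsilon> * Q\<^sup>2"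
    proof -
      have "0 \<le> (P - \<epsilon> * Q)\<^sup>2" by simp
      then have "2 * (P * Q) * \<epsilon> \<le> P\<^sup>2 + \<epsilon> * Q\<^sup>2 * \<epsilon>" by (simp add: power2_eq_square algebra_simps)
      then show ?thesis using e by (simp add: field_simps)
    qed
    also have "P\<^sup>2 / \<epsilon> \<le> (\<eta> x)\<^sup>2 * (s * (1 - s)) * (norm (g x))\<^sup>2 / \<epsilon>"
    proof -
      \<comment> \<open>The bound s <= 1/2 is where u >= 0 enters: it lets the good term, which
        carries s (1 - s), absorb the square s^2 left over by Young's inequality.\<close>
      have "s * s \<le> s * (1 - s)" using s by (intro mult_left_mono) auto
      from mult_right_mono[OF mult_left_mono[OF this zero_le_power2[of "\<eta> x"]] zero_le_power2[of "norm (g x)"]]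
      have "P\<^sup>2 \<le> (\<eta> x)\<^sup>2 * (s * (1 - s)) * (norm (g x))\<^sup>2"
        by (simp add: P_def power_mult_distrib power2_eq_square[of s])
      then show ?thesis using e by (intro divide_right_mono) auto
    qed
    finally have main: "2 * \<eta> x * s * (g x \<bullet> grad \<eta> x) \<le> (\<eta> x)\<^sup>2 * (s * (1 - s)) * (norm (g x))\<^sup>2 / \<epsilon> + \<epsilon> * Q\<^sup>2" by simp
    have "a x * (2 * \<eta> x * s * (g x \<bullet> grad \<eta> x)) \<le> a x * ((\<eta> x)\<^sup>2 * (s * (1 - s)) * (norm (g x))\<^sup>2 / \<epsilon>) + a x * (\<epsilon> * Q\<^sup>2)"
      using mult_left_mono[OF main, of "a x"] elim(1) by (simp add: distrib_left)
    moreover have "a x * (\<epsilon> * Q\<^sup>2) \<le> L * (\<epsilon> * Q\<^sup>2)" using elim(1) e by (intro mult_right_mono) auto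
    moreover have "c * ((\<eta> x)\<^sup>2 * s) \<le> F x * ((\<eta> x)\<^sup>2 * s)" using elim(2) s by (intro mult_right_mono) auto
    moreover have "A2 x \<bullet> (?k x *\<^sub>R g x) = a x * ((\<eta> x)\<^sup>2 * (s * (1 - s)) * (norm (g x))\<^sup>2 / \<epsilon>)"
      by (simp add: A2_def A1_def s_def power2_norm_eq_inner power2_eq_square[of "\<eta> x"])
    moreover have "F2 x * ?s x = F x * ((\<eta> x)\<^sup>2 * s) - a x * (2 * \<eta> x * s * (g x \<bullet> grad \<eta> x))"
      by (simp add: F2_def F1_def A1_def s_def power2_eq_square algebra_simps)
    moreover have "\<epsilon> * L * (norm (grad \<eta> x))\<^sup>2 = L * (\<epsilon> * Q\<^sup>2)" by (simp add: Q_def)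
    ultimately show ?case unfolding s_def Q_def by linarith
  qed
  have "(\<integral>x. c * ((\<eta> x)\<^sup>2 * ?s x) - \<epsilon> * L * (norm (grad \<eta> x))\<^sup>2 \<partial>lebesgue_on D) \<le>
      (\<integral>x. A2 x \<bullet> (?k x *\<^sub>R g x) + F2 x * ?s x \<partial>lebesgue_on D)"
    by (rule integral_mono_AE[OF Bochner_Integration.integrable_diff[OF i1 i2] Bochner_Integration.integrable_add[OF iA iFs] le])
  also have "\<dots> = 0" using iA iFs eq by simp
  finally show ?thesis unfolding l2_square using i1 i2 by simp
qed

text \<open>Let h = 1 - 2 logistic, A = a grad u and q = grad (w h(u)). Testing the equation for u
  with w^2 h(u) shows that the integral of w^2 F h(u) is at most twice that of w A . q. Up to
  errors, w A is the difference of the two fluxes, which is free of divergence and therefore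
  orthogonal to q. The errors are b times the gradient difference and a (\<psi> - w) grad u, and
  Cauchy-Schwarz against q gives the bound; the factor 1/(2 \<epsilon>) is the maximum of
  h'.\<close>

lemma weighted_difference_estimate:
  assumes D: "open D" "bounded D"
    and A: "weak_div D (\<lambda>x. a x *\<^sub>R ga x) F" and B: "weak_div D (\<lambda>x. b x *\<^sub>R gb x) F"
    and u: "H10_seq D u ga \<phi>" and Lgb: "L2 D gb" and w: "multiplier D w p"
    and am: "a \<in> borel_measurable (lebesgue_on D)" "b \<in> borel_measurable (lebesgue_on D)" "\<psi> \<in> borel_measurable (lebesgue_on D)"
    and a0: "AE x in lebesgue_on D. 0 \<le> a x \<and> a x \<le> L" and b0: "AE x in lebesgue_on D. 0 \<le> b x \<and> b x \<le> L"
    and F: "AE x in lebesgue_on D. c \<le> F x" and c: "c \<ge> 0" and L: "L \<ge> 0"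
    and u0: "AE x in lebesgue_on D. 0 \<le> u x" and e: "\<epsilon> > 0"
    and wK: "AE x in lebesgue_on D. \<bar>w x\<bar> \<le> K" and pK: "AE x in lebesgue_on D. \<bar>\<psi> x\<bar> \<le> K"
    and \<psi>: "AE x in lebesgue_on D. a x - b x = a x * \<psi> x"
  shows "c * (\<integral>x. (w x)\<^sup>2 * (1 - 2 * logistic \<epsilon> (u x)) \<partial>lebesgue_on D) \<le>
    2 * L * (K / (2 * \<epsilon>) * l2 D ga + l2 D p) * (l2 D (\<lambda>x. ga x - gb x) + l2 D (\<lambda>x. (\<psi> x - w x) *\<^sub>R ga x))"
proof -
  define H0 where "H0 x = 1 - 2 * logistic \<epsilon> (u x)" for x
  define H1 where "H1 x = 2 / \<epsilon> * (logistic \<epsilon> (u x) * (1 - logistic \<epsilon> (u x)))" for x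
  define q where "q x = (w x * H1 x) *\<^sub>R ga x + H0 x *\<^sub>R p x" for x
  have Lga: "L2 D ga" and Lu: "L2 D u" using u by (auto simp: H10_seq_def)
  have Lp: "L2 D p" and wm: "w \<in> borel_measurable (lebesgue_on D)" using w by (auto simp: multiplier_def)
  have LA: "L2 D (\<lambda>x. a x *\<^sub>R ga x)" and LB: "L2 D (\<lambda>x. b x *\<^sub>R gb x)" and iF: "integrable (lebesgue_on D) F"
    using A B by (auto simp: weak_div_def)
  note [measurable] = L2_measurable[OF Lga] L2_measurable[OF Lgb] L2_measurable[OF Lu] L2_measurable[OF Lp] wm am borel_measurable_integrable[OF iF]
  have H0m [measurable]: "H0 \<in> borel_measurable (lebesgue_on D)" and H1m [measurable]: "H1 \<in> borel_measurable (lebesgue_on D)"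
    unfolding H0_def[abs_def] H1_def[abs_def] by measurable
  have H1b: "0 \<le> H1 x" "H1 x \<le> 1 / (2 * \<epsilon>)" for x
  proof -
    show "0 \<le> H1 x" unfolding H1_def using logistic_mult_bound(1)[of \<epsilon> "u x"] e by simp
    have "H1 x \<le> 2 / \<epsilon> * (1/4)" unfolding H1_def using logistic_mult_bound(2)[of \<epsilon> "u x"] e by (intro mult_left_mono) auto
    then show "H1 x \<le> 1 / (2 * \<epsilon>)" by simp
  qed
  have H0b: "\<bar>H0 x\<bar> \<le> 1" for x
    unfolding H0_def using logistic_pos[of \<epsilon> "u x"] logistic_less_1[of \<epsilon> "u x"] by linarith
  have H0n: "AE x in lebesgue_on D. 0 \<le> H0 x"
    using u0
  proof eventually_elim
    case (elim x)
    show ?case using logistic_le_half[OF e elim] by (simp add: H0_def)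
  qed
  consider "K < 0" | "K \<ge> 0" by linarith
  then show ?thesis
  proof cases
    case 1
    \<comment> \<open>A negative bound for |w| can hold almost everywhere only if \<open>D\<close>
      is a null set, and then all integrals vanish.\<close>
    have "AE x in lebesgue_on D. False" using wK by eventually_elim (use 1 in linarith)
    then have z: "AE x in lebesgue_on D. f x = 0" for f :: "'a \<Rightarrow> real" by eventually_elim simp
    have I0: "(\<integral>x. f x \<partial>lebesgue_on D) = 0" for f :: "'a \<Rightarrow> real"
      using integral_eq_zero_AE[OF z] .
    show ?thesis by (simp add: l2_def I0)
  next
    case K: 2
  have Lq1: "L2 D (\<lambda>x. (w x * H1 x) *\<^sub>R ga x)" "l2 D (\<lambda>x. (w x * H1 x) *\<^sub>R ga x) \<le> (K * (1 / (2 * \<epsilon>))) * l2 D ga"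
  proof -
    have ae: "AE x in lebesgue_on D. \<bar>w x * H1 x\<bar> \<le> K * (1 / (2 * \<epsilon>))"
      using wK
    proof eventually_elim
      case (elim x)
      show ?case unfolding abs_mult using elim H1b[of x] K by (intro mult_mono) auto
    qed
    show "L2 D (\<lambda>x. (w x * H1 x) *\<^sub>R ga x)" by (rule L2_scaleR_bounded(1)[OF Lga _ ae]) measurable
    show "l2 D (\<lambda>x. (w x * H1 x) *\<^sub>R ga x) \<le> (K * (1 / (2 * \<epsilon>))) * l2 D ga"
      by (rule L2_scaleR_bounded(2)[OF Lga _ ae]) (use K e in auto)
  qed
  have Lq2: "L2 D (\<lambda>x. H0 x *\<^sub>R p x)" "l2 D (\<lambda>x. H0 x *\<^sub>R p x) \<le> 1 * l2 D p"
    using L2_scaleR_bounded[OF Lp H0m AE_I2[OF H0b]] by (blast, simp)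
  have Lq: "L2 D q" unfolding q_def[abs_def] by (rule L2_add[OF Lq1(1) Lq2(1)])
  have lq: "l2 D q \<le> K / (2 * \<epsilon>) * l2 D ga + l2 D p"
    using l2_triangle[OF Lq1(1) Lq2(1)] Lq1(2) Lq2(2) by (simp add: q_def[abs_def])
  let ?d = "\<lambda>x. a x *\<^sub>R ga x - b x *\<^sub>R gb x"
  have Ld: "L2 D ?d" by (rule L2_diff[OF LA LB])
  have Wd: "weak_div D ?d (\<lambda>x. 0)"
    unfolding weak_div_def
  proof (intro conjI allI impI Ld)
    fix \<phi>' assume t: "test_function D \<phi>'"
    have "(\<integral>x. ?d x \<bullet> grad \<phi>' x \<partial>lebesgue_on D) =
        (\<integral>x. (a x *\<^sub>R ga x) \<bullet> grad \<phi>' x \<partial>lebesgue_on D) - (\<integral>x. (b x *\<^sub>R gb x) \<bullet> grad \<phi>' x \<partial>lebesgue_on D)"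
      unfolding inner_diff_left
      by (rule Bochner_Integration.integral_diff L2_inner_integrable LA LB test_L2(2)[OF D t])+
    also have "\<dots> = 0" using A B t by (simp add: weak_div_def)
    finally show "(\<integral>x. ?d x \<bullet> grad \<phi>' x \<partial>lebesgue_on D) = (\<integral>x. 0 * \<phi>' x \<partial>lebesgue_on D)" by simp
  qed simp
  have mb: "AE x in lebesgue_on D. \<bar>w x\<bar> \<le> K" by (rule wK)
  have iprod: "integrable (lebesgue_on D) (\<lambda>x. h x * (X x \<bullet> Y x))"
    if "L2 D X" "L2 D Y" "h \<in> borel_measurable (lebesgue_on D)" "AE x in lebesgue_on D. \<bar>h x\<bar> \<le> C" for h C and X Y :: "'a \<Rightarrow> 'a"
    using L2_inner_integrable[OF L2_scaleR_bounded(1)[OF that(1,3,4)] that(2)] by simp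
  \<comment> \<open>\<open>q\<close> is the gradient of w h(u), and the source of the flux
    difference is 0.\<close>
  have e1: "(\<integral>x. ?d x \<bullet> q x \<partial>lebesgue_on D) = 0"
  proof -
    have 1: "(\<integral>x. (w x *\<^sub>R ?d x) \<bullet> (H1 x *\<^sub>R ga x) \<partial>lebesgue_on D) = (\<integral>x. (w x * 0 - ?d x \<bullet> p x) * H0 x \<partial>lebesgue_on D)"
      unfolding H1_def H0_def by (rule weak_div_compose_logistic[OF D weak_div_multiplier[OF D Wd w] u e])
    have "(\<integral>x. ?d x \<bullet> q x \<partial>lebesgue_on D) = (\<integral>x. ?d x \<bullet> ((w x * H1 x) *\<^sub>R ga x) + ?d x \<bullet> (H0 x *\<^sub>R p x) \<partial>lebesgue_on D)"
      by (simp only: q_def inner_add_right)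
    also have "\<dots> = (\<integral>x. ?d x \<bullet> ((w x * H1 x) *\<^sub>R ga x) \<partial>lebesgue_on D) + (\<integral>x. ?d x \<bullet> (H0 x *\<^sub>R p x) \<partial>lebesgue_on D)"
      by (rule Bochner_Integration.integral_add[OF L2_inner_integrable[OF Ld Lq1(1)] L2_inner_integrable[OF Ld Lq2(1)]])
    also have "(\<integral>x. ?d x \<bullet> ((w x * H1 x) *\<^sub>R ga x) \<partial>lebesgue_on D) = (\<integral>x. (w x *\<^sub>R ?d x) \<bullet> (H1 x *\<^sub>R ga x) \<partial>lebesgue_on D)"
      by (rule Bochner_Integration.integral_cong[OF refl]) (simp only: inner_scaleR_left inner_scaleR_right mult_ac)
    also have "(\<integral>x. ?d x \<bullet> (H0 x *\<^sub>R p x) \<partial>lebesgue_on D) = - (\<integral>x. (w x * 0 - ?d x \<bullet> p x) * H0 x \<partial>lebesgue_on D)"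
      by (subst integral_minus[symmetric], rule Bochner_Integration.integral_cong[OF refl]) simp
    finally show ?thesis using 1 by simp
  qed
  let ?A = "\<lambda>x. a x *\<^sub>R ga x"
  let ?wA = "\<lambda>x. w x *\<^sub>R ?A x"
  have LwA: "L2 D ?wA" by (rule L2_scaleR_bounded(1)[OF LA wm wK])
  have LwwA: "L2 D (\<lambda>x. w x *\<^sub>R ?wA x)" by (rule L2_scaleR_bounded(1)[OF LwA wm wK])
  have iX: "integrable (lebesgue_on D) (\<lambda>x. (w x *\<^sub>R ?wA x) \<bullet> (H1 x *\<^sub>R ga x))"
  proof -
    have "L2 D (\<lambda>x. H1 x *\<^sub>R ga x)"
      by (rule L2_scaleR_bounded(1)[OF Lga H1m, of "1 / (2 * \<epsilon>)"]) (use H1b in auto)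
    from L2_inner_integrable[OF LwwA this] show ?thesis .
  qed
  have iY: "integrable (lebesgue_on D) (\<lambda>x. ?wA x \<bullet> (H0 x *\<^sub>R p x))" by (rule L2_inner_integrable[OF LwA Lq2(1)])
  have iwq: "integrable (lebesgue_on D) (\<lambda>x. ?wA x \<bullet> q x)" by (rule L2_inner_integrable[OF LwA Lq])
  have iZ: "integrable (lebesgue_on D) (\<lambda>x. (w x)\<^sup>2 * F x * H0 x)"
  proof (rule Bochner_Integration.integrable_bound[where f = "\<lambda>x. K\<^sup>2 * F x"])
    show "AE x in lebesgue_on D. norm ((w x)\<^sup>2 * F x * H0 x) \<le> norm (K\<^sup>2 * F x)"
      using wK
    proof eventually_elim
      case (elim x)
      have "(w x)\<^sup>2 \<le> K\<^sup>2" using power_mono[OF elim, of 2] by simp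
      then have "(w x)\<^sup>2 * \<bar>F x\<bar> * \<bar>H0 x\<bar> \<le> K\<^sup>2 * \<bar>F x\<bar> * 1" using H0b[of x] by (intro mult_mono) auto
      then show ?case by (simp add: abs_mult)
    qed
  qed (use iF in auto)
  \<comment> \<open>The equation for \<open>u\<close> tested with w^2 h(u), through two applications
    of the product rule and one of the chain rule.\<close>
  have e2: "(\<integral>x. (w x *\<^sub>R ?wA x) \<bullet> (H1 x *\<^sub>R ga x) \<partial>lebesgue_on D) =
      (\<integral>x. (w x)\<^sup>2 * F x * H0 x \<partial>lebesgue_on D) - 2 * (\<integral>x. ?wA x \<bullet> (H0 x *\<^sub>R p x) \<partial>lebesgue_on D)"
  proof -
    have "(\<integral>x. (w x *\<^sub>R ?wA x) \<bullet> (H1 x *\<^sub>R ga x) \<partial>lebesgue_on D) =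
      (\<integral>x. (w x * (w x * F x - ?A x \<bullet> p x) - ?wA x \<bullet> p x) * H0 x \<partial>lebesgue_on D)"
      unfolding H1_def H0_def
      by (rule weak_div_compose_logistic[OF D weak_div_multiplier[OF D weak_div_multiplier[OF D A w] w] u e])
    also have "\<dots> = (\<integral>x. (w x)\<^sup>2 * F x * H0 x - 2 * (?wA x \<bullet> (H0 x *\<^sub>R p x)) \<partial>lebesgue_on D)"
      by (rule Bochner_Integration.integral_cong[OF refl]) (simp add: power2_eq_square algebra_simps)
    also have "\<dots> = (\<integral>x. (w x)\<^sup>2 * F x * H0 x \<partial>lebesgue_on D) - 2 * (\<integral>x. ?wA x \<bullet> (H0 x *\<^sub>R p x) \<partial>lebesgue_on D)"
      using iZ iY by (subst Bochner_Integration.integral_diff) auto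
    finally show ?thesis .
  qed
  have e3: "(\<integral>x. ?wA x \<bullet> q x \<partial>lebesgue_on D) = (\<integral>x. (w x *\<^sub>R ?wA x) \<bullet> (H1 x *\<^sub>R ga x) \<partial>lebesgue_on D) + (\<integral>x. ?wA x \<bullet> (H0 x *\<^sub>R p x) \<partial>lebesgue_on D)"
  proof -
    have "(\<integral>x. ?wA x \<bullet> q x \<partial>lebesgue_on D) = (\<integral>x. (w x *\<^sub>R ?wA x) \<bullet> (H1 x *\<^sub>R ga x) + ?wA x \<bullet> (H0 x *\<^sub>R p x) \<partial>lebesgue_on D)"
      by (rule Bochner_Integration.integral_cong[OF refl]) (simp add: q_def inner_add_right mult_ac)
    also have "\<dots> = (\<integral>x. (w x *\<^sub>R ?wA x) \<bullet> (H1 x *\<^sub>R ga x) \<partial>lebesgue_on D) + (\<integral>x. ?wA x \<bullet> (H0 x *\<^sub>R p x) \<partial>lebesgue_on D)"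
      by (rule Bochner_Integration.integral_add[OF iX iY])
    finally show ?thesis .
  qed
  have Xn: "0 \<le> (\<integral>x. (w x *\<^sub>R ?wA x) \<bullet> (H1 x *\<^sub>R ga x) \<partial>lebesgue_on D)"
  proof (rule integral_nonneg_AE)
    show "AE x in lebesgue_on D. 0 \<le> (w x *\<^sub>R ?wA x) \<bullet> (H1 x *\<^sub>R ga x)"
      using a0
    proof eventually_elim
      case (elim x)
      have "(w x *\<^sub>R ?wA x) \<bullet> (H1 x *\<^sub>R ga x) = (w x)\<^sup>2 * a x * H1 x * (ga x \<bullet> ga x)"
        by (simp only: inner_scaleR_left inner_scaleR_right power2_eq_square mult_ac)
      moreover have "0 \<le> (w x)\<^sup>2 * a x * H1 x * (ga x \<bullet> ga x)"
        using elim H1b(1)[of x] by (intro mult_nonneg_nonneg) auto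
      ultimately show ?case by (simp only:)
    qed
  qed
  let ?e = "\<lambda>x. ga x - gb x" and ?r = "\<lambda>x. (\<psi> x - w x) *\<^sub>R ga x"
  have Le: "L2 D ?e" by (rule L2_diff[OF Lga Lgb])
  have Lr: "L2 D ?r"
    by (rule L2_scaleR_bounded(1)[OF Lga _, of _ "K + K"]) (use wK pK in \<open>auto elim!: eventually_elim2\<close>)
  have aL: "AE x in lebesgue_on D. \<bar>a x\<bar> \<le> L" "AE x in lebesgue_on D. \<bar>b x\<bar> \<le> L" using a0 b0 by auto
  have Lbe: "L2 D (\<lambda>x. b x *\<^sub>R ?e x)" "l2 D (\<lambda>x. b x *\<^sub>R ?e x) \<le> L * l2 D ?e"
    using L2_scaleR_bounded[OF Le am(2) aL(2)] L by blast+
  have Lar: "L2 D (\<lambda>x. a x *\<^sub>R ?r x)" "l2 D (\<lambda>x. a x *\<^sub>R ?r x) \<le> L * l2 D ?r"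
    using L2_scaleR_bounded[OF Lr am(1) aL(1)] L by blast+
  \<comment> \<open>From a - b = a \<psi> follows a w grad u = (a grad u - b grad v) - b (grad u -
    grad v) - a (\<psi> - w) grad u, where \<open>ga\<close> and \<open>gb\<close> are grad u and
    grad v.\<close>
  have e4: "(\<integral>x. ?wA x \<bullet> q x \<partial>lebesgue_on D) = (\<integral>x. ?d x \<bullet> q x - (b x *\<^sub>R ?e x) \<bullet> q x - (a x *\<^sub>R ?r x) \<bullet> q x \<partial>lebesgue_on D)"
  proof (rule integral_cong_AE)
    have qm [measurable]: "q \<in> borel_measurable (lebesgue_on D)" by (rule L2_measurable[OF Lq])
    show "AE x in lebesgue_on D. ?wA x \<bullet> q x = ?d x \<bullet> q x - (b x *\<^sub>R ?e x) \<bullet> q x - (a x *\<^sub>R ?r x) \<bullet> q x"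
      using \<psi>
    proof eventually_elim
      case (elim x)
      have bx: "b x = a x - a x * \<psi> x" using elim by simp
      show ?case unfolding bx by (simp add: inner_diff_left algebra_simps)
    qed
  qed (use L2_measurable[OF Lq] in measurable)
  have "(\<integral>x. ?wA x \<bullet> q x \<partial>lebesgue_on D) = - (\<integral>x. (b x *\<^sub>R ?e x) \<bullet> q x \<partial>lebesgue_on D) - (\<integral>x. (a x *\<^sub>R ?r x) \<bullet> q x \<partial>lebesgue_on D)"
    unfolding e4 using e1 L2_inner_integrable[OF Ld Lq] L2_inner_integrable[OF Lbe(1) Lq] L2_inner_integrable[OF Lar(1) Lq]
    by simp
  also have "\<dots> \<le> l2 D (\<lambda>x. b x *\<^sub>R ?e x) * l2 D q + l2 D (\<lambda>x. a x *\<^sub>R ?r x) * l2 D q"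
    using L2_inner_le[OF Lbe(1) Lq] L2_inner_le[OF Lar(1) Lq] by linarith
  also have "\<dots> \<le> (L * l2 D ?e) * l2 D q + (L * l2 D ?r) * l2 D q"
    using Lbe(2) Lar(2) by (intro add_mono mult_right_mono l2_nonneg)
  also have "\<dots> = L * (l2 D ?e + l2 D ?r) * l2 D q" by (simp add: algebra_simps)
  also have "\<dots> \<le> L * (l2 D ?e + l2 D ?r) * (K / (2 * \<epsilon>) * l2 D ga + l2 D p)"
    by (intro mult_left_mono lq mult_nonneg_nonneg L add_nonneg_nonneg l2_nonneg)
  finally have bound: "(\<integral>x. ?wA x \<bullet> q x \<partial>lebesgue_on D) \<le> L * (l2 D ?e + l2 D ?r) * (K / (2 * \<epsilon>) * l2 D ga + l2 D p)" .
  have iw2: "integrable (lebesgue_on D) (\<lambda>x. c * ((w x)\<^sup>2 * H0 x))"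
  proof (rule Bochner_Integration.integrable_bound[OF iZ])
    show "AE x in lebesgue_on D. norm (c * ((w x)\<^sup>2 * H0 x)) \<le> norm ((w x)\<^sup>2 * F x * H0 x)"
      using F H0n
    proof eventually_elim
      case (elim x)
      have "c * ((w x)\<^sup>2 * H0 x) \<le> F x * ((w x)\<^sup>2 * H0 x)" using elim by (intro mult_right_mono) auto
      moreover have "0 \<le> c * ((w x)\<^sup>2 * H0 x)" using elim c by simp
      ultimately show ?case by (simp add: mult_ac)
    qed
  qed measurable
  have "c * (\<integral>x. (w x)\<^sup>2 * H0 x \<partial>lebesgue_on D) = (\<integral>x. c * ((w x)\<^sup>2 * H0 x) \<partial>lebesgue_on D)" by simp
  also have "\<dots> \<le> (\<integral>x. (w x)\<^sup>2 * F x * H0 x \<partial>lebesgue_on D)"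
  proof (rule integral_mono_AE[OF iw2 iZ])
    show "AE x in lebesgue_on D. c * ((w x)\<^sup>2 * H0 x) \<le> (w x)\<^sup>2 * F x * H0 x"
      using F H0n
    proof eventually_elim
      case (elim x)
      have "c * ((w x)\<^sup>2 * H0 x) \<le> F x * ((w x)\<^sup>2 * H0 x)" using elim by (intro mult_right_mono) auto
      then show ?case by (simp add: mult_ac)
    qed
  qed
  \<comment> \<open>Call the two summands of \<open>e3\<close> X and Y. Then \<open>e2\<close> says
    that the left side is X + 2 Y = 2 (X + Y) - X, and X >= 0.\<close>
  also have "\<dots> \<le> 2 * (\<integral>x. ?wA x \<bullet> q x \<partial>lebesgue_on D)" using e2 e3 Xn by linarith
  also have "\<dots> \<le> 2 * (L * (l2 D ?e + l2 D ?r) * (K / (2 * \<epsilon>) * l2 D ga + l2 D p))" using bound by simp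
  also have "\<dots> = 2 * L * (K / (2 * \<epsilon>) * l2 D ga + l2 D p) * (l2 D ?e + l2 D ?r)" by (simp only: mult_ac)
  finally show ?thesis unfolding H0_def .
  qed
qed

subsection \<open>Lipschitz domains\<close>

definition hyp_proj :: "'a::euclidean_space \<Rightarrow> 'a \<Rightarrow> 'a" where
  "hyp_proj e x = x - (x \<bullet> e) *\<^sub>R e"

lemma hyp_proj_le: "norm e = 1 \<Longrightarrow> norm (hyp_proj e x - hyp_proj e y) \<le> norm (x - y)"
proof -
  assume e: "norm e = 1"
  have ee: "e \<bullet> e = 1" using e by (simp add: norm_eq_1)
  let ?z = "x - y"
  have eq: "hyp_proj e x - hyp_proj e y = ?z - (?z \<bullet> e) *\<^sub>R e"
    by (simp add: hyp_proj_def inner_diff_left scaleR_diff_left)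
  have "(norm (?z - (?z \<bullet> e) *\<^sub>R e))\<^sup>2 = (norm ?z)\<^sup>2 - (?z \<bullet> e)\<^sup>2"
    by (simp only: power2_norm_eq_inner inner_diff_left inner_diff_right inner_scaleR_left inner_scaleR_right ee)
      (simp add: inner_commute power2_eq_square algebra_simps)
  also have "\<dots> \<le> (norm ?z)\<^sup>2" by simp
  finally show ?thesis unfolding eq by (rule power2_le_imp_le) simp
qed

lemma lipschitz_hyp_proj:
  assumes e: "norm e = 1" and \<gamma>: "L-lipschitz_on {y. y \<bullet> e = 0} \<gamma>"
  shows "\<bar>\<gamma> (hyp_proj e x) - \<gamma> (hyp_proj e y)\<bar> \<le> L * norm (x - y)"
proof -
  have ee: "e \<bullet> e = 1" using e by (simp add: norm_eq_1)
  have m: "hyp_proj e z \<in> {y. y \<bullet> e = 0}" for z by (simp add: hyp_proj_def inner_diff_left ee)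
  have "\<bar>\<gamma> (hyp_proj e x) - \<gamma> (hyp_proj e y)\<bar> \<le> L * norm (hyp_proj e x - hyp_proj e y)"
    using lipschitz_onD[OF \<gamma> m m] by (simp add: dist_real_def dist_norm)
  also have "\<dots> \<le> L * norm (x - y)"
    using lipschitz_on_nonneg[OF \<gamma>] hyp_proj_le[OF e] by (intro mult_left_mono) auto
  finally show ?thesis .
qed

text \<open>Move from \<open>x\<close> by r/2 in the direction \<open>e\<close>, away from the
  graph. A displacement shorter than t lowers the height by less than t and raises the graph by at
  most L t, and t (1 + L) = r/2 is the gain in height.\<close>

lemma chart_ball:
  assumes e: "norm e = 1" and \<gamma>: "L-lipschitz_on {y. y \<bullet> e = 0} \<gamma>"
    and U: "D \<inter> U = {x \<in> U. \<gamma> (hyp_proj e x) < x \<bullet> e}" and x: "x \<in> D" and r: "r > 0" "ball x r \<subseteq> U"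
  shows "ball (x + (r/2) *\<^sub>R e) (r / (2 * (1 + L))) \<subseteq> D \<inter> ball x r"
proof
  have L: "L \<ge> 0" using \<gamma> by (rule lipschitz_on_nonneg)
  let ?t = "r / (2 * (1 + L))"
  have t: "?t \<le> r/2" "?t * (1 + L) = r / 2" using L r by (auto simp: field_simps)
  fix y assume y: "y \<in> ball (x + (r/2) *\<^sub>R e) ?t"
  define q where "q = y - (x + (r/2) *\<^sub>R e)"
  have q: "norm q < ?t" using y by (simp add: q_def dist_norm norm_minus_commute)
  have yq: "y = x + (r/2) *\<^sub>R e + q" by (simp add: q_def)
  have "norm (y - x) \<le> r/2 + norm q"
    using norm_triangle_ineq[of "(r/2) *\<^sub>R e" q] r e by (simp add: yq add.assoc)
  then have "norm (y - x) < r" using q t(1) by linarith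
  then have yx: "y \<in> ball x r" by (simp add: dist_norm norm_minus_commute)
  have xU: "x \<in> U" using r by auto
  then have gx: "\<gamma> (hyp_proj e x) < x \<bullet> e" using U x by blast
  have ee: "e \<bullet> e = 1" using e by (simp add: norm_eq_1)
  have pe: "hyp_proj e y = hyp_proj e (x + q)"
    by (simp add: hyp_proj_def yq inner_add_left ee algebra_simps)
  have "\<bar>\<gamma> (hyp_proj e (x + q)) - \<gamma> (hyp_proj e x)\<bar> \<le> L * norm q"
    using lipschitz_hyp_proj[OF e \<gamma>, of "x + q" x] by simp
  also have "\<dots> \<le> L * ?t" using q L by (intro mult_left_mono) auto
  finally have "\<gamma> (hyp_proj e y) \<le> \<gamma> (hyp_proj e x) + L * ?t" unfolding pe by linarith
  moreover have "y \<bullet> e = x \<bullet> e + r/2 + q \<bullet> e" by (simp add: yq inner_add_left ee)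
  moreover have "\<bar>q \<bullet> e\<bar> < ?t" using Cauchy_Schwarz_ineq2[of q e] e q by simp
  moreover have "L * ?t + ?t = r / 2"
  proof -
    have "L * t' + t' = t' * (1 + L)" for t' by (simp add: algebra_simps)
    then show ?thesis using t(2) by (simp only:)
  qed
  ultimately have "\<gamma> (hyp_proj e y) < y \<bullet> e" using gx by linarith
  then show "y \<in> D \<inter> ball x r" using U yx r by blast
qed

lemma finite_pos_lower:
  fixes f :: "'b \<Rightarrow> real"
  assumes "finite F" "\<And>p. p \<in> F \<Longrightarrow> f p > 0"
  obtains m where "m > 0" "\<And>p. p \<in> F \<Longrightarrow> m \<le> f p"
proof
  \<comment> \<open>The element 1 keeps the minimum defined for an empty \<open>F\<close>.\<close>
  show "Min (insert 1 (f ` F)) > 0" using assms by (subst Min_gr_iff) auto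
  show "Min (insert 1 (f ` F)) \<le> f p" if "p \<in> F" for p using assms that by (intro Min_le) auto
qed

text \<open>Charts as functions of the boundary point. The chart contains a ball of radius
  \<open>2 * \<rho> p\<close>, while the balls of radius \<open>\<rho> p\<close> will cover the
  frontier: every point of such a ball keeps a neighbourhood of radius \<open>\<rho> p\<close>
  inside the chart.\<close>

lemma lipschitz_charts:
  assumes "lipschitz_boundary D"
  shows "\<exists>e \<gamma> L U \<rho>. \<forall>p\<in>frontier D. norm (e p) = 1 \<and>
    (L p)-lipschitz_on {y. y \<bullet> e p = 0} (\<gamma> p :: 'a::euclidean_space \<Rightarrow> real) \<and>
    D \<inter> U p = {x \<in> U p. \<gamma> p (hyp_proj (e p) x) < x \<bullet> e p} \<and> \<rho> p > 0 \<and> ball p (2 * \<rho> p) \<subseteq> U p"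
proof -
  have "\<forall>p\<in>frontier D. \<exists>e. \<exists>\<gamma>. \<exists>L. \<exists>U. \<exists>\<rho>. norm e = 1 \<and> L-lipschitz_on {y. y \<bullet> e = 0} (\<gamma> :: 'a \<Rightarrow> real) \<and>
      D \<inter> U = {x \<in> U. \<gamma> (hyp_proj e x) < x \<bullet> e} \<and> \<rho> > 0 \<and> ball p (2 * \<rho>) \<subseteq> U"
  proof
    fix p assume "p \<in> frontier D"
    then obtain e \<gamma> L U where c: "norm e = 1" "L-lipschitz_on {y. y \<bullet> e = 0} (\<gamma> :: 'a \<Rightarrow> real)" "open U" "p \<in> U"
      "D \<inter> U = {x \<in> U. \<gamma> (x - (x \<bullet> e) *\<^sub>R e) < x \<bullet> e}"
      using assms unfolding lipschitz_boundary_def by blast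
    obtain d where d: "d > 0" "ball p d \<subseteq> U" using c(3,4) openE by metis
    have "norm e = 1 \<and> L-lipschitz_on {y. y \<bullet> e = 0} \<gamma> \<and> D \<inter> U = {x \<in> U. \<gamma> (hyp_proj e x) < x \<bullet> e} \<and>
        d / 2 > 0 \<and> ball p (2 * (d / 2)) \<subseteq> U"
      using c d by (simp add: hyp_proj_def)
    then show "\<exists>e \<gamma> L U \<rho>. norm e = 1 \<and> L-lipschitz_on {y. y \<bullet> e = 0} (\<gamma> :: 'a \<Rightarrow> real) \<and>
      D \<inter> U = {x \<in> U. \<gamma> (hyp_proj e x) < x \<bullet> e} \<and> \<rho> > 0 \<and> ball p (2 * \<rho>) \<subseteq> U" by (intro exI)
  qed
  from bchoice[OF this] obtain e where "\<forall>p\<in>frontier D. \<exists>\<gamma>. \<exists>L. \<exists>U. \<exists>\<rho>. norm (e p) = 1 \<and> L-lipschitz_on {y. y \<bullet> e p = 0} (\<gamma> :: 'a \<Rightarrow> real) \<and>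
      D \<inter> U = {x \<in> U. \<gamma> (hyp_proj (e p) x) < x \<bullet> e p} \<and> \<rho> > 0 \<and> ball p (2 * \<rho>) \<subseteq> U" by (rule exE)
  from bchoice[OF this] obtain \<gamma> where "\<forall>p\<in>frontier D. \<exists>L. \<exists>U. \<exists>\<rho>. norm (e p) = 1 \<and> L-lipschitz_on {y. y \<bullet> e p = 0} (\<gamma> p :: 'a \<Rightarrow> real) \<and>
      D \<inter> U = {x \<in> U. \<gamma> p (hyp_proj (e p) x) < x \<bullet> e p} \<and> \<rho> > 0 \<and> ball p (2 * \<rho>) \<subseteq> U" by (rule exE)
  from bchoice[OF this] obtain L where "\<forall>p\<in>frontier D. \<exists>U. \<exists>\<rho>. norm (e p) = 1 \<and> (L p)-lipschitz_on {y. y \<bullet> e p = 0} (\<gamma> p :: 'a \<Rightarrow> real) \<and>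
      D \<inter> U = {x \<in> U. \<gamma> p (hyp_proj (e p) x) < x \<bullet> e p} \<and> \<rho> > 0 \<and> ball p (2 * \<rho>) \<subseteq> U" by (rule exE)
  from bchoice[OF this] obtain U where "\<forall>p\<in>frontier D. \<exists>\<rho>. norm (e p) = 1 \<and> (L p)-lipschitz_on {y. y \<bullet> e p = 0} (\<gamma> p :: 'a \<Rightarrow> real) \<and>
      D \<inter> U p = {x \<in> U p. \<gamma> p (hyp_proj (e p) x) < x \<bullet> e p} \<and> \<rho> > 0 \<and> ball p (2 * \<rho>) \<subseteq> U p" by (rule exE)
  from bchoice[OF this] obtain \<rho> where *: "\<forall>p\<in>frontier D. norm (e p) = 1 \<and> (L p)-lipschitz_on {y. y \<bullet> e p = 0} (\<gamma> p :: 'a \<Rightarrow> real) \<and>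
      D \<inter> U p = {x \<in> U p. \<gamma> p (hyp_proj (e p) x) < x \<bullet> e p} \<and> \<rho> p > 0 \<and> ball p (2 * \<rho> p) \<subseteq> U p" by (rule exE)
  then show ?thesis by (intro exI)
qed

lemma compact_frontier_subcover:
  fixes D :: "'a::euclidean_space set"
  assumes "bounded D" and \<rho>: "\<And>p. p \<in> frontier D \<Longrightarrow> \<rho> p > (0::real)"
  obtains F where "finite F" "F \<subseteq> frontier D" "frontier D \<subseteq> (\<Union>p\<in>F. ball p (\<rho> p))"
proof -
  have cov: "frontier D \<subseteq> (\<Union>p\<in>frontier D. ball p (\<rho> p))" using \<rho> by auto
  obtain F where "F \<subseteq> frontier D" "finite F" "frontier D \<subseteq> (\<Union>p\<in>F. ball p (\<rho> p))"
    by (rule compactE_image[OF compact_frontier_bounded[OF assms(1)] _ cov]) auto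
  then show thesis by (intro that)
qed

text \<open>Near the frontier \<open>chart_ball\<close> applies with the worst of finitely many
  Lipschitz constants; the remaining part of the closure is a compact subset of \<open>D\<close> and
  has a Lebesgue number \<open>r1\<close>. The result bounds from below the mass by which the
  Gaussian average is normalised.\<close>

lemma interior_ball_condition:
  assumes D: "open D" "bounded (D :: 'a::euclidean_space set)" and lip: "lipschitz_boundary D"
  shows "\<exists>\<kappa>>0. \<exists>r0>0. \<forall>x\<in>D. \<forall>r. 0 < r \<and> r \<le> r0 \<longrightarrow> (\<exists>z. ball z (\<kappa> * r) \<subseteq> D \<inter> ball x r)"
proof -
  obtain e \<gamma> L U \<rho> where *: "\<forall>p\<in>frontier D. norm (e p) = 1 \<and>
    (L p)-lipschitz_on {y. y \<bullet> e p = 0} (\<gamma> p :: 'a \<Rightarrow> real) \<and>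
    D \<inter> U p = {x \<in> U p. \<gamma> p (hyp_proj (e p) x) < x \<bullet> e p} \<and> \<rho> p > 0 \<and> ball p (2 * \<rho> p) \<subseteq> U p"
    using lipschitz_charts[OF lip] by (elim exE) (rule that)
  have c: "norm (e p) = 1" "(L p)-lipschitz_on {y. y \<bullet> e p = 0} (\<gamma> p)"
    "D \<inter> U p = {x \<in> U p. \<gamma> p (hyp_proj (e p) x) < x \<bullet> e p}" "\<rho> p > 0" "ball p (2 * \<rho> p) \<subseteq> U p"
    if "p \<in> frontier D" for p
    using bspec[OF * that] by blast+
  obtain F where F: "finite F" "F \<subseteq> frontier D" "frontier D \<subseteq> (\<Union>p\<in>F. ball p (\<rho> p))"
    by (rule compact_frontier_subcover[OF D(2) c(4)])
  let ?C = "closure D - (\<Union>p\<in>F. ball p (\<rho> p))"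
  have "compact ?C" using D(2) by (intro compact_diff) auto
  moreover have CD: "?C \<subseteq> \<Union>{D}" using F(3) D(1) by (auto simp: frontier_def interior_open)
  ultimately obtain r1 where r1: "r1 > 0" "\<And>x. x \<in> ?C \<Longrightarrow> \<exists>G\<in>{D}. ball x r1 \<subseteq> G"
    using Heine_Borel_lemma[of ?C "{D}"] D(1) by auto
  obtain r2 where r2: "r2 > 0" "\<And>p. p \<in> F \<Longrightarrow> r2 \<le> \<rho> p"
    using finite_pos_lower[of F \<rho>] F c(4) by blast
  have Lp: "L p \<ge> 0" if "p \<in> F" for p using lipschitz_on_nonneg[OF c(2)] F(2) that by blast
  obtain k where k: "k > 0" "\<And>p. p \<in> F \<Longrightarrow> k \<le> 1 / (2 * (1 + L p))"
    using finite_pos_lower[of F "\<lambda>p. 1 / (2 * (1 + L p))"] F(1) Lp by (auto simp: add_pos_nonneg)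
  have main: "\<forall>x\<in>D. \<forall>r. 0 < r \<and> r \<le> min r1 r2 \<longrightarrow> (\<exists>z. ball z (min 1 k * r) \<subseteq> D \<inter> ball x r)"
  proof (intro ballI allI impI)
    fix x r assume x: "x \<in> D" and r: "0 < r \<and> r \<le> min r1 r2"
    show "\<exists>z. ball z (min 1 k * r) \<subseteq> D \<inter> ball x r"
    proof (cases "x \<in> ?C")
      case True
      have "ball x r \<subseteq> ball x r1" using r by (intro subset_ball) auto
      moreover have "ball x r1 \<subseteq> D" using r1(2)[OF True] by simp
      moreover have "ball x (min 1 k * r) \<subseteq> ball x r" using r k by (intro subset_ball) (auto simp: mult_left_le_one_le)
      ultimately show ?thesis by blast
    next
      case False
      then obtain p where p: "p \<in> F" "x \<in> ball p (\<rho> p)" using x closure_subset by blast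
      have pf: "p \<in> frontier D" using p F by blast
      have sub: "ball x r \<subseteq> U p"
      proof
        fix y assume "y \<in> ball x r"
        then have "dist p y < \<rho> p + r" using p(2) dist_triangle[of p y x] by simp
        also have "\<dots> \<le> 2 * \<rho> p" using r r2(2)[OF p(1)] by simp
        finally show "y \<in> U p" using c(5)[OF pf] by auto
      qed
      have le: "min 1 k * r \<le> r / (2 * (1 + L p))"
      proof -
        have "min 1 k \<le> 1 / (2 * (1 + L p))" using k(2)[OF p(1)] by simp
        from mult_right_mono[OF this, of r] r show ?thesis by simp
      qed
      show ?thesis
        using chart_ball[OF c(1)[OF pf] c(2)[OF pf] c(3)[OF pf] x _ sub] r subset_ball[OF le] by blast
    qed
  qed
  have "min 1 k > 0" "min r1 r2 > 0" using k r1 r2 by auto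
  with main show ?thesis by (intro exI[of _ "min 1 k"] conjI exI[of _ "min r1 r2"])
qed

text \<open>The translates of the strip by multiples of \<open>\<tau>\<close> along \<open>e\<close>
  are disjoint and of equal measure. For \<tau> <= 1 at least 1/(2 \<tau>) of them fit into the ball
  enlarged by 1, which gives the factor \<open>2 * \<tau>\<close>; for \<tau> > 1 the bound is
  trivial.\<close>

lemma strip_measure:
  fixes p e :: "'a::euclidean_space"
  assumes e: "norm e = 1" and \<gamma>: "L-lipschitz_on {y. y \<bullet> e = 0} \<gamma>" and t: "\<tau> > 0"
  shows "emeasure lborel {x \<in> ball p R. \<gamma> (hyp_proj e x) < x \<bullet> e \<and> x \<bullet> e \<le> \<gamma> (hyp_proj e x) + \<tau>}
     \<le> ennreal (2 * \<tau> * measure lborel (ball p (R + 1)))" (is "emeasure lborel ?S \<le> _")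
proof -
  let ?V = "measure lborel (ball p (R + 1))"
  have finV: "emeasure lborel (ball p (R + 1)) = ennreal ?V"
    using emeasure_lborel_ball_finite[of p "R + 1"] by (simp add: emeasure_eq_ennreal_measure)
  have L0: "L \<ge> 0" using \<gamma> by (rule lipschitz_on_nonneg)
  have cont: "continuous_on UNIV (\<lambda>x. \<gamma> (hyp_proj e x))"
  proof (rule lipschitz_on_continuous_on[of L])
    show "L-lipschitz_on UNIV (\<lambda>x. \<gamma> (hyp_proj e x))"
      using lipschitz_hyp_proj[OF e \<gamma>] L0 by (auto simp: lipschitz_on_def dist_real_def dist_norm)
  qed
  have [measurable]: "(\<lambda>x. \<gamma> (hyp_proj e x)) \<in> borel_measurable borel" by (rule borel_measurable_continuous_onI[OF cont])
  have Sm: "?S \<in> sets borel" by measurable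
  have ee: "e \<bullet> e = 1" using e by (simp add: norm_eq_1)
  define A where "A k = {x. x + (- (real k * \<tau>)) *\<^sub>R e \<in> ?S}" for k :: nat
  have A_iff: "x \<in> A k \<longleftrightarrow> x - (real k * \<tau>) *\<^sub>R e \<in> ball p R \<and>
      \<gamma> (hyp_proj e x) + real k * \<tau> < x \<bullet> e \<and> x \<bullet> e \<le> \<gamma> (hyp_proj e x) + real (Suc k) * \<tau>" for x k
  proof -
    have "hyp_proj e (x - (real k * \<tau>) *\<^sub>R e) = hyp_proj e x"
      by (simp add: hyp_proj_def inner_diff_left ee algebra_simps)
    then show ?thesis by (auto simp: A_def inner_diff_left ee algebra_simps)
  qed
  have Am: "A k \<in> sets borel" and Ae: "emeasure lborel (A k) = emeasure lborel ?S" for k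
  proof -
    have eq: "A k = (+) (- (real k * \<tau>) *\<^sub>R e) -` ?S \<inter> space lborel" by (auto simp: A_def add.commute)
    have "(+) (- (real k * \<tau>) *\<^sub>R e) \<in> measurable lborel borel" by simp
    from measurable_sets[OF this Sm] show "A k \<in> sets borel" unfolding eq by simp
    have "emeasure lborel ?S = emeasure (distr lborel borel ((+) (- (real k * \<tau>) *\<^sub>R e))) ?S"
      by (simp add: lborel_distr_plus)
    also have "\<dots> = emeasure lborel (A k)" unfolding eq using Sm by (subst emeasure_distr) auto
    finally show "emeasure lborel (A k) = emeasure lborel ?S" by simp
  qed
  have disj: "disjoint_family_on A {..<m}" for m
  proof (unfold disjoint_family_on_def, intro ballI impI)
    fix i j :: nat assume "i \<noteq> j"
    have *: "False" if "x \<in> A i" "x \<in> A j" "i < j" for x i j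
    proof -
      have "real (Suc i) * \<tau> \<le> real j * \<tau>" using that(3) t by (intro mult_right_mono) auto
      then show False using that(1,2) unfolding A_iff by linarith
    qed
    show "A i \<inter> A j = {}" using *[of _ i j] *[of _ j i] \<open>i \<noteq> j\<close> by (meson disjoint_iff nat_neq_iff)
  qed
  have S_le: "emeasure lborel ?S \<le> ennreal ?V"
    unfolding finV[symmetric] by (intro emeasure_mono) auto
  show ?thesis
  proof (cases "\<tau> \<le> 1")
    case False
    have "?V \<le> 2 * \<tau> * ?V" using False by (intro mult_right_mono[of 1 "2 * \<tau>", simplified]) auto
    then show ?thesis using S_le ennreal_leI order_trans by blast
  next
    case True
    define m where "m = nat \<lfloor>1 / \<tau>\<rfloor>"
    have "1 \<le> 1 / \<tau>" using True t by simp
    then have f1: "1 \<le> \<lfloor>1 / \<tau>\<rfloor>" by (simp add: le_floor_iff)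
    then have "int m = \<lfloor>1 / \<tau>\<rfloor>" unfolding m_def by (intro nat_0_le) linarith
    then have "real m = of_int \<lfloor>1 / \<tau>\<rfloor>" by (metis of_int_of_nat_eq)
    then have m: "real m \<le> 1 / \<tau>" "1 / \<tau> \<le> 2 * real m" using f1 by linarith+
    have sub: "(\<Union>k\<in>{..<m}. A k) \<subseteq> ball p (R + 1)"
    proof
      fix x assume "x \<in> (\<Union>k\<in>{..<m}. A k)"
      then obtain k where k1: "k < m" "x \<in> A k" by auto
      have k: "k < m" "x - (real k * \<tau>) *\<^sub>R e \<in> ball p R"
        using k1(1) k1(2)[unfolded A_iff] by blast+
      have "real k * \<tau> \<le> real m * \<tau>" using k t by (intro mult_right_mono) auto
      also have "\<dots> \<le> 1" using m(1) t by (simp add: field_simps)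
      finally have kt: "real k * \<tau> \<le> 1" .
      have "dist p x \<le> dist p (x - (real k * \<tau>) *\<^sub>R e) + dist (x - (real k * \<tau>) *\<^sub>R e) x" by (rule dist_triangle)
      also have "dist (x - (real k * \<tau>) *\<^sub>R e) x = real k * \<tau>" using t e by (simp add: dist_norm)
      finally show "x \<in> ball p (R + 1)" using k(2) kt by simp
    qed
    have "ennreal (real m) * emeasure lborel ?S = (\<Sum>k\<in>{..<m}. emeasure lborel (A k))"
      by (simp add: Ae ennreal_of_nat_eq_real_of_nat)
    also have "\<dots> = emeasure lborel (\<Union>k\<in>{..<m}. A k)"
      by (rule sum_emeasure) (use Am disj in auto)
    also have "\<dots> \<le> ennreal ?V" unfolding finV[symmetric] by (intro emeasure_mono sub) auto
    finally have mS: "ennreal (real m) * emeasure lborel ?S \<le> ennreal ?V" .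
    obtain s where s: "emeasure lborel ?S = ennreal s" "s \<ge> 0"
      using S_le by (cases "emeasure lborel ?S") (auto simp: top_unique)
    have "real m * s \<le> ?V" using mS s by (simp add: ennreal_mult''[symmetric])
    moreover have "(1 / \<tau>) * s \<le> 2 * real m * s" using m(2) s(2) by (rule mult_right_mono)
    ultimately have "(1 / \<tau>) * s \<le> 2 * ?V" by simp
    then have "s \<le> 2 * \<tau> * ?V" using t by (simp add: field_simps)
    then show ?thesis using s by (simp add: ennreal_leI)
  qed
qed

text \<open>A point of \<open>D\<close> within \<open>\<sigma>\<close> of the frontier lies above
  the graph of a chart by at most (1 + L) \<sigma>, so the layer is covered by finitely many strips.
  For widths of at least \<open>r2\<close> the measure of \<open>D\<close> itself is a multiple of
  the width.\<close>

lemma boundary_layer: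
  assumes D: "open D" "bounded (D :: 'a::euclidean_space set)" and lip: "lipschitz_boundary D"
  shows "\<exists>C>0. \<forall>\<rho>>0. emeasure lborel {x \<in> D. \<exists>q\<in>frontier D. dist x q < \<rho>} \<le> ennreal (C * \<rho>)"
proof -
  obtain e \<gamma> L U \<rho> where *: "\<forall>p\<in>frontier D. norm (e p) = 1 \<and>
    (L p)-lipschitz_on {y. y \<bullet> e p = 0} (\<gamma> p :: 'a \<Rightarrow> real) \<and>
    D \<inter> U p = {x \<in> U p. \<gamma> p (hyp_proj (e p) x) < x \<bullet> e p} \<and> \<rho> p > 0 \<and> ball p (2 * \<rho> p) \<subseteq> U p"
    using lipschitz_charts[OF lip] by (elim exE) (rule that)
  have c: "norm (e p) = 1" "(L p)-lipschitz_on {y. y \<bullet> e p = 0} (\<gamma> p)"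
    "D \<inter> U p = {x \<in> U p. \<gamma> p (hyp_proj (e p) x) < x \<bullet> e p}" "\<rho> p > 0" "ball p (2 * \<rho> p) \<subseteq> U p"
    if "p \<in> frontier D" for p
    using bspec[OF * that] by blast+
  obtain F where F: "finite F" "F \<subseteq> frontier D" "frontier D \<subseteq> (\<Union>p\<in>F. ball p (\<rho> p))"
    by (rule compact_frontier_subcover[OF D(2) c(4)])
  obtain r2 where r2: "r2 > 0" "\<And>p. p \<in> F \<Longrightarrow> r2 \<le> \<rho> p"
    using finite_pos_lower[of F \<rho>] F c(4) by blast
  have Lp: "L p \<ge> 0" if "p \<in> F" for p using lipschitz_on_nonneg[OF c(2)] F(2) that by blast
  define S where "S p \<tau> = {x \<in> ball p (2 * \<rho> p). \<gamma> p (hyp_proj (e p) x) < x \<bullet> e p \<and> x \<bullet> e p \<le> \<gamma> p (hyp_proj (e p) x) + \<tau>}" for p \<tau>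
  define C1 where "C1 = (\<Sum>p\<in>F. 2 * (1 + L p) * measure lborel (ball p (2 * \<rho> p + 1)))"
  define C where "C = C1 + measure lborel D / r2 + 1"
  have C1: "C1 \<ge> 0" unfolding C1_def using Lp by (intro sum_nonneg mult_nonneg_nonneg) (auto intro: add_nonneg_nonneg)
  have Dfin: "emeasure lborel D = ennreal (measure lborel D)"
    using emeasure_bounded_finite[OF D(2)] by (simp add: emeasure_eq_ennreal_measure)
  have "emeasure lborel {x \<in> D. \<exists>q\<in>frontier D. dist x q < \<sigma>} \<le> ennreal (C * \<sigma>)" if s: "\<sigma> > 0" for \<sigma>
  proof (cases "\<sigma> < r2")
    case True
    have Sm: "S p \<tau> \<in> sets borel" if "p \<in> F" for p \<tau>
    proof -
      have pf: "p \<in> frontier D" using that F by blast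
      have "continuous_on UNIV (\<lambda>x. \<gamma> p (hyp_proj (e p) x))"
      proof (rule lipschitz_on_continuous_on[of "L p"])
        show "(L p)-lipschitz_on UNIV (\<lambda>x. \<gamma> p (hyp_proj (e p) x))"
          using lipschitz_hyp_proj[OF c(1,2)[OF pf]] Lp[OF that] by (auto simp: lipschitz_on_def dist_real_def dist_norm)
      qed
      then have [measurable]: "(\<lambda>x. \<gamma> p (hyp_proj (e p) x)) \<in> borel_measurable borel" by (rule borel_measurable_continuous_onI)
      show ?thesis unfolding S_def by measurable
    qed
    have "{x \<in> D. \<exists>q\<in>frontier D. dist x q < \<sigma>} \<subseteq> (\<Union>p\<in>F. S p ((1 + L p) * \<sigma>))"
    proof
      fix x assume "x \<in> {x \<in> D. \<exists>q\<in>frontier D. dist x q < \<sigma>}"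
      then obtain q where x: "x \<in> D" and q: "q \<in> frontier D" "dist x q < \<sigma>" by blast
      obtain p where p: "p \<in> F" "q \<in> ball p (\<rho> p)" using q F(3) by blast
      have pf: "p \<in> frontier D" using p F by blast
      have "dist p x \<le> dist p q + dist q x" by (rule dist_triangle)
      then have xb: "x \<in> ball p (2 * \<rho> p)" using p(2) q(2) r2(2)[OF p(1)] True by (simp add: dist_commute)
      then have xU: "x \<in> U p" and qU: "q \<in> U p" using c(5)[OF pf] p(2) c(4)[OF pf] by auto
      \<comment> \<open>Since \<open>D\<close> is open its frontier lies outside \<open>D\<close>,
        so \<open>q\<close> is on or below the graph; this bounds the height of \<open>x\<close>
        from above.\<close>
      have qD: "q \<notin> D" using q(1) D(1) by (simp add: frontier_def interior_open)
      have "x \<in> D \<inter> U p" using x xU by simp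
      then have gx: "\<gamma> p (hyp_proj (e p) x) < x \<bullet> e p" unfolding c(3)[OF pf] by simp
      have gq: "q \<bullet> e p \<le> \<gamma> p (hyp_proj (e p) q)"
      proof (rule ccontr)
        assume "\<not> ?thesis"
        then have "q \<in> D \<inter> U p" unfolding c(3)[OF pf] using qU by simp
        then show False using qD by simp
      qed
      have "\<bar>\<gamma> p (hyp_proj (e p) q) - \<gamma> p (hyp_proj (e p) x)\<bar> \<le> L p * norm (q - x)"
        by (rule lipschitz_hyp_proj[OF c(1,2)[OF pf]])
      also have "\<dots> \<le> L p * \<sigma>" using q(2) Lp[OF p(1)] by (intro mult_left_mono) (auto simp: dist_norm norm_minus_commute)
      finally have g2: "\<gamma> p (hyp_proj (e p) q) \<le> \<gamma> p (hyp_proj (e p) x) + L p * \<sigma>" by linarith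
      have "\<bar>(x - q) \<bullet> e p\<bar> \<le> norm (x - q) * norm (e p)" by (rule Cauchy_Schwarz_ineq2)
      then have "x \<bullet> e p \<le> q \<bullet> e p + \<sigma>" using q(2) c(1)[OF pf] by (simp add: inner_diff_left dist_norm)
      then have "x \<bullet> e p \<le> \<gamma> p (hyp_proj (e p) x) + (1 + L p) * \<sigma>" using gq g2 by (simp add: algebra_simps)
      then show "x \<in> (\<Union>p\<in>F. S p ((1 + L p) * \<sigma>))" using gx xb p(1) by (auto simp: S_def)
    qed
    then have "emeasure lborel {x \<in> D. \<exists>q\<in>frontier D. dist x q < \<sigma>} \<le> emeasure lborel (\<Union>p\<in>F. S p ((1 + L p) * \<sigma>))"
      by (rule emeasure_mono) (use Sm F(1) in auto)
    also have "\<dots> \<le> (\<Sum>p\<in>F. emeasure lborel (S p ((1 + L p) * \<sigma>)))"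
      by (rule emeasure_subadditive_finite) (use Sm F(1) in auto)
    also have "\<dots> \<le> (\<Sum>p\<in>F. ennreal (2 * ((1 + L p) * \<sigma>) * measure lborel (ball p (2 * \<rho> p + 1))))"
    proof (rule sum_mono)
      fix p assume p: "p \<in> F"
      then have pf: "p \<in> frontier D" using F by blast
      show "emeasure lborel (S p ((1 + L p) * \<sigma>)) \<le> ennreal (2 * ((1 + L p) * \<sigma>) * measure lborel (ball p (2 * \<rho> p + 1)))"
        unfolding S_def by (rule strip_measure[OF c(1,2)[OF pf]]) (use s Lp[OF p] in \<open>auto intro: mult_pos_pos add_pos_nonneg\<close>)
    qed
    also have "\<dots> = ennreal (C1 * \<sigma>)"
      unfolding C1_def sum_distrib_right using s Lp
      by (subst sum_ennreal) (auto intro!: mult_nonneg_nonneg add_nonneg_nonneg sum.cong arg_cong[where f = ennreal] simp: mult_ac)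
    also have "\<dots> \<le> ennreal (C * \<sigma>)"
      unfolding C_def using s r2 by (intro ennreal_leI mult_right_mono) auto
    finally show ?thesis .
  next
    case False
    have "emeasure lborel {x \<in> D. \<exists>q\<in>frontier D. dist x q < \<sigma>} \<le> emeasure lborel D"
      using D by (intro emeasure_mono) auto
    also have "\<dots> \<le> ennreal (measure lborel D / r2 * \<sigma>)"
    proof -
      have "measure lborel D * r2 \<le> measure lborel D * \<sigma>" using False by (intro mult_left_mono) auto
      then show ?thesis unfolding Dfin using r2(1) by (intro ennreal_leI) (simp add: pos_le_divide_eq)
    qed
    also have "\<dots> \<le> ennreal (C * \<sigma>)"
      unfolding C_def using s r2 C1 by (intro ennreal_leI mult_right_mono) auto
    finally show ?thesis .
  qed
  moreover have "C > 0" unfolding C_def using C1 r2 by (intro add_nonneg_pos add_nonneg_nonneg) auto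
  ultimately show ?thesis by (intro exI[of _ C] conjI allI impI)
qed

text \<open>If \<open>f\<close> is not integrable, its integral is 0 by convention and the
  nonnegativity of \<open>g\<close> is enough.\<close>

lemma abs_integral_le_integral:
  fixes f g :: "'a \<Rightarrow> real"
  assumes g: "integrable M g" and le: "\<And>x. \<bar>f x\<bar> \<le> g x"
  shows "\<bar>integral\<^sup>L M f\<bar> \<le> integral\<^sup>L M g"
proof (cases "integrable M f")
  case True
  have "\<bar>integral\<^sup>L M f\<bar> \<le> (\<integral>x. \<bar>f x\<bar> \<partial>M)" by (rule integral_abs_bound)
  also have "\<dots> \<le> integral\<^sup>L M g" by (rule integral_mono[OF integrable_abs[OF True] g le])
  finally show ?thesis .
next
  case False
  have "0 \<le> g x" for x using le[of x] abs_ge_zero[of "f x"] by linarith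
  then show ?thesis using False by (simp add: not_integrable_integral_eq integral_nonneg_AE)
qed

subsection \<open>Normalised Gaussian regularisation\<close>

lemma nn_integral_gaussian_1: "(\<integral>\<^sup>+x. ennreal (exp (- (x\<^sup>2 / 2))) \<partial>lborel) < \<infinity>"
proof -
  interpret prob_space "density lborel (\<lambda>x. ennreal (normal_density 0 1 x))"
    by (rule prob_space_normal_density) simp
  have n: "(\<integral>\<^sup>+x. ennreal (normal_density 0 1 x) \<partial>lborel) = 1"
    using emeasure_space_1 by (simp add: emeasure_density)
  have "(\<integral>\<^sup>+x. ennreal (exp (- (x\<^sup>2 / 2))) \<partial>lborel) = (\<integral>\<^sup>+x. ennreal (sqrt (2 * pi)) * ennreal (normal_density 0 1 x) \<partial>lborel)"
  proof (rule nn_integral_cong)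
    fix x :: real
    have "exp (- (x\<^sup>2 / 2)) = sqrt (2 * pi) * normal_density 0 1 x"
      by (simp add: normal_density_def)
    then show "ennreal (exp (- (x\<^sup>2 / 2))) = ennreal (sqrt (2 * pi)) * ennreal (normal_density 0 1 x)"
      by (simp add: ennreal_mult''[symmetric])
  qed
  also have "\<dots> = ennreal (sqrt (2 * pi)) * 1" by (subst nn_integral_cmult) (simp_all add: n)
  finally show ?thesis by simp
qed

text \<open>The integral factors into one-dimensional normal integrals, and the substitution z = r y
  produces the power of \<open>r\<close>; hence one \<open>G\<close> serves all scales.\<close>

lemma gaussian_mass:
  obtains G where "G > 0"
    "\<And>r. r > 0 \<Longrightarrow> (\<integral>\<^sup>+z. ennreal (exp (- ((z::'a::euclidean_space) \<bullet> z / (2 * r\<^sup>2)))) \<partial>lborel) \<le> ennreal (G * r ^ DIM('a))"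
proof -
  let ?I = "\<integral>\<^sup>+z. ennreal (exp (- ((z::'a) \<bullet> z / 2))) \<partial>lborel"
  have "?I = (\<integral>\<^sup>+z. (\<Prod>b\<in>Basis. ennreal (exp (- (((z::'a) \<bullet> b)\<^sup>2 / 2)))) \<partial>lborel)"
  proof (rule nn_integral_cong)
    fix z :: 'a
    have "z \<bullet> z = (\<Sum>b\<in>Basis. (z \<bullet> b)\<^sup>2)" by (subst euclidean_inner) (simp add: power2_eq_square)
    then have "exp (- (z \<bullet> z / 2)) = (\<Prod>b\<in>Basis. exp (- ((z \<bullet> b)\<^sup>2 / 2)))"
      by (simp add: exp_sum[symmetric] sum_negf sum_divide_distrib)
    then show "ennreal (exp (- (z \<bullet> z / 2))) = (\<Prod>b\<in>Basis. ennreal (exp (- ((z \<bullet> b)\<^sup>2 / 2))))"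
      by (simp add: prod_ennreal)
  qed
  also have "\<dots> = (\<Prod>b\<in>(Basis::'a set). \<integral>\<^sup>+x. ennreal (exp (- (x\<^sup>2 / 2))) \<partial>lborel)"
    by (rule nn_integral_lborel_prod) auto
  also have "\<dots> < \<infinity>" using nn_integral_gaussian_1 by (simp add: prod_constant power_less_top_ennreal)
  finally have fin: "?I < \<infinity>" .
  define G where "G = enn2real ?I + 1"
  have G: "G > 0" "?I \<le> ennreal G"
    using fin by (auto simp: G_def add_nonneg_pos intro!: ennreal_enn2real[symmetric, THEN order_trans[OF eq_refl]] ennreal_leI)
  have "(\<integral>\<^sup>+z. ennreal (exp (- ((z::'a) \<bullet> z / (2 * r\<^sup>2)))) \<partial>lborel) \<le> ennreal (G * r ^ DIM('a))" if r: "r > 0" for r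
  proof -
    have "(\<integral>\<^sup>+z. ennreal (exp (- ((z::'a) \<bullet> z / (2 * r\<^sup>2)))) \<partial>lborel) =
        ennreal (r ^ DIM('a)) * (\<integral>\<^sup>+z. ennreal (exp (- ((0 + r *\<^sub>R z) \<bullet> (0 + r *\<^sub>R (z::'a)) / (2 * r\<^sup>2)))) \<partial>lborel)"
      using r by (subst nn_integral_lborel_affine[of _ r 0]) auto
    also have "\<dots> = ennreal (r ^ DIM('a)) * ?I"
      using r by (simp add: power2_eq_square)
    also have "\<dots> \<le> ennreal (r ^ DIM('a)) * ennreal G" by (rule mult_left_mono[OF G(2)]) simp
    finally show ?thesis using r G(1) by (simp add: ennreal_mult''[symmetric] mult.commute)
  qed
  with G(1) show thesis by (rule that)
qed

text \<open>With u = t^2/2, the inequality exp u >= (1 + u/m)^m >= (u/m)^m reads t^(2m) <= (2m)^m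
  exp u. This comparison of the Gaussian with a negative power links Gaussian averages to the
  Gagliardo kernel.\<close>

lemma gaussian_decay:
  assumes t: "t \<ge> 0" and q: "0 \<le> q" "q \<le> 2 * real m" and m: "m > 0"
  shows "exp (- (t\<^sup>2 / 2)) * t powr q \<le> 1 + (2 * real m) ^ m"
proof -
  have le: "t powr q \<le> 1 + (t\<^sup>2) ^ m"
  proof (cases "t \<le> 1")
    case True
    have "t powr q \<le> 1" using t True q by (intro powr_le1) auto
    moreover have "0 \<le> (t\<^sup>2) ^ m" by simp
    ultimately show ?thesis by linarith
  next
    case False
    have "t powr q \<le> t powr (real (2 * m))" using False q by (intro powr_mono) auto
    also have "\<dots> = t ^ (2 * m)" using False by (intro powr_realpow) auto
    also have "\<dots> = (t\<^sup>2) ^ m" by (simp add: power_mult)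
    finally show ?thesis by simp
  qed
  let ?u = "t\<^sup>2 / 2"
  have "(?u / real m) ^ m \<le> (1 + ?u / real m) ^ m" by (intro power_mono) auto
  also have "\<dots> \<le> exp ?u"
  proof (rule exp_ge_one_plus_x_over_n_power_n)
    show "- real m \<le> ?u" using zero_le_power2[of t] of_nat_0_le_iff[of m] by linarith
  qed (rule m)
  finally have "(?u / real m) ^ m \<le> exp ?u" .
  then have "(2 * real m) ^ m * (?u / real m) ^ m \<le> (2 * real m) ^ m * exp ?u" by (intro mult_left_mono) auto
  also have "(2 * real m) ^ m * (?u / real m) ^ m = (t\<^sup>2) ^ m"
  proof -
    have "2 * real m * (?u / real m) = t\<^sup>2" using m by simp
    then show ?thesis unfolding power_mult_distrib[symmetric] by (rule arg_cong)
  qed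
  finally have p: "(t\<^sup>2) ^ m \<le> (2 * real m) ^ m * exp ?u" .
  have "exp (- ?u) * t powr q \<le> exp (- ?u) * (1 + (t\<^sup>2) ^ m)" by (intro mult_left_mono le) auto
  also have "\<dots> \<le> exp (- ?u) * (1 + (2 * real m) ^ m * exp ?u)" using p by (intro mult_left_mono) auto
  also have "\<dots> = exp (- ?u) + (2 * real m) ^ m" by (simp add: distrib_left exp_minus)
  also have "\<dots> \<le> 1 + (2 * real m) ^ m" by simp
  finally show ?thesis by simp
qed

text \<open>The integral of (f - t)^2 k is nonnegative, in particular at its minimiser t = P/S; if S
  = 0 then k vanishes almost everywhere.\<close>

lemma weighted_Cauchy_Schwarz:
  fixes f k :: "'a \<Rightarrow> real"
  assumes k: "integrable M k" "\<And>x. 0 \<le> k x" and fk: "integrable M (\<lambda>x. f x * k x)" and f2k: "integrable M (\<lambda>x. (f x)\<^sup>2 * k x)"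
  shows "(\<integral>x. f x * k x \<partial>M)\<^sup>2 \<le> (\<integral>x. (f x)\<^sup>2 * k x \<partial>M) * (\<integral>x. k x \<partial>M)"
proof -
  let ?P = "\<integral>x. f x * k x \<partial>M" and ?Q = "\<integral>x. (f x)\<^sup>2 * k x \<partial>M" and ?S = "\<integral>x. k x \<partial>M"
  have S: "?S \<ge> 0" using k(2) by (simp add: integral_nonneg_AE)
  have *: "0 \<le> ?Q - 2 * t * ?P + t\<^sup>2 * ?S" for t
  proof -
    have "0 \<le> (\<integral>x. (f x - t)\<^sup>2 * k x \<partial>M)" using k(2) by (intro integral_nonneg_AE) simp
    also have "\<dots> = (\<integral>x. (f x)\<^sup>2 * k x - 2 * t * (f x * k x) + t\<^sup>2 * k x \<partial>M)"
      by (rule Bochner_Integration.integral_cong[OF refl]) (simp add: power2_eq_square algebra_simps)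
    also have "\<dots> = ?Q - 2 * t * ?P + t\<^sup>2 * ?S" using k(1) fk f2k by simp
    finally show ?thesis .
  qed
  show ?thesis
  proof (cases "?S = 0")
    case True
    then have "AE x in M. k x = 0" using integral_nonneg_eq_0_iff_AE[OF k(1)] k(2) by simp
    then have "?P = 0" by (intro integral_eq_zero_AE) (auto elim: eventually_mono)
    then show ?thesis using True by simp
  next
    case False
    then have S0: "?S > 0" using S by linarith
    have "0 \<le> (?Q - 2 * (?P / ?S) * ?P + (?P / ?S)\<^sup>2 * ?S) * ?S" using *[of "?P / ?S"] S by (rule mult_nonneg_nonneg)
    also have "\<dots> = ?Q * ?S - ?P\<^sup>2" using S0 by (simp add: power2_eq_square field_simps)
    finally show ?thesis by simp
  qed
qed

text \<open>The average w = N/Z is taken over \<open>D\<close> only, with Z the Gaussian mass of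
  \<open>D\<close> seen from \<open>x\<close>. Both estimates reduce to the weighted quadratic
  deviation of \<open>\<psi>\<close> from \<open>\<psi> x\<close>. Their left sides contain the
  lower bound c r^d for Z, where d is the dimension: by hypothesis this is at most the volume of
  \<open>D\<close> in the ball of radius \<open>r\<close> times exp(-1), and exp(-1) bounds the
  kernel from below on that ball.\<close>

lemma gaussian_regularisation:
  fixes \<psi> :: "'a::euclidean_space \<Rightarrow> real"
  assumes D: "open D" "bounded D" "D \<noteq> {}" and \<psi>m [measurable]: "\<psi> \<in> borel_measurable borel"
    and \<psi>0: "\<And>x. x \<notin> D \<Longrightarrow> \<psi> x = 0" and \<psi>B: "\<And>x. \<bar>\<psi> x\<bar> \<le> B" and r: "r > 0"
    and G: "G > 0" "(\<integral>\<^sup>+z. ennreal (exp (- ((z::'a) \<bullet> z / (2 * r\<^sup>2)))) \<partial>lborel) \<le> ennreal (G * r ^ DIM('a))"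
    and c: "c > 0" and ball: "\<And>x. x \<in> D \<Longrightarrow> c * r ^ DIM('a) \<le> measure lborel (D \<inter> ball x r) * exp (-1)"
  obtains w where "smooth_fun w" "\<And>x. \<bar>w x\<bar> \<le> B"
    "\<And>x. x \<in> D \<Longrightarrow> (w x - \<psi> x)\<^sup>2 * (c * r ^ DIM('a)) \<le> (\<integral>y. (\<psi> y - \<psi> x)\<^sup>2 * (indicator D y * exp (- ((x - y) \<bullet> (x - y) / (2 * r\<^sup>2)))) \<partial>lborel)"
    "\<And>x. x \<in> D \<Longrightarrow> (norm (grad w x))\<^sup>2 * (c\<^sup>2 * r ^ (DIM('a) + 2)) \<le>
       8 * real DIM('a) * G * (1 + G / c) * (\<integral>y. (\<psi> y - \<psi> x)\<^sup>2 * (indicator D y * exp (- ((x - y) \<bullet> (x - y) / (2 * r\<^sup>2)))) \<partial>lborel)"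
proof -
  define \<kappa> where "\<kappa> z = exp ((- 1 / r\<^sup>2) * (z \<bullet> z))" for z :: 'a
  have s\<kappa>: "smooth_fun \<kappa>" unfolding \<kappa>_def[abs_def]
    by (intro smooth_fun_exp smooth_fun_mult smooth_fun_const smooth_fun_inner_self)
  have g\<kappa>: "grad \<kappa> z = (- 2 / r\<^sup>2 * \<kappa> z) *\<^sub>R z" for z
  proof (rule grad_eqI)
    have "((\<lambda>z. exp (c0 * (z \<bullet> z))) has_derivative (\<lambda>v. ((2 * c0 * exp (c0 * (z \<bullet> z))) *\<^sub>R z) \<bullet> v)) (at z)" for c0
      by (auto intro!: derivative_eq_intros simp: inner_commute)
    from this[of "- 1 / r\<^sup>2"]
    show "(\<kappa> has_derivative (\<lambda>v. ((- 2 / r\<^sup>2 * \<kappa> z) *\<^sub>R z) \<bullet> v)) (at z)"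
      unfolding \<kappa>_def[abs_def] by simp
  qed
  \<comment> \<open>The kernel \<open>\<kappa>\<close> is the square of \<open>\<kappa>2\<close>, so
    one factor can pay for the power of |z| that differentiation produces while the other remains as
    the weight.\<close>
  define \<kappa>2 where "\<kappa>2 z = exp (- (z \<bullet> z / (2 * r\<^sup>2)))" for z :: 'a
  have \<kappa>sq: "\<kappa> z = \<kappa>2 z * \<kappa>2 z" for z
    unfolding \<kappa>_def \<kappa>2_def exp_add[symmetric] by (simp add: field_simps)
  have \<kappa>2: "0 < \<kappa>2 z" "\<kappa>2 z \<le> 1" for z using r by (auto simp: \<kappa>2_def)
  have \<kappa>_le: "\<kappa> z \<le> \<kappa>2 z" "0 < \<kappa> z" for z using \<kappa>2[of z] by (auto simp: \<kappa>sq mult_left_le)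
  have \<kappa>z: "norm z * \<kappa> z \<le> r * \<kappa>2 z" for z
  proof -
    let ?t = "norm z / r"
    have "s \<le> 1 + s\<^sup>2 / 2" for s :: real
    proof -
      have "0 \<le> (s - 1)\<^sup>2" by simp
      then have "2 * s \<le> 1 + s\<^sup>2" by (simp add: power2_eq_square algebra_simps)
      then show ?thesis by simp
    qed
    from this[of ?t] have "?t \<le> 1 + ?t\<^sup>2 / 2" .
    also have "\<dots> \<le> exp (?t\<^sup>2 / 2)" by (rule exp_ge_add_one_self)
    finally have tq: "?t \<le> exp (?t\<^sup>2 / 2)" .
    have "s * exp (- q) \<le> 1" if "s \<le> exp q" for s q :: real
      using mult_right_mono[OF that, of "exp (- q)"] by (simp add: exp_minus)
    from this[OF tq] have "?t * exp (- (?t\<^sup>2 / 2)) \<le> 1" .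
    moreover have "\<kappa>2 z = exp (- (?t\<^sup>2 / 2))" by (simp add: \<kappa>2_def power_divide power2_norm_eq_inner)
    ultimately have "norm z * \<kappa>2 z \<le> r" using r by (simp add: field_simps)
    from mult_right_mono[OF this less_imp_le[OF \<kappa>2(1)[of z]]] show ?thesis by (simp add: \<kappa>sq mult_ac)
  qed
  let ?I = "indicat_real D"
  have Dm: "D \<in> sets borel" using D by simp
  have [measurable]: "\<kappa> \<in> borel_measurable borel" "\<kappa>2 \<in> borel_measurable borel"
    by (rule borel_measurable_continuous_onI[OF smooth_fun_continuous[OF s\<kappa>]]) (simp add: \<kappa>2_def[abs_def])
  note [measurable] = Dm
  obtain R where R: "\<And>x. x \<in> D \<Longrightarrow> norm x \<le> R" using D(2) by (auto simp: bounded_iff)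
  have iI: "integrable lborel ?I"
    using emeasure_bounded_finite[OF D(2)] Dm by (intro integrable_real_indicator) auto
  have bi: "integrable lborel (\<lambda>y. f y * ?I y)" if [measurable]: "f \<in> borel_measurable borel" and b: "\<And>y. \<bar>f y\<bar> \<le> b" for f b
    by (rule Bochner_Integration.integrable_bound[OF integrable_mult_right[OF iI, of b]])
      (auto intro!: AE_I2 simp: indicator_def intro: order_trans[OF b] abs_ge_self)
  have B0: "B \<ge> 0" using \<psi>B[of undefined] by linarith
  have \<psi>I: "\<psi> y = \<psi> y * ?I y" for y using \<psi>0[of y] by (cases "y \<in> D") auto
  have \<psi>eq: "(\<lambda>y. \<psi> y * ?I y) = \<psi>" by (rule ext) (rule \<psi>I[symmetric])
  have i\<psi>: "integrable lborel \<psi>" using bi[OF \<psi>m \<psi>B] unfolding \<psi>eq .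
  have I0: "?I y = 0" "\<psi> y = 0" if "norm y > R" for y
    using R[of y] \<psi>0[of y] that by (auto simp: indicator_def)
  define Z where "Z = conv ?I \<kappa>"
  define N where "N = conv \<psi> \<kappa>"
  have sZ: "smooth_fun Z" unfolding Z_def by (rule smooth_fun_conv[OF iI I0(1) s\<kappa>])
  have sN: "smooth_fun N" unfolding N_def by (rule smooth_fun_conv[OF i\<psi> I0(2) s\<kappa>])
  let ?K = "\<lambda>x y. ?I y * \<kappa> (x - y)" and ?K2 = "\<lambda>x y. ?I y * \<kappa>2 (x - y)"
  have K0: "0 \<le> ?K x y" "0 \<le> ?K2 x y" "?K x y \<le> ?K2 x y" for x y
    using \<kappa>_le[of "x - y"] \<kappa>2[of "x - y"] by (auto simp: indicator_def)
  have iK: "integrable lborel (\<lambda>y. f y * ?K x y)" "integrable lborel (\<lambda>y. f y * ?K2 x y)"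
    if [measurable]: "f \<in> borel_measurable borel" and b: "\<And>y. \<bar>f y\<bar> \<le> b" for f b x
  proof -
    have fk: "\<bar>f y * k\<bar> \<le> b" if "0 < k" "k \<le> 1" for y k
      using b[of y] that mult_mono[of "\<bar>f y\<bar>" b k 1] by (simp add: abs_mult)
    have 1: "\<bar>f y * \<kappa> (x - y)\<bar> \<le> b" "\<bar>f y * \<kappa>2 (x - y)\<bar> \<le> b" for y
      by (rule fk[OF \<kappa>_le(2) order_trans[OF \<kappa>_le(1) \<kappa>2(2)]], rule fk[OF \<kappa>2])
    show "integrable lborel (\<lambda>y. f y * ?K x y)"
      using bi[of "\<lambda>y. f y * \<kappa> (x - y)" b, OF _ 1(1)] by (simp add: mult_ac)
    show "integrable lborel (\<lambda>y. f y * ?K2 x y)"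
      using bi[of "\<lambda>y. f y * \<kappa>2 (x - y)" b, OF _ 1(2)] by (simp add: mult_ac)
  qed
  have iK1: "integrable lborel (?K x)" "integrable lborel (?K2 x)" for x
    using iK[of "\<lambda>_. 1" 1 x] by simp_all
  \<comment> \<open>Positivity on the whole space, and not only on \<open>D\<close>, makes the
    quotient smooth everywhere. It holds because a nonempty open set is not a null set.\<close>
  have Zpos: "Z x > 0" for x
  proof -
    have "Z x \<ge> 0" unfolding Z_def conv_def using K0 by (intro integral_nonneg_AE) auto
    moreover have "Z x \<noteq> 0"
    proof
      assume "Z x = 0"
      then have "AE y in lborel. ?K x y = 0"
        using integral_nonneg_eq_0_iff_AE[OF iK1(1)[of x]] K0 by (auto simp: Z_def conv_def)
      then have "AE y in lborel. y \<notin> D"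
        by eventually_elim (use \<kappa>_le(2) in \<open>auto simp: less_imp_neq[symmetric]\<close>)
      then have "D \<in> null_sets lborel" using Dm by (simp add: AE_iff_null_sets)
      then have "negligible D" using negligible_iff_null_sets null_sets_completionI by blast
      then show False using open_not_negligible D by blast
    qed
    ultimately show ?thesis by linarith
  qed
  define w where "w x = N x / Z x" for x
  have sw: "smooth_fun w" unfolding w_def[abs_def] by (rule smooth_fun_divide[OF sN sZ]) (use Zpos in \<open>simp add: less_imp_neq[symmetric]\<close>)
  have NZ: "N x = w x * Z x" for x using Zpos[of x] by (simp add: w_def)
  have NK: "N x = (\<integral>y. \<psi> y * ?K x y \<partial>lborel)" for x
    unfolding N_def conv_def by (rule Bochner_Integration.integral_cong[OF refl]) (subst \<psi>I, simp)
  have ZK: "Z x = (\<integral>y. ?K x y \<partial>lborel)" for x by (simp add: Z_def conv_def)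
  have wB: "\<bar>w x\<bar> \<le> B" for x
  proof -
    have "\<bar>N x\<bar> \<le> (\<integral>y. \<bar>\<psi> y * ?K x y\<bar> \<partial>lborel)" unfolding NK by (rule integral_abs_bound)
    also have "\<dots> \<le> (\<integral>y. B * ?K x y \<partial>lborel)"
    proof (rule integral_mono)
      show "integrable lborel (\<lambda>y. \<bar>\<psi> y * ?K x y\<bar>)" by (rule integrable_abs[OF iK(1)[OF \<psi>m \<psi>B]])
      show "integrable lborel (\<lambda>y. B * ?K x y)" using iK1 by simp
      show "\<bar>\<psi> y * ?K x y\<bar> \<le> B * ?K x y" for y
        unfolding abs_mult[of "\<psi> y"] abs_of_nonneg[OF K0(1)] by (rule mult_right_mono[OF \<psi>B K0(1)])
    qed
    also have "\<dots> = B * Z x" unfolding ZK by simp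
    finally show ?thesis unfolding w_def using Zpos[of x] by (simp add: pos_divide_le_eq)
  qed
  have Zlow: "c * r ^ DIM('a) \<le> Z x" if x: "x \<in> D" for x
  proof -
    have "measure lborel (D \<inter> ball x r) * exp (-1) = (\<integral>y. indicator (D \<inter> ball x r) y * exp (-1) \<partial>lborel)" by simp
    also have "\<dots> \<le> (\<integral>y. ?K x y \<partial>lborel)"
    proof (rule integral_mono)
      show "integrable lborel (\<lambda>y. indicat_real (D \<inter> ball x r) y * exp (- 1))"
        using emeasure_bounded_finite[of "D \<inter> ball x r"] D(2) by (intro integrable_mult_left integrable_real_indicator) (auto intro: bounded_Int)
      show "integrable lborel (?K x)" by (rule iK1)
      fix y
      show "indicat_real (D \<inter> ball x r) y * exp (- 1) \<le> ?K x y"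
      proof (cases "y \<in> D \<inter> ball x r")
        case True
        then have "norm (x - y) \<le> r" by (simp add: dist_norm)
        then have "(x - y) \<bullet> (x - y) \<le> r\<^sup>2" unfolding power2_norm_eq_inner[symmetric] by (intro power_mono) auto
        then have "exp (- 1) \<le> \<kappa> (x - y)" using r by (simp add: \<kappa>_def field_simps)
        then show ?thesis using True by simp
      qed (use K0(1) in simp)
    qed
    finally show ?thesis using ball[OF x] unfolding ZK by linarith
  qed
  define J where "J x = (\<integral>y. (\<psi> y - \<psi> x)\<^sup>2 * ?K2 x y \<partial>lborel)" for x
  have dm [measurable]: "(\<lambda>y. \<psi> y - t) \<in> borel_measurable borel" "(\<lambda>y. (\<psi> y - t)\<^sup>2) \<in> borel_measurable borel" for t by measurable
  have db: "\<bar>\<psi> y - t\<bar> \<le> B + \<bar>t\<bar>" for y t using \<psi>B[of y] by linarith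
  have db2: "\<bar>(\<psi> y - t)\<^sup>2\<bar> \<le> (B + \<bar>t\<bar>)\<^sup>2" for y t using power_mono[OF db[of y t], of 2] by simp
  have K2mass: "(\<integral>y. ?K2 x y \<partial>lborel) \<le> G * r ^ DIM('a)" for x
  proof -
    have "ennreal (\<integral>y. ?K2 x y \<partial>lborel) = (\<integral>\<^sup>+y. ennreal (?K2 x y) \<partial>lborel)"
      by (rule nn_integral_eq_integral[symmetric, OF iK1(2)]) (use K0 in auto)
    also have "\<dots> \<le> (\<integral>\<^sup>+y. ennreal (\<kappa>2 (x - y)) \<partial>lborel)"
      by (intro nn_integral_mono ennreal_leI) (use \<kappa>2 in \<open>auto simp: indicator_def less_imp_le\<close>)
    also have "\<dots> = (\<integral>\<^sup>+y. ennreal (\<kappa>2 y) \<partial>lborel)"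
      by (rule nn_integral_lborel_reflect(1)[where f = "\<lambda>z. ennreal (\<kappa>2 z)"]) measurable
    also have "\<dots> \<le> ennreal (G * r ^ DIM('a))" using G(2) by (simp add: \<kappa>2_def)
    finally show ?thesis using G(1) r by (subst (asm) ennreal_le_iff) auto
  qed
  have wm: "(w x - \<psi> x)\<^sup>2 * Z x \<le> J x" for x
  proof -
    have "(\<integral>y. (\<psi> y - \<psi> x) * ?K x y \<partial>lborel) = (\<integral>y. \<psi> y * ?K x y - \<psi> x * ?K x y \<partial>lborel)"
      by (simp only: left_diff_distrib)
    also have "\<dots> = N x - \<psi> x * Z x"
      unfolding NK ZK using iK(1)[OF \<psi>m \<psi>B, of x] iK1(1)[of x] by (subst Bochner_Integration.integral_diff) auto
    also have "\<dots> = (w x - \<psi> x) * Z x" by (simp add: NZ left_diff_distrib)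
    finally have eq: "(\<integral>y. (\<psi> y - \<psi> x) * ?K x y \<partial>lborel) = (w x - \<psi> x) * Z x" .
    have "(\<integral>y. (\<psi> y - \<psi> x) * ?K x y \<partial>lborel)\<^sup>2 \<le> (\<integral>y. (\<psi> y - \<psi> x)\<^sup>2 * ?K x y \<partial>lborel) * (\<integral>y. ?K x y \<partial>lborel)"
      by (rule weighted_Cauchy_Schwarz[OF iK1(1) K0(1) iK(1)[OF dm(1) db] iK(1)[OF dm(2) db2]])
    then have "((w x - \<psi> x) * Z x)\<^sup>2 \<le> (\<integral>y. (\<psi> y - \<psi> x)\<^sup>2 * ?K x y \<partial>lborel) * (\<integral>y. ?K x y \<partial>lborel)"
      unfolding eq .
    also have "\<dots> \<le> J x * Z x"
      unfolding J_def ZK[symmetric] using Zpos[of x]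
      by (intro mult_right_mono integral_mono iK(1)[OF dm(2) db2] iK(2)[OF dm(2) db2] mult_left_mono K0) auto
    finally have "((w x - \<psi> x)\<^sup>2 * Z x) * Z x \<le> J x * Z x" by (simp add: power2_eq_square mult_ac)
    then show ?thesis using Zpos[of x] by (rule mult_right_le_imp_le)
  qed
  have J0: "J x \<ge> 0" for x unfolding J_def using K0 by (intro integral_nonneg_AE) auto
  have est1: "(w x - \<psi> x)\<^sup>2 * (c * r ^ DIM('a)) \<le> J x" if x: "x \<in> D" for x
    using mult_left_mono[OF Zlow[OF x], of "(w x - \<psi> x)\<^sup>2"] wm[of x] by simp
  let ?d = "r ^ DIM('a)"
  have est2: "(norm (grad w x))\<^sup>2 * (c\<^sup>2 * r ^ (DIM('a) + 2)) \<le> 8 * real DIM('a) * G * (1 + G / c) * J x" if x: "x \<in> D" for x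
  proof -
    let ?W = "\<lambda>y. \<psi> y - w x"
    have Wb: "\<bar>?W y\<bar> \<le> B + \<bar>w x\<bar>" for y by (rule db)
    \<comment> \<open>The quotient rule gives Z grad w = grad N - w grad Z: subtracting the number
      \<open>w x\<close> under the integral leaves only deviations of \<open>\<psi>\<close>, so a
      constant \<open>\<psi>\<close> has zero gradient.\<close>
    have part: "Z x * (grad w x \<bullet> i) = (\<integral>y. ?W y * (?I y * (grad \<kappa> (x - y) \<bullet> i)) \<partial>lborel)" if i: "i \<in> Basis" for i
    proof -
      have pN: "grad N x \<bullet> i = (\<integral>y. \<psi> y * (grad \<kappa> (x - y) \<bullet> i) \<partial>lborel)"
        unfolding grad_inner_Basis[OF i] N_def using partial_conv[OF i\<psi> I0(2) s\<kappa> i, of R x] by (simp add: conv_def)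
      have pZ: "grad Z x \<bullet> i = (\<integral>y. ?I y * (grad \<kappa> (x - y) \<bullet> i) \<partial>lborel)"
        unfolding grad_inner_Basis[OF i] Z_def using partial_conv[OF iI I0(1) s\<kappa> i, of R x] by (simp add: conv_def)
      have ci: "continuous_on UNIV (\<lambda>z. grad \<kappa> z \<bullet> i)"
        by (intro continuous_on_inner continuous_on_grad[OF s\<kappa>] continuous_on_const)
      have "grad N x = w x *\<^sub>R grad Z x + Z x *\<^sub>R grad w x"
        using grad_mult[OF sw sZ, of x] by (simp add: NZ[symmetric])
      then have "Z x * (grad w x \<bullet> i) = grad N x \<bullet> i - w x * (grad Z x \<bullet> i)" by (simp add: inner_add_left)
      also have "\<dots> = (\<integral>y. \<psi> y * (grad \<kappa> (x - y) \<bullet> i) - w x * (?I y * (grad \<kappa> (x - y) \<bullet> i)) \<partial>lborel)"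
        unfolding pN pZ
        using integrable_conv[OF i\<psi> _ ci, of R x] integrable_conv[OF iI _ ci, of R x] I0 by simp
      also have "\<dots> = (\<integral>y. ?W y * (?I y * (grad \<kappa> (x - y) \<bullet> i)) \<partial>lborel)"
      proof (rule Bochner_Integration.integral_cong[OF refl])
        fix y
        have "\<psi> y * (grad \<kappa> (x - y) \<bullet> i) = \<psi> y * ?I y * (grad \<kappa> (x - y) \<bullet> i)" using \<psi>I[of y] by simp
        then show "\<psi> y * (grad \<kappa> (x - y) \<bullet> i) - w x * (?I y * (grad \<kappa> (x - y) \<bullet> i)) = ?W y * (?I y * (grad \<kappa> (x - y) \<bullet> i))"
          by (simp only: left_diff_distrib mult.assoc)
      qed
      finally show ?thesis .
    qed
    have gb: "\<bar>grad \<kappa> z \<bullet> i\<bar> \<le> 2 / r * \<kappa>2 z" if i: "i \<in> Basis" for z i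
    proof -
      have "\<bar>grad \<kappa> z \<bullet> i\<bar> \<le> norm (grad \<kappa> z)" by (rule Basis_le_norm[OF i])
      also have "\<dots> = 2 / r\<^sup>2 * (norm z * \<kappa> z)" using \<kappa>_le(2)[of z] by (simp add: g\<kappa> abs_mult less_imp_le)
      also have "\<dots> \<le> 2 / r\<^sup>2 * (r * \<kappa>2 z)" by (intro mult_left_mono \<kappa>z) simp
      also have "\<dots> = 2 / r * \<kappa>2 z" using r by (simp add: power2_eq_square)
      finally show ?thesis .
    qed
    define P where "P = (\<integral>y. \<bar>?W y\<bar> * ?K2 x y \<partial>lborel)"
    have Wm: "(\<lambda>y. \<bar>?W y\<bar>) \<in> borel_measurable borel" by measurable
    have iP: "integrable lborel (\<lambda>y. \<bar>?W y\<bar> * ?K2 x y)" by (rule iK(2)[OF Wm, of "B + \<bar>w x\<bar>"]) (use Wb in simp)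
    have P0: "P \<ge> 0" unfolding P_def using K0 by (intro integral_nonneg_AE) auto
    have pb: "Z x * \<bar>grad w x \<bullet> i\<bar> \<le> 2 / r * P" if i: "i \<in> Basis" for i
    proof -
      have "Z x * \<bar>grad w x \<bullet> i\<bar> = \<bar>\<integral>y. ?W y * (?I y * (grad \<kappa> (x - y) \<bullet> i)) \<partial>lborel\<bar>"
        unfolding part[OF i, symmetric] using Zpos[of x] by (simp add: abs_mult)
      also have "\<dots> \<le> (\<integral>y. 2 / r * (\<bar>?W y\<bar> * ?K2 x y) \<partial>lborel)"
      proof (rule abs_integral_le_integral)
        show "\<bar>?W y * (?I y * (grad \<kappa> (x - y) \<bullet> i))\<bar> \<le> 2 / r * (\<bar>?W y\<bar> * ?K2 x y)" for y
        proof -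
          have "\<bar>?W y\<bar> * ?I y * \<bar>grad \<kappa> (x - y) \<bullet> i\<bar> \<le> \<bar>?W y\<bar> * ?I y * (2 / r * \<kappa>2 (x - y))"
            by (intro mult_left_mono gb[OF i]) auto
          then show ?thesis by (simp add: abs_mult mult_ac)
        qed
        show "integrable lborel (\<lambda>y. 2 / r * (\<bar>?W y\<bar> * ?K2 x y))" using iP by simp
      qed
      also have "\<dots> = 2 / r * P" unfolding P_def by simp
      finally show ?thesis .
    qed
    \<comment> \<open>The deviation from \<open>w x\<close> is split at \<open>\<psi> x\<close>; the
      estimate \<open>est1\<close> bounds the second part by a multiple of \<open>J x / c\<close>,
      which is the origin of the factor 1 + G/c.\<close>
    have W2: "(\<integral>y. (?W y)\<^sup>2 * ?K2 x y \<partial>lborel) \<le> 2 * J x + 2 * (w x - \<psi> x)\<^sup>2 * (G * ?d)"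
    proof -
      have "(\<integral>y. (?W y)\<^sup>2 * ?K2 x y \<partial>lborel) \<le> (\<integral>y. 2 * ((\<psi> y - \<psi> x)\<^sup>2 * ?K2 x y) + 2 * (w x - \<psi> x)\<^sup>2 * ?K2 x y \<partial>lborel)"
      proof (rule integral_mono)
        show "integrable lborel (\<lambda>y. (?W y)\<^sup>2 * ?K2 x y)" by (rule iK(2)[OF dm(2) db2])
        show "integrable lborel (\<lambda>y. 2 * ((\<psi> y - \<psi> x)\<^sup>2 * ?K2 x y) + 2 * (w x - \<psi> x)\<^sup>2 * ?K2 x y)"
          using iK(2)[OF dm(2) db2, of "\<psi> x" x] iK1(2)[of x] by simp
        fix y
        have "(?W y)\<^sup>2 \<le> 2 * (\<psi> y - \<psi> x)\<^sup>2 + 2 * (w x - \<psi> x)\<^sup>2"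
          using sum_squares_ge_zero[of "(\<psi> y - \<psi> x) + (w x - \<psi> x)" 0] by (simp add: power2_eq_square algebra_simps)
        from mult_right_mono[OF this K0(2)[of y x]]
        show "(?W y)\<^sup>2 * ?K2 x y \<le> 2 * ((\<psi> y - \<psi> x)\<^sup>2 * ?K2 x y) + 2 * (w x - \<psi> x)\<^sup>2 * ?K2 x y"
          by (simp add: distrib_right mult.assoc)
      qed
      also have "\<dots> = 2 * J x + 2 * (w x - \<psi> x)\<^sup>2 * (\<integral>y. ?K2 x y \<partial>lborel)"
        unfolding J_def using iK(2)[OF dm(2) db2, of "\<psi> x" x] iK1(2)[of x] by simp
      also have "\<dots> \<le> 2 * J x + 2 * (w x - \<psi> x)\<^sup>2 * (G * ?d)"
        using K2mass by (intro add_left_mono mult_left_mono) auto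
      finally show ?thesis .
    qed
    have "(w x - \<psi> x)\<^sup>2 * ?d \<le> J x / c" using est1[OF x] c by (simp add: pos_le_divide_eq mult_ac)
    then have "2 * (w x - \<psi> x)\<^sup>2 * (G * ?d) \<le> 2 * G * (J x / c)" 
    proof -
      have "(2 * G) * ((w x - \<psi> x)\<^sup>2 * ?d) \<le> (2 * G) * (J x / c)"
        using \<open>(w x - \<psi> x)\<^sup>2 * ?d \<le> J x / c\<close> G(1) by (intro mult_left_mono) auto
      then show ?thesis by (simp only: mult_ac)
    qed
    then have Q: "(\<integral>y. (?W y)\<^sup>2 * ?K2 x y \<partial>lborel) \<le> 2 * (1 + G / c) * J x"
      using W2 by (simp add: algebra_simps)
    have "P\<^sup>2 \<le> (\<integral>y. (\<bar>?W y\<bar>)\<^sup>2 * ?K2 x y \<partial>lborel) * (\<integral>y. ?K2 x y \<partial>lborel)"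
      unfolding P_def by (rule weighted_Cauchy_Schwarz[OF iK1(2) K0(2) iP]) (simp add: iK(2)[OF dm(2) db2])
    also have "\<dots> \<le> (2 * (1 + G / c) * J x) * (G * ?d)"
      using Q K2mass[of x] c G J0[of x] K0 by (intro mult_mono) (auto intro!: integral_nonneg_AE mult_nonneg_nonneg)
    finally have P2: "P\<^sup>2 \<le> (2 * (1 + G / c) * J x) * (G * ?d)" .
    have comp: "(grad w x \<bullet> i)\<^sup>2 * (c * ?d)\<^sup>2 \<le> (2 / r)\<^sup>2 * P\<^sup>2" if i: "i \<in> Basis" for i
    proof -
      have "(c * ?d) * \<bar>grad w x \<bullet> i\<bar> \<le> 2 / r * P"
        using pb[OF i] mult_right_mono[OF Zlow[OF x], of "\<bar>grad w x \<bullet> i\<bar>"] by linarith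
      then have "((c * ?d) * \<bar>grad w x \<bullet> i\<bar>)\<^sup>2 \<le> (2 / r * P)\<^sup>2" using c r by (intro power_mono) auto
      then have "(c * ?d)\<^sup>2 * \<bar>grad w x \<bullet> i\<bar>\<^sup>2 \<le> (2 / r)\<^sup>2 * P\<^sup>2" unfolding power_mult_distrib[of _ P]
        by (simp only: power_mult_distrib)
      then show ?thesis by (simp only: power2_abs mult.commute)
    qed
    have "(norm (grad w x))\<^sup>2 * (c * ?d)\<^sup>2 = (\<Sum>i\<in>Basis. (grad w x \<bullet> i)\<^sup>2 * (c * ?d)\<^sup>2)"
      unfolding power2_norm_eq_inner by (subst euclidean_inner) (simp add: sum_distrib_right power2_eq_square)
    also have "\<dots> \<le> (\<Sum>i\<in>(Basis::'a set). (2 / r)\<^sup>2 * P\<^sup>2)" by (rule sum_mono) (rule comp)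
    also have "\<dots> = real DIM('a) * ((2 / r)\<^sup>2 * P\<^sup>2)" by simp
    also have "\<dots> \<le> real DIM('a) * ((2 / r)\<^sup>2 * ((2 * (1 + G / c) * J x) * (G * ?d)))"
      by (intro mult_left_mono P2) auto
    finally have f: "(norm (grad w x))\<^sup>2 * (c * ?d)\<^sup>2 \<le> real DIM('a) * ((2 / r)\<^sup>2 * ((2 * (1 + G / c) * J x) * (G * ?d)))" .
    have "((norm (grad w x))\<^sup>2 * (c\<^sup>2 * r ^ (DIM('a) + 2))) * ?d = r\<^sup>2 * ((norm (grad w x))\<^sup>2 * (c * ?d)\<^sup>2)"
      by (simp add: power_add power2_eq_square mult_ac)
    also have "\<dots> \<le> r\<^sup>2 * (real DIM('a) * ((2 / r)\<^sup>2 * ((2 * (1 + G / c) * J x) * (G * ?d))))"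
      by (intro mult_left_mono f) simp
    also have "\<dots> = (8 * real DIM('a) * G * (1 + G / c) * J x) * ?d"
    proof -
      have "r\<^sup>2 * (2 / r)\<^sup>2 = 4" using r by (simp add: power_divide)
      then have "r\<^sup>2 * (real DIM('a) * ((2 / r)\<^sup>2 * X)) = 4 * real DIM('a) * X" for X
        by (metis (no_types, lifting) mult.assoc mult.left_commute)
      from this[of "(2 * (1 + G / c) * J x) * (G * ?d)"] show ?thesis by (simp only: mult_ac) simp
    qed
    finally show ?thesis using r by (simp add: mult_le_cancel_right)
  qed
  show thesis
    by (rule that[of w, OF sw wB]) (use est1 est2 in \<open>simp_all add: J_def \<kappa>2_def\<close>)
qed

section \<open>Smooth approximation of H1 functions and of their quotients\<close>

lemma AE_in_lebesgue_on: "AE x in lebesgue_on K. x \<in> K"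
  by (rule AE_lebesgue_on_I)

lemma L2_continuous_compact:
  fixes f :: "'a::euclidean_space \<Rightarrow> 'b::euclidean_space"
  assumes "continuous_on UNIV f" "compact K"
  shows "L2 K f"
proof -
  have "continuous_on UNIV (\<lambda>x. (norm (f x))\<^sup>2)" using assms(1) by (intro continuous_intros)
  then show ?thesis
    using continuous_measurable_lebesgue_on[OF assms(1)]
      integrable_continuous_lebesgue_on_bounded[OF _ compact_imp_bounded[OF assms(2)] compact_in_lebesgue[OF assms(2)]]
    by (simp add: L2_def)
qed

text \<open>The difference is split as c_m (G_m - g) + (c_m - c') g. The first part is small by the
  uniform bound on the coefficients, the second by dominated convergence.\<close>

lemma l2_product_limit:
  fixes g :: "'a::euclidean_space \<Rightarrow> 'a" and G :: "nat \<Rightarrow> 'a \<Rightarrow> 'a"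
  assumes g: "L2 K g" and G: "\<And>m. L2 K (G m)" and lim: "(\<lambda>m. l2 K (\<lambda>x. G m x - g x)) \<longlonglongrightarrow> 0"
    and c: "\<And>m. c m \<in> borel_measurable (lebesgue_on K)" and c': "c' \<in> borel_measurable (lebesgue_on K)"
    and cB: "\<And>m x. x \<in> K \<Longrightarrow> \<bar>c m x\<bar> \<le> C" and clim: "AE x in lebesgue_on K. (\<lambda>m. c m x) \<longlonglongrightarrow> c' x"
  shows "(\<lambda>m. l2 K (\<lambda>x. c m x *\<^sub>R G m x - c' x *\<^sub>R g x)) \<longlonglongrightarrow> 0" "AE x in lebesgue_on K. \<bar>c' x\<bar> \<le> C"
proof -
  show c'B: "AE x in lebesgue_on K. \<bar>c' x\<bar> \<le> C"
    using clim AE_in_lebesgue_on[of K]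
  proof eventually_elim
    case (elim x)
    show ?case by (rule LIMSEQ_le_const2[OF tendsto_rabs[OF elim(1)]]) (use cB elim(2) in auto)
  qed
  have cBA: "AE x in lebesgue_on K. \<bar>c m x\<bar> \<le> C" for m by (rule AE_lebesgue_on_I) (rule cB)
  note [measurable] = c c' L2_measurable[OF g] L2_measurable[OF G]
  \<comment> \<open>On an empty \<open>K\<close> nothing forces \<open>C\<close> to be
    nonnegative.\<close>
  define C0 where "C0 = \<bar>C\<bar>"
  have C0: "C0 \<ge> 0" "C \<le> C0" by (auto simp: C0_def)
  have L1: "L2 K (\<lambda>x. c m x *\<^sub>R (G m x - g x))" "l2 K (\<lambda>x. c m x *\<^sub>R (G m x - g x)) \<le> C0 * l2 K (\<lambda>x. G m x - g x)" for m
  proof -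
    have ae: "AE x in lebesgue_on K. \<bar>c m x\<bar> \<le> C0" using cBA[of m] by eventually_elim (use C0(2) in linarith)
    show "L2 K (\<lambda>x. c m x *\<^sub>R (G m x - g x))" by (rule L2_scaleR_bounded(1)[OF L2_diff[OF G g] c ae])
    show "l2 K (\<lambda>x. c m x *\<^sub>R (G m x - g x)) \<le> C0 * l2 K (\<lambda>x. G m x - g x)"
      by (rule L2_scaleR_bounded(2)[OF L2_diff[OF G g] c ae C0(1)])
  qed
  have L2': "L2 K (\<lambda>x. (c m x - c' x) *\<^sub>R g x)" for m
  proof (rule L2_scaleR_bounded(1)[OF g])
    show "AE x in lebesgue_on K. \<bar>c m x - c' x\<bar> \<le> 2 * C"
      using cBA[of m] c'B by eventually_elim linarith
  qed measurable
  have "(\<lambda>m. \<integral>x. (norm ((c m x - c' x) *\<^sub>R g x))\<^sup>2 \<partial>lebesgue_on K) \<longlonglongrightarrow> (\<integral>x. 0 \<partial>lebesgue_on K)"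
  proof (rule integral_dominated_convergence[where w = "\<lambda>x. (2 * C)\<^sup>2 * (norm (g x))\<^sup>2"])
    show "AE x in lebesgue_on K. (\<lambda>m. (norm ((c m x - c' x) *\<^sub>R g x))\<^sup>2) \<longlonglongrightarrow> 0"
      using clim
    proof eventually_elim
      case (elim x)
      have "(\<lambda>m. (norm ((c m x - c' x) *\<^sub>R g x))\<^sup>2) \<longlonglongrightarrow> (norm ((c' x - c' x) *\<^sub>R g x))\<^sup>2"
        by (intro tendsto_intros elim)
      then show ?case by simp
    qed
    show "AE x in lebesgue_on K. norm ((norm ((c m x - c' x) *\<^sub>R g x))\<^sup>2) \<le> (2 * C)\<^sup>2 * (norm (g x))\<^sup>2" for m
      using cBA[of m] c'B
    proof eventually_elim
      case (elim x)
      then have "\<bar>c m x - c' x\<bar> \<le> 2 * C" by linarith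
      then have "\<bar>c m x - c' x\<bar>\<^sup>2 \<le> (2 * C)\<^sup>2" by (intro power_mono) auto
      then show ?case by (simp add: power_mult_distrib mult_right_mono)
    qed
  qed (use L2_integrable[OF g] in auto)
  then have "(\<lambda>m. sqrt (\<integral>x. (norm ((c m x - c' x) *\<^sub>R g x))\<^sup>2 \<partial>lebesgue_on K)) \<longlonglongrightarrow> sqrt 0"
    by (intro tendsto_real_sqrt) simp
  then have lim2: "(\<lambda>m. l2 K (\<lambda>x. (c m x - c' x) *\<^sub>R g x)) \<longlonglongrightarrow> 0" by (simp add: l2_def)
  have le: "l2 K (\<lambda>x. c m x *\<^sub>R G m x - c' x *\<^sub>R g x) \<le> C0 * l2 K (\<lambda>x. G m x - g x) + l2 K (\<lambda>x. (c m x - c' x) *\<^sub>R g x)" for m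
  proof -
    have "c m x *\<^sub>R G m x - c' x *\<^sub>R g x = c m x *\<^sub>R (G m x - g x) + (c m x - c' x) *\<^sub>R g x" for x
      by (simp add: scaleR_diff_right scaleR_diff_left)
    then show ?thesis using l2_triangle[OF L1(1) L2'] L1(2)[of m] by (simp only:) (meson add_mono order_refl order_trans)
  qed
  have "(\<lambda>m. C0 * l2 K (\<lambda>x. G m x - g x) + l2 K (\<lambda>x. (c m x - c' x) *\<^sub>R g x)) \<longlonglongrightarrow> C0 * 0 + 0"
    by (intro tendsto_add tendsto_mult_left lim lim2)
  then have up: "(\<lambda>m. C0 * l2 K (\<lambda>x. G m x - g x) + l2 K (\<lambda>x. (c m x - c' x) *\<^sub>R g x)) \<longlonglongrightarrow> 0" by simp
  show "(\<lambda>m. l2 K (\<lambda>x. c m x *\<^sub>R G m x - c' x *\<^sub>R g x)) \<longlonglongrightarrow> 0"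
    by (rule tendsto_sandwich[OF always_eventually[OF allI[OF l2_nonneg]] always_eventually[OF allI[OF le]] tendsto_const up])
qed

text \<open>The bounds \<open>l\<close> and \<open>L\<close> hold at every point of the space, so
  for l > 0 the reciprocals of the approximations are smooth and bounded.\<close>

definition H1_approx :: "'a::euclidean_space set \<Rightarrow> ('a \<Rightarrow> real) \<Rightarrow> ('a \<Rightarrow> 'a) \<Rightarrow> real \<Rightarrow> real \<Rightarrow> (nat \<Rightarrow> 'a \<Rightarrow> real) \<Rightarrow> bool" where
  "H1_approx D a g l L W \<longleftrightarrow> (\<forall>m. smooth_fun (W m)) \<and> (\<forall>m x. l \<le> W m x \<and> W m x \<le> L) \<and>
     (AE x in lebesgue_on D. (\<lambda>m. W m x) \<longlonglongrightarrow> a x) \<and>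
     (\<forall>K. compact K \<and> K \<subseteq> D \<longrightarrow> (\<lambda>m. l2 K (\<lambda>x. grad (W m) x - g x)) \<longlonglongrightarrow> 0)"

text \<open>Mollification commutes with the weak gradient wherever the kernel fits into
  \<open>D\<close>, since the shifted kernel is then a test function; the reflection in its argument
  produces the sign of integration by parts. The constant \<open>l\<close> drops out because partial
  derivatives of test functions have integral 0.\<close>

lemma grad_conv_moll_weak:
  fixes a :: "'a::euclidean_space \<Rightarrow> real"
  assumes D: "open D" "bounded D" and a: "has_weak_gradient D a g" and ga: "g \<in> borel_measurable (lebesgue_on D)"
    and am: "a \<in> borel_measurable (lebesgue_on D)"
    and \<alpha>: "\<alpha> \<in> borel_measurable borel" "\<And>x. x \<notin> D \<Longrightarrow> \<alpha> x = 0" "integrable lborel \<alpha>" "AE x in lebesgue_on D. a x - l = \<alpha> x"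
    and i: "i \<in> Basis" and \<gamma>: "\<gamma> \<in> borel_measurable borel" "\<And>x. x \<notin> D \<Longrightarrow> \<gamma> x = 0" "AE x in lebesgue_on D. g x \<bullet> i = \<gamma> x"
    and r: "\<rho> > 0" and x: "cball x \<rho> \<subseteq> D"
  shows "grad (conv \<alpha> (moll \<rho>)) x \<bullet> i = conv \<gamma> (moll \<rho>) x"
proof -
  obtain R where R: "\<And>y. y \<in> D \<Longrightarrow> norm y \<le> R" using D(2) by (auto simp: bounded_iff)
  have \<alpha>R: "\<alpha> y = 0" if "norm y > R" for y using \<alpha>(2)[of y] R[of y] that by fastforce
  let ?\<phi> = "\<lambda>y. moll \<rho> (x - y)"
  have out: "?\<phi> y = 0" if "y \<notin> cball x \<rho>" for y
    using that moll_zero[OF r, of "x - y"] by (simp add: dist_norm)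
  have sm: "smooth_fun ?\<phi>"
    using smooth_fun_affine_compose[OF smooth_fun_moll[of \<rho>], of "-1" x] by simp
  have t: "test_function D ?\<phi>" by (rule test_functionI[OF sm compact_cball x out])
  have pd: "frechet_derivative ?\<phi> (at y) i = - frechet_derivative (moll \<rho>) (at (x - y)) i" for y
  proof -
    have d1: "((\<lambda>y. x - y) has_derivative (\<lambda>h. - h)) (at y)" by (auto intro!: derivative_eq_intros)
    have "(?\<phi> has_derivative (\<lambda>v. grad (moll \<rho>) (x - y) \<bullet> (- v))) (at y)"
      by (rule has_derivative_compose[OF d1 smooth_fun_has_grad[OF smooth_fun_moll]])
    from frechet_derivative_eqI[OF this] show ?thesis
      by (simp add: grad_inner_Basis[OF i])
  qed
  have \<phi>0: "(\<integral>y. grad ?\<phi> y \<bullet> i \<partial>lebesgue_on D) = 0" and i\<phi>: "integrable (lebesgue_on D) (\<lambda>y. grad ?\<phi> y \<bullet> i)"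
  proof -
    have c: "continuous_on UNIV (\<lambda>y. grad ?\<phi> y \<bullet> i)" by (intro continuous_on_inner continuous_on_grad[OF sm] continuous_on_const)
    have z: "grad ?\<phi> y \<bullet> i = 0" if "y \<notin> D" for y
    proof -
      have "grad ?\<phi> y = 0"
        by (rule grad_zero_open[of "- cball x \<rho>"]) (use that x in \<open>auto intro!: out\<close>)
      then show ?thesis by simp
    qed
    have mm: "(\<lambda>y. grad ?\<phi> y \<bullet> i) \<in> borel_measurable borel" by (rule borel_measurable_continuous_onI[OF c])
    have "(\<integral>y. grad ?\<phi> y \<bullet> i \<partial>lebesgue_on D) = (\<integral>y. grad ?\<phi> y \<bullet> i \<partial>lborel)"
      by (rule integral_lebesgue_on_eq_lborel(1)[OF _ mm z]) (use D in auto)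
    also have "\<dots> = (\<integral>y. frechet_derivative ?\<phi> (at y) i \<partial>lborel)" by (simp only: grad_inner_Basis[OF i])
    also have "\<dots> = 0"
    proof (rule integral_partial_zero[OF sm _ i])
      fix y :: 'a assume "norm y > R"
      then have "y \<notin> D" using R[of y] by auto
      then have "y \<notin> cball x \<rho>" using x by blast
      then show "?\<phi> y = 0" by (rule out)
    qed
    finally show "(\<integral>y. grad ?\<phi> y \<bullet> i \<partial>lebesgue_on D) = 0" .
    show "integrable (lebesgue_on D) (\<lambda>y. grad ?\<phi> y \<bullet> i)"
      by (rule integrable_continuous_lebesgue_on_bounded[OF c D(2)]) (use D in auto)
  qed
  have \<phi>m [measurable]: "?\<phi> \<in> borel_measurable (lebesgue_on D)" "(\<lambda>y. grad ?\<phi> y \<bullet> i) \<in> borel_measurable (lebesgue_on D)"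
    using continuous_measurable_lebesgue_on[OF smooth_fun_continuous[OF sm]] borel_measurable_integrable[OF i\<phi>] by auto
  have \<alpha>m [measurable]: "\<alpha> \<in> borel_measurable (lebesgue_on D)" "\<gamma> \<in> borel_measurable (lebesgue_on D)"
    using \<alpha>(1) \<gamma>(1) by (auto intro!: measurable_restrict_space1 measurable_completion)
  note [measurable] = am ga
  have "grad (conv \<alpha> (moll \<rho>)) x \<bullet> i = conv \<alpha> (\<lambda>z. frechet_derivative (moll \<rho>) (at z) i) x"
    unfolding grad_inner_Basis[OF i] by (rule partial_conv[OF \<alpha>(3) \<alpha>R smooth_fun_moll i])
  also have "\<dots> = (\<integral>y. \<alpha> y * (- (grad ?\<phi> y \<bullet> i)) \<partial>lborel)"
    unfolding conv_def grad_inner_Basis[OF i] pd by simp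
  also have "\<dots> = (\<integral>y. \<alpha> y * (- (grad ?\<phi> y \<bullet> i)) \<partial>lebesgue_on D)"
  proof (rule integral_lebesgue_on_eq_lborel(1)[symmetric])
    have "(\<lambda>y. grad ?\<phi> y \<bullet> i) \<in> borel_measurable borel"
      by (rule borel_measurable_continuous_onI) (intro continuous_on_inner continuous_on_grad[OF sm] continuous_on_const)
    then show "(\<lambda>y. \<alpha> y * (- (grad ?\<phi> y \<bullet> i))) \<in> borel_measurable borel" using \<alpha>(1) by simp
  qed (use D \<alpha>(2) in auto)
  also have "\<dots> = (\<integral>y. l * (grad ?\<phi> y \<bullet> i) - a y * (grad ?\<phi> y \<bullet> i) \<partial>lebesgue_on D)"
  proof (rule integral_cong_AE)
    show "AE y in lebesgue_on D. \<alpha> y * (- (grad ?\<phi> y \<bullet> i)) = l * (grad ?\<phi> y \<bullet> i) - a y * (grad ?\<phi> y \<bullet> i)"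
      using \<alpha>(4) by eventually_elim (simp add: algebra_simps flip: left_diff_distrib)
  qed measurable
  also have "\<dots> = l * 0 - (\<integral>y. a y * (grad ?\<phi> y \<bullet> i) \<partial>lebesgue_on D)"
  proof -
    have la: "locally_integrable D a" using a by (simp add: has_weak_gradient_def)
    have t': "test_function D (\<lambda>y. grad ?\<phi> y \<bullet> i)"
    proof (rule test_functionI[OF _ compact_cball x])
      show "smooth_fun (\<lambda>y. grad ?\<phi> y \<bullet> i)" unfolding grad_inner_Basis[OF i] by (rule smooth_fun_partial[OF sm i])
      fix y assume "y \<notin> cball x \<rho>"
      then have "grad ?\<phi> y = 0" by (intro grad_zero_open[of "- cball x \<rho>"]) (auto intro!: out)
      then show "grad ?\<phi> y \<bullet> i = 0" by simp
    qed
    have "integrable (lebesgue_on D) (\<lambda>y. a y * (grad ?\<phi> y \<bullet> i))" by (rule loc_integrable_test[OF D(1) la t'])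
    then show ?thesis using i\<phi> \<phi>0 by (subst Bochner_Integration.integral_diff) simp_all
  qed
  also have "\<dots> = (\<integral>y. (g y \<bullet> i) * ?\<phi> y \<partial>lebesgue_on D)"
    using a t i by (simp add: has_weak_gradient_def)
  also have "\<dots> = (\<integral>y. \<gamma> y * ?\<phi> y \<partial>lebesgue_on D)"
    by (rule integral_cong_AE) (use \<gamma>(3) in \<open>auto elim!: eventually_mono\<close>)
  also have "\<dots> = conv \<gamma> (moll \<rho>) x"
    unfolding conv_def by (rule integral_lebesgue_on_eq_lborel(1)) (use D \<gamma> in auto)
  finally show ?thesis .
qed

lemma H1_approx_exists:
  fixes a :: "'a::euclidean_space \<Rightarrow> real"
  assumes D: "open D" "bounded D" and a: "a \<in> H1_space D" and al: "AE x in lebesgue_on D. l \<le> a x \<and> a x \<le> L" and lL: "l \<le> L"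
  shows "\<exists>W. H1_approx D a (weak_grad D a) l L W"
proof -
  let ?g = "weak_grad D a"
  note p = weak_grad_props[OF D(1) a]
  have Db: "D \<in> sets borel" using D by simp
  obtain a' where a' [measurable]: "a' \<in> borel_measurable borel" and a'eq: "AE x in lebesgue_on D. a x = a' x"
    by (rule borel_representative[OF Db L2_measurable[OF p(1)]])
  \<comment> \<open>Subtracting \<open>l\<close> before the extension by zero keeps the
    mollification between 0 and L - l on the whole space. Extending \<open>a\<close> itself by zero
    could push the averages near the boundary below \<open>l\<close>.\<close>
  define \<alpha> where "\<alpha> x = indicator D x * (max l (min L (a' x)) - l)" for x
  note [measurable] = Db
  have \<alpha>m [measurable]: "\<alpha> \<in> borel_measurable borel" unfolding \<alpha>_def[abs_def] by measurable
  have \<alpha>0: "\<alpha> x = 0" if "x \<notin> D" for x using that by (simp add: \<alpha>_def)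
  have \<alpha>b: "0 \<le> \<alpha> x" "\<alpha> x \<le> L - l" for x using lL by (auto simp: \<alpha>_def indicator_def)
  have iI: "integrable lborel (indicat_real D)"
    using emeasure_bounded_finite[OF D(2)] Db by (intro integrable_real_indicator) auto
  have \<alpha>i: "integrable lborel \<alpha>"
  proof (rule Bochner_Integration.integrable_bound[OF integrable_mult_right[OF iI, of "L - l"]])
    show "AE x in lborel. norm (\<alpha> x) \<le> norm ((L - l) * indicat_real D x)"
    proof (rule AE_I2)
      fix x
      show "norm (\<alpha> x) \<le> norm ((L - l) * indicat_real D x)"
        using \<alpha>b[of x] \<alpha>0[of x] lL by (cases "x \<in> D") auto
    qed
  qed measurable
  have \<alpha>eq: "AE x in lebesgue_on D. a x - l = \<alpha> x"
    using a'eq al AE_in_lebesgue_on[of D] by eventually_elim (simp add: \<alpha>_def max_def min_def)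
  have \<alpha>fin: "(\<integral>\<^sup>+x. ennreal (\<bar>\<alpha> x\<bar> ^ 2) \<partial>lborel) < \<infinity>"
  proof -
    have "integrable lborel (\<lambda>x. \<bar>\<alpha> x\<bar> ^ 2)"
    proof (rule Bochner_Integration.integrable_bound[OF integrable_mult_right[OF iI, of "(L - l)\<^sup>2"]])
      show "AE x in lborel. norm (\<bar>\<alpha> x\<bar>\<^sup>2) \<le> norm ((L - l)\<^sup>2 * indicat_real D x)"
      proof (rule AE_I2)
        fix x
        have "(\<alpha> x)\<^sup>2 \<le> (L - l)\<^sup>2" by (rule power_mono[OF \<alpha>b(2) \<alpha>b(1)])
        then show "norm (\<bar>\<alpha> x\<bar>\<^sup>2) \<le> norm ((L - l)\<^sup>2 * indicat_real D x)"
          using \<alpha>0[of x] by (cases "x \<in> D") simp_all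
      qed
    qed measurable
    then show ?thesis by (simp add: integrable_iff_bounded)
  qed
  define \<rho> where "\<rho> n = 1 / real (Suc n)" for n
  have r0: "\<rho> n > 0" for n by (simp add: \<rho>_def)
  have lim\<alpha>: "(\<lambda>n. \<integral>\<^sup>+x. ennreal (\<bar>conv \<alpha> (moll (\<rho> n)) x - \<alpha> x\<bar> ^ 2) \<partial>lborel) \<longlonglongrightarrow> 0"
    unfolding \<rho>_def by (rule conv_moll_tendsto[OF _ \<alpha>m \<alpha>fin]) simp
  obtain r :: "nat \<Rightarrow> nat" where r: "strict_mono r"
    and ae: "AE x in lborel. (\<lambda>n. conv \<alpha> (moll (\<rho> (r n))) x - \<alpha> x) \<longlonglongrightarrow> 0"
    by (rule AE_subseq_of_Lq[OF _ _ lim\<alpha>]) auto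
  obtain R where R: "\<And>y. y \<in> D \<Longrightarrow> norm y \<le> R" using D(2) by (auto simp: bounded_iff)
  have \<alpha>R: "\<alpha> y = 0" if "norm y > R" for y using \<alpha>0[of y] R[of y] that by fastforce
  have sc: "smooth_fun (conv \<alpha> (moll (\<rho> n)))" for n by (rule smooth_fun_conv[OF \<alpha>i \<alpha>R smooth_fun_moll])
  define W where "W n x = l + conv \<alpha> (moll (\<rho> (r n))) x" for n x
  have sW: "smooth_fun (W n)" for n unfolding W_def[abs_def] by (intro smooth_fun_add smooth_fun_const sc)
  have gW: "grad (W n) x = grad (conv \<alpha> (moll (\<rho> (r n)))) x" for n x
  proof -
    have "grad (\<lambda>x. l) x = (0::'a)" by (rule grad_eqI) simp
    then show ?thesis unfolding W_def[abs_def] using grad_add[OF smooth_fun_const sc, of l "r n" x] by simp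
  qed
  have Wb: "l \<le> W n x \<and> W n x \<le> L" for n x
  proof -
    have i: "integrable lborel (\<lambda>y. \<alpha> y * moll (\<rho> (r n)) (x - y))"
      by (rule integrable_conv[OF \<alpha>i \<alpha>R smooth_fun_continuous[OF smooth_fun_moll]])
    have "0 \<le> conv \<alpha> (moll (\<rho> (r n))) x"
      unfolding conv_def by (intro integral_nonneg_AE AE_I2 mult_nonneg_nonneg \<alpha>b(1) moll_nonneg[OF r0])
    moreover have "conv \<alpha> (moll (\<rho> (r n))) x \<le> (\<integral>y. (L - l) * moll (\<rho> (r n)) (x - y) \<partial>lborel)"
      unfolding conv_def
      by (intro integral_mono i mult_right_mono \<alpha>b(2) moll_nonneg[OF r0] integrable_mult_right integral_moll(1)[OF r0])
    ultimately show ?thesis using integral_moll(2)[OF r0, of "r n" x] by (simp add: W_def)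
  qed
  have WA: "AE x in lebesgue_on D. (\<lambda>m. W m x) \<longlonglongrightarrow> a x"
  proof -
    have "AE x in lebesgue. (\<lambda>n. conv \<alpha> (moll (\<rho> (r n))) x - \<alpha> x) \<longlonglongrightarrow> 0" using ae by (rule AE_completion)
    then have "AE x in lebesgue_on D. (\<lambda>n. conv \<alpha> (moll (\<rho> (r n))) x - \<alpha> x) \<longlonglongrightarrow> 0"
      using D by (subst AE_restrict_space_iff) (simp, rule eventually_mono, assumption, rule impI)
    then show ?thesis using \<alpha>eq
    proof eventually_elim
      case (elim x)
      have "(\<lambda>n. (conv \<alpha> (moll (\<rho> (r n))) x - \<alpha> x) + (l + \<alpha> x)) \<longlonglongrightarrow> 0 + (l + \<alpha> x)"
        by (intro tendsto_add elim(1) tendsto_const)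
      moreover have "l + \<alpha> x = a x" using elim(2) by simp
      moreover have "(\<lambda>m. W m x) = (\<lambda>n. (conv \<alpha> (moll (\<rho> (r n))) x - \<alpha> x) + (l + \<alpha> x))"
        by (rule ext) (simp add: W_def)
      ultimately show ?case by (simp only: add_0_left)
    qed
  qed
  have "\<forall>i\<in>(Basis::'a set). \<exists>\<gamma>. \<gamma> \<in> borel_measurable borel \<and> (\<forall>x. x \<notin> D \<longrightarrow> \<gamma> x = 0) \<and> (AE x in lebesgue_on D. ?g x \<bullet> i = \<gamma> x)"
  proof
    fix i :: 'a assume "i \<in> Basis"
    have "(\<lambda>x. ?g x \<bullet> i) \<in> borel_measurable (lebesgue_on D)" using L2_measurable[OF p(3)] by simp
    then obtain \<gamma> where "\<gamma> \<in> borel_measurable borel" "\<And>x. x \<notin> D \<Longrightarrow> \<gamma> x = 0" "AE x in lebesgue_on D. ?g x \<bullet> i = \<gamma> x"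
      by (rule borel_representative[OF Db]) (rule that)
    then show "\<exists>\<gamma>. \<gamma> \<in> borel_measurable borel \<and> (\<forall>x. x \<notin> D \<longrightarrow> \<gamma> x = 0) \<and> (AE x in lebesgue_on D. ?g x \<bullet> i = \<gamma> x)"
      by (intro exI[of _ \<gamma>] conjI allI impI)
  qed
  from bchoice[OF this] obtain \<gamma> where \<gamma>': "\<forall>i\<in>(Basis::'a set). \<gamma> i \<in> borel_measurable borel \<and> (\<forall>x. x \<notin> D \<longrightarrow> \<gamma> i x = 0) \<and> (AE x in lebesgue_on D. ?g x \<bullet> i = \<gamma> i x)"
    by (rule exE)
  have \<gamma>: "\<gamma> i \<in> borel_measurable borel" "\<And>x. x \<notin> D \<Longrightarrow> \<gamma> i x = 0" "AE x in lebesgue_on D. ?g x \<bullet> i = \<gamma> i x" if "i \<in> Basis" for i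
    using bspec[OF \<gamma>' that] by simp_all
  define E where "E i n = (\<integral>\<^sup>+x. ennreal (\<bar>conv (\<gamma> i) (moll (\<rho> n)) x - \<gamma> i x\<bar> ^ 2) \<partial>lborel)" for i n
  have limE: "E i \<longlonglongrightarrow> 0" if i: "i \<in> Basis" for i
  proof -
    have "(\<integral>\<^sup>+x. ennreal (\<bar>\<gamma> i x\<bar> ^ 2) \<partial>lborel) = (\<integral>\<^sup>+x. ennreal (\<bar>\<gamma> i x\<bar> ^ 2) * indicator D x \<partial>lborel)"
    proof (rule nn_integral_cong)
      fix x
      show "ennreal (\<bar>\<gamma> i x\<bar> ^ 2) = ennreal (\<bar>\<gamma> i x\<bar> ^ 2) * indicator D x"
        using \<gamma>(2)[OF i, of x] by (cases "x \<in> D") simp_all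
    qed
    also have "\<dots> = (\<integral>\<^sup>+x. ennreal (\<bar>\<gamma> i x\<bar> ^ 2) \<partial>lebesgue_on D)" by (rule nn_integral_lebesgue_on_open[symmetric, OF D(1)])
    also have "\<dots> \<le> (\<integral>\<^sup>+x. ennreal ((norm (?g x))\<^sup>2) \<partial>lebesgue_on D)"
    proof (rule nn_integral_mono_AE)
      show "AE x in lebesgue_on D. ennreal (\<bar>\<gamma> i x\<bar>\<^sup>2) \<le> ennreal ((norm (?g x))\<^sup>2)"
        using \<gamma>(3)[OF i]
      proof eventually_elim
        case (elim x)
        have "\<bar>?g x \<bullet> i\<bar> \<le> norm (?g x)" by (rule Basis_le_norm[OF i])
        then show ?case unfolding elim by (intro ennreal_leI power_mono) auto
      qed
    qed
    also have "\<dots> < \<infinity>" using p(3) by (simp add: L2_iff)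
    finally have fin: "(\<integral>\<^sup>+x. ennreal (\<bar>\<gamma> i x\<bar> ^ 2) \<partial>lborel) < \<infinity>" .
    show ?thesis unfolding E_def[abs_def] \<rho>_def by (rule conv_moll_tendsto[OF _ \<gamma>(1)[OF i] fin]) simp
  qed
  have WK: "(\<lambda>m. l2 K (\<lambda>x. grad (W m) x - ?g x)) \<longlonglongrightarrow> 0" if K: "compact K" "K \<subseteq> D" for K
  proof -
    have Km: "K \<in> sets lebesgue" "D \<in> sets lebesgue" using compact_in_lebesgue[OF K(1)] D by auto
    have KD: "K \<subseteq> \<Union>{D}" using K by simp
    have op: "open G" if "G \<in> {D}" for G using that D(1) by simp
    \<comment> \<open>A Lebesgue number of the cover of \<open>K\<close> by the single set
      \<open>D\<close>: for scales below \<open>d\<close> the commutation of mollification and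
      gradient holds at every point of \<open>K\<close>.\<close>
    obtain d where d: "d > 0" "\<And>x. x \<in> K \<Longrightarrow> \<exists>G\<in>{D}. ball x d \<subseteq> G"
      by (rule Heine_Borel_lemma[OF K(1) KD op]) (assumption, rule that)
    have LG: "L2 K (\<lambda>x. grad (W m) x - ?g x)" for m
      by (rule L2_diff[OF L2_continuous_compact[OF continuous_on_grad[OF sW] K(1)] L2_subset[OF p(3) K(2) Km]])
    have AEK: "AE x in lebesgue_on K. P x" if "AE x in lebesgue_on D. P x" for P
    proof -
      have "AE x in lebesgue. x \<in> D \<longrightarrow> P x" using that Km by (subst (asm) AE_restrict_space_iff) simp_all
      then have "AE x in lebesgue. x \<in> K \<longrightarrow> P x" by eventually_elim (use K(2) in blast)
      then show ?thesis using Km by (subst AE_restrict_space_iff) simp_all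
    qed
    have bound: "ennreal ((l2 K (\<lambda>x. grad (W m) x - ?g x))\<^sup>2) \<le> (\<Sum>i\<in>(Basis::'a set). E i (r m))" if m: "\<rho> (r m) < d" for m
    proof -
      have gradeq: "grad (W m) x \<bullet> i = conv (\<gamma> i) (moll (\<rho> (r m))) x" if "x \<in> K" "i \<in> Basis" for x i
      proof -
        have "ball x d \<subseteq> D" using d(2)[OF that(1)] by simp
        then have sub: "cball x (\<rho> (r m)) \<subseteq> D" using m by (auto simp: subset_eq)
        show ?thesis unfolding gW
          by (rule grad_conv_moll_weak[OF D p(2) L2_measurable[OF p(3)] L2_measurable[OF p(1)] \<alpha>m \<alpha>0 \<alpha>i \<alpha>eq that(2) \<gamma>(1)[OF that(2)] \<gamma>(2)[OF that(2)] \<gamma>(3)[OF that(2)] r0 sub])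
      qed
      have g2: "AE x in lebesgue_on K. \<forall>i\<in>Basis. ?g x \<bullet> i = \<gamma> i x"
        by (rule AE_finite_allI[OF finite_Basis]) (rule AEK[OF \<gamma>(3)])
      have "ennreal ((l2 K (\<lambda>x. grad (W m) x - ?g x))\<^sup>2) = (\<integral>\<^sup>+x. ennreal ((norm (grad (W m) x - ?g x))\<^sup>2) \<partial>lebesgue_on K)"
        by (rule L2_nn_integral[symmetric, OF LG])
      also have "\<dots> = (\<integral>\<^sup>+x. (\<Sum>i\<in>(Basis::'a set). ennreal (\<bar>conv (\<gamma> i) (moll (\<rho> (r m))) x - \<gamma> i x\<bar> ^ 2)) \<partial>lebesgue_on K)"
      proof (rule nn_integral_cong_AE)
        show "AE x in lebesgue_on K. ennreal ((norm (grad (W m) x - ?g x))\<^sup>2) =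
           (\<Sum>i\<in>(Basis::'a set). ennreal (\<bar>conv (\<gamma> i) (moll (\<rho> (r m))) x - \<gamma> i x\<bar> ^ 2))"
          using g2 AE_in_lebesgue_on[of K]
        proof eventually_elim
          case (elim x)
          have "(norm (grad (W m) x - ?g x))\<^sup>2 = (\<Sum>i\<in>Basis. ((grad (W m) x - ?g x) \<bullet> i)\<^sup>2)"
            unfolding power2_norm_eq_inner by (subst euclidean_inner) (simp add: power2_eq_square)
          also have "\<dots> = (\<Sum>i\<in>Basis. \<bar>conv (\<gamma> i) (moll (\<rho> (r m))) x - \<gamma> i x\<bar> ^ 2)"
            using elim by (intro sum.cong refl) (simp add: inner_diff_left gradeq)
          finally show ?case by (simp add: sum_ennreal)
        qed
      qed
      also have "\<dots> \<le> (\<integral>\<^sup>+x. (\<Sum>i\<in>(Basis::'a set). ennreal (\<bar>conv (\<gamma> i) (moll (\<rho> (r m))) x - \<gamma> i x\<bar> ^ 2)) \<partial>lborel)"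
      proof -
        have "K \<inter> space lebesgue \<in> sets lebesgue" using Km by simp
        then have "(\<integral>\<^sup>+x. (\<Sum>i\<in>(Basis::'a set). ennreal (\<bar>conv (\<gamma> i) (moll (\<rho> (r m))) x - \<gamma> i x\<bar> ^ 2)) \<partial>lebesgue_on K) = (\<integral>\<^sup>+x. (\<Sum>i\<in>(Basis::'a set). ennreal (\<bar>conv (\<gamma> i) (moll (\<rho> (r m))) x - \<gamma> i x\<bar> ^ 2)) * indicator K x \<partial>lebesgue)"
          by (rule nn_integral_restrict_space)
        also have "\<dots> \<le> (\<integral>\<^sup>+x. (\<Sum>i\<in>(Basis::'a set). ennreal (\<bar>conv (\<gamma> i) (moll (\<rho> (r m))) x - \<gamma> i x\<bar> ^ 2)) \<partial>lebesgue)"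
          by (rule nn_integral_mono) (simp split: split_indicator)
        also have "\<dots> = (\<integral>\<^sup>+x. (\<Sum>i\<in>(Basis::'a set). ennreal (\<bar>conv (\<gamma> i) (moll (\<rho> (r m))) x - \<gamma> i x\<bar> ^ 2)) \<partial>lborel)" by (rule nn_integral_completion)
        finally show ?thesis .
      qed
      also have "\<dots> = (\<Sum>i\<in>(Basis::'a set). E i (r m))"
        unfolding E_def
      proof (rule nn_integral_sum)
        fix i :: 'a assume "i \<in> Basis"
        then have [measurable]: "\<gamma> i \<in> borel_measurable borel" by (rule \<gamma>(1))
        show "(\<lambda>x. ennreal (\<bar>conv (\<gamma> i) (moll (\<rho> (r m))) x - \<gamma> i x\<bar> ^ 2)) \<in> borel_measurable lborel"
          unfolding conv_def by measurable
      qed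
      finally show ?thesis .
    qed
    have "(\<lambda>m. \<Sum>i\<in>(Basis::'a set). E i (r m)) \<longlonglongrightarrow> (\<Sum>i\<in>(Basis::'a set). 0)"
      by (intro tendsto_sum LIMSEQ_subseq_LIMSEQ[OF limE r, unfolded comp_def])
    then have up: "(\<lambda>m. \<Sum>i\<in>(Basis::'a set). E i (r m)) \<longlonglongrightarrow> 0" by simp
    have "\<rho> \<longlonglongrightarrow> 0" unfolding \<rho>_def[abs_def] using LIMSEQ_Suc[OF lim_1_over_n] by simp
    from LIMSEQ_subseq_LIMSEQ[OF this r] have "(\<lambda>m. \<rho> (r m)) \<longlonglongrightarrow> 0" by (simp add: comp_def)
    then have ev: "\<forall>\<^sub>F m in sequentially. \<rho> (r m) < d" using d(1) by (rule order_tendstoD(2))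
    have "(\<lambda>m. ennreal ((l2 K (\<lambda>x. grad (W m) x - ?g x))\<^sup>2)) \<longlonglongrightarrow> 0"
    proof (rule tendsto_sandwich[OF _ _ tendsto_const up])
      show "\<forall>\<^sub>F m in sequentially. 0 \<le> ennreal ((l2 K (\<lambda>x. grad (W m) x - ?g x))\<^sup>2)" by simp
      show "\<forall>\<^sub>F m in sequentially. ennreal ((l2 K (\<lambda>x. grad (W m) x - ?g x))\<^sup>2) \<le> (\<Sum>i\<in>(Basis::'a set). E i (r m))"
        using ev by eventually_elim (rule bound)
    qed
    then have "(\<lambda>m. ennreal ((l2 K (\<lambda>x. grad (W m) x - ?g x))\<^sup>2)) \<longlonglongrightarrow> ennreal 0" by simp
    then have "(\<lambda>m. (l2 K (\<lambda>x. grad (W m) x - ?g x))\<^sup>2) \<longlonglongrightarrow> 0"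
      by (subst (asm) tendsto_ennreal_iff) auto
    from tendsto_real_sqrt[OF this] show ?thesis by (simp add: l2_nonneg)
  qed
  show ?thesis unfolding H1_approx_def
    by (intro exI[of _ W] conjI allI impI sW Wb[THEN conjunct1] Wb[THEN conjunct2] WA) (rule WK, auto)
qed

text \<open>The quotient rule gives the gradient (b/a^2) grad a - (1/a) grad b, with coefficients
  bounded by L/l^2 and 1/l. It is first formed for smooth approximations of \<open>a\<close> and
  \<open>b\<close> that respect the bounds, and then passed to the limit.\<close>

lemma multiplier_H1_quotient:
  fixes a b :: "'a::euclidean_space \<Rightarrow> real"
  assumes D: "open D" "bounded D" and ab: "a \<in> H1_space D" "b \<in> H1_space D" and l: "0 < l" "l \<le> L"
    and al: "AE x in lebesgue_on D. l \<le> a x \<and> a x \<le> L" and bl: "AE x in lebesgue_on D. l \<le> b x \<and> b x \<le> L"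
  shows "\<exists>p. multiplier D (\<lambda>x. 1 - b x / a x) p \<and> l2 D p \<le> (L / l\<^sup>2 + 1 / l) * (l2 D (weak_grad D a) + l2 D (weak_grad D b))"
proof -
  let ?ga = "weak_grad D a" and ?gb = "weak_grad D b"
  obtain Wa where "H1_approx D a ?ga l L Wa" using H1_approx_exists[OF D ab(1) al l(2)] by (rule exE)
  then have Wa: "\<And>m. smooth_fun (Wa m)" "\<And>m x. l \<le> Wa m x \<and> Wa m x \<le> L" "AE x in lebesgue_on D. (\<lambda>m. Wa m x) \<longlonglongrightarrow> a x"
     "\<And>K. compact K \<Longrightarrow> K \<subseteq> D \<Longrightarrow> (\<lambda>m. l2 K (\<lambda>x. grad (Wa m) x - ?ga x)) \<longlonglongrightarrow> 0"
    by (simp_all add: H1_approx_def)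
  obtain Wb where "H1_approx D b ?gb l L Wb" using H1_approx_exists[OF D ab(2) bl l(2)] by (rule exE)
  then have Wb: "\<And>m. smooth_fun (Wb m)" "\<And>m x. l \<le> Wb m x \<and> Wb m x \<le> L" "AE x in lebesgue_on D. (\<lambda>m. Wb m x) \<longlonglongrightarrow> b x"
     "\<And>K. compact K \<Longrightarrow> K \<subseteq> D \<Longrightarrow> (\<lambda>m. l2 K (\<lambda>x. grad (Wb m) x - ?gb x)) \<longlonglongrightarrow> 0"
    by (simp_all add: H1_approx_def)
  note pa = weak_grad_props[OF D(1) ab(1)] and pb = weak_grad_props[OF D(1) ab(2)]
  note [measurable] = L2_measurable[OF pa(1)] L2_measurable[OF pa(3)] L2_measurable[OF pb(1)] L2_measurable[OF pb(3)]
  define W where "W m x = 1 - Wb m x * inverse (Wa m x)" for m x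
  define ca where "ca m x = Wb m x * (inverse (Wa m x))\<^sup>2" for m x
  define cb where "cb m x = - inverse (Wa m x)" for m x
  define p where "p x = (b x * (inverse (a x))\<^sup>2) *\<^sub>R ?ga x + (- inverse (a x)) *\<^sub>R ?gb x" for x
  have Wa0: "0 < Wa m x" "Wa m x \<noteq> 0" for m x using Wa(2)[of m x] l(1) by auto
  have inv: "0 < inverse (Wa m x)" "inverse (Wa m x) \<le> inverse l" for m x
    using Wa(2)[of m x] l(1) Wa0(1)[of m x] by (auto intro!: le_imp_inverse_le)
  have si: "smooth_fun (\<lambda>x. inverse (Wa m x))" for m by (rule smooth_fun_inverse[OF Wa(1) Wa0(2)])
  have sW: "smooth_fun (W m)" for m
    unfolding W_def[abs_def] by (intro smooth_fun_diff smooth_fun_const smooth_fun_mult Wb(1) si)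
  have gW: "grad (W m) x = ca m x *\<^sub>R grad (Wa m) x + cb m x *\<^sub>R grad (Wb m) x" for m x
  proof (rule grad_eqI)
    have "((\<lambda>x. inverse (Wa m x)) has_derivative (\<lambda>h. - (inverse (Wa m x) * (grad (Wa m) x \<bullet> h) * inverse (Wa m x)))) (at x)"
      by (rule Deriv.has_derivative_inverse[OF Wa0(2) smooth_fun_has_grad[OF Wa(1)]])
    from has_derivative_mult[OF smooth_fun_has_grad[OF Wb(1), of m] this]
    have "((\<lambda>x. 1 - Wb m x * inverse (Wa m x)) has_derivative (\<lambda>h. 0 - (Wb m x * - (inverse (Wa m x) * (grad (Wa m) x \<bullet> h) * inverse (Wa m x)) + (grad (Wb m) x \<bullet> h) * inverse (Wa m x)))) (at x)"
      by (intro has_derivative_diff has_derivative_const)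
    then show "(W m has_derivative (\<lambda>v. (ca m x *\<^sub>R grad (Wa m) x + cb m x *\<^sub>R grad (Wb m) x) \<bullet> v)) (at x)"
      unfolding W_def[abs_def] by (simp add: ca_def cb_def inner_add_left power2_eq_square algebra_simps)
  qed
  have L0: "L > 0" using l by linarith
  have caB: "\<bar>ca m x\<bar> \<le> L * (inverse l)\<^sup>2" for m x
  proof -
    have "0 \<le> Wb m x" "Wb m x \<le> L" using Wb(2)[of m x] l by auto
    moreover have "(inverse (Wa m x))\<^sup>2 \<le> (inverse l)\<^sup>2" using inv by (intro power_mono) (auto simp: less_imp_le)
    ultimately show ?thesis unfolding ca_def abs_mult using L0 by (intro mult_mono) auto
  qed
  have cbB: "\<bar>cb m x\<bar> \<le> inverse l" for m x unfolding cb_def using inv[of m x] by simp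
  have lims: "AE x in lebesgue_on D. (\<lambda>m. ca m x) \<longlonglongrightarrow> b x * (inverse (a x))\<^sup>2" "AE x in lebesgue_on D. (\<lambda>m. cb m x) \<longlonglongrightarrow> - inverse (a x)"
     "AE x in lebesgue_on D. (\<lambda>m. W m x) \<longlonglongrightarrow> 1 - b x / a x"
  proof -
    have nz: "AE x in lebesgue_on D. a x \<noteq> 0" using al by eventually_elim (use l in auto)
    show "AE x in lebesgue_on D. (\<lambda>m. ca m x) \<longlonglongrightarrow> b x * (inverse (a x))\<^sup>2"
      using Wa(3) Wb(3) nz unfolding ca_def by eventually_elim (intro tendsto_intros)
    show "AE x in lebesgue_on D. (\<lambda>m. cb m x) \<longlonglongrightarrow> - inverse (a x)"
      using Wa(3) nz unfolding cb_def by eventually_elim (intro tendsto_intros)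
    show "AE x in lebesgue_on D. (\<lambda>m. W m x) \<longlonglongrightarrow> 1 - b x / a x"
      using Wa(3) Wb(3) nz unfolding W_def divide_inverse by eventually_elim (intro tendsto_intros)
  qed
  have WB: "\<bar>W m x\<bar> \<le> 1 + L * inverse l" for m x
  proof -
    have "0 \<le> Wb m x" "Wb m x \<le> L" using Wb(2)[of m x] l by auto
    then have "\<bar>Wb m x * inverse (Wa m x)\<bar> \<le> L * inverse l" unfolding abs_mult using inv[of m x] L0 by (intro mult_mono) auto
    then show ?thesis unfolding W_def by linarith
  qed
  have mc: "ca m \<in> borel_measurable (lebesgue_on K)" "cb m \<in> borel_measurable (lebesgue_on K)" for m K
  proof -
    have "continuous_on UNIV (ca m)" "continuous_on UNIV (cb m)"
      unfolding ca_def[abs_def] cb_def[abs_def]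
      by (intro continuous_intros smooth_fun_continuous[OF si] smooth_fun_continuous[OF Wb(1)])+
    then show "ca m \<in> borel_measurable (lebesgue_on K)" "cb m \<in> borel_measurable (lebesgue_on K)"
      by (auto intro: continuous_measurable_lebesgue_on)
  qed
  have Ca: "AE x in lebesgue_on D. \<bar>b x * (inverse (a x))\<^sup>2\<bar> \<le> L / l\<^sup>2" "AE x in lebesgue_on D. \<bar>- inverse (a x)\<bar> \<le> 1 / l"
  proof -
    show "AE x in lebesgue_on D. \<bar>b x * (inverse (a x))\<^sup>2\<bar> \<le> L / l\<^sup>2"
      using al bl
    proof eventually_elim
      case (elim x)
      have "inverse (a x) \<le> inverse l" "0 \<le> inverse (a x)" using elim l by (auto intro!: le_imp_inverse_le)
      then have "(inverse (a x))\<^sup>2 \<le> (inverse l)\<^sup>2" by (intro power_mono)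
      then have "\<bar>b x\<bar> * \<bar>(inverse (a x))\<^sup>2\<bar> \<le> L * (inverse l)\<^sup>2" using elim l by (intro mult_mono) auto
      then show ?case by (simp add: abs_mult divide_inverse power_inverse)
    qed
    show "AE x in lebesgue_on D. \<bar>- inverse (a x)\<bar> \<le> 1 / l"
      using al
    proof eventually_elim
      case (elim x)
      have "inverse (a x) \<le> inverse l" "0 \<le> inverse (a x)" using elim l by (auto intro!: le_imp_inverse_le)
      then show ?case by (simp add: divide_inverse)
    qed
  qed
  have Lp1: "L2 D (\<lambda>x. (b x * (inverse (a x))\<^sup>2) *\<^sub>R ?ga x)" "l2 D (\<lambda>x. (b x * (inverse (a x))\<^sup>2) *\<^sub>R ?ga x) \<le> L / l\<^sup>2 * l2 D ?ga"
    using L2_scaleR_bounded[OF pa(3) _ Ca(1)] L0 by auto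
  have Lp2: "L2 D (\<lambda>x. (- inverse (a x)) *\<^sub>R ?gb x)" "l2 D (\<lambda>x. (- inverse (a x)) *\<^sub>R ?gb x) \<le> 1 / l * l2 D ?gb"
    using L2_scaleR_bounded[OF pb(3) _ Ca(2)] l(1) by auto
  have Lp: "L2 D p" unfolding p_def[abs_def] by (rule L2_add[OF Lp1(1) Lp2(1)])
  have lp: "l2 D p \<le> (L / l\<^sup>2 + 1 / l) * (l2 D ?ga + l2 D ?gb)"
  proof -
    have "l2 D p \<le> L / l\<^sup>2 * l2 D ?ga + 1 / l * l2 D ?gb"
      using l2_triangle[OF Lp1(1) Lp2(1)] Lp1(2) Lp2(2) unfolding p_def[abs_def] by linarith
    moreover have "0 \<le> L / l\<^sup>2 * l2 D ?gb" "0 \<le> 1 / l * l2 D ?ga" 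
      using L0 l(1) by (intro mult_nonneg_nonneg divide_nonneg_nonneg l2_nonneg zero_le_power; simp)+
    ultimately show ?thesis by (simp add: algebra_simps)
  qed
  have WK: "(\<lambda>m. l2 K (\<lambda>x. grad (W m) x - p x)) \<longlonglongrightarrow> 0" if K: "compact K" "K \<subseteq> D" for K
  proof -
    have Km: "K \<in> sets lebesgue" "D \<in> sets lebesgue" using compact_in_lebesgue[OF K(1)] D by auto
    have AEK: "AE x in lebesgue_on K. P x" if "AE x in lebesgue_on D. P x" for P
    proof -
      have "AE x in lebesgue. x \<in> D \<longrightarrow> P x" using that Km by (subst (asm) AE_restrict_space_iff) simp_all
      then have "AE x in lebesgue. x \<in> K \<longrightarrow> P x" by eventually_elim (use K(2) in blast)
      then show ?thesis using Km by (subst AE_restrict_space_iff) simp_all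
    qed
    have sub: "f \<in> borel_measurable (lebesgue_on K)" if "f \<in> borel_measurable (lebesgue_on D)" for f :: "'a \<Rightarrow> real"
      by (rule measurable_restrict_mono[OF that K(2)])
    have LWa: "L2 K (grad (Wa m))" "L2 K (grad (Wb m))" for m
      by (rule L2_continuous_compact[OF continuous_on_grad[OF Wa(1)] K(1)], rule L2_continuous_compact[OF continuous_on_grad[OF Wb(1)] K(1)])
    have mab: "(\<lambda>x. b x * (inverse (a x))\<^sup>2) \<in> borel_measurable (lebesgue_on K)" "(\<lambda>x. - inverse (a x)) \<in> borel_measurable (lebesgue_on K)"
    proof -
      have "(\<lambda>x. b x * (inverse (a x))\<^sup>2) \<in> borel_measurable (lebesgue_on D)" "(\<lambda>x. - inverse (a x)) \<in> borel_measurable (lebesgue_on D)"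
        by measurable
      from sub[OF this(1)] sub[OF this(2)]
      show "(\<lambda>x. b x * (inverse (a x))\<^sup>2) \<in> borel_measurable (lebesgue_on K)" "(\<lambda>x. - inverse (a x)) \<in> borel_measurable (lebesgue_on K)" .
    qed
    have l1: "(\<lambda>m. l2 K (\<lambda>x. ca m x *\<^sub>R grad (Wa m) x - (b x * (inverse (a x))\<^sup>2) *\<^sub>R ?ga x)) \<longlonglongrightarrow> 0"
      by (rule l2_product_limit(1)[OF L2_subset[OF pa(3) K(2) Km] LWa(1) Wa(4)[OF K] mc(1) mab(1) caB AEK[OF lims(1)]])
    have l2: "(\<lambda>m. l2 K (\<lambda>x. cb m x *\<^sub>R grad (Wb m) x - (- inverse (a x)) *\<^sub>R ?gb x)) \<longlonglongrightarrow> 0"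
      by (rule l2_product_limit(1)[OF L2_subset[OF pb(3) K(2) Km] LWa(2) Wb(4)[OF K] mc(2) mab(2) cbB AEK[OF lims(2)]])
    have T1: "L2 K (\<lambda>x. ca m x *\<^sub>R grad (Wa m) x - (b x * (inverse (a x))\<^sup>2) *\<^sub>R ?ga x)" for m
      by (intro L2_diff L2_scaleR_bounded(1)[OF LWa(1) mc(1) AE_lebesgue_on_I[OF caB]] L2_subset[OF Lp1(1) K(2) Km])
    have T2: "L2 K (\<lambda>x. cb m x *\<^sub>R grad (Wb m) x - (- inverse (a x)) *\<^sub>R ?gb x)" for m
      by (intro L2_diff L2_scaleR_bounded(1)[OF LWa(2) mc(2) AE_lebesgue_on_I[OF cbB]] L2_subset[OF Lp2(1) K(2) Km])
    have eq: "grad (W m) x - p x = (ca m x *\<^sub>R grad (Wa m) x - (b x * (inverse (a x))\<^sup>2) *\<^sub>R ?ga x) + (cb m x *\<^sub>R grad (Wb m) x - (- inverse (a x)) *\<^sub>R ?gb x)" for m x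
      unfolding gW p_def by (simp only: add_diff_add)
    have le: "l2 K (\<lambda>x. grad (W m) x - p x) \<le> l2 K (\<lambda>x. ca m x *\<^sub>R grad (Wa m) x - (b x * (inverse (a x))\<^sup>2) *\<^sub>R ?ga x) + l2 K (\<lambda>x. cb m x *\<^sub>R grad (Wb m) x - (- inverse (a x)) *\<^sub>R ?gb x)" for m
      unfolding eq by (rule l2_triangle[OF T1 T2])
    from tendsto_add[OF l1 l2] have up: "(\<lambda>m. l2 K (\<lambda>x. ca m x *\<^sub>R grad (Wa m) x - (b x * (inverse (a x))\<^sup>2) *\<^sub>R ?ga x) + l2 K (\<lambda>x. cb m x *\<^sub>R grad (Wb m) x - (- inverse (a x)) *\<^sub>R ?gb x)) \<longlonglongrightarrow> 0"
      by simp
    show ?thesis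
      by (rule tendsto_sandwich[OF always_eventually[OF allI[OF l2_nonneg]] always_eventually[OF allI[OF le]] tendsto_const up])
  qed
  have "multiplier D (\<lambda>x. 1 - b x / a x) p"
    unfolding multiplier_def
  proof (intro conjI exI[of _ W] exI[of _ "1 + L * inverse l"] allI ballI impI)
    show "(\<lambda>x. 1 - b x / a x) \<in> borel_measurable (lebesgue_on D)" by measurable
    show "L2 D p" by (rule Lp)
    show "smooth_fun (W m)" for m by (rule sW)
    show "\<bar>W m x\<bar> \<le> 1 + L * inverse l" for m x by (rule WB)
    show "AE x in lebesgue_on D. (\<lambda>m. W m x) \<longlonglongrightarrow> 1 - b x / a x" by (rule lims(3))
    show "(\<lambda>m. l2 K (\<lambda>x. grad (W m) x - p x)) \<longlonglongrightarrow> 0" if "compact K \<and> K \<subseteq> D" for K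
      using WK that by simp
  qed
  then show ?thesis using lp by (intro exI[of _ p] conjI)
qed

section \<open>Cutoff functions and the size of sublevel sets\<close>

lemma near_point_in_domain:
  fixes x y :: "'a::euclidean_space"
  assumes y: "y \<in> D" and far: "\<And>q. q \<in> frontier D \<Longrightarrow> \<sigma> \<le> dist y q" and xy: "dist x y < \<sigma>"
  shows "x \<in> D"
proof (rule ccontr)
  assume x: "x \<notin> D"
  have s: "0 < \<sigma>" using xy zero_le_dist[of x y] by linarith
  \<comment> \<open>A connected set that meets both \<open>D\<close> and its complement meets the
    frontier.\<close>
  have "ball y \<sigma> \<inter> frontier D \<noteq> {}"
  proof (rule connected_Int_frontier)
    show "connected (ball y \<sigma>)" by (rule connected_ball)
    have "y \<in> ball y \<sigma> \<inter> D" using y s by simp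
    then show "ball y \<sigma> \<inter> D \<noteq> {}" by (rule ex_in_conv[THEN iffD1, OF exI])
    have "x \<in> ball y \<sigma> - D" using x xy by (simp add: dist_commute)
    then show "ball y \<sigma> - D \<noteq> {}" by (rule ex_in_conv[THEN iffD1, OF exI])
  qed
  then obtain q where "q \<in> ball y \<sigma>" "q \<in> frontier D" by auto
  then show False using far[of q] by simp
qed

text \<open>The indicator of the points of \<open>D\<close> at distance at least 2 \<rho> from the
  frontier is mollified at scale \<open>\<rho>\<close>. The result vanishes closer than \<rho> to
  the frontier, equals 1 from distance 3 \<rho> on, and has zero gradient from distance 4 \<rho> on.
  A gradient of size M/\<rho> on a layer of measure at most 4 C \<rho> has squared norm at most 4
  M^2 C/\<rho>.\<close>

lemma cutoff_exists:
  fixes D :: "'a::euclidean_space set"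
  assumes D: "open D" "bounded D" and C: "C > 0" and layer: "\<forall>\<rho>>0. emeasure lborel {x \<in> D. \<exists>q\<in>frontier D. dist x q < \<rho>} \<le> ennreal (C * \<rho>)"
  shows "\<exists>C'>0. \<forall>\<rho>>0. \<exists>\<eta>. test_function D \<eta> \<and> (\<forall>x\<in>D. (\<forall>q\<in>frontier D. 3 * \<rho> \<le> dist x q) \<longrightarrow> \<eta> x = 1) \<and>
     (l2 D (grad \<eta>))\<^sup>2 \<le> C' / \<rho>"
proof -
  obtain C1 where C1: "C1 > 0" "\<And>\<rho> z. \<rho> > 0 \<Longrightarrow> norm (grad (moll \<rho>) (z::'a)) \<le> C1 / \<rho> ^ (DIM('a) + 1)"
    "\<And>\<rho> z. \<rho> > 0 \<Longrightarrow> norm z > \<rho> \<Longrightarrow> grad (moll \<rho>) (z::'a) = 0"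
    by (rule grad_moll_bound[where 'a = 'a]) (rule that)
  define V where "V = unit_ball_vol (real DIM('a))"
  have V: "V > 0" unfolding V_def by simp
  define M where "M = real DIM('a) * (C1 * V)"
  have M: "M > 0" unfolding M_def using C1 V by simp
  have main: "\<exists>\<eta>. test_function D \<eta> \<and> (\<forall>x\<in>D. (\<forall>q\<in>frontier D. 3 * \<rho> \<le> dist x q) \<longrightarrow> \<eta> x = 1) \<and>
     (l2 D (grad \<eta>))\<^sup>2 \<le> (M\<^sup>2 * C * 4) / \<rho>" if r: "\<rho> > 0" for \<rho>
  proof -
    define A where "A = D - (\<Union>q\<in>frontier D. ball q (2 * \<rho>))"
    have A_iff: "y \<in> A \<longleftrightarrow> y \<in> D \<and> (\<forall>q\<in>frontier D. 2 * \<rho> \<le> dist y q)" for y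
      by (auto simp: A_def not_less dist_commute)
    have Am: "A \<in> sets borel" unfolding A_def using D by (intro sets.Diff borel_open open_UN ballI open_ball)
    define K where "K = closure D \<inter> - (\<Union>q\<in>frontier D. ball q \<rho>)"
    have Kc: "compact K" unfolding K_def using D(2) by (intro closed_Int_compact compact_Int_closed) (auto intro: closed_Compl)
    have KD: "K \<subseteq> D"
    proof
      fix x assume x: "x \<in> K"
      show "x \<in> D"
      proof (rule ccontr)
        assume "x \<notin> D"
        then have "x \<in> frontier D" using x D(1) by (auto simp: K_def frontier_def interior_open)
        then show False using x r by (auto simp: K_def)
      qed
    qed
    have iA: "integrable lborel (indicat_real A)"
      using emeasure_bounded_finite[of A] bounded_subset[OF D(2), of A] Am
      by (intro integrable_real_indicator) (auto simp: A_def)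
    obtain R where R: "\<And>y. y \<in> D \<Longrightarrow> norm y \<le> R" using D(2) by (auto simp: bounded_iff)
    have A0: "indicat_real A y = 0" if "norm y > R" for y using R[of y] that by (auto simp: A_def indicator_def)
    define \<eta> where "\<eta> = conv (indicat_real A) (moll \<rho>)"
    have s: "smooth_fun \<eta>" unfolding \<eta>_def by (rule smooth_fun_conv[OF iA A0 smooth_fun_moll])
    have \<eta>0: "\<eta> x = 0" if x: "x \<notin> K" for x
    proof -
      have "indicat_real A y * moll \<rho> (x - y) = 0" for y
      proof (rule ccontr)
        assume nz: "indicat_real A y * moll \<rho> (x - y) \<noteq> 0"
        then have y: "y \<in> A" by (auto simp: indicator_def split: if_splits)
        have d: "dist x y < \<rho>" using nz moll_zero[OF r, of "x - y"] by (auto simp: dist_norm not_less[symmetric])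
        have yD: "y \<in> D" and far: "\<And>q. q \<in> frontier D \<Longrightarrow> 2 * \<rho> \<le> dist y q" using y by (auto simp: A_iff)
        have xD: "x \<in> D" by (rule near_point_in_domain[OF yD far]) (use d r in auto)
        have "\<rho> \<le> dist x q" if "q \<in> frontier D" for q
          using far[OF that] dist_triangle[of y q x] d by (simp add: dist_commute)
        then have "x \<in> K" unfolding K_def using xD closure_subset[of D] by (auto simp: not_less dist_commute)
        then show False using x by simp
      qed
      then have "(\<integral>y. indicat_real A y * moll \<rho> (x - y) \<partial>lborel) = (\<integral>y. 0 \<partial>(lborel :: 'a measure))"
        by (intro Bochner_Integration.integral_cong[OF refl])
      then show ?thesis unfolding \<eta>_def conv_def by simp
    qed
    have t: "test_function D \<eta>" by (rule test_functionI[OF s Kc KD \<eta>0])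
    have \<eta>1: "\<eta> x = 1" if x: "x \<in> D" and far: "\<And>q. q \<in> frontier D \<Longrightarrow> 3 * \<rho> \<le> dist x q" for x
    proof -
      have "indicat_real A y * moll \<rho> (x - y) = moll \<rho> (x - y)" for y
      proof (cases "dist y x < \<rho>")
        case True
        have yD: "y \<in> D" by (rule near_point_in_domain[OF x far]) (use True r in auto)
        have "2 * \<rho> \<le> dist y q" if "q \<in> frontier D" for q
          using far[OF that] dist_triangle[of x q y] True by (simp add: dist_commute)
        then show ?thesis using yD by (simp add: A_iff)
      next
        case False
        then have "moll \<rho> (x - y) = 0" by (intro moll_zero[OF r]) (simp add: dist_norm norm_minus_commute)
        then show ?thesis by simp
      qed
      then have "(\<integral>y. indicat_real A y * moll \<rho> (x - y) \<partial>lborel) = (\<integral>y. moll \<rho> (x - y) \<partial>lborel)"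
        by (intro Bochner_Integration.integral_cong[OF refl])
      then show ?thesis unfolding \<eta>_def conv_def using integral_moll(2)[OF r, of x] by simp
    qed
    have g0: "grad \<eta> x = 0" if x: "x \<in> D" and far: "\<And>q. q \<in> frontier D \<Longrightarrow> 4 * \<rho> \<le> dist x q" for x
    proof -
      have one: "\<eta> y = 1" if "y \<in> ball x \<rho>" for y
      proof (rule \<eta>1)
        show "y \<in> D" by (rule near_point_in_domain[OF x far]) (use that r in \<open>auto simp: dist_commute\<close>)
        show "3 * \<rho> \<le> dist y q" if q: "q \<in> frontier D" for q
          using far[OF q] dist_triangle[of x q y] \<open>y \<in> ball x \<rho>\<close> by simp
      qed
      have "(\<eta> has_derivative (\<lambda>v. 0 \<bullet> v)) (at x)"
      proof (rule has_derivative_transform_within_open[OF _ open_ball[of x \<rho>]])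
        show "((\<lambda>x. 1) has_derivative (\<lambda>v. 0 \<bullet> v)) (at x)" by simp
      qed (use r one in auto)
      then show ?thesis by (rule grad_eqI)
    qed
    have gB: "norm (grad \<eta> x) \<le> M / \<rho>" for x
    proof -
      have "\<bar>grad \<eta> x \<bullet> i\<bar> \<le> C1 * V / \<rho>" if i: "i \<in> Basis" for i
      proof -
        have "grad \<eta> x \<bullet> i = conv (indicat_real A) (\<lambda>z. frechet_derivative (moll \<rho>) (at z) i) x"
          unfolding grad_inner_Basis[OF i] \<eta>_def by (rule partial_conv[OF iA A0 smooth_fun_moll i])
        also have "\<bar>\<dots>\<bar> \<le> (\<integral>y. C1 / \<rho> ^ (DIM('a) + 1) * indicator (cball x \<rho>) y \<partial>lborel)"
          unfolding conv_def
        proof (rule abs_integral_le_integral)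
          show "integrable lborel (\<lambda>y. C1 / \<rho> ^ (DIM('a) + 1) * indicat_real (cball x \<rho>) y)"
            using emeasure_lborel_cball_finite[of x \<rho>] by (intro integrable_mult_right integrable_real_indicator) auto
          fix y
          have "\<bar>frechet_derivative (moll \<rho>) (at (x - y)) i\<bar> \<le> C1 / \<rho> ^ (DIM('a) + 1) * indicator (cball x \<rho>) y"
          proof (cases "y \<in> cball x \<rho>")
            case True
            have "\<bar>grad (moll \<rho>) (x - y) \<bullet> i\<bar> \<le> norm (grad (moll \<rho>) (x - y))" by (rule Basis_le_norm[OF i])
            then show ?thesis using C1(2)[OF r, of "x - y"] True by (simp add: grad_inner_Basis[OF i])
          next
            case False
            then have "grad (moll \<rho>) (x - y) = 0" by (intro C1(3)[OF r]) (simp add: dist_norm)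
            then have "frechet_derivative (moll \<rho>) (at (x - y)) i = 0" using grad_inner_Basis[OF i, of "moll \<rho>" "x - y"] by simp
            then show ?thesis using C1(1) r by simp
          qed
          then show "\<bar>indicat_real A y * frechet_derivative (moll \<rho>) (at (x - y)) i\<bar> \<le> C1 / \<rho> ^ (DIM('a) + 1) * indicat_real (cball x \<rho>) y"
            by (cases "y \<in> A") (use C1(1) r in \<open>auto simp: indicator_def\<close>)
        qed
        also have "\<dots> = C1 / \<rho> ^ (DIM('a) + 1) * (V * \<rho> ^ DIM('a))"
          using r by (simp add: content_cball V_def)
        also have "\<dots> = C1 * V / \<rho>" using r by (simp add: field_simps)
        finally show ?thesis .
      qed
      then have "(\<Sum>i\<in>Basis. \<bar>grad \<eta> x \<bullet> i\<bar>) \<le> (\<Sum>i\<in>(Basis::'a set). C1 * V / \<rho>)" by (rule sum_mono)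
      moreover have "(\<Sum>i\<in>(Basis::'a set). C1 * V / \<rho>) = M / \<rho>" by (simp add: M_def)
      ultimately show ?thesis using norm_le_l1[of "grad \<eta> x"] by linarith
    qed
    let ?S = "{x \<in> D. \<exists>q\<in>frontier D. dist x q < 4 * \<rho>}"
    have "?S = D \<inter> (\<Union>q\<in>frontier D. ball q (4 * \<rho>))" by (auto simp: dist_commute)
    then have Sm: "?S \<in> sets borel" by (rule ssubst[of _ _ "\<lambda>S. S \<in> sets borel"]) (intro borel_open open_Int D(1) open_UN ballI open_ball)
    have "ennreal ((l2 D (grad \<eta>))\<^sup>2) = (\<integral>\<^sup>+x. ennreal ((norm (grad \<eta> x))\<^sup>2) \<partial>lebesgue_on D)"
      by (rule L2_nn_integral[symmetric, OF test_L2(2)[OF D t]])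
    also have "\<dots> = (\<integral>\<^sup>+x. ennreal ((norm (grad \<eta> x))\<^sup>2) * indicator D x \<partial>lborel)"
      by (rule nn_integral_lebesgue_on_open[OF D(1)])
    also have "\<dots> \<le> (\<integral>\<^sup>+x. ennreal ((M / \<rho>)\<^sup>2) * indicator ?S x \<partial>lborel)"
    proof (rule nn_integral_mono)
      fix x
      show "ennreal ((norm (grad \<eta> x))\<^sup>2) * indicator D x \<le> ennreal ((M / \<rho>)\<^sup>2) * indicator ?S x"
      proof (cases "x \<in> D \<and> x \<notin> ?S")
        case True
        then have "grad \<eta> x = 0" by (intro g0) (auto simp: not_less)
        then show ?thesis by simp
      next
        case False
        have "(norm (grad \<eta> x))\<^sup>2 \<le> (M / \<rho>)\<^sup>2" by (intro power_mono gB) simp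
        then show ?thesis using False by (auto simp: indicator_def intro!: ennreal_leI)
      qed
    qed
    also have "\<dots> = ennreal ((M / \<rho>)\<^sup>2) * emeasure lborel ?S"
      using Sm by (subst nn_integral_cmult_indicator) auto
    also have "\<dots> \<le> ennreal ((M / \<rho>)\<^sup>2) * ennreal (C * (4 * \<rho>))"
      using layer r by (intro mult_left_mono) auto
    also have "\<dots> = ennreal ((M / \<rho>)\<^sup>2 * (C * (4 * \<rho>)))" using C r by (simp add: ennreal_mult''[symmetric])
    also have "(M / \<rho>)\<^sup>2 * (C * (4 * \<rho>)) = M\<^sup>2 * C * 4 / \<rho>" using r by (simp add: power2_eq_square field_simps)
    finally have "(l2 D (grad \<eta>))\<^sup>2 \<le> M\<^sup>2 * C * 4 / \<rho>"
      using C r by (subst (asm) ennreal_le_iff) auto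
    then show ?thesis using t \<eta>1 by (intro exI[of _ \<eta>] conjI ballI impI) auto
  qed
  have "M\<^sup>2 * C * 4 > 0" using M C by simp
  then show ?thesis using main by (intro exI[of _ "M\<^sup>2 * C * 4"] conjI allI impI)
qed

text \<open>The choice \<open>\<rho> = sqrt \<epsilon>\<close> balances the boundary layer of width \<open>\<rho>\<close> against the interior
contribution \<open>\<epsilon> / \<rho>\<close>.\<close>

lemma sublevel_measure:
  fixes D :: "'a::euclidean_space set"
  assumes D: "open D" "bounded D" and lip: "lipschitz_boundary D" and c: "c > 0" and L: "L > 0"
  shows "\<exists>C>0. \<forall>a g F u \<phi> \<epsilon>. weak_div D (\<lambda>x. a x *\<^sub>R g x) F \<and> H10_seq D u g \<phi> \<and>
     (AE x in lebesgue_on D. 0 \<le> a x \<and> a x \<le> L) \<and> (AE x in lebesgue_on D. c \<le> F x) \<and> (AE x in lebesgue_on D. 0 \<le> u x) \<and> 0 < \<epsilon> \<longrightarrow>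
     measure (lebesgue_on D) {x \<in> D. u x \<le> \<epsilon>} \<le> C * sqrt \<epsilon>"
proof -
  obtain Cb where "Cb > 0 \<and> (\<forall>\<rho>>0. emeasure lborel {x \<in> D. \<exists>q\<in>frontier D. dist x q < \<rho>} \<le> ennreal (Cb * \<rho>))"
    using boundary_layer[OF D lip] by (rule exE)
  then have Cb: "Cb > 0" and layer: "\<forall>\<rho>>0. emeasure lborel {x \<in> D. \<exists>q\<in>frontier D. dist x q < \<rho>} \<le> ennreal (Cb * \<rho>)" by auto
  obtain C' where "C' > 0 \<and> (\<forall>\<rho>>0. \<exists>\<eta>. test_function D \<eta> \<and> (\<forall>x\<in>D. (\<forall>q\<in>frontier D. 3 * \<rho> \<le> dist x q) \<longrightarrow> \<eta> x = 1) \<and>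
     (l2 D (grad \<eta>))\<^sup>2 \<le> C' / \<rho>)"
    using cutoff_exists[OF D Cb layer] by (rule exE)
  then have C': "C' > 0" and cut: "\<And>\<rho>. \<rho> > 0 \<Longrightarrow> \<exists>\<eta>. test_function D \<eta> \<and> (\<forall>x\<in>D. (\<forall>q\<in>frontier D. 3 * \<rho> \<le> dist x q) \<longrightarrow> \<eta> x = 1) \<and>
     (l2 D (grad \<eta>))\<^sup>2 \<le> C' / \<rho>" by auto
  define C where "C = 3 * Cb + 4 * L * C' / c"
  have "C > 0" unfolding C_def using Cb C' L c by (intro add_pos_pos) auto
  moreover have "measure (lebesgue_on D) {x \<in> D. u x \<le> \<epsilon>} \<le> C * sqrt \<epsilon>"
    if A: "weak_div D (\<lambda>x. a x *\<^sub>R g x) F" and u: "H10_seq D u g \<phi>" and a0: "AE x in lebesgue_on D. 0 \<le> a x \<and> a x \<le> L"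
      and F: "AE x in lebesgue_on D. c \<le> F x" and u0: "AE x in lebesgue_on D. 0 \<le> u x" and e: "0 < \<epsilon>" for a g F u \<phi> \<epsilon>
  proof -
    define \<rho> where "\<rho> = sqrt \<epsilon>"
    have r: "\<rho> > 0" "\<rho> * \<rho> = \<epsilon>" using e by (auto simp: \<rho>_def)
    obtain \<eta> where "test_function D \<eta> \<and> (\<forall>x\<in>D. (\<forall>q\<in>frontier D. 3 * \<rho> \<le> dist x q) \<longrightarrow> \<eta> x = 1) \<and> (l2 D (grad \<eta>))\<^sup>2 \<le> C' / \<rho>"
      using cut[OF r(1)] by (rule exE)
    then have \<eta>: "test_function D \<eta>" and \<eta>1: "\<And>x. x \<in> D \<Longrightarrow> \<forall>q\<in>frontier D. 3 * \<rho> \<le> dist x q \<Longrightarrow> \<eta> x = 1"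
      and \<eta>g: "(l2 D (grad \<eta>))\<^sup>2 \<le> C' / \<rho>" by auto
    have Lu: "L2 D u" using u by (simp add: H10_seq_def)
    note l\<eta> = test_L2[OF D \<eta>]
    note [measurable] = L2_measurable[OF Lu] L2_measurable[OF l\<eta>(1)]
    interpret finite_measure "lebesgue_on D"
      by (rule finite_measure_lebesgue_on_bounded[OF D(2)]) (use D in auto)
    have spD: "space (lebesgue_on D) = D" by (simp add: space_restrict_space)
    let ?S = "{x \<in> D. \<exists>q\<in>frontier D. dist x q < 3 * \<rho>}"
    have "?S = D \<inter> (\<Union>q\<in>frontier D. ball q (3 * \<rho>))" by (auto simp: dist_commute)
    then have Sb: "?S \<in> sets borel" by (rule ssubst[of _ _ "\<lambda>S. S \<in> sets borel"]) (intro borel_open open_Int D(1) open_UN ballI open_ball)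
    have Sm: "?S \<in> sets (lebesgue_on D)" using Sb D by (subst sets_restrict_space_iff) auto
    let ?U = "{x \<in> D. u x \<le> \<epsilon>}" and ?T = "{x \<in> D. u x \<le> \<epsilon> \<and> \<eta> x = 1}"
    have Um: "?U \<in> sets (lebesgue_on D)"
    proof -
      have "{x \<in> space (lebesgue_on D). u x \<le> \<epsilon>} \<in> sets (lebesgue_on D)" by measurable
      then show ?thesis unfolding spD .
    qed
    have Tm: "?T \<in> sets (lebesgue_on D)"
    proof -
      have "{x \<in> space (lebesgue_on D). u x \<le> \<epsilon> \<and> \<eta> x = 1} \<in> sets (lebesgue_on D)" by measurable
      then show ?thesis unfolding spD .
    qed
    \<comment> \<open>Points of \<open>?U\<close> outside the layer \<open>?S\<close> have distance
      at least 3 \<rho> from the frontier, where the cutoff equals 1.\<close>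
    have "measure (lebesgue_on D) ?U \<le> measure (lebesgue_on D) (?S \<union> ?T)"
      by (rule finite_measure_mono) (use \<eta>1 Sm Tm in \<open>auto simp: not_less\<close>)
    also have "\<dots> \<le> measure (lebesgue_on D) ?S + measure (lebesgue_on D) ?T"
      by (rule measure_Un_le[OF Sm Tm])
    also have "measure (lebesgue_on D) ?S \<le> Cb * (3 * \<rho>)"
    proof -
      have "emeasure (lebesgue_on D) ?S = emeasure lborel ?S"
        using Sb D by (subst emeasure_restrict_space) auto
      also have "\<dots> \<le> ennreal (Cb * (3 * \<rho>))" using layer r(1) by auto
      finally have "emeasure (lebesgue_on D) ?S \<le> ennreal (Cb * (3 * \<rho>))" .
      from enn2real_mono[OF this] show ?thesis using Cb r by (simp add: measure_def)
    qed
    \<comment> \<open>On \<open>?T\<close> the integrand of \<open>sublevel_estimate\<close> is at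
      least 1/4. As \<epsilon> = \<rho>^2 and the cutoff has energy at most C'/\<rho>, the bound
      becomes linear in \<open>\<rho>\<close>.\<close>
    also have "measure (lebesgue_on D) ?T \<le> 4 * (L * C' / c * \<rho>)"
    proof -
      have i1: "integrable (lebesgue_on D) (\<lambda>x. (\<eta> x)\<^sup>2 * logistic \<epsilon> (u x))"
      proof (rule Bochner_Integration.integrable_bound[OF L2_integrable[OF l\<eta>(1)]])
        show "AE x in lebesgue_on D. norm ((\<eta> x)\<^sup>2 * logistic \<epsilon> (u x)) \<le> norm ((norm (\<eta> x))\<^sup>2)"
          using logistic_pos logistic_less_1 by (intro AE_I2) (simp add: abs_mult mult_left_le less_imp_le)
      qed measurable
      have "1/4 * measure (lebesgue_on D) ?T = (\<integral>x. 1/4 * indicator ?T x \<partial>lebesgue_on D)"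
      proof -
        have "?T \<inter> space (lebesgue_on D) = ?T" using sets.sets_into_space[OF Tm] by (rule Int_absorb2)
        then show ?thesis by (simp only: Bochner_Integration.integral_mult_right_zero Bochner_Integration.integral_indicator)
      qed
      also have "\<dots> \<le> (\<integral>x. (\<eta> x)\<^sup>2 * logistic \<epsilon> (u x) \<partial>lebesgue_on D)"
      proof (rule integral_mono[OF _ i1])
        show "integrable (lebesgue_on D) (\<lambda>x. 1/4 * indicat_real ?T x)"
          by (intro integrable_mult_right integrable_real_indicator Tm) (simp add: emeasure_finite less_top[symmetric])
        fix x
        show "1/4 * indicat_real ?T x \<le> (\<eta> x)\<^sup>2 * logistic \<epsilon> (u x)"
        proof (cases "x \<in> ?T")
          case True
          then have "1/4 \<le> logistic \<epsilon> (u x)" "\<eta> x = 1" using logistic_ge_quarter[OF e] by auto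
          then show ?thesis using True by simp
        next
          case False
          then show ?thesis using logistic_pos[of \<epsilon> "u x"] by simp
        qed
      qed
      finally have "c * (1/4 * measure (lebesgue_on D) ?T) \<le> c * (\<integral>x. (\<eta> x)\<^sup>2 * logistic \<epsilon> (u x) \<partial>lebesgue_on D)"
        using c by (intro mult_left_mono) auto
      also have "\<dots> \<le> \<epsilon> * L * (l2 D (grad \<eta>))\<^sup>2"
        by (rule sublevel_estimate[OF D A u a0 F u0 \<eta> e])
      also have "\<dots> \<le> \<epsilon> * L * (C' / \<rho>)" using e L by (intro mult_left_mono \<eta>g) auto
      also have "\<dots> = L * C' * \<rho>" using r by (simp add: r(2)[symmetric])
      finally show ?thesis using c by (simp add: field_simps)
    qed
    finally show ?thesis unfolding C_def \<rho>_def by (simp add: algebra_simps)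
  qed
  ultimately show ?thesis by (intro exI[of _ C] conjI allI impI) (assumption, elim conjE)
qed

subsection \<open>The Gagliardo energy\<close>

lemma gagliardo_energy_cong_AE:
  assumes "AE x in lebesgue_on D. a x = a' x"
  shows "gagliardo_energy D s a = gagliardo_energy D s a'"
  unfolding gagliardo_energy_def
proof (rule nn_integral_cong_AE)
  show "AE x in lebesgue_on D. (\<integral>\<^sup>+ y. ennreal (\<bar>a x - a y\<bar>\<^sup>2 / dist x y powr (real DIM('a) + 2 * s)) \<partial>lebesgue_on D) =
      (\<integral>\<^sup>+ y. ennreal (\<bar>a' x - a' y\<bar>\<^sup>2 / dist x y powr (real DIM('a) + 2 * s)) \<partial>lebesgue_on D)"
    using assms
  proof eventually_elim
    case (elim x)
    show ?case by (rule nn_integral_cong_AE) (use assms elim in \<open>auto elim!: eventually_mono\<close>)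
  qed
qed

lemma borel_measurable_lebesgue_on_borel:
  "f \<in> borel_measurable borel \<Longrightarrow> f \<in> borel_measurable (lebesgue_on D)"
  by (intro measurable_restrict_space1 measurable_completion) simp

lemma gagliardo_inner_measurable:
  fixes a :: "'a::euclidean_space \<Rightarrow> real"
  assumes D: "open D" and [measurable]: "a \<in> borel_measurable borel"
  shows "(\<lambda>x. \<integral>\<^sup>+ y. ennreal (\<bar>a x - a y\<bar>\<^sup>2 / dist x y powr q) \<partial>lebesgue_on D) \<in> borel_measurable (lebesgue_on D)"
proof (rule borel_measurable_lebesgue_on_borel)
  have [measurable]: "D \<in> sets borel" using D by simp
  show "(\<lambda>x. \<integral>\<^sup>+ y. ennreal (\<bar>a x - a y\<bar>\<^sup>2 / dist x y powr q) \<partial>lebesgue_on D) \<in> borel_measurable borel"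
    unfolding nn_integral_lebesgue_on_open[OF D] by measurable
qed

text \<open>Over the common denominator a(x) a(y) >= l^2, the difference of the two quotients has
  numerator (b(y) - b(x)) a(x) + b(x) (a(x) - a(y)). Squaring gives the constant (L/l^2)^2, doubled
  by the elementary bound for the square of a sum.\<close>

lemma gagliardo_energy_quotient:
  fixes a b :: "'a::euclidean_space \<Rightarrow> real"
  assumes D: "open D" and m [measurable]: "a \<in> borel_measurable borel" "b \<in> borel_measurable borel"
    and l: "0 < l" and ab: "\<And>x. x \<in> D \<Longrightarrow> l \<le> a x \<and> a x \<le> L" "\<And>x. x \<in> D \<Longrightarrow> l \<le> b x \<and> b x \<le> L"
  shows "gagliardo_energy D s (\<lambda>x. 1 - b x / a x) \<le> ennreal (2 * L\<^sup>2 / l ^ 4) * (gagliardo_energy D s a + gagliardo_energy D s b)"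
proof -
  let ?q = "real DIM('a) + 2 * s" and ?C = "2 * L\<^sup>2 / l ^ 4"
  have C0: "?C \<ge> 0" by simp
  have pt: "\<bar>(1 - b x / a x) - (1 - b y / a y)\<bar>\<^sup>2 \<le> ?C * (\<bar>a x - a y\<bar>\<^sup>2 + \<bar>b x - b y\<bar>\<^sup>2)" if x: "x \<in> D" and y: "y \<in> D" for x y
  proof -
    have p: "0 < a x" "0 < a y" "0 < b x" using ab(1)[OF x] ab(1)[OF y] ab(2)[OF x] l by auto
    have "(1 - b x / a x) - (1 - b y / a y) = ((b y - b x) * a x + b x * (a x - a y)) / (a x * a y)"
      using p by (simp add: field_simps)
    then have "\<bar>(1 - b x / a x) - (1 - b y / a y)\<bar> = \<bar>(b y - b x) * a x + b x * (a x - a y)\<bar> / (a x * a y)"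
      using p by (simp add: abs_mult)
    also have "\<dots> \<le> (L * \<bar>b x - b y\<bar> + L * \<bar>a x - a y\<bar>) / (l * l)"
    proof (rule frac_le)
      have "\<bar>(b y - b x) * a x + b x * (a x - a y)\<bar> \<le> \<bar>b x - b y\<bar> * a x + b x * \<bar>a x - a y\<bar>"
        using abs_triangle_ineq[of "(b y - b x) * a x" "b x * (a x - a y)"] p by (simp add: abs_mult abs_minus_commute)
      also have "\<dots> \<le> \<bar>b x - b y\<bar> * L + L * \<bar>a x - a y\<bar>"
        using ab(1)[OF x] ab(2)[OF x] by (intro add_mono mult_left_mono mult_right_mono) auto
      finally show "\<bar>(b y - b x) * a x + b x * (a x - a y)\<bar> \<le> L * \<bar>b x - b y\<bar> + L * \<bar>a x - a y\<bar>" by (simp add: mult.commute)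
      show "0 < l * l" using l by simp
      show "l * l \<le> a x * a y" using ab(1)[OF x] ab(1)[OF y] l by (intro mult_mono) auto
      show "0 \<le> L * \<bar>b x - b y\<bar> + L * \<bar>a x - a y\<bar>" using ab(1)[OF x] l by simp
    qed
    also have "\<dots> = (L / (l * l)) * (\<bar>b x - b y\<bar> + \<bar>a x - a y\<bar>)" by (simp add: algebra_simps add_divide_distrib)
    finally have "\<bar>(1 - b x / a x) - (1 - b y / a y)\<bar>\<^sup>2 \<le> ((L / (l * l)) * (\<bar>b x - b y\<bar> + \<bar>a x - a y\<bar>))\<^sup>2"
      by (rule power_mono) simp
    also have "\<dots> = (L / (l * l))\<^sup>2 * (\<bar>b x - b y\<bar> + \<bar>a x - a y\<bar>)\<^sup>2" by (rule power_mult_distrib)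
    also have "\<dots> \<le> (L / (l * l))\<^sup>2 * (2 * (\<bar>a x - a y\<bar>\<^sup>2 + \<bar>b x - b y\<bar>\<^sup>2))"
    proof (rule mult_left_mono)
      have "(s + t)\<^sup>2 \<le> 2 * (t\<^sup>2 + s\<^sup>2)" for s t :: real
        using sum_squares_ge_zero[of "s - t" 0] by (simp add: power2_eq_square algebra_simps)
      then show "(\<bar>b x - b y\<bar> + \<bar>a x - a y\<bar>)\<^sup>2 \<le> 2 * (\<bar>a x - a y\<bar>\<^sup>2 + \<bar>b x - b y\<bar>\<^sup>2)" by blast
    qed simp
    also have "(L / (l * l))\<^sup>2 * (2 * X) = ?C * X" for X
      using l by (simp add: power_divide power2_eq_square power4_eq_xxxx mult_ac)
    finally show ?thesis .
  qed
  let ?e = "\<lambda>f x y. ennreal (\<bar>f x - f y\<bar>\<^sup>2 / dist x y powr ?q)"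
  have mi: "(\<lambda>y. ?e f x y) \<in> borel_measurable (lebesgue_on D)" if [measurable]: "f \<in> borel_measurable borel" for f :: "'a \<Rightarrow> real" and x
    by (rule borel_measurable_lebesgue_on_borel) measurable
  note ma = gagliardo_inner_measurable[OF D m(1), of ?q] and mb = gagliardo_inner_measurable[OF D m(2), of ?q]
  have "gagliardo_energy D s (\<lambda>x. 1 - b x / a x) \<le>
      (\<integral>\<^sup>+x. ennreal ?C * ((\<integral>\<^sup>+y. ?e a x y \<partial>lebesgue_on D) + (\<integral>\<^sup>+y. ?e b x y \<partial>lebesgue_on D)) \<partial>lebesgue_on D)"
    unfolding gagliardo_energy_def
  proof (rule nn_integral_mono)
    fix x assume "x \<in> space (lebesgue_on D)"
    then have x: "x \<in> D" by (simp add: space_restrict_space)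
    have "(\<integral>\<^sup>+y. ?e (\<lambda>x. 1 - b x / a x) x y \<partial>lebesgue_on D) \<le> (\<integral>\<^sup>+y. ennreal ?C * (?e a x y + ?e b x y) \<partial>lebesgue_on D)"
    proof (rule nn_integral_mono)
      fix y assume "y \<in> space (lebesgue_on D)"
      then have y: "y \<in> D" by (simp add: space_restrict_space)
      have "\<bar>(1 - b x / a x) - (1 - b y / a y)\<bar>\<^sup>2 / dist x y powr ?q \<le> ?C * (\<bar>a x - a y\<bar>\<^sup>2 + \<bar>b x - b y\<bar>\<^sup>2) / dist x y powr ?q"
        by (rule divide_right_mono[OF pt[OF x y]]) simp
      also have "\<dots> = ?C * (\<bar>a x - a y\<bar>\<^sup>2 / dist x y powr ?q + \<bar>b x - b y\<bar>\<^sup>2 / dist x y powr ?q)"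
        by (simp only: add_divide_distrib[symmetric] times_divide_eq_right)
      finally have "?e (\<lambda>x. 1 - b x / a x) x y \<le> ennreal (?C * (\<bar>a x - a y\<bar>\<^sup>2 / dist x y powr ?q + \<bar>b x - b y\<bar>\<^sup>2 / dist x y powr ?q))"
        by (rule ennreal_leI)
      also have "\<dots> = ennreal ?C * (?e a x y + ?e b x y)"
        using C0 by (subst ennreal_mult) (simp_all add: ennreal_plus)
      finally show "?e (\<lambda>x. 1 - b x / a x) x y \<le> ennreal ?C * (?e a x y + ?e b x y)" .
    qed
    also have "\<dots> = ennreal ?C * ((\<integral>\<^sup>+y. ?e a x y \<partial>lebesgue_on D) + (\<integral>\<^sup>+y. ?e b x y \<partial>lebesgue_on D))"
      using mi[OF m(1), of x] mi[OF m(2), of x] by (subst nn_integral_cmult) (auto simp: nn_integral_add)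
    finally show "(\<integral>\<^sup>+y. ?e (\<lambda>x. 1 - b x / a x) x y \<partial>lebesgue_on D) \<le>
       ennreal ?C * ((\<integral>\<^sup>+y. ?e a x y \<partial>lebesgue_on D) + (\<integral>\<^sup>+y. ?e b x y \<partial>lebesgue_on D))" .
  qed
  also have "\<dots> = ennreal ?C * (gagliardo_energy D s a + gagliardo_energy D s b)"
    unfolding gagliardo_energy_def using ma mb
    by (subst nn_integral_cmult) (auto simp: nn_integral_add)
  finally show ?thesis .
qed

text \<open>Divides a pointwise real estimate by \<open>k\<close> and inserts the majorant of
  \<open>J\<close>. In the applications \<open>e\<close> is the inner Gagliardo integral, which may
  be infinite at some points.\<close>

lemma ennreal_mult_bound:
  assumes "X * k \<le> M * J" "k > 0" "M \<ge> 0" "0 \<le> J" "ennreal J \<le> ennreal b * e" "b \<ge> 0"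
  shows "ennreal X \<le> ennreal (M * b / k) * e"
proof -
  have "X \<le> (M / k) * J" using assms by (simp add: field_simps)
  then have "ennreal X \<le> ennreal ((M / k) * J)" by (rule ennreal_leI)
  also have "\<dots> = ennreal (M / k) * ennreal J" using assms by (subst ennreal_mult) auto
  also have "\<dots> \<le> ennreal (M / k) * (ennreal b * e)" by (rule mult_left_mono[OF assms(5)]) simp
  also have "\<dots> = ennreal (M * b / k) * e"
    using assms by (simp add: mult.assoc[symmetric] ennreal_mult''[symmetric])
  finally show ?thesis .
qed

lemma l2_le_of_density:
  assumes f: "L2 D f" and le: "\<And>x. x \<in> D \<Longrightarrow> ennreal ((norm (f x))\<^sup>2) \<le> ennreal A * e x"
    and e: "e \<in> borel_measurable (lebesgue_on D)" "(\<integral>\<^sup>+x. e x \<partial>lebesgue_on D) \<le> ennreal (K\<^sup>2)" and A: "A \<ge> 0" and K: "K \<ge> 0"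
  shows "l2 D f \<le> sqrt A * K"
proof -
  have "ennreal ((l2 D f)\<^sup>2) = (\<integral>\<^sup>+x. ennreal ((norm (f x))\<^sup>2) \<partial>lebesgue_on D)" by (rule L2_nn_integral[symmetric, OF f])
  also have "\<dots> \<le> (\<integral>\<^sup>+x. ennreal A * e x \<partial>lebesgue_on D)"
    by (rule nn_integral_mono) (simp add: le space_restrict_space)
  also have "\<dots> = ennreal A * (\<integral>\<^sup>+x. e x \<partial>lebesgue_on D)" by (rule nn_integral_cmult[OF e(1)])
  also have "\<dots> \<le> ennreal A * ennreal (K\<^sup>2)" by (rule mult_left_mono[OF e(2)]) simp
  also have "\<dots> = ennreal (A * K\<^sup>2)" using A by (simp add: ennreal_mult)
  finally have "(l2 D f)\<^sup>2 \<le> A * K\<^sup>2" using A by (subst (asm) ennreal_le_iff) auto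
  also have "\<dots> = (sqrt A * K)\<^sup>2" using A by (simp add: power_mult_distrib)
  finally show ?thesis by (rule power2_le_imp_le) (use A K in simp)
qed

text \<open>With q = d + 2s, where d is the dimension, the Gaussian weight is at most C0 r^q / |x -
  y|^q, so the quadratic deviation at \<open>x\<close> is bounded by r^q times the inner Gagliardo
  integral. Dividing by r^d, respectively r^(d+2), leaves r^(2s) and r^(2s-2); the roots are the
  claimed powers. The constants depend on \<open>D\<close> only, not on \<open>s\<close>.\<close>

lemma gagliardo_regularisation:
  fixes D :: "'a::euclidean_space set"
  assumes D: "open D" "bounded D" "D \<noteq> {}" and lip: "lipschitz_boundary D"
  shows "\<exists>C>0. \<exists>r0>0. r0 \<le> 1 \<and> (\<forall>s \<psi> B K r. 0 < s \<and> s < 1 \<and> \<psi> \<in> borel_measurable borel \<and> (\<forall>x. x \<notin> D \<longrightarrow> \<psi> x = 0) \<and>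
     (\<forall>x. \<bar>\<psi> x\<bar> \<le> B) \<and> gagliardo_energy D s \<psi> \<le> ennreal (K\<^sup>2) \<and> 0 \<le> K \<and> 0 < r \<and> r \<le> r0 \<longrightarrow>
     (\<exists>w. smooth_fun w \<and> (\<forall>x. \<bar>w x\<bar> \<le> B) \<and> l2 D (\<lambda>x. \<psi> x - w x) \<le> C * r powr s * K \<and> l2 D (grad w) \<le> C * r powr (s - 1) * K))"
proof -
  obtain \<kappa> where "\<kappa> > 0 \<and> (\<exists>r0>0. \<forall>x\<in>D. \<forall>r. 0 < r \<and> r \<le> r0 \<longrightarrow> (\<exists>z. ball z (\<kappa> * r) \<subseteq> D \<inter> ball x r))"
    using interior_ball_condition[OF D(1,2) lip] by (rule exE)
  then have k: "\<kappa> > 0" and "\<exists>r0>0. \<forall>x\<in>D. \<forall>r. 0 < r \<and> r \<le> r0 \<longrightarrow> (\<exists>z. ball z (\<kappa> * r) \<subseteq> D \<inter> ball x r)" by auto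
  from this(2) obtain r1 where r1': "r1 > 0 \<and> (\<forall>x\<in>D. \<forall>r. 0 < r \<and> r \<le> r1 \<longrightarrow> (\<exists>z. ball z (\<kappa> * r) \<subseteq> D \<inter> ball x r))" by (rule exE)
  then have r1: "r1 > 0" by simp
  have ib: "\<exists>z. ball z (\<kappa> * r) \<subseteq> D \<inter> ball x r" if "x \<in> D" "0 < r" "r \<le> r1" for x r using r1' that by simp
  obtain G where G: "G > 0"
    "\<And>r. r > 0 \<Longrightarrow> (\<integral>\<^sup>+z. ennreal (exp (- ((z::'a) \<bullet> z / (2 * r\<^sup>2)))) \<partial>lborel) \<le> ennreal (G * r ^ DIM('a))"
    by (rule gaussian_mass[where 'a = 'a]) (rule that)
  define d where "d = DIM('a)"
  define V where "V = unit_ball_vol (real d)"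
  have V: "V > 0" unfolding V_def by simp
  define c where "c = V * \<kappa> ^ d * exp (- 1)"
  have c: "c > 0" unfolding c_def using V k by simp
  \<comment> \<open>The constant of \<open>gaussian_decay\<close> for m = d + 2; the exponent d + 2s
    stays below 2m for every s < 1.\<close>
  define C0 where "C0 = 1 + (2 * real (d + 2)) ^ (d + 2)"
  have C0: "C0 > 0" unfolding C0_def by (intro add_pos_nonneg) auto
  define H where "H = 8 * real d * G * (1 + G / c)"
  have H: "H \<ge> 0" unfolding H_def using G c by (intro mult_nonneg_nonneg add_nonneg_nonneg) auto
  define A1 where "A1 = C0 / c"
  define A2 where "A2 = H * C0 / c\<^sup>2"
  have A: "A1 > 0" "A2 \<ge> 0" using C0 c H by (auto simp: A1_def A2_def)
  define C where "C = sqrt A1 + sqrt A2"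
  have C: "C > 0" "sqrt A1 \<le> C" "sqrt A2 \<le> C" using A by (auto simp: C_def intro: add_pos_nonneg)
  have main: "\<exists>w. smooth_fun w \<and> (\<forall>x. \<bar>w x\<bar> \<le> B) \<and> l2 D (\<lambda>x. \<psi> x - w x) \<le> C * r powr s * K \<and> l2 D (grad w) \<le> C * r powr (s - 1) * K"
    if s: "0 < s" "s < 1" and \<psi>m [measurable]: "\<psi> \<in> borel_measurable borel" and \<psi>0: "\<And>x. x \<notin> D \<Longrightarrow> \<psi> x = 0"
      and \<psi>B: "\<And>x. \<bar>\<psi> x\<bar> \<le> B" and en: "gagliardo_energy D s \<psi> \<le> ennreal (K\<^sup>2)" and K: "0 \<le> K" and r: "0 < r" "r \<le> r1" for s \<psi> B K r
  proof -
    define q where "q = real d + 2 * s"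
    have rq: "r powr q = r ^ d * r powr (2 * s)" unfolding q_def using r by (simp add: powr_add powr_realpow)
    have ballm: "c * r ^ DIM('a) \<le> measure lborel (D \<inter> ball x r) * exp (-1)" if x: "x \<in> D" for x
    proof -
      obtain z where z: "ball z (\<kappa> * r) \<subseteq> D \<inter> ball x r" using ib[OF x r] by (rule exE)
      have fm: "D \<inter> ball x r \<in> fmeasurable lborel"
        using emeasure_bounded_finite[of "D \<inter> ball x r"] D by (intro fmeasurableI) (auto intro: bounded_Int)
      have "V * (\<kappa> * r) ^ d = measure lborel (ball z (\<kappa> * r))"
        using k r by (simp add: content_ball V_def d_def)
      also have "\<dots> \<le> measure lborel (D \<inter> ball x r)"
        by (rule measure_mono_fmeasurable[OF z _ fm]) simp
      finally show ?thesis unfolding c_def d_def[symmetric] by (simp add: power_mult_distrib mult_ac)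
    qed
    obtain w where w: "smooth_fun w" "\<And>x. \<bar>w x\<bar> \<le> B"
      "\<And>x. x \<in> D \<Longrightarrow> (w x - \<psi> x)\<^sup>2 * (c * r ^ DIM('a)) \<le> (\<integral>y. (\<psi> y - \<psi> x)\<^sup>2 * (indicator D y * exp (- ((x - y) \<bullet> (x - y) / (2 * r\<^sup>2)))) \<partial>lborel)"
      "\<And>x. x \<in> D \<Longrightarrow> (norm (grad w x))\<^sup>2 * (c\<^sup>2 * r ^ (DIM('a) + 2)) \<le>
       8 * real DIM('a) * G * (1 + G / c) * (\<integral>y. (\<psi> y - \<psi> x)\<^sup>2 * (indicator D y * exp (- ((x - y) \<bullet> (x - y) / (2 * r\<^sup>2)))) \<partial>lborel)"
      by (rule gaussian_regularisation[OF D \<psi>m \<psi>0 \<psi>B r(1) G(1) G(2)[OF r(1)] c ballm]) (assumption, assumption, rule that)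
    define J where "J x = (\<integral>y. (\<psi> y - \<psi> x)\<^sup>2 * (indicator D y * exp (- ((x - y) \<bullet> (x - y) / (2 * r\<^sup>2)))) \<partial>lborel)" for x
    define e where "e x = (\<integral>\<^sup>+ y. ennreal (\<bar>\<psi> x - \<psi> y\<bar>\<^sup>2 / dist x y powr q) \<partial>lebesgue_on D)" for x
    have em: "e \<in> borel_measurable (lebesgue_on D)"
      unfolding e_def[abs_def] by (rule gagliardo_inner_measurable[OF D(1) \<psi>m])
    have eint: "(\<integral>\<^sup>+x. e x \<partial>lebesgue_on D) \<le> ennreal (K\<^sup>2)"
      using en unfolding gagliardo_energy_def e_def q_def d_def .
    have [measurable]: "D \<in> sets borel" using D by simp
    have J0: "J x \<ge> 0" for x unfolding J_def by (intro integral_nonneg_AE) (auto simp: indicator_def)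
    have Jle: "ennreal (J x) \<le> ennreal (C0 * r powr q) * e x" for x
    proof -
      let ?f = "\<lambda>y. (\<psi> y - \<psi> x)\<^sup>2 * (indicator D y * exp (- ((x - y) \<bullet> (x - y) / (2 * r\<^sup>2))))"
      have "J x = enn2real (\<integral>\<^sup>+y. ennreal (?f y) \<partial>lborel)"
        unfolding J_def by (rule integral_eq_nn_integral) (auto simp: indicator_def)
      then have "ennreal (J x) \<le> (\<integral>\<^sup>+y. ennreal (?f y) \<partial>lborel)" by (simp add: ennreal_enn2real_if)
      also have "\<dots> \<le> (\<integral>\<^sup>+y. ennreal (C0 * r powr q) * ennreal (\<bar>\<psi> x - \<psi> y\<bar>\<^sup>2 / dist x y powr q) * indicator D y \<partial>lborel)"
      proof (rule nn_integral_mono)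
        fix y
        have "(\<psi> y - \<psi> x)\<^sup>2 * exp (- ((x - y) \<bullet> (x - y) / (2 * r\<^sup>2))) \<le> C0 * r powr q * (\<bar>\<psi> x - \<psi> y\<bar>\<^sup>2 / dist x y powr q)"
        proof (cases "x = y")
          case False
          then have dp: "dist x y > 0" by simp
          define t where "t = dist x y / r"
          have t: "t > 0" using dp r by (simp add: t_def)
          have ex: "(x - y) \<bullet> (x - y) / (2 * r\<^sup>2) = t\<^sup>2 / 2"
            by (simp add: t_def power_divide dist_norm power2_norm_eq_inner)
          have "exp (- (t\<^sup>2 / 2)) * t powr q \<le> 1 + (2 * real (d + 2)) ^ (d + 2)"
            by (rule gaussian_decay) (use t s in \<open>auto simp: q_def\<close>)
          then have g: "exp (- (t\<^sup>2 / 2)) * t powr q \<le> C0" by (simp add: C0_def)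
          have tq: "t powr q = dist x y powr q / r powr q" unfolding t_def using dp r by (simp add: powr_divide)
          have rq0: "r powr q > 0" "dist x y powr q > 0" using r dp by auto
          have "exp (- (t\<^sup>2 / 2)) * dist x y powr q \<le> C0 * r powr q"
            using g rq0 unfolding tq by (simp add: pos_divide_le_eq)
          then have "exp (- (t\<^sup>2 / 2)) \<le> C0 * r powr q / dist x y powr q" using rq0 by (simp add: pos_le_divide_eq)
          then have "(\<psi> y - \<psi> x)\<^sup>2 * exp (- (t\<^sup>2 / 2)) \<le> (\<psi> y - \<psi> x)\<^sup>2 * (C0 * r powr q / dist x y powr q)"
            by (rule mult_left_mono) simp
          also have "\<dots> = C0 * r powr q * (\<bar>\<psi> x - \<psi> y\<bar>\<^sup>2 / dist x y powr q)"
            by (simp add: power2_commute mult_ac)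
          finally show ?thesis unfolding ex .
        qed (use C0 in simp)
        then have "ennreal ((\<psi> y - \<psi> x)\<^sup>2 * exp (- ((x - y) \<bullet> (x - y) / (2 * r\<^sup>2)))) \<le> ennreal (C0 * r powr q * (\<bar>\<psi> x - \<psi> y\<bar>\<^sup>2 / dist x y powr q))"
          by (rule ennreal_leI)
        also have "\<dots> = ennreal (C0 * r powr q) * ennreal (\<bar>\<psi> x - \<psi> y\<bar>\<^sup>2 / dist x y powr q)"
          using C0 by (subst ennreal_mult) auto
        finally show "ennreal (?f y) \<le> ennreal (C0 * r powr q) * ennreal (\<bar>\<psi> x - \<psi> y\<bar>\<^sup>2 / dist x y powr q) * indicator D y"
          by (cases "y \<in> D") auto
      qed
      also have "\<dots> = (\<integral>\<^sup>+y. ennreal (C0 * r powr q) * ennreal (\<bar>\<psi> x - \<psi> y\<bar>\<^sup>2 / dist x y powr q) \<partial>lebesgue_on D)"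
        by (rule nn_integral_lebesgue_on_open[symmetric, OF D(1)])
      also have "\<dots> = ennreal (C0 * r powr q) * e x"
        unfolding e_def by (rule nn_integral_cmult) (rule borel_measurable_lebesgue_on_borel, measurable)
      finally show ?thesis .
    qed
    have b0: "0 \<le> C0 * r powr q" using C0 by simp
    have rd: "r ^ d > 0" using r by simp
    note wc = smooth_fun_continuous[OF w(1)]
    have L1: "L2 D (\<lambda>x. \<psi> x - w x)"
    proof (rule L2_bounded[OF D(2,1)])
      show "(\<lambda>x. \<psi> x - w x) \<in> borel_measurable (lebesgue_on D)"
        using borel_measurable_lebesgue_on_borel[OF \<psi>m] continuous_measurable_lebesgue_on[OF wc] by measurable
      show "AE x in lebesgue_on D. norm (\<psi> x - w x) \<le> B + B"
      proof (rule AE_I2)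
        fix x
        show "norm (\<psi> x - w x) \<le> B + B" unfolding real_norm_def using \<psi>B[of x] w(2)[of x] by linarith
      qed
    qed
    have "l2 D (\<lambda>x. \<psi> x - w x) \<le> sqrt (A1 * r powr (2 * s)) * K"
    proof (rule l2_le_of_density[OF L1 _ em eint _ K])
      fix x assume x: "x \<in> D"
      have "(norm (\<psi> x - w x))\<^sup>2 * (c * r ^ d) \<le> 1 * J x"
        using w(3)[OF x] by (simp add: J_def d_def power2_commute)
      from ennreal_mult_bound[OF this _ _ J0 Jle b0] c rd
      have "ennreal ((norm (\<psi> x - w x))\<^sup>2) \<le> ennreal (1 * (C0 * r powr q) / (c * r ^ d)) * e x" by simp
      also have "1 * (C0 * r powr q) / (c * r ^ d) = A1 * r powr (2 * s)"
        unfolding rq A1_def using rd c by simp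
      finally show "ennreal ((norm (\<psi> x - w x))\<^sup>2) \<le> ennreal (A1 * r powr (2 * s)) * e x" .
    qed (use A in simp)
    also have "sqrt (A1 * r powr (2 * s)) = sqrt A1 * r powr s"
    proof -
      have "r powr (2 * s) = (r powr s)\<^sup>2" by (simp add: power2_eq_square powr_add[symmetric])
      then show ?thesis by (simp add: real_sqrt_mult)
    qed
    also have "sqrt A1 * r powr s * K \<le> C * r powr s * K" using C K by (intro mult_right_mono) auto
    finally have e1: "l2 D (\<lambda>x. \<psi> x - w x) \<le> C * r powr s * K" .
    have L2g: "L2 D (grad w)" using multiplier_smooth[OF D(1,2) w(1)] by (simp add: multiplier_def)
    have "l2 D (grad w) \<le> sqrt (A2 * r powr (2 * s - 2)) * K"
    proof (rule l2_le_of_density[OF L2g _ em eint _ K])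
      fix x assume x: "x \<in> D"
      have "(norm (grad w x))\<^sup>2 * (c\<^sup>2 * r ^ (d + 2)) \<le> H * J x"
        using w(4)[OF x] by (simp only: J_def d_def H_def)
      from ennreal_mult_bound[OF this _ H J0 Jle b0] c r
      have "ennreal ((norm (grad w x))\<^sup>2) \<le> ennreal (H * (C0 * r powr q) / (c\<^sup>2 * r ^ (d + 2))) * e x" by simp
      also have "H * (C0 * r powr q) / (c\<^sup>2 * r ^ (d + 2)) = A2 * r powr (2 * s - 2)"
      proof -
        have "r powr (2 * s - 2) = r powr (2 * s) / r\<^sup>2" using r by (simp add: powr_diff powr_numeral)
        then show ?thesis unfolding rq A2_def using rd c by (simp add: power_add power2_eq_square mult_ac)
      qed
      finally show "ennreal ((norm (grad w x))\<^sup>2) \<le> ennreal (A2 * r powr (2 * s - 2)) * e x" .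
    qed (use A in simp)
    also have "sqrt (A2 * r powr (2 * s - 2)) = sqrt A2 * r powr (s - 1)"
    proof -
      have "r powr (2 * s - 2) = (r powr (s - 1))\<^sup>2" by (simp add: power2_eq_square powr_add[symmetric])
      then show ?thesis by (simp add: real_sqrt_mult)
    qed
    also have "sqrt A2 * r powr (s - 1) * K \<le> C * r powr (s - 1) * K" using C K by (intro mult_right_mono) auto
    finally show ?thesis using w e1 by (intro exI[of _ w] conjI allI)
  qed
  have fin: "\<forall>s \<psi> B K r. 0 < s \<and> s < 1 \<and> \<psi> \<in> borel_measurable borel \<and> (\<forall>x. x \<notin> D \<longrightarrow> \<psi> x = 0) \<and>
     (\<forall>x. \<bar>\<psi> x\<bar> \<le> B) \<and> gagliardo_energy D s \<psi> \<le> ennreal (K\<^sup>2) \<and> 0 \<le> K \<and> 0 < r \<and> r \<le> min 1 r1 \<longrightarrow>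
     (\<exists>w. smooth_fun w \<and> (\<forall>x. \<bar>w x\<bar> \<le> B) \<and> l2 D (\<lambda>x. \<psi> x - w x) \<le> C * r powr s * K \<and> l2 D (grad w) \<le> C * r powr (s - 1) * K)"
    by (intro allI impI, elim conjE, rule main) simp_all
  have "min 1 r1 > 0" "min 1 r1 \<le> 1" using r1 by auto
  with fin C(1) show ?thesis by (intro exI[of _ C] conjI exI[of _ "min 1 r1"])
qed

subsection \<open>Interpolation and optimisation\<close>

lemma Lp_space_infinity_AE:
  fixes f :: "'a::euclidean_space \<Rightarrow> 'b::euclidean_space"
  assumes f: "f \<in> Lp_space D \<infinity>"
  shows "AE x in lebesgue_on D. norm (f x) \<le> Lp_norm D \<infinity> f"
proof -
  have fin: "Lp_enorm D \<infinity> f < \<infinity>"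
    using f by (auto simp: Lp_space_def)
  have "AE x in lebesgue_on D. ennreal (norm (f x)) \<le> Lp_enorm D \<infinity> f"
    unfolding Lp_enorm_def if_P[OF refl] by (rule esssup_AE)
  then show ?thesis
  proof eventually_elim
    case (elim x)
    have "enn2real (ennreal (norm (f x))) \<le> enn2real (Lp_enorm D \<infinity> f)"
      by (rule enn2real_mono[OF elim]) (use fin in \<open>simp add: top.not_eq_extremum infinity_ennreal_def\<close>)
    then show ?case by (simp add: Lp_norm_def)
  qed
qed

lemma grad_exponent_integral:
  fixes g :: "'a::euclidean_space \<Rightarrow> 'b::euclidean_space"
  assumes \<theta>: "0 < \<theta>" "\<theta> < 1" and g: "g \<in> Lp_space D (grad_exponent \<theta>)" and M: "Lp_norm D (grad_exponent \<theta>) g \<le> M"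
  shows "(\<integral>\<^sup>+x. ennreal (norm (g x) powr (2 / (1 - \<theta>))) \<partial>lebesgue_on D) \<le> ennreal (M powr (2 / (1 - \<theta>)))"
proof -
  define p where "p = 2 / (1 - \<theta>)"
  define I where "I = (\<integral>\<^sup>+x. ennreal (norm (g x) powr p) \<partial>lebesgue_on D)"
  have p: "p > 0" using \<theta> by (simp add: p_def)
  have ge: "grad_exponent \<theta> = ennreal p"
    unfolding grad_exponent_def p_def using \<theta> divide_ennreal[of 2 "1 - \<theta>"] by simp
  have np: "ennreal p \<noteq> \<infinity>" by simp
  have en: "Lp_enorm D (ennreal p) g = (if I = \<infinity> then \<infinity> else ennreal (enn2real I powr (1 / p)))"
    unfolding Lp_enorm_def if_not_P[OF np] Let_def I_def using p by (simp add: enn2real_ennreal)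
  have If: "I \<noteq> \<infinity>" using g en unfolding ge Lp_space_def by auto
  then have "Lp_norm D (ennreal p) g = enn2real I powr (1 / p)"
    unfolding Lp_norm_def en by simp
  then have "enn2real I powr (1 / p) \<le> M" using M unfolding ge by simp
  then have "(enn2real I powr (1 / p)) powr p \<le> M powr p" by (rule powr_mono2[rotated 2]) (use p in auto)
  then have "enn2real I \<le> M powr p" using p by (simp add: powr_powr)
  then have "ennreal (enn2real I) \<le> ennreal (M powr p)" by (rule ennreal_leI)
  also have "ennreal (enn2real I) = I" using If by (simp add: ennreal_enn2real_if)
  finally show ?thesis unfolding I_def p_def .
qed

text \<open>Write F^2 = F^(2(1-\<theta>)) F^(2\<theta>), bound the first factor through B, and apply
  Young's inequality with weights \<theta> and 1 - \<theta> to F^2/\<kappa>^2 and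
  G^(2/(1-\<theta>)). The free scale \<open>\<kappa>\<close> makes both terms comparable after
  integration.\<close>

lemma interpolation_pointwise:
  fixes F G B \<kappa> \<theta> :: real
  assumes \<theta>: "0 < \<theta>" "\<theta> < 1" and F: "0 \<le> F" "F \<le> B" and G: "0 \<le> G" and k: "0 < \<kappa>"
  shows "(F * G)\<^sup>2 \<le> B powr (2 * (1 - \<theta>)) * \<kappa> powr (2 * \<theta>) * (F\<^sup>2 / \<kappa>\<^sup>2 + G powr (2 / (1 - \<theta>)))"
proof (cases "F = 0 \<or> G = 0")
  case True
  have "0 \<le> B powr (2 * (1 - \<theta>)) * \<kappa> powr (2 * \<theta>) * (F\<^sup>2 / \<kappa>\<^sup>2 + G powr (2 / (1 - \<theta>)))"
    by (intro mult_nonneg_nonneg add_nonneg_nonneg) auto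
  then show ?thesis using True by auto
next
  case False
  then have F0: "F > 0" and G0: "G > 0" using F G by auto
  let ?a = "F\<^sup>2 / \<kappa>\<^sup>2" and ?b = "G powr (2 / (1 - \<theta>))"
  have ab: "?a > 0" "?b > 0" using F0 G0 k by auto
  have "?a powr \<theta> * ?b powr (1 - \<theta>) \<le> \<theta> * ?a + (1 - \<theta>) * ?b"
    by (rule Youngs_inequality_0) (use \<theta> ab in auto)
  also have "\<dots> \<le> 1 * ?a + 1 * ?b" using \<theta> ab by (intro add_mono mult_right_mono) auto
  finally have Y: "?a powr \<theta> * ?b powr (1 - \<theta>) \<le> ?a + ?b" by simp
  have sq: "x\<^sup>2 = x powr 2" if "x > 0" for x :: real using that by simp
  have h1: "F\<^sup>2 = F powr (2 * (1 - \<theta>)) * F powr (2 * \<theta>)" unfolding sq[OF F0] powr_add[symmetric] by (simp add: algebra_simps)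
  have h2: "F powr (2 * \<theta>) = \<kappa> powr (2 * \<theta>) * ?a powr \<theta>"
  proof -
    have "?a = (F / \<kappa>) powr 2" using F0 k by (simp add: power_divide)
    then have "?a powr \<theta> = ((F / \<kappa>) powr 2) powr \<theta>" by (rule arg_cong)
    also have "\<dots> = (F / \<kappa>) powr (2 * \<theta>)" by (rule powr_powr)
    also have "\<dots> = F powr (2 * \<theta>) / \<kappa> powr (2 * \<theta>)" using F0 k by (simp add: powr_divide)
    finally show ?thesis using k by simp
  qed
  have h3: "G\<^sup>2 = ?b powr (1 - \<theta>)" 
  proof -
    have "2 / (1 - \<theta>) * (1 - \<theta>) = 2"
      by (subst times_divide_eq_left, subst nonzero_divide_eq_eq) (use \<theta> in simp_all)
    then show ?thesis unfolding powr_powr using G0 by simp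
  qed
  have h12: "F\<^sup>2 = F powr (2 * (1 - \<theta>)) * (\<kappa> powr (2 * \<theta>) * ?a powr \<theta>)"
    by (rule trans[OF h1 arg_cong[where f = "\<lambda>z. F powr (2 * (1 - \<theta>)) * z", OF h2]])
  have "(F * G)\<^sup>2 = F\<^sup>2 * G\<^sup>2" by (rule power_mult_distrib)
  also have "\<dots> = (F powr (2 * (1 - \<theta>)) * (\<kappa> powr (2 * \<theta>) * ?a powr \<theta>)) * ?b powr (1 - \<theta>)"
    by (rule arg_cong2[where f = "(*)", OF h12 h3])
  also have "\<dots> = F powr (2 * (1 - \<theta>)) * \<kappa> powr (2 * \<theta>) * (?a powr \<theta> * ?b powr (1 - \<theta>))"
    by (simp only: mult.assoc)
  also have "\<dots> \<le> B powr (2 * (1 - \<theta>)) * \<kappa> powr (2 * \<theta>) * (?a + ?b)"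
    using F F0 \<theta> by (intro mult_mono Y powr_mono2 order_refl) auto
  finally show ?thesis .
qed

text \<open>Hoelder's inequality combined with the interpolation of L_(2/\<theta>) between L2 and
  L_infinity, obtained by integrating \<open>interpolation_pointwise\<close>; for \<theta> = 1 the
  gradient is bounded and the estimate is direct. The summand 1 in the constants serves
  positivity.\<close>

lemma l2_product_interpolation:
  fixes D :: "'a::euclidean_space set"
  assumes \<theta>: "0 < \<theta>" "\<theta> \<le> 1" and A: "0 \<le> A"
  shows "\<exists>C>0. \<forall>f (g :: 'a \<Rightarrow> 'a) \<kappa>. L2 D f \<and> (AE x in lebesgue_on D. \<bar>f x\<bar> \<le> B) \<and> L2 D g \<and> g \<in> Lp_space D (grad_exponent \<theta>) \<and>
     Lp_norm D (grad_exponent \<theta>) g \<le> M \<and> 0 < \<kappa> \<and> l2 D f \<le> A * \<kappa> \<longrightarrow> l2 D (\<lambda>x. f x *\<^sub>R g x) \<le> C * \<kappa> powr \<theta>"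
proof (cases "\<theta> = 1")
  case True
  have "l2 D (\<lambda>x. f x *\<^sub>R g x) \<le> (\<bar>M\<bar> * A + 1) * \<kappa> powr \<theta>"
    if f: "L2 D f" and g: "L2 D g" "g \<in> Lp_space D (grad_exponent \<theta>)" "Lp_norm D (grad_exponent \<theta>) g \<le> M"
      and k: "0 < \<kappa>" "l2 D f \<le> A * \<kappa>" for f and g :: "'a \<Rightarrow> 'a" and \<kappa>
  proof -
    note [measurable] = L2_measurable[OF f] L2_measurable[OF g(1)]
    have g': "g \<in> Lp_space D \<infinity>" "Lp_norm D \<infinity> g \<le> M" using g unfolding True grad_exponent_1 by auto
    have "AE x in lebesgue_on D. norm (f x *\<^sub>R g x) \<le> \<bar>M\<bar> * norm (f x)"
      using Lp_space_infinity_AE[OF g'(1)]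
    proof eventually_elim
      case (elim x)
      then have "norm (g x) \<le> \<bar>M\<bar>" using g'(2) by linarith
      then show ?case using mult_right_mono[of "norm (g x)" "\<bar>M\<bar>" "\<bar>f x\<bar>"] by (simp add: mult.commute)
    qed
    from L2_dominated(2)[OF f _ this] have "l2 D (\<lambda>x. f x *\<^sub>R g x) \<le> \<bar>M\<bar> * l2 D f" by simp
    also have "\<dots> \<le> \<bar>M\<bar> * (A * \<kappa>)" using k by (intro mult_left_mono) auto
    also have "\<dots> \<le> (\<bar>M\<bar> * A + 1) * \<kappa>" using k by (simp add: algebra_simps)
    finally show ?thesis using k True by simp
  qed
  moreover have "\<bar>M\<bar> * A + 1 > 0" using A by (intro add_nonneg_pos mult_nonneg_nonneg) auto
  ultimately show ?thesis by (intro exI[of _ "\<bar>M\<bar> * A + 1"] conjI allI impI) simp_all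
next
  case False
  then have \<theta>1: "\<theta> < 1" using \<theta> by simp
  define p where "p = 2 / (1 - \<theta>)"
  define C where "C = B powr (2 * (1 - \<theta>)) * (A\<^sup>2 + M powr p)"
  have C: "C \<ge> 0" unfolding C_def by (intro mult_nonneg_nonneg add_nonneg_nonneg) auto
  have "l2 D (\<lambda>x. f x *\<^sub>R g x) \<le> (sqrt C + 1) * \<kappa> powr \<theta>"
    if f: "L2 D f" and fB: "AE x in lebesgue_on D. \<bar>f x\<bar> \<le> B" and g: "L2 D g" "g \<in> Lp_space D (grad_exponent \<theta>)" "Lp_norm D (grad_exponent \<theta>) g \<le> M"
      and k: "0 < \<kappa>" "l2 D f \<le> A * \<kappa>" for f and g :: "'a \<Rightarrow> 'a" and \<kappa>
  proof -
    note [measurable] = L2_measurable[OF f] L2_measurable[OF g(1)]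
    have fg: "L2 D (\<lambda>x. f x *\<^sub>R g x)" by (rule L2_scaleR_bounded(1)[OF g(1) _ fB]) measurable
    define K where "K = B powr (2 * (1 - \<theta>)) * \<kappa> powr (2 * \<theta>)"
    have K: "K \<ge> 0" by (simp add: K_def)
    have lin: "ennreal (a * x + b * y) = ennreal a * ennreal x + ennreal b * ennreal y" if "0 \<le> a" "0 \<le> b" "0 \<le> x" "0 \<le> y" for a b x y
      using that by (simp add: ennreal_mult)
    have "ennreal ((l2 D (\<lambda>x. f x *\<^sub>R g x))\<^sup>2) = (\<integral>\<^sup>+x. ennreal ((norm (f x *\<^sub>R g x))\<^sup>2) \<partial>lebesgue_on D)"
      by (rule L2_nn_integral[symmetric, OF fg])
    also have "\<dots> \<le> (\<integral>\<^sup>+x. ennreal (K / \<kappa>\<^sup>2) * ennreal ((norm (f x))\<^sup>2) + ennreal K * ennreal (norm (g x) powr p) \<partial>lebesgue_on D)"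
    proof (rule nn_integral_mono_AE)
      show "AE x in lebesgue_on D. ennreal ((norm (f x *\<^sub>R g x))\<^sup>2) \<le> ennreal (K / \<kappa>\<^sup>2) * ennreal ((norm (f x))\<^sup>2) + ennreal K * ennreal (norm (g x) powr p)"
        using fB
      proof eventually_elim
        case (elim x)
        have "(norm (f x *\<^sub>R g x))\<^sup>2 \<le> K * (\<bar>f x\<bar>\<^sup>2 / \<kappa>\<^sup>2 + norm (g x) powr p)"
          using interpolation_pointwise[OF \<theta>(1) \<theta>1 abs_ge_zero elim norm_ge_zero[of "g x"] k(1)]
          by (simp add: K_def p_def)
        also have "\<dots> = K / \<kappa>\<^sup>2 * (norm (f x))\<^sup>2 + K * norm (g x) powr p" by (simp add: distrib_left)
        finally have "ennreal ((norm (f x *\<^sub>R g x))\<^sup>2) \<le> ennreal (K / \<kappa>\<^sup>2 * (norm (f x))\<^sup>2 + K * norm (g x) powr p)"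
          by (rule ennreal_leI)
        also have "\<dots> = ennreal (K / \<kappa>\<^sup>2) * ennreal ((norm (f x))\<^sup>2) + ennreal K * ennreal (norm (g x) powr p)"
          by (rule lin) (use K in auto)
        finally show ?case .
      qed
    qed
    also have "\<dots> = ennreal (K / \<kappa>\<^sup>2) * ennreal ((l2 D f)\<^sup>2) + ennreal K * (\<integral>\<^sup>+x. ennreal (norm (g x) powr p) \<partial>lebesgue_on D)"
      by (subst nn_integral_add) (auto simp: nn_integral_cmult L2_nn_integral[OF f, simplified])
    also have "\<dots> \<le> ennreal (K / \<kappa>\<^sup>2) * ennreal ((A * \<kappa>)\<^sup>2) + ennreal K * ennreal (M powr p)"
      using grad_exponent_integral[OF \<theta>(1) \<theta>1 g(2,3)] k l2_nonneg[of D f]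
      by (intro add_mono mult_left_mono ennreal_leI power_mono) (auto simp: p_def)
    also have "\<dots> = ennreal (K / \<kappa>\<^sup>2 * (A * \<kappa>)\<^sup>2 + K * M powr p)"
      by (rule lin[symmetric]) (use K in auto)
    also have "K / \<kappa>\<^sup>2 * (A * \<kappa>)\<^sup>2 + K * M powr p = C * (\<kappa> powr \<theta>)\<^sup>2"
    proof -
      have "\<kappa> powr (2 * \<theta>) = (\<kappa> powr \<theta>)\<^sup>2" by (simp add: power2_eq_square powr_add[symmetric])
      moreover have "K / \<kappa>\<^sup>2 * (A * \<kappa>)\<^sup>2 = K * A\<^sup>2" using k by (simp add: power_mult_distrib)
      ultimately show ?thesis unfolding C_def K_def by (simp add: algebra_simps)
    qed
    finally have "(l2 D (\<lambda>x. f x *\<^sub>R g x))\<^sup>2 \<le> C * (\<kappa> powr \<theta>)\<^sup>2"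
      using C by (subst (asm) ennreal_le_iff) auto
    also have "\<dots> = (sqrt C * \<kappa> powr \<theta>)\<^sup>2" using C by (simp add: power_mult_distrib)
    finally have "l2 D (\<lambda>x. f x *\<^sub>R g x) \<le> sqrt C * \<kappa> powr \<theta>" by (rule power2_le_imp_le) (use C in simp)
    also have "\<dots> \<le> (sqrt C + 1) * \<kappa> powr \<theta>" by (intro mult_right_mono) auto
    finally show ?thesis .
  qed
  moreover have "sqrt C + 1 > 0" using C by (intro add_nonneg_pos) auto
  ultimately show ?thesis by (intro exI[of _ "sqrt C + 1"] conjI allI impI) simp_all
qed

text \<open>Where u <= \<epsilon> only the bound \<open>B\<close> is used. Elsewhere \<psi>^2 <= 2
  (\<psi> - w)^2 + 2 w^2, and the weight 1 - 2 logistic is at least 1/3 there, which turns the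
  second 2 into 6.\<close>

lemma square_integral_split:
  fixes D :: "'a::euclidean_space set" and \<psi> w u :: "'a \<Rightarrow> real"
  assumes D: "open D" "bounded D" and m [measurable]: "\<psi> \<in> borel_measurable (lebesgue_on D)" "w \<in> borel_measurable (lebesgue_on D)"
      "u \<in> borel_measurable (lebesgue_on D)"
    and u: "AE x in lebesgue_on D. 0 \<le> u x" and e: "\<epsilon> > 0"
    and \<psi>B: "AE x in lebesgue_on D. \<bar>\<psi> x\<bar> \<le> B" and wB: "AE x in lebesgue_on D. \<bar>w x\<bar> \<le> B"
    and meas: "measure (lebesgue_on D) {x \<in> D. u x \<le> \<epsilon>} \<le> S"
  shows "(l2 D \<psi>)\<^sup>2 \<le> B\<^sup>2 * S + 2 * (l2 D (\<lambda>x. \<psi> x - w x))\<^sup>2 +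
    6 * (\<integral>x. (w x)\<^sup>2 * (1 - 2 * logistic \<epsilon> (u x)) \<partial>lebesgue_on D)"
proof -
  let ?M = "lebesgue_on D" and ?H = "\<lambda>x. 1 - 2 * logistic \<epsilon> (u x)"
  have sp: "space ?M = D" by (simp add: space_restrict_space)
  interpret finite_measure ?M by (rule finite_measure_lebesgue_on_bounded[OF D(2)]) (use D in auto)
  have Sm: "{x \<in> D. u x \<le> \<epsilon>} \<in> sets ?M"
  proof -
    have "{x \<in> space ?M. u x \<le> \<epsilon>} \<in> sets ?M" by measurable
    then show ?thesis unfolding sp .
  qed
  have H: "0 \<le> 1 - 2 * logistic \<epsilon> t" "1 - 2 * logistic \<epsilon> t \<le> 1" if "0 \<le> t" for t
    using logistic_le_half[OF e that] logistic_pos[of \<epsilon> t] by auto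
  have sq: "(x::real)\<^sup>2 \<le> b\<^sup>2" if "\<bar>x\<bar> \<le> b" for x b using power_mono[OF that, of 2] by simp
  have i1: "integrable ?M (\<lambda>x. (\<psi> x)\<^sup>2)"
    by (rule integrable_bounded_lebesgue_on[OF D(2,1), where B = "B\<^sup>2"]) (use \<psi>B in \<open>measurable, auto elim!: eventually_mono intro: sq\<close>)
  have i2: "integrable ?M (\<lambda>x. (w x)\<^sup>2 * ?H x)"
  proof (rule integrable_bounded_lebesgue_on[OF D(2,1), where B = "B\<^sup>2 * 1"])
    show "(\<lambda>x. (w x)\<^sup>2 * ?H x) \<in> borel_measurable ?M" by measurable
    show "AE x in ?M. norm ((w x)\<^sup>2 * ?H x) \<le> B\<^sup>2 * 1"
      using wB u
    proof eventually_elim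
      case (elim x)
      have "\<bar>(w x)\<^sup>2\<bar> * \<bar>?H x\<bar> \<le> B\<^sup>2 * 1"
        by (rule mult_mono) (use sq[OF elim(1)] H[OF elim(2)] in auto)
      then show ?case by (simp add: abs_mult)
    qed
  qed
  have i3: "integrable ?M (\<lambda>x. (\<psi> x - w x)\<^sup>2)"
  proof (rule integrable_bounded_lebesgue_on[OF D(2,1), where B = "(B + B)\<^sup>2"])
    show "(\<lambda>x. (\<psi> x - w x)\<^sup>2) \<in> borel_measurable ?M" by measurable
    show "AE x in ?M. norm ((\<psi> x - w x)\<^sup>2) \<le> (B + B)\<^sup>2"
      using wB \<psi>B
    proof eventually_elim
      case (elim x)
      have "\<bar>\<psi> x - w x\<bar> \<le> B + B" using elim by linarith
      from sq[OF this] show ?case by simp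
    qed
  qed
  have i4: "integrable ?M (\<lambda>x. B\<^sup>2 * indicator {x \<in> D. u x \<le> \<epsilon>} x)"
    by (intro integrable_mult_right integrable_real_indicator Sm) (simp add: emeasure_finite less_top[symmetric])
  have "(l2 D \<psi>)\<^sup>2 = (\<integral>x. (\<psi> x)\<^sup>2 \<partial>?M)" by (simp add: l2_square)
  also have "\<dots> \<le> (\<integral>x. B\<^sup>2 * indicator {x \<in> D. u x \<le> \<epsilon>} x + 2 * (\<psi> x - w x)\<^sup>2 + 6 * ((w x)\<^sup>2 * ?H x) \<partial>?M)"
  proof (rule integral_mono_AE)
    show "integrable ?M (\<lambda>x. B\<^sup>2 * indicator {x \<in> D. u x \<le> \<epsilon>} x + 2 * (\<psi> x - w x)\<^sup>2 + 6 * ((w x)\<^sup>2 * ?H x))"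
      by (intro Bochner_Integration.integrable_add integrable_mult_right i2 i3 i4)
    show "AE x in ?M. (\<psi> x)\<^sup>2 \<le> B\<^sup>2 * indicator {x \<in> D. u x \<le> \<epsilon>} x + 2 * (\<psi> x - w x)\<^sup>2 + 6 * ((w x)\<^sup>2 * ?H x)"
      using u \<psi>B AE_space
    proof eventually_elim
      case (elim x)
      have xD: "x \<in> D" using elim(3) by (simp add: sp)
      have h0: "0 \<le> (w x)\<^sup>2 * ?H x" using H[OF elim(1)] by (intro mult_nonneg_nonneg) auto
      show ?case
      proof (cases "u x \<le> \<epsilon>")
        case True
        then have i: "indicator {x \<in> D. u x \<le> \<epsilon>} x = (1::real)" using xD by simp
        show ?thesis unfolding i using sq[OF elim(2)] h0 zero_le_power2[of "\<psi> x - w x"] by linarith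
      next
        case False
        then have "logistic \<epsilon> (u x) \<le> 1/3" by (intro logistic_le_third[OF e]) simp
        then have "(w x)\<^sup>2 * (1/3) \<le> (w x)\<^sup>2 * ?H x" by (intro mult_left_mono) auto
        moreover have "(\<psi> x)\<^sup>2 \<le> 2 * (\<psi> x - w x)\<^sup>2 + 2 * (w x)\<^sup>2"
          using zero_le_power2[of "\<psi> x - 2 * w x"] by (simp add: power2_eq_square algebra_simps)
        ultimately show ?thesis using False by simp
      qed
    qed
  qed (rule i1)
  also have "\<dots> = B\<^sup>2 * measure ?M {x \<in> D. u x \<le> \<epsilon>} + 2 * (\<integral>x. (\<psi> x - w x)\<^sup>2 \<partial>?M) + 6 * (\<integral>x. (w x)\<^sup>2 * ?H x \<partial>?M)"
  proof -
    have "(\<integral>x. indicator {x \<in> D. u x \<le> \<epsilon>} x \<partial>?M) = measure ?M {x \<in> D. u x \<le> \<epsilon>}"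
    proof -
      have "{x \<in> D. u x \<le> \<epsilon>} \<inter> space ?M = {x \<in> D. u x \<le> \<epsilon>}" by (rule Int_absorb2[OF sets.sets_into_space[OF Sm]])
      then show ?thesis by (simp only: Bochner_Integration.integral_indicator)
    qed
    then show ?thesis using i2 i3 i4 by (simp del: integrable_mult_left_iff integrable_mult_right_iff)
  qed
  also have "\<dots> \<le> B\<^sup>2 * S + 2 * (l2 D (\<lambda>x. \<psi> x - w x))\<^sup>2 + 6 * (\<integral>x. (w x)\<^sup>2 * ?H x \<partial>?M)"
    using meas by (simp add: l2_square mult_left_mono)
  finally show ?thesis .
qed

text \<open>At \<epsilon> = Q^(2/3) both sqrt \<epsilon> and Q/\<epsilon> equal Q^(1/3). The choice
  is admissible for Q <= 1; for larger Q the a priori bound \<open>C4\<close> takes over.\<close>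

lemma optimise_parameter:
  fixes X :: real
  assumes X: "\<And>\<epsilon>. 0 < \<epsilon> \<Longrightarrow> \<epsilon> \<le> 1 \<Longrightarrow> X \<le> C1 * sqrt \<epsilon> + C2 * R + C3 * (Q / \<epsilon>)" and X4: "X \<le> C4"
    and R: "R \<le> Q powr (1/3)" and Q: "0 < Q" and C: "0 \<le> C1" "0 \<le> C2" "0 \<le> C3" "0 \<le> C4"
  shows "X \<le> (C1 + C2 + C3 + C4) * Q powr (1/3)"
proof (cases "Q \<le> 1")
  case True
  let ?e = "Q powr (2/3)"
  have "?e \<le> 1" using True Q by (intro powr_le1) auto
  moreover have "0 < ?e" using Q by simp
  ultimately have "X \<le> C1 * sqrt ?e + C2 * R + C3 * (Q / ?e)" by (intro X)
  moreover have "sqrt ?e = Q powr (1/3)" using Q by (simp add: powr_half_sqrt[symmetric] powr_powr)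
  moreover have "Q / ?e = Q powr (1/3)"
  proof -
    have "Q powr 1 / Q powr (2/3) = Q powr (1/3)" unfolding powr_diff[symmetric] by simp
    then show ?thesis using Q by simp
  qed
  moreover have "C2 * R \<le> C2 * Q powr (1/3)" using R C by (intro mult_left_mono)
  moreover have "0 \<le> C4 * Q powr (1/3)" using C by simp
  ultimately show ?thesis by (simp add: algebra_simps)
next
  case False
  then have "1 \<le> Q powr (1/3)" by (intro ge_one_powr_ge_zero) auto
  then have "C4 * 1 \<le> C4 * Q powr (1/3)" using C by (intro mult_left_mono)
  moreover have "0 \<le> (C1 + C2 + C3) * Q powr (1/3)" using C by simp
  ultimately show ?thesis using X4 by (simp add: algebra_simps)
qed

text \<open>For y = K^(1/(3s)) this is 1 + y^3 <= (1 + y)^3. It converts the power 1/s, which the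
  choice of the smoothing scale produces, into the power 1/(3s) of the final estimate.\<close>

lemma powr_third_subadditive:
  fixes K :: real
  assumes K: "K \<ge> 0" and s: "s > 0"
  shows "(1 + K powr (1 / s)) powr (1/3) \<le> 1 + K powr (1 / (3 * s))"
proof -
  let ?y = "K powr (1 / (3 * s))"
  have "K powr (1 / s) = ?y powr 3" by (simp add: powr_powr)
  also have "\<dots> = ?y ^ 3"
  proof (cases "?y = 0")
    case False
    then have "?y > 0" using powr_ge_zero[of K "1 / (3 * s)"] by linarith
    then show ?thesis using powr_realpow[of ?y 3] by simp
  qed simp
  finally have k: "K powr (1 / s) = ?y ^ 3" .
  have y: "?y \<ge> 0" by simp
  have "1 + ?y ^ 3 \<le> (1 + ?y) ^ 3"
    using y by (simp add: power3_eq_cube algebra_simps)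
  also have "\<dots> = (1 + ?y) powr 3" using y powr_realpow[of "1 + ?y" 3] by (simp add: add_pos_nonneg)
  finally have "(1 + K powr (1 / s)) powr (1/3) \<le> ((1 + ?y) powr 3) powr (1/3)"
    unfolding k using y by (intro powr_mono2) auto
  also have "\<dots> = (1 + ?y) powr 1" unfolding powr_powr by simp
  also have "\<dots> = 1 + ?y" using y by (simp add: add_nonneg_nonneg)
  finally show ?thesis .
qed

text \<open>The scales of the proof are powers of a number in (0,1], whereas the norm of the
  difference of the solutions may be 0 or exceed 1. In the first case the estimate is applied to
  ever smaller E'; if \<open>X\<close> were positive, the E' with E'^e <= X/(2C) would give X <=
  X/2. In the second case the a priori bound suffices.\<close>

lemma powr_bound_limit:
  fixes X E :: real
  assumes X: "\<And>E'. 0 < E' \<Longrightarrow> E' \<le> 1 \<Longrightarrow> E \<le> E' \<Longrightarrow> X \<le> C * E' powr e" and X1: "X \<le> C"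
    and E: "0 \<le> E" and C: "C > 0" and e: "e > 0"
  shows "X \<le> C * E powr e"
proof -
  consider "E > 1" | "0 < E" "E \<le> 1" | "E = 0" using E by linarith
  then show ?thesis
  proof cases
    case 1
    then have "1 \<le> E powr e" using e by (intro ge_one_powr_ge_zero) auto
    then have "C * 1 \<le> C * E powr e" using C by (intro mult_left_mono) auto
    then show ?thesis using X1 by simp
  next
    case 2
    then show ?thesis by (intro X) auto
  next
    case 3
    show ?thesis
    proof (rule ccontr)
      assume "\<not> X \<le> C * E powr e"
      then have X0: "X > 0" using 3 by simp
      define y where "y = X / (2 * C)"
      have y: "y > 0" using X0 C by (simp add: y_def)
      let ?E = "min 1 (y powr (1 / e))"
      have E0: "0 < ?E" using y by simp
      have "X \<le> C * ?E powr e" by (rule X) (use E0 3 in auto)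
      also have "\<dots> \<le> C * (y powr (1 / e)) powr e" using C E0 e by (intro mult_left_mono powr_mono2) auto
      also have "(y powr (1 / e)) powr e = y" using y e by (simp add: powr_powr)
      also have "C * y = X / 2" using C by (simp add: y_def)
      finally show False using X0 by simp
    qed
  qed
qed

subsection \<open>The stability estimate\<close>

text \<open>Almost everywhere bounds become bounds at every point, as
  \<open>gagliardo_energy_quotient\<close> and the sup bound on the function to be regularised
  require.\<close>

lemma clamped_borel_representative:
  fixes a :: "'a::euclidean_space \<Rightarrow> real"
  assumes D: "open D" and a: "a \<in> borel_measurable (lebesgue_on D)" and ab: "AE x in lebesgue_on D. l \<le> a x \<and> a x \<le> L" and l: "l \<le> L"
  obtains a' where "a' \<in> borel_measurable borel" "\<And>x. l \<le> a' x \<and> a' x \<le> L" "AE x in lebesgue_on D. a x = a' x"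
proof -
  have Db: "D \<in> sets borel" using D by simp
  obtain a0 where a0: "a0 \<in> borel_measurable borel" "AE x in lebesgue_on D. a x = a0 x"
    by (rule borel_representative[OF Db a]) (rule that)
  show thesis
  proof (rule that[of "\<lambda>x. min L (max l (a0 x))"])
    show "(\<lambda>x. min L (max l (a0 x))) \<in> borel_measurable borel" using a0(1) by measurable
    show "l \<le> min L (max l (a0 x)) \<and> min L (max l (a0 x)) \<le> L" for x using l by simp
    show "AE x in lebesgue_on D. a x = min L (max l (a0 x))"
      using a0(2) ab by eventually_elim auto
  qed
qed

lemma quotient_deviation_bound:
  fixes a b l L :: real
  assumes "0 < l" "l \<le> a" "a \<le> L" "l \<le> b" "b \<le> L"
  shows "\<bar>1 - b / a\<bar> \<le> L / l"
proof -
  have "\<bar>a - b\<bar> \<le> L" using assms by linarith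
  then have "\<bar>a - b\<bar> / a \<le> L / l" using assms by (intro frac_le) auto
  moreover have "\<bar>1 - b / a\<bar> = \<bar>a - b\<bar> / a"
  proof -
    have "1 - b / a = (a - b) / a" using assms by (simp add: diff_divide_distrib)
    then show ?thesis using assms by simp
  qed
  ultimately show ?thesis by simp
qed

text \<open>The regularisation expressed through its error \<open>\<kappa>\<close> instead of its
  scale: an error \<open>\<kappa>\<close> in L2 costs a gradient of order \<kappa>^(-(1-s)/s). For s
  = 1 the exponent is 0 and the quotient is its own multiplier, with error 0.\<close>

lemma multiplier_near_quotient:
  fixes D :: "'a::euclidean_space set"
  assumes dom: "bounded_lipschitz_domain D" and l: "0 < l" "l \<le> L"
  shows "\<exists>C>0. \<forall>s a b \<kappa>. 0 < s \<and> s \<le> 1 \<and> a \<in> Hs_space D s \<and> b \<in> Hs_space D s \<and>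
      (AE x in lebesgue_on D. l \<le> a x \<and> a x \<le> L) \<and> (AE x in lebesgue_on D. l \<le> b x \<and> b x \<le> L) \<and> 0 < \<kappa> \<and> \<kappa> \<le> 1 \<longrightarrow>
      (\<exists>w p. multiplier D w p \<and> (AE x in lebesgue_on D. \<bar>w x\<bar> \<le> L / l) \<and> l2 D (\<lambda>x. (1 - b x / a x) - w x) \<le> C * \<kappa> \<and>
        l2 D p \<le> C * (\<kappa> powr (- ((1 - s) / s)) * (1 + (Hs_norm D s a + Hs_norm D s b) powr (1 / s))))"
proof -
  have D: "open D" "bounded D" "D \<noteq> {}" and lip: "lipschitz_boundary D" using dom by (auto simp: bounded_lipschitz_domain_def)
  obtain C0 where h0: "C0 > 0 \<and> (\<exists>r0>0. r0 \<le> 1 \<and> (\<forall>s \<psi> B K r. 0 < s \<and> s < 1 \<and> \<psi> \<in> borel_measurable borel \<and> (\<forall>x. x \<notin> D \<longrightarrow> \<psi> x = 0) \<and>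
     (\<forall>x. \<bar>\<psi> x\<bar> \<le> B) \<and> gagliardo_energy D s \<psi> \<le> ennreal (K\<^sup>2) \<and> 0 \<le> K \<and> 0 < r \<and> r \<le> r0 \<longrightarrow>
     (\<exists>w. smooth_fun w \<and> (\<forall>x. \<bar>w x\<bar> \<le> B) \<and> l2 D (\<lambda>x. \<psi> x - w x) \<le> C0 * r powr s * K \<and> l2 D (grad w) \<le> C0 * r powr (s - 1) * K)))"
    using gagliardo_regularisation[OF D lip] by (rule exE)
  have C0: "C0 > 0" by (rule h0[THEN conjunct1])
  from h0[THEN conjunct2] obtain r0 where r0': "r0 > 0 \<and> r0 \<le> 1 \<and> (\<forall>s \<psi> B K r. 0 < s \<and> s < 1 \<and> \<psi> \<in> borel_measurable borel \<and> (\<forall>x. x \<notin> D \<longrightarrow> \<psi> x = 0) \<and>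
     (\<forall>x. \<bar>\<psi> x\<bar> \<le> B) \<and> gagliardo_energy D s \<psi> \<le> ennreal (K\<^sup>2) \<and> 0 \<le> K \<and> 0 < r \<and> r \<le> r0 \<longrightarrow>
     (\<exists>w. smooth_fun w \<and> (\<forall>x. \<bar>w x\<bar> \<le> B) \<and> l2 D (\<lambda>x. \<psi> x - w x) \<le> C0 * r powr s * K \<and> l2 D (grad w) \<le> C0 * r powr (s - 1) * K))"
    by (rule exE)
  have r0: "r0 > 0" "r0 \<le> 1" by (rule r0'[THEN conjunct1], rule r0'[THEN conjunct2, THEN conjunct1])
  note reg = r0'[THEN conjunct2, THEN conjunct2, THEN spec, THEN spec, THEN spec, THEN spec, THEN spec, THEN mp]
  define cK where "cK = sqrt (2 * L\<^sup>2 / l ^ 4)"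
  have cK: "cK \<ge> 0" "cK\<^sup>2 = 2 * L\<^sup>2 / l ^ 4" by (simp_all add: cK_def)
  \<comment> \<open>As r0 <= 1, both r0^s and r0^(s-1) are at most 1/r0, so the first summand is
    independent of \<open>s\<close>; the second is the constant of the case s = 1.\<close>
  define C where "C = C0 * cK / r0 + (L / l\<^sup>2 + 1 / l)"
  have L: "L > 0" using l by simp
  have Cp: "0 \<le> C0 * cK / r0" "0 < L / l\<^sup>2 + 1 / l" using C0 cK r0 l L by (auto intro: add_pos_pos)
  have C: "C > 0" unfolding C_def using Cp by linarith
  have main: "\<exists>w p. multiplier D w p \<and> (AE x in lebesgue_on D. \<bar>w x\<bar> \<le> L / l) \<and> l2 D (\<lambda>x. (1 - b x / a x) - w x) \<le> C * \<kappa> \<and>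
        l2 D p \<le> C * (\<kappa> powr (- ((1 - s) / s)) * (1 + (Hs_norm D s a + Hs_norm D s b) powr (1 / s)))"
    if s: "0 < s" "s \<le> 1" and ab: "a \<in> Hs_space D s" "b \<in> Hs_space D s" and al: "AE x in lebesgue_on D. l \<le> a x \<and> a x \<le> L"
      and bl: "AE x in lebesgue_on D. l \<le> b x \<and> b x \<le> L" and k: "0 < \<kappa>" "\<kappa> \<le> 1" for s a b \<kappa>
  proof (cases "s = 1")
    case True
    have H: "a \<in> H1_space D" "b \<in> H1_space D" using ab True by (simp_all add: Hs_space_def)
    obtain p where p: "multiplier D (\<lambda>x. 1 - b x / a x) p \<and> l2 D p \<le> (L / l\<^sup>2 + 1 / l) * (l2 D (weak_grad D a) + l2 D (weak_grad D b))"
      using multiplier_H1_quotient[OF D(1,2) H l al bl] by (rule exE)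
    have n: "l2 D (weak_grad D c) \<le> Hs_norm D 1 c" if "c \<in> H1_space D" for c
    proof -
      have "sqrt ((l2 D (weak_grad D c))\<^sup>2) \<le> sqrt ((Lp_norm D 2 c)\<^sup>2 + (l2 D (weak_grad D c))\<^sup>2)" by (rule real_sqrt_le_mono) simp
      then show ?thesis by (simp add: Hs_norm_def Lp_norm_2[OF weak_grad_props(3)[OF D(1) that]] l2_nonneg)
    qed
    let ?K = "Hs_norm D 1 a + Hs_norm D 1 b"
    have K: "0 \<le> ?K" using n[OF H(1)] n[OF H(2)] l2_nonneg[of D "weak_grad D a"] l2_nonneg[of D "weak_grad D b"] by linarith
    have "l2 D p \<le> (L / l\<^sup>2 + 1 / l) * (l2 D (weak_grad D a) + l2 D (weak_grad D b))" using p by (rule conjunct2)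
    also have "\<dots> \<le> C * (1 + ?K)"
      using n[OF H(1)] n[OF H(2)] Cp K l2_nonneg[of D "weak_grad D a"] l2_nonneg[of D "weak_grad D b"]
      by (intro mult_mono) (auto simp: C_def)
    finally have pb: "l2 D p \<le> C * (\<kappa> powr (- ((1 - s) / s)) * (1 + (Hs_norm D s a + Hs_norm D s b) powr (1 / s)))"
      using k K True by simp
    have wb: "AE x in lebesgue_on D. \<bar>1 - b x / a x\<bar> \<le> L / l"
      using al bl by eventually_elim (rule quotient_deviation_bound[OF l(1)], auto)
    have z: "l2 D (\<lambda>x. (1 - b x / a x) - (1 - b x / a x)) \<le> C * \<kappa>" using C k by (simp add: l2_def)
    show ?thesis by (rule exI, rule exI, intro conjI) (rule p[THEN conjunct1], rule wb, rule z, rule pb)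
  next
    case False
    then have s1: "s < 1" using s by simp
    have H: "L2 D a" "gagliardo_energy D s a < \<infinity>" "L2 D b" "gagliardo_energy D s b < \<infinity>"
      using ab False by (simp_all add: Hs_space_def Lp_space_2)
    obtain a' where a': "a' \<in> borel_measurable borel" "\<And>x. l \<le> a' x \<and> a' x \<le> L" "AE x in lebesgue_on D. a x = a' x"
      by (rule clamped_borel_representative[OF D(1) L2_measurable[OF H(1)] al l(2)]) (rule that)
    obtain b' where b': "b' \<in> borel_measurable borel" "\<And>x. l \<le> b' x \<and> b' x \<le> L" "AE x in lebesgue_on D. b x = b' x"
      by (rule clamped_borel_representative[OF D(1) L2_measurable[OF H(3)] bl l(2)]) (rule that)
    define \<psi> where "\<psi> x = indicator D x * (1 - b' x / a' x)" for x
    have Db: "D \<in> sets borel" using D(1) by simp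
    have \<psi>m: "\<psi> \<in> borel_measurable borel" unfolding \<psi>_def[abs_def] using a'(1) b'(1) Db by measurable
    have \<psi>0: "\<psi> x = 0" if "x \<notin> D" for x using that by (simp add: \<psi>_def)
    have \<psi>B: "\<bar>\<psi> x\<bar> \<le> L / l" for x
    proof -
      have "\<bar>1 - b' x / a' x\<bar> \<le> L / l" by (rule quotient_deviation_bound[OF l(1)]) (use a'(2) b'(2) in auto)
      moreover have "0 \<le> L / l" using L l by simp
      ultimately show ?thesis by (cases "x \<in> D") (auto simp: \<psi>_def)
    qed
    let ?A = "Hs_norm D s a" and ?B = "Hs_norm D s b"
    have gn: "gagliardo_energy D s c \<le> ennreal ((Hs_norm D s c)\<^sup>2)" if "gagliardo_energy D s c < \<infinity>" for c
    proof -
      have "gagliardo_energy D s c = ennreal (enn2real (gagliardo_energy D s c))" using that by (simp add: less_top[symmetric])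
      also have "\<dots> \<le> ennreal ((Hs_norm D s c)\<^sup>2)" using False by (intro ennreal_leI) (simp add: Hs_norm_def)
      finally show ?thesis .
    qed
    have N0: "0 \<le> ?A" "0 \<le> ?B" by (simp_all add: Hs_norm_def)
    \<comment> \<open>The maximum with 1 ensures \<kappa>/K1 <= 1, which keeps the scale below
      \<open>r0\<close>; afterwards K1^(1/s) is at most 1 plus the power of the norms.\<close>
    define K1 where "K1 = max 1 (?A + ?B)"
    have K1: "1 \<le> K1" "?A + ?B \<le> K1" by (auto simp: K1_def)
    have "gagliardo_energy D s \<psi> = gagliardo_energy D s (\<lambda>x. 1 - b' x / a' x)"
      by (rule gagliardo_energy_cong_AE) (rule AE_lebesgue_on_I, simp add: \<psi>_def)
    also have "\<dots> \<le> ennreal (2 * L\<^sup>2 / l ^ 4) * (gagliardo_energy D s a' + gagliardo_energy D s b')"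
      by (rule gagliardo_energy_quotient[OF D(1) a'(1) b'(1) l(1) a'(2) b'(2)])
    also have "\<dots> = ennreal (2 * L\<^sup>2 / l ^ 4) * (gagliardo_energy D s a + gagliardo_energy D s b)"
      by (simp only: gagliardo_energy_cong_AE[OF a'(3)] gagliardo_energy_cong_AE[OF b'(3)])
    also have "\<dots> \<le> ennreal (2 * L\<^sup>2 / l ^ 4) * (ennreal (?A\<^sup>2) + ennreal (?B\<^sup>2))"
      by (intro mult_left_mono add_mono gn H) simp
    also have "\<dots> = ennreal (cK\<^sup>2 * (?A\<^sup>2 + ?B\<^sup>2))"
      unfolding cK(2)[symmetric] by (simp add: ennreal_mult' ennreal_plus)
    also have "\<dots> \<le> ennreal ((cK * K1)\<^sup>2)"
    proof (rule ennreal_leI)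
      have "?A\<^sup>2 + ?B\<^sup>2 \<le> (?A + ?B)\<^sup>2" using N0 by (simp add: power2_sum)
      also have "\<dots> \<le> K1\<^sup>2" using K1 N0 by (intro power_mono) auto
      finally show "cK\<^sup>2 * (?A\<^sup>2 + ?B\<^sup>2) \<le> (cK * K1)\<^sup>2" by (simp add: power_mult_distrib mult_left_mono)
    qed
    finally have en: "gagliardo_energy D s \<psi> \<le> ennreal ((cK * K1)\<^sup>2)" .
    \<comment> \<open>Chosen so that t^s K1 = \<kappa>. The gradient bound then contains t^(s-1) K1
      = \<kappa>^(-(1-s)/s) K1^(1/s), the source of the power 1/s of the norms.\<close>
    define t where "t = (\<kappa> / K1) powr (1 / s)"
    define r where "r = r0 * t"
    have kK: "0 < \<kappa> / K1" "\<kappa> / K1 \<le> 1" using k K1 by (auto simp: divide_le_eq)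
    have t: "0 < t" "t \<le> 1" using kK s by (auto simp: t_def intro!: powr_le1)
    have r: "0 < r" "r \<le> r0" using r0 t by (auto simp: r_def mult_left_le)
    have K0: "0 \<le> cK * K1" using cK K1 by simp
    have prem: "0 < s \<and> s < 1 \<and> \<psi> \<in> borel_measurable borel \<and> (\<forall>x. x \<notin> D \<longrightarrow> \<psi> x = 0) \<and> (\<forall>x. \<bar>\<psi> x\<bar> \<le> L / l) \<and>
        gagliardo_energy D s \<psi> \<le> ennreal ((cK * K1)\<^sup>2) \<and> 0 \<le> cK * K1 \<and> 0 < r \<and> r \<le> r0"
      by (intro conjI allI impI s(1) s1 \<psi>m \<psi>0 \<psi>B en K0 r)
    obtain w where w': "smooth_fun w \<and> (\<forall>x. \<bar>w x\<bar> \<le> L / l) \<and> l2 D (\<lambda>x. \<psi> x - w x) \<le> C0 * r powr s * (cK * K1) \<and> l2 D (grad w) \<le> C0 * r powr (s - 1) * (cK * K1)"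
      using reg[OF prem] by (rule exE)
    then have w: "smooth_fun w" "\<And>x. \<bar>w x\<bar> \<le> L / l" "l2 D (\<lambda>x. \<psi> x - w x) \<le> C0 * r powr s * (cK * K1)" "l2 D (grad w) \<le> C0 * r powr (s - 1) * (cK * K1)"
      by simp_all
    have ts: "t powr s = \<kappa> / K1" 
    proof -
      have "0 < K1" using K1(1) by linarith
      then show ?thesis using s k(1) by (simp add: t_def powr_powr abs_of_pos)
    qed
    have "C0 * r powr s * (cK * K1) = C0 * cK * (r0 powr s * \<kappa>)"
      unfolding r_def using r0 t K1 by (simp add: powr_mult ts)
    also have "\<dots> \<le> C0 * cK * (1 / r0 * \<kappa>)"
    proof (intro mult_left_mono mult_right_mono)
      have "r0 powr s \<le> 1" using r0 s by (intro powr_le1) auto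
      also have "1 \<le> 1 / r0" using r0 by simp
      finally show "r0 powr s \<le> 1 / r0" .
    qed (use k C0 cK in auto)
    also have "\<dots> \<le> C * \<kappa>"
    proof -
      have "0 \<le> (L / l\<^sup>2 + 1 / l) * \<kappa>" using Cp(2) k(1) by (intro mult_nonneg_nonneg less_imp_le)
      moreover have "C * \<kappa> = C0 * cK / r0 * \<kappa> + (L / l\<^sup>2 + 1 / l) * \<kappa>" unfolding C_def by (rule distrib_right)
      moreover have "C0 * cK * (1 / r0 * \<kappa>) = C0 * cK / r0 * \<kappa>" by simp
      ultimately show ?thesis by linarith
    qed
    finally have e1: "l2 D (\<lambda>x. \<psi> x - w x) \<le> C * \<kappa>" using w(3) by linarith
    have e1': "l2 D (\<lambda>x. (1 - b x / a x) - w x) \<le> C * \<kappa>"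
    proof -
      have "l2 D (\<lambda>x. (1 - b x / a x) - w x) = l2 D (\<lambda>x. \<psi> x - w x)"
      proof (rule L2_cong_AE(2))
        note [measurable] = L2_measurable[OF H(1)] L2_measurable[OF H(3)] continuous_measurable_lebesgue_on[OF smooth_fun_continuous[OF w(1)]]
          borel_measurable_lebesgue_on_borel[OF \<psi>m]
        show "AE x in lebesgue_on D. (1 - b x / a x) - w x = \<psi> x - w x"
          using a'(3) b'(3) AE_in_lebesgue_on[of D] by eventually_elim (simp add: \<psi>_def)
        show "(\<lambda>x. (1 - b x / a x) - w x) \<in> borel_measurable (lebesgue_on D)" "(\<lambda>x. \<psi> x - w x) \<in> borel_measurable (lebesgue_on D)"
          by measurable
      qed
      then show ?thesis using e1 by simp
    qed
    have t1: "t powr (s - 1) * K1 = \<kappa> powr (- ((1 - s) / s)) * K1 powr (1 / s)"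
    proof -
      have "t powr (s - 1) = (\<kappa> / K1) powr (- ((1 - s) / s))" 
      proof -
        have e: "1 / s * (s - 1) = - ((1 - s) / s)" by (simp add: minus_divide_left)
        show ?thesis by (simp only: t_def powr_powr e)
      qed
      also have "\<dots> = \<kappa> powr (- ((1 - s) / s)) * K1 powr ((1 - s) / s)"
        using k K1 by (simp add: powr_divide powr_minus divide_simps)
      finally have "t powr (s - 1) * K1 = \<kappa> powr (- ((1 - s) / s)) * (K1 powr ((1 - s) / s) * K1 powr 1)"
        using K1 by simp
      also have "K1 powr ((1 - s) / s) * K1 powr 1 = K1 powr (1 / s)"
        unfolding powr_add[symmetric] using s by (simp add: field_simps)
      finally show ?thesis .
    qed
    have K1P: "K1 powr (1 / s) \<le> 1 + (?A + ?B) powr (1 / s)"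
      by (simp add: K1_def max_def)
    have "C0 * r powr (s - 1) * (cK * K1) = C0 * cK * (r0 powr (s - 1) * (t powr (s - 1) * K1))"
      unfolding r_def using r0 t by (simp add: powr_mult mult_ac)
    also have "\<dots> \<le> C0 * cK * (1 / r0 * (\<kappa> powr (- ((1 - s) / s)) * (1 + (?A + ?B) powr (1 / s))))"
      unfolding t1
    proof (intro mult_left_mono mult_mono K1P order_refl)
      have "r0 powr (s - 1) \<le> r0 powr (- 1)" using r0 s by (intro powr_mono') auto
      then show "r0 powr (s - 1) \<le> 1 / r0" using r0 by (simp add: powr_minus divide_inverse)
    qed (use r0 C0 cK in auto)
    also have "\<dots> \<le> C * (\<kappa> powr (- ((1 - s) / s)) * (1 + (?A + ?B) powr (1 / s)))"
    proof -
      have "0 \<le> (L / l\<^sup>2 + 1 / l) * (\<kappa> powr (- ((1 - s) / s)) * (1 + (?A + ?B) powr (1 / s)))"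
        using l L by (intro mult_nonneg_nonneg add_nonneg_nonneg) auto
      then show ?thesis unfolding C_def distrib_right by simp
    qed
    finally have e2: "l2 D (grad w) \<le> C * (\<kappa> powr (- ((1 - s) / s)) * (1 + (?A + ?B) powr (1 / s)))"
      using w(4) by linarith
    show ?thesis
      by (rule exI[of _ w], rule exI[of _ "grad w"], intro conjI) (rule multiplier_smooth[OF D(1,2) w(1)], rule AE_I2, rule w(2), rule e1', rule e2)
  qed
  have "\<forall>s a b \<kappa>. 0 < s \<and> s \<le> 1 \<and> a \<in> Hs_space D s \<and> b \<in> Hs_space D s \<and>
      (AE x in lebesgue_on D. l \<le> a x \<and> a x \<le> L) \<and> (AE x in lebesgue_on D. l \<le> b x \<and> b x \<le> L) \<and> 0 < \<kappa> \<and> \<kappa> \<le> 1 \<longrightarrow>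
      (\<exists>w p. multiplier D w p \<and> (AE x in lebesgue_on D. \<bar>w x\<bar> \<le> L / l) \<and> l2 D (\<lambda>x. (1 - b x / a x) - w x) \<le> C * \<kappa> \<and>
        l2 D p \<le> C * (\<kappa> powr (- ((1 - s) / s)) * (1 + (Hs_norm D s a + Hs_norm D s b) powr (1 / s))))"
    by (intro allI impI, elim conjE, rule main)
  then show ?thesis using C by (intro exI[of _ C] conjI)
qed

lemma weak_solution_weak_div:
  fixes D :: "'a::euclidean_space set"
  assumes D: "open D" "bounded D" and a: "a \<in> borel_measurable (lebesgue_on D)" "AE x in lebesgue_on D. 0 \<le> a x \<and> a x \<le> L"
    and f: "f \<in> Lp_space D \<infinity>" and u: "weak_solution D a f u"
  shows "weak_div D (\<lambda>x. a x *\<^sub>R weak_grad D u x) f"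
proof -
  have uH: "u \<in> H1_space D" using u by (simp add: weak_solution_def H10_space_def)
  have fm: "f \<in> borel_measurable (lebesgue_on D)" using f by (simp add: Lp_space_def)
  have "AE x in lebesgue_on D. \<bar>a x\<bar> \<le> L" using a(2) by eventually_elim auto
  then have "L2 D (\<lambda>x. a x *\<^sub>R weak_grad D u x)" by (rule L2_scaleR_bounded(1)[OF weak_grad_props(3)[OF D(1) uH] a(1)])
  moreover have "integrable (lebesgue_on D) f"
    by (rule integrable_bounded_lebesgue_on[OF D(2,1) fm Lp_space_infinity_AE[OF f]])
  ultimately show ?thesis using weak_solution_test[OF D a(1) u] by (simp add: weak_div_def)
qed

text \<open>Combines regularisation, interpolation, the tested identity and the sublevel bound.
  \<open>E\<close> is an upper bound for the gradient difference rather than this difference,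
  because it has to be positive and at most 1 to define the error E^(1/\<theta>) of the
  regularisation.\<close>

lemma coefficient_square_estimate:
  fixes D :: "'a::euclidean_space set"
  assumes dom: "bounded_lipschitz_domain D" and l: "0 < l" "l \<le> L" and c: "0 < c" and \<theta>: "0 < \<theta>" "\<theta> \<le> 1"
  shows "\<exists>C>0. \<forall>f s a b u\<^sub>a u\<^sub>b E. f \<in> Lp_space D \<infinity> \<and> (AE x in lebesgue_on D. c \<le> f x) \<and> 0 < s \<and> s \<le> 1 \<and> (1 - s) / s < \<theta> \<and>
      a \<in> borel_measurable (lebesgue_on D) \<and> b \<in> borel_measurable (lebesgue_on D) \<and> a \<in> Hs_space D s \<and> b \<in> Hs_space D s \<and>
      (AE x in lebesgue_on D. l \<le> a x \<and> a x \<le> L) \<and> (AE x in lebesgue_on D. l \<le> b x \<and> b x \<le> L) \<and>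
      weak_solution D a f u\<^sub>a \<and> weak_solution D b f u\<^sub>b \<and>
      weak_grad D u\<^sub>a \<in> Lp_space D (grad_exponent \<theta>) \<and> Lp_norm D (grad_exponent \<theta>) (weak_grad D u\<^sub>a) \<le> M \<and>
      0 < E \<and> E \<le> 1 \<and> l2 D (\<lambda>x. weak_grad D u\<^sub>a x - weak_grad D u\<^sub>b x) \<le> E \<longrightarrow>
      (l2 D (\<lambda>x. 1 - b x / a x))\<^sup>2 \<le>
        C * (E powr (1 - (1 - s) / (s * \<theta>)) * (1 + (Hs_norm D s a + Hs_norm D s b) powr (1 / s))) powr (1/3)"
proof -
  have D: "open D" "bounded D" and lip: "lipschitz_boundary D" using dom by (auto simp: bounded_lipschitz_domain_def)
  have L: "L > 0" using l by simp
  define B where "B = L / l"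
  have B: "B > 0" using l L by (simp add: B_def)
  obtain C1 where h1: "C1 > 0 \<and> (\<forall>s a b \<kappa>. 0 < s \<and> s \<le> 1 \<and> a \<in> Hs_space D s \<and> b \<in> Hs_space D s \<and>
      (AE x in lebesgue_on D. l \<le> a x \<and> a x \<le> L) \<and> (AE x in lebesgue_on D. l \<le> b x \<and> b x \<le> L) \<and> 0 < \<kappa> \<and> \<kappa> \<le> 1 \<longrightarrow>
      (\<exists>w p. multiplier D w p \<and> (AE x in lebesgue_on D. \<bar>w x\<bar> \<le> L / l) \<and> l2 D (\<lambda>x. (1 - b x / a x) - w x) \<le> C1 * \<kappa> \<and>
        l2 D p \<le> C1 * (\<kappa> powr (- ((1 - s) / s)) * (1 + (Hs_norm D s a + Hs_norm D s b) powr (1 / s)))))"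
    using multiplier_near_quotient[OF dom l] by (rule exE)
  have C1: "C1 > 0" by (rule h1[THEN conjunct1])
  note near = h1[THEN conjunct2, THEN spec, THEN spec, THEN spec, THEN spec, THEN mp]
  let ?one = "\<lambda>_::'a. 1::real"
  have one: "L2 D ?one" by (rule L2_bounded[OF D(2,1), where B = 1]) auto
  obtain C2 where "C2 > 0 \<and> (\<forall>f (g :: 'a \<Rightarrow> 'a) \<kappa>. L2 D f \<and> (AE x in lebesgue_on D. \<bar>f x\<bar> \<le> B + B) \<and> L2 D g \<and> g \<in> Lp_space D (grad_exponent \<theta>) \<and>
     Lp_norm D (grad_exponent \<theta>) g \<le> M \<and> 0 < \<kappa> \<and> l2 D f \<le> C1 * \<kappa> \<longrightarrow> l2 D (\<lambda>x. f x *\<^sub>R g x) \<le> C2 * \<kappa> powr \<theta>)"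
    using l2_product_interpolation[OF \<theta> less_imp_le[OF C1]] by (rule exE)
  then have C2: "C2 > 0" and prod: "\<And>f g \<kappa>. L2 D f \<and> (AE x in lebesgue_on D. \<bar>f x\<bar> \<le> B + B) \<and> L2 D g \<and> g \<in> Lp_space D (grad_exponent \<theta>) \<and>
     Lp_norm D (grad_exponent \<theta>) g \<le> M \<and> 0 < \<kappa> \<and> l2 D f \<le> C1 * \<kappa> \<Longrightarrow> l2 D (\<lambda>x. f x *\<^sub>R (g x :: 'a)) \<le> C2 * \<kappa> powr \<theta>" by simp_all
  \<comment> \<open>Interpolation with f = 1, and later \<kappa> = 1, serves as the embedding of
    L_(2/(1-\<theta>)) into L2 on the bounded set \<open>D\<close>.\<close>
  obtain M1 where "M1 > 0 \<and> (\<forall>f (g :: 'a \<Rightarrow> 'a) \<kappa>. L2 D f \<and> (AE x in lebesgue_on D. \<bar>f x\<bar> \<le> 1) \<and> L2 D g \<and> g \<in> Lp_space D (grad_exponent \<theta>) \<and>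
     Lp_norm D (grad_exponent \<theta>) g \<le> M \<and> 0 < \<kappa> \<and> l2 D f \<le> l2 D ?one * \<kappa> \<longrightarrow> l2 D (\<lambda>x. f x *\<^sub>R g x) \<le> M1 * \<kappa> powr \<theta>)"
    using l2_product_interpolation[OF \<theta> l2_nonneg[of D ?one]] by (rule exE)
  then have M1: "M1 > 0" and prod1: "\<And>f g \<kappa>. L2 D f \<and> (AE x in lebesgue_on D. \<bar>f x\<bar> \<le> 1) \<and> L2 D g \<and> g \<in> Lp_space D (grad_exponent \<theta>) \<and>
     Lp_norm D (grad_exponent \<theta>) g \<le> M \<and> 0 < \<kappa> \<and> l2 D f \<le> l2 D ?one * \<kappa> \<Longrightarrow> l2 D (\<lambda>x. f x *\<^sub>R (g x :: 'a)) \<le> M1 * \<kappa> powr \<theta>" by simp_all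
  obtain Cs where hs: "Cs > 0 \<and> (\<forall>a g F u \<phi> \<epsilon>. weak_div D (\<lambda>x. a x *\<^sub>R g x) F \<and> H10_seq D u g \<phi> \<and>
     (AE x in lebesgue_on D. 0 \<le> a x \<and> a x \<le> L) \<and> (AE x in lebesgue_on D. c \<le> F x) \<and> (AE x in lebesgue_on D. 0 \<le> u x) \<and> 0 < \<epsilon> \<longrightarrow>
     measure (lebesgue_on D) {x \<in> D. u x \<le> \<epsilon>} \<le> Cs * sqrt \<epsilon>)"
    using sublevel_measure[OF D lip c L] by (rule exE)
  have Cs: "Cs > 0" by (rule hs[THEN conjunct1])
  note sublevel = hs[THEN conjunct2, THEN spec, THEN spec, THEN spec, THEN spec, THEN spec, THEN spec, THEN mp]
  define K3 where "K3 = 2 * L * (B * M1 + C1) * (1 + C2) / c"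
  have K3: "K3 > 0" unfolding K3_def using L B M1 C1 C2 c by (intro divide_pos_pos mult_pos_pos add_pos_pos) auto
  define C where "C = B\<^sup>2 * Cs + 2 * C1\<^sup>2 + 6 * K3 + (B * l2 D ?one)\<^sup>2"
  have C: "C > 0" unfolding C_def using B Cs C1 K3 by (intro add_pos_nonneg add_pos_pos) auto
  have main: "(l2 D (\<lambda>x. 1 - b x / a x))\<^sup>2 \<le>
        C * (E powr (1 - (1 - s) / (s * \<theta>)) * (1 + (Hs_norm D s a + Hs_norm D s b) powr (1 / s))) powr (1/3)"
    if f: "f \<in> Lp_space D \<infinity>" "AE x in lebesgue_on D. c \<le> f x" and s: "0 < s" "s \<le> 1" "(1 - s) / s < \<theta>"
      and m: "a \<in> borel_measurable (lebesgue_on D)" "b \<in> borel_measurable (lebesgue_on D)" and H: "a \<in> Hs_space D s" "b \<in> Hs_space D s"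
      and al: "AE x in lebesgue_on D. l \<le> a x \<and> a x \<le> L" and bl: "AE x in lebesgue_on D. l \<le> b x \<and> b x \<le> L"
      and sol: "weak_solution D a f u\<^sub>a" "weak_solution D b f u\<^sub>b"
      and g: "weak_grad D u\<^sub>a \<in> Lp_space D (grad_exponent \<theta>)" "Lp_norm D (grad_exponent \<theta>) (weak_grad D u\<^sub>a) \<le> M"
      and E: "0 < E" "E \<le> 1" "l2 D (\<lambda>x. weak_grad D u\<^sub>a x - weak_grad D u\<^sub>b x) \<le> E" for f s a b u\<^sub>a u\<^sub>b E
  proof -
    let ?ga = "weak_grad D u\<^sub>a" and ?gb = "weak_grad D u\<^sub>b"
    define \<psi> where "\<psi> x = 1 - b x / a x" for x
    have uH: "u\<^sub>a \<in> H10_space D" "u\<^sub>a \<in> H1_space D" "u\<^sub>b \<in> H1_space D" using sol by (simp_all add: weak_solution_def H10_space_def)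
    have Lga: "L2 D ?ga" and Lgb: "L2 D ?gb" and Lua: "L2 D u\<^sub>a"
      by (rule weak_grad_props(3)[OF D(1) uH(2)], rule weak_grad_props(3)[OF D(1) uH(3)], rule weak_grad_props(1)[OF D(1) uH(2)])
    obtain \<phi> where \<phi>: "H10_seq D u\<^sub>a ?ga \<phi>" by (rule H10_seq_exists[OF D uH(1)])
    have a0: "AE x in lebesgue_on D. 0 \<le> a x \<and> a x \<le> L" using al by eventually_elim (use l in auto)
    have b0: "AE x in lebesgue_on D. 0 \<le> b x \<and> b x \<le> L" using bl by eventually_elim (use l in auto)
    have wa: "weak_div D (\<lambda>x. a x *\<^sub>R ?ga x) f" by (rule weak_solution_weak_div[OF D m(1) a0 f(1) sol(1)])
    have wb: "weak_div D (\<lambda>x. b x *\<^sub>R ?gb x) f" by (rule weak_solution_weak_div[OF D m(2) b0 f(1) sol(2)])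
    have u0: "AE x in lebesgue_on D. 0 \<le> u\<^sub>a x"
    proof (rule weak_supersolution_nonneg[OF D wa \<phi>])
      show "AE x in lebesgue_on D. 0 \<le> a x" using a0 by eventually_elim auto
      show "AE x in lebesgue_on D. 0 < f x" using f(2) by eventually_elim (use c in auto)
    qed
    have \<psi>B: "AE x in lebesgue_on D. \<bar>\<psi> x\<bar> \<le> B"
      unfolding \<psi>_def B_def using al bl by eventually_elim (rule quotient_deviation_bound[OF l(1)], auto)
    have \<psi>m: "\<psi> \<in> borel_measurable (lebesgue_on D)" unfolding \<psi>_def[abs_def] using m by measurable
    have \<psi>eq: "AE x in lebesgue_on D. a x - b x = a x * \<psi> x"
      using al by eventually_elim (use l in \<open>auto simp: \<psi>_def right_diff_distrib\<close>)
    define \<gamma> where "\<gamma> = (1 - s) / (s * \<theta>)"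
    have \<gamma>: "0 \<le> \<gamma>" "\<gamma> < 1"
    proof -
      show "0 \<le> \<gamma>" using s \<theta> by (simp add: \<gamma>_def)
      have "(1 - s) / s / \<theta> < 1" unfolding pos_divide_less_eq[OF \<theta>(1)] mult_1 by (rule s(3))
      then show "\<gamma> < 1" unfolding \<gamma>_def by (simp only: divide_divide_eq_left)
    qed
    define P where "P = 1 + (Hs_norm D s a + Hs_norm D s b) powr (1 / s)"
    have P: "P \<ge> 1" by (simp add: P_def)
    define \<kappa> where "\<kappa> = E powr (1 / \<theta>)"
    have k: "0 < \<kappa>" "\<kappa> \<le> 1" using E \<theta> by (auto simp: \<kappa>_def intro: powr_le1)
    have k\<theta>: "\<kappa> powr \<theta> = E" using E \<theta> by (simp add: \<kappa>_def powr_powr)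
    have k\<gamma>: "\<kappa> powr (- ((1 - s) / s)) = E powr (- \<gamma>)" unfolding \<kappa>_def powr_powr by (simp add: \<gamma>_def mult.commute)
    have "\<exists>w p. multiplier D w p \<and> (AE x in lebesgue_on D. \<bar>w x\<bar> \<le> L / l) \<and> l2 D (\<lambda>x. (1 - b x / a x) - w x) \<le> C1 * \<kappa> \<and>
        l2 D p \<le> C1 * (\<kappa> powr (- ((1 - s) / s)) * (1 + (Hs_norm D s a + Hs_norm D s b) powr (1 / s)))"
      by (rule near) (intro conjI s(1) s(2) H al bl k)
    then obtain w p where wp: "multiplier D w p" "AE x in lebesgue_on D. \<bar>w x\<bar> \<le> B" "l2 D (\<lambda>x. \<psi> x - w x) \<le> C1 * \<kappa>"
      "l2 D p \<le> C1 * (E powr (- \<gamma>) * P)"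
      unfolding \<psi>_def[symmetric] B_def[symmetric] P_def[symmetric] k\<gamma> by (elim exE conjE) (rule that)
    have wm: "w \<in> borel_measurable (lebesgue_on D)" using wp(1) by (simp add: multiplier_def)
    have dB: "AE x in lebesgue_on D. \<bar>\<psi> x - w x\<bar> \<le> B + B" using \<psi>B wp(2) by eventually_elim linarith
    have Ld: "L2 D (\<lambda>x. \<psi> x - w x)"
      by (rule L2_bounded[OF D(2,1), where B = "B + B"]) (use \<psi>m wm dB in simp_all)
    have h1: "l2 D (\<lambda>x. (\<psi> x - w x) *\<^sub>R ?ga x) \<le> C2 * E"
    proof -
      have "l2 D (\<lambda>x. (\<psi> x - w x) *\<^sub>R ?ga x) \<le> C2 * \<kappa> powr \<theta>"
        by (rule prod) (intro conjI Ld dB Lga g k(1) wp(3))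
      then show ?thesis by (simp only: k\<theta>)
    qed
    have h2: "l2 D ?ga \<le> M1"
    proof -
      have "l2 D (\<lambda>x. ?one x *\<^sub>R ?ga x) \<le> M1 * 1 powr \<theta>"
        by (rule prod1, intro conjI one Lga g) simp_all
      then show ?thesis by simp
    qed
    define Q where "Q = E powr (1 - \<gamma>) * P"
    have Q0: "Q > 0" using E P by (simp add: Q_def)
    have est: "(l2 D \<psi>)\<^sup>2 \<le> B\<^sup>2 * Cs * sqrt \<epsilon> + 2 * C1\<^sup>2 * \<kappa>\<^sup>2 + 6 * K3 * (Q / \<epsilon>)" if e: "0 < \<epsilon>" "\<epsilon> \<le> 1" for \<epsilon>
    proof -
      let ?I = "\<integral>x. (w x)\<^sup>2 * (1 - 2 * logistic \<epsilon> (u\<^sub>a x)) \<partial>lebesgue_on D"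
      have "c * ?I \<le> 2 * L * (B / (2 * \<epsilon>) * l2 D ?ga + l2 D p) * (l2 D (\<lambda>x. ?ga x - ?gb x) + l2 D (\<lambda>x. (\<psi> x - w x) *\<^sub>R ?ga x))"
        by (rule weighted_difference_estimate[OF D wa wb \<phi> Lgb wp(1) m \<psi>m a0 b0 f(2) less_imp_le[OF c] less_imp_le[OF L] u0 e(1) wp(2) \<psi>B \<psi>eq])
      also have "\<dots> \<le> 2 * L * ((B * M1 + C1) * (E powr (- \<gamma>) * P / \<epsilon>)) * ((1 + C2) * E)"
      proof (rule mult_mono)
        \<comment> \<open>The two parts of the gradient of the test function are of order
          1/\<epsilon> and E^(-\<gamma>) P. Since \<epsilon> <= 1 and E^(-\<gamma>) P >= 1, both are
          absorbed into E^(-\<gamma>) P/\<epsilon>.\<close>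
        have "1 * 1 \<le> E powr (- \<gamma>) * P"
        proof (rule mult_mono)
          have "E powr 0 \<le> E powr (- \<gamma>)" by (rule powr_mono') (use \<gamma> E in auto)
          then show "1 \<le> E powr (- \<gamma>)" using E by simp
        qed (use P in auto)
        define Z where "Z = E powr (- \<gamma>) * P"
        have Z: "1 \<le> Z" using \<open>1 * 1 \<le> E powr (- \<gamma>) * P\<close> by (simp add: Z_def)
        have "B / (2 * \<epsilon>) * l2 D ?ga \<le> B * M1 * (Z / \<epsilon>)"
        proof -
          have "l2 D ?ga \<le> M1 * Z" using mult_left_mono[OF Z less_imp_le[OF M1]] h2 by simp
          then have "B * l2 D ?ga \<le> B * (M1 * Z)" using B by (intro mult_left_mono) auto
          then have "B * l2 D ?ga \<le> B * M1 * Z" by (simp only: mult.assoc)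
          then have "B * l2 D ?ga / \<epsilon> \<le> B * M1 * Z / \<epsilon>" using e by (intro divide_right_mono) auto
          moreover have "B / (2 * \<epsilon>) * l2 D ?ga = B * l2 D ?ga / \<epsilon> / 2" by simp
          moreover have "0 \<le> B * l2 D ?ga / \<epsilon>" using B e l2_nonneg[of D ?ga] by simp
          ultimately show ?thesis by simp
        qed
        moreover have "l2 D p \<le> C1 * (Z / \<epsilon>)"
        proof -
          have "Z \<le> Z / \<epsilon>" using Z e by (simp add: le_divide_eq mult_left_le)
          then have "C1 * Z \<le> C1 * (Z / \<epsilon>)" using C1 by (intro mult_left_mono) auto
          then show ?thesis using wp(4) unfolding Z_def by linarith
        qed
        ultimately have "B / (2 * \<epsilon>) * l2 D ?ga + l2 D p \<le> (B * M1 + C1) * (Z / \<epsilon>)" unfolding distrib_right by linarith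
        then show "2 * L * (B / (2 * \<epsilon>) * l2 D ?ga + l2 D p) \<le> 2 * L * ((B * M1 + C1) * (E powr (- \<gamma>) * P / \<epsilon>))"
          unfolding Z_def using L by (intro mult_left_mono) auto
        show "l2 D (\<lambda>x. ?ga x - ?gb x) + l2 D (\<lambda>x. (\<psi> x - w x) *\<^sub>R ?ga x) \<le> (1 + C2) * E"
          unfolding distrib_right using E(3) h1 by simp
        show "0 \<le> 2 * L * ((B * M1 + C1) * (E powr (- \<gamma>) * P / \<epsilon>))"
          using L B M1 C1 P e by (intro mult_nonneg_nonneg add_nonneg_nonneg divide_nonneg_nonneg) auto
        show "0 \<le> l2 D (\<lambda>x. ?ga x - ?gb x) + l2 D (\<lambda>x. (\<psi> x - w x) *\<^sub>R ?ga x)" by (intro add_nonneg_nonneg l2_nonneg)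
      qed
      also have "\<dots> = c * (K3 * (Q / \<epsilon>))"
      proof -
        have "E powr (- \<gamma>) * E = E powr (1 - \<gamma>)" using E powr_add[of E "- \<gamma>" 1] by simp
        then have q: "E powr (- \<gamma>) * P / \<epsilon> * E = Q / \<epsilon>" by (simp add: Q_def mult_ac)
        have "2 * L * ((B * M1 + C1) * (E powr (- \<gamma>) * P / \<epsilon>)) * ((1 + C2) * E) = 2 * L * (B * M1 + C1) * (1 + C2) * (Q / \<epsilon>)"
          unfolding q[symmetric] by (simp only: mult_ac)
        also have "\<dots> = c * (K3 * (Q / \<epsilon>))" using c by (simp add: K3_def)
        finally show ?thesis .
      qed
      finally have I: "?I \<le> K3 * (Q / \<epsilon>)" using c by (rule mult_left_le_imp_le)
      have S: "measure (lebesgue_on D) {x \<in> D. u\<^sub>a x \<le> \<epsilon>} \<le> Cs * sqrt \<epsilon>"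
        by (rule sublevel) (intro conjI, rule wa, rule \<phi>, rule a0, rule f(2), rule u0, rule e(1))
      have q: "(l2 D (\<lambda>x. \<psi> x - w x))\<^sup>2 \<le> C1\<^sup>2 * \<kappa>\<^sup>2"
        using power_mono[OF wp(3) l2_nonneg, of 2] by (simp add: power_mult_distrib)
      have "(l2 D \<psi>)\<^sup>2 \<le> B\<^sup>2 * (Cs * sqrt \<epsilon>) + 2 * (l2 D (\<lambda>x. \<psi> x - w x))\<^sup>2 + 6 * ?I"
        by (rule square_integral_split[OF D \<psi>m wm L2_measurable[OF Lua] u0 e(1) \<psi>B wp(2) S])
      then show ?thesis using I q by (simp add: mult.assoc)
    qed
    have triv: "(l2 D \<psi>)\<^sup>2 \<le> (B * l2 D ?one)\<^sup>2"
    proof (rule power_mono[OF _ l2_nonneg])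
      show "l2 D \<psi> \<le> B * l2 D ?one"
        by (rule L2_dominated(2)[OF one \<psi>m]) (use \<psi>B B in simp_all)
    qed
    \<comment> \<open>The squared approximation error is E^(2/\<theta>). As E <= 1 and P >= 1, it is
      of lower order than Q^(1/3), because 2/\<theta> >= 2 >= (1 - \<gamma>)/3.\<close>
    have R: "\<kappa>\<^sup>2 \<le> Q powr (1/3)"
    proof -
      have "\<kappa>\<^sup>2 = E powr (2 / \<theta>)" by (simp add: \<kappa>_def power2_eq_square powr_add[symmetric])
      also have "\<dots> \<le> E powr ((1 - \<gamma>) * (1/3))"
      proof (rule powr_mono')
        have "(1 - \<gamma>) * (1/3) \<le> 2" using \<gamma> by simp
        also have "2 \<le> 2 / \<theta>" using \<theta> by (simp add: le_divide_eq)
        finally show "(1 - \<gamma>) * (1/3) \<le> 2 / \<theta>" .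
      qed (use E in auto)
      also have "\<dots> = (E powr (1 - \<gamma>)) powr (1/3)" by (simp add: powr_powr)
      also have "\<dots> \<le> Q powr (1/3)" unfolding Q_def using P by (intro powr_mono2) (auto simp: mult_le_cancel_left1)
      finally show ?thesis .
    qed
    have "(l2 D \<psi>)\<^sup>2 \<le> (B\<^sup>2 * Cs + 2 * C1\<^sup>2 + 6 * K3 + (B * l2 D ?one)\<^sup>2) * Q powr (1/3)"
      by (rule optimise_parameter[OF est triv R Q0]) (use Cs K3 in auto)
    then show ?thesis unfolding C_def Q_def P_def \<gamma>_def \<psi>_def .
  qed
  show ?thesis
    by (rule exI[of _ C], rule conjI, rule C, intro allI impI, elim conjE, rule main)
qed

lemma AE_lebesgue_on_open_False:
  assumes "open D" "D \<noteq> {}"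
  shows "\<not> (AE x in lebesgue_on D. False)"
proof
  assume "AE x in lebesgue_on D. False"
  then have "AE x in lebesgue. x \<notin> D" using assms(1) by (subst (asm) AE_restrict_space_iff) simp_all
  then have "D \<in> null_sets lebesgue" using AE_iff_null_sets[of D lebesgue] assms(1) by simp
  then have "negligible D" by (simp add: negligible_iff_null_sets)
  then show False using open_not_negligible[OF assms] by blast
qed

text \<open>Since a - b = a \<psi>, a factor \<open>L\<close> leads back from the relative to the
  absolute difference, and the square root halves the exponent 1/3 to 1/6. The auxiliary
  \<open>E\<close> is then replaced by the norm of the difference of the solutions through
  \<open>powr_bound_limit\<close>.\<close>

lemma coefficient_stability:
  fixes D :: "'a::euclidean_space set"
  assumes dom: "bounded_lipschitz_domain D" and l: "0 < l" "l \<le> L" and c: "0 < c" and \<theta>: "0 < \<theta>" "\<theta> \<le> 1"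
  shows "\<exists>C>0. \<forall>f s N a b u\<^sub>a u\<^sub>b.
      f \<in> Lp_space D \<infinity> \<and> (AE x in lebesgue_on D. c \<le> f x) \<and>
      0 < s \<and> s \<le> 1 \<and> (1 - s) / s < \<theta> \<and>
      a \<in> Hs_coeff_class D l L s N \<and> b \<in> Hs_coeff_class D l L s N \<and>
      weak_solution D a f u\<^sub>a \<and> weak_solution D b f u\<^sub>b \<and>
      weak_grad D u\<^sub>a \<in> Lp_space D (grad_exponent \<theta>) \<and>
      Lp_norm D (grad_exponent \<theta>) (weak_grad D u\<^sub>a) \<le> M
      \<longrightarrow>
      Lp_norm D 2 (\<lambda>x. a x - b x)
        \<le> C * sqrt (1 + (Hs_norm D s a + Hs_norm D s b) powr (1 / (3 * s)))
            * H10_norm D (\<lambda>x. u\<^sub>a x - u\<^sub>b x) powr (1/6 - (1 - s) / (6 * s * \<theta>))"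
proof -
  have D: "open D" "bounded D" using dom by (auto simp: bounded_lipschitz_domain_def)
  have L: "L > 0" using l by simp
  let ?one = "\<lambda>_::'a. 1::real"
  have one: "L2 D ?one" by (rule L2_bounded[OF D(2,1), where B = 1]) auto
  obtain C0 where h0: "C0 > 0 \<and> (\<forall>f s a b u\<^sub>a u\<^sub>b E. f \<in> Lp_space D \<infinity> \<and> (AE x in lebesgue_on D. c \<le> f x) \<and> 0 < s \<and> s \<le> 1 \<and> (1 - s) / s < \<theta> \<and>
      a \<in> borel_measurable (lebesgue_on D) \<and> b \<in> borel_measurable (lebesgue_on D) \<and> a \<in> Hs_space D s \<and> b \<in> Hs_space D s \<and>
      (AE x in lebesgue_on D. l \<le> a x \<and> a x \<le> L) \<and> (AE x in lebesgue_on D. l \<le> b x \<and> b x \<le> L) \<and>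
      weak_solution D a f u\<^sub>a \<and> weak_solution D b f u\<^sub>b \<and>
      weak_grad D u\<^sub>a \<in> Lp_space D (grad_exponent \<theta>) \<and> Lp_norm D (grad_exponent \<theta>) (weak_grad D u\<^sub>a) \<le> M \<and>
      0 < E \<and> E \<le> 1 \<and> l2 D (\<lambda>x. weak_grad D u\<^sub>a x - weak_grad D u\<^sub>b x) \<le> E \<longrightarrow>
      (l2 D (\<lambda>x. 1 - b x / a x))\<^sup>2 \<le>
        C0 * (E powr (1 - (1 - s) / (s * \<theta>)) * (1 + (Hs_norm D s a + Hs_norm D s b) powr (1 / s))) powr (1/3))"
    using coefficient_square_estimate[OF dom l c \<theta>] by (rule exE)
  have C0: "C0 > 0" by (rule h0[THEN conjunct1])
  note sq = h0[THEN conjunct2, THEN spec, THEN spec, THEN spec, THEN spec, THEN spec, THEN spec, THEN spec, THEN mp]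
  \<comment> \<open>The second summand covers the trivial bound |a - b| <= L, which is used when the
    solutions are far apart.\<close>
  define C where "C = L * sqrt C0 + L * l2 D ?one"
  have LC: "0 < L * sqrt C0" "0 \<le> L * l2 D ?one" using L C0 l2_nonneg[of D ?one] by auto
  have C: "C > 0" unfolding C_def using LC by linarith
  have main: "Lp_norm D 2 (\<lambda>x. a x - b x) \<le> C * sqrt (1 + (Hs_norm D s a + Hs_norm D s b) powr (1 / (3 * s)))
            * H10_norm D (\<lambda>x. u\<^sub>a x - u\<^sub>b x) powr (1/6 - (1 - s) / (6 * s * \<theta>))"
    if f: "f \<in> Lp_space D \<infinity>" "AE x in lebesgue_on D. c \<le> f x" and s: "0 < s" "s \<le> 1" "(1 - s) / s < \<theta>"
      and ab: "a \<in> Hs_coeff_class D l L s N" "b \<in> Hs_coeff_class D l L s N"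
      and sol: "weak_solution D a f u\<^sub>a" "weak_solution D b f u\<^sub>b"
      and g: "weak_grad D u\<^sub>a \<in> Lp_space D (grad_exponent \<theta>)" "Lp_norm D (grad_exponent \<theta>) (weak_grad D u\<^sub>a) \<le> M"
    for f s N a b u\<^sub>a u\<^sub>b
  proof -
    have m: "a \<in> borel_measurable (lebesgue_on D)" "b \<in> borel_measurable (lebesgue_on D)" and H: "a \<in> Hs_space D s" "b \<in> Hs_space D s"
      and al: "AE x in lebesgue_on D. l \<le> a x \<and> a x \<le> L" and bl: "AE x in lebesgue_on D. l \<le> b x \<and> b x \<le> L"
      using ab by (simp_all add: Hs_coeff_class_def coeff_class_def Lp_space_def)
    note [measurable] = m
    have uH: "u\<^sub>a \<in> H1_space D" "u\<^sub>b \<in> H1_space D" using sol by (simp_all add: weak_solution_def H10_space_def)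
    define E0 where "E0 = l2 D (\<lambda>x. weak_grad D u\<^sub>a x - weak_grad D u\<^sub>b x)"
    have E0: "0 \<le> E0" by (simp add: E0_def l2_nonneg)
    have nE: "H10_norm D (\<lambda>x. u\<^sub>a x - u\<^sub>b x) = E0" unfolding E0_def by (rule H10_norm_diff[OF D(1) uH])
    define \<gamma> where "\<gamma> = (1 - s) / (s * \<theta>)"
    have \<gamma>: "\<gamma> < 1"
    proof -
      have "(1 - s) / s / \<theta> < 1" unfolding pos_divide_less_eq[OF \<theta>(1)] mult_1 by (rule s(3))
      then show "\<gamma> < 1" unfolding \<gamma>_def by (simp only: divide_divide_eq_left)
    qed
    have ex: "1/6 - (1 - s) / (6 * s * \<theta>) = (1 - \<gamma>) / 6" using s \<theta> by (simp add: \<gamma>_def field_simps)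
    let ?K = "Hs_norm D s a + Hs_norm D s b"
    have K0: "0 \<le> ?K" by (simp add: Hs_norm_def)
    define T where "T = 1 + ?K powr (1 / (3 * s))"
    have T: "1 \<le> T" "1 \<le> sqrt T" by (simp_all add: T_def)
    have db: "AE x in lebesgue_on D. \<bar>a x - b x\<bar> \<le> L" using al bl by eventually_elim (use l in auto)
    have Ld: "L2 D (\<lambda>x. a x - b x)" by (rule L2_bounded[OF D(2,1), where B = L]) (use db in simp_all)
    let ?X = "l2 D (\<lambda>x. a x - b x)"
    have X1: "?X \<le> C * sqrt T"
    proof -
      have "?X \<le> L * l2 D ?one" by (rule L2_dominated(2)[OF one]) (use db L in simp_all)
      also have "\<dots> \<le> C * 1" using LC by (simp add: C_def)
      also have "\<dots> \<le> C * sqrt T" using C T by (intro mult_left_mono) auto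
      finally show ?thesis .
    qed
    have XE: "?X \<le> C * sqrt T * E powr ((1 - \<gamma>) / 6)" if E: "0 < E" "E \<le> 1" "E0 \<le> E" for E
    proof -
      let ?\<psi> = "\<lambda>x. 1 - b x / a x"
      let ?P = "1 + ?K powr (1 / s)"
      have Y: "(l2 D ?\<psi>)\<^sup>2 \<le> C0 * (E powr (1 - \<gamma>) * ?P) powr (1/3)"
        unfolding \<gamma>_def
        by (rule sq, intro conjI, rule f(1), rule f(2), rule s(1), rule s(2), rule s(3), rule m(1), rule m(2), rule H(1), rule H(2),
            rule al, rule bl, rule sol(1), rule sol(2), rule g(1), rule g(2), rule E(1), rule E(2), rule E(3)[unfolded E0_def])
      also have "(E powr (1 - \<gamma>) * ?P) powr (1/3) = E powr ((1 - \<gamma>) / 3) * ?P powr (1/3)"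
        by (simp add: powr_mult powr_powr)
      also have "C0 * (E powr ((1 - \<gamma>) / 3) * ?P powr (1/3)) \<le> C0 * (E powr ((1 - \<gamma>) / 3) * T)"
        unfolding T_def using C0 by (intro mult_left_mono powr_third_subadditive[OF K0 s(1)]) auto
      also have "\<dots> = (sqrt C0 * sqrt T * E powr ((1 - \<gamma>) / 6))\<^sup>2"
      proof -
        have "(E powr ((1 - \<gamma>) / 6))\<^sup>2 = E powr ((1 - \<gamma>) / 3)" by (simp add: power2_eq_square powr_add[symmetric])
        then show ?thesis using C0 T by (simp add: power_mult_distrib)
      qed
      finally have \<psi>E: "l2 D ?\<psi> \<le> sqrt C0 * sqrt T * E powr ((1 - \<gamma>) / 6)"
        by (rule power2_le_imp_le) (use C0 T in auto)
      have \<psi>B: "AE x in lebesgue_on D. norm (?\<psi> x) \<le> L / l"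
        unfolding real_norm_def using al bl by eventually_elim (rule quotient_deviation_bound[OF l(1)], auto)
      have L\<psi>: "L2 D ?\<psi>" by (rule L2_bounded[OF D(2,1) _ \<psi>B]) measurable
      have "?X \<le> L * l2 D ?\<psi>"
      proof (rule L2_dominated(2)[OF L\<psi>])
        show "(\<lambda>x. a x - b x) \<in> borel_measurable (lebesgue_on D)" by measurable
        show "AE x in lebesgue_on D. norm (a x - b x) \<le> L * norm (?\<psi> x)"
          using al
        proof eventually_elim
          case (elim x)
          have "a x - b x = a x * ?\<psi> x" using elim l by (simp add: right_diff_distrib)
          then have "norm (a x - b x) = a x * norm (?\<psi> x)" using elim l by (simp add: abs_mult)
          also have "\<dots> \<le> L * norm (?\<psi> x)" using elim by (intro mult_right_mono) auto
          finally show ?case .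
        qed
      qed (use L in simp)
      also have "\<dots> \<le> L * (sqrt C0 * sqrt T * E powr ((1 - \<gamma>) / 6))" using L by (intro mult_left_mono \<psi>E) auto
      also have "\<dots> = (L * sqrt C0) * (sqrt T * E powr ((1 - \<gamma>) / 6))" by (simp only: mult.assoc)
      also have "\<dots> \<le> C * (sqrt T * E powr ((1 - \<gamma>) / 6))" using LC T by (intro mult_right_mono mult_nonneg_nonneg) (auto simp: C_def)
      finally show ?thesis by (simp only: mult.assoc)
    qed
    have "?X \<le> C * sqrt T * E0 powr ((1 - \<gamma>) / 6)"
    proof (rule powr_bound_limit[OF XE X1 E0])
      show "C * sqrt T > 0" using C T by (intro mult_pos_pos) auto
      show "(1 - \<gamma>) / 6 > 0" using \<gamma> by simp
    qed
    then show ?thesis unfolding Lp_norm_2[OF Ld] nE ex T_def .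
  qed
  show ?thesis
    by (rule exI[of _ C], rule conjI, rule C, intro allI impI, elim conjE, rule main)
qed

theorem theorem4p3:
  fixes D :: "(real ^ 'n) set" and l L \<theta> c\<^sub>f F M :: real
  assumes dim: "CARD('n) \<ge> 2"
    and dom: "bounded_lipschitz_domain D"
    and "0 < l" "0 < L" "0 < c\<^sub>f"
  shows "\<exists>C>0. \<forall>f s N a b u\<^sub>a u\<^sub>b.
      f \<in> Lp_space D \<infinity> \<and> (AE x in lebesgue_on D. c\<^sub>f \<le> f x) \<and> Lp_norm D \<infinity> f = F \<and>
      1/2 < s \<and> s \<le> 1 \<and> (1 - s) / s < \<theta> \<and> \<theta> \<le> 1 \<and> 0 < N \<and>
      a \<in> Hs_coeff_class D l L s N \<and> b \<in> Hs_coeff_class D l L s N \<and>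
      weak_solution D a f u\<^sub>a \<and> weak_solution D b f u\<^sub>b \<and>
      weak_grad D u\<^sub>a \<in> Lp_space D (grad_exponent \<theta>) \<and>
      Lp_norm D (grad_exponent \<theta>) (weak_grad D u\<^sub>a) \<le> M \<and>
      weak_grad D u\<^sub>b \<in> Lp_space D (grad_exponent \<theta>) \<and>
      Lp_norm D (grad_exponent \<theta>) (weak_grad D u\<^sub>b) \<le> M
      \<longrightarrow>
      Lp_norm D 2 (\<lambda>x. a x - b x)
        \<le> C * sqrt (1 + (Hs_norm D s a + Hs_norm D s b) powr (1 / (3 * s)))
            * H10_norm D (\<lambda>x. u\<^sub>a x - u\<^sub>b x) powr (1/6 - (1 - s) / (6 * s * \<theta>))"
proof (cases "l \<le> L \<and> 0 < \<theta> \<and> \<theta> \<le> 1")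
  case True
  then have lL: "l \<le> L" and \<theta>: "0 < \<theta>" "\<theta> \<le> 1" by auto
  show ?thesis
  proof (rule exE[OF coefficient_stability[OF dom assms(3) lL assms(5) \<theta>, of M]])
    fix C
    assume C: "C > 0 \<and> (\<forall>f s N a b u\<^sub>a u\<^sub>b.
      f \<in> Lp_space D \<infinity> \<and> (AE x in lebesgue_on D. c\<^sub>f \<le> f x) \<and>
      0 < s \<and> s \<le> 1 \<and> (1 - s) / s < \<theta> \<and>
      a \<in> Hs_coeff_class D l L s N \<and> b \<in> Hs_coeff_class D l L s N \<and>
      weak_solution D a f u\<^sub>a \<and> weak_solution D b f u\<^sub>b \<and>
      weak_grad D u\<^sub>a \<in> Lp_space D (grad_exponent \<theta>) \<and>
      Lp_norm D (grad_exponent \<theta>) (weak_grad D u\<^sub>a) \<le> M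
      \<longrightarrow>
      Lp_norm D 2 (\<lambda>x. a x - b x)
        \<le> C * sqrt (1 + (Hs_norm D s a + Hs_norm D s b) powr (1 / (3 * s)))
            * H10_norm D (\<lambda>x. u\<^sub>a x - u\<^sub>b x) powr (1/6 - (1 - s) / (6 * s * \<theta>)))"
    show ?thesis
      by (rule exI[of _ C], rule conjI, rule C[THEN conjunct1], intro allI impI, elim conjE,
          rule C[THEN conjunct2, rule_format]) (intro conjI, assumption+, linarith, assumption+)
  qed
next
  case False
  have D: "open D" "D \<noteq> {}" using dom by (auto simp: bounded_lipschitz_domain_def)
  \<comment> \<open>\<open>C\<close> is chosen when only the parameters are known, so inconsistent
    parameters must be covered too. An admissible \<theta> is positive because (1-s)/s >= 0; hence
    the failing condition is l <= L, and then no coefficient exists on the nonempty open set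
    \<open>D\<close>. Any \<open>C\<close> will do.\<close>
  have contra: "False" if "1/2 < s" "s \<le> 1" "(1 - s) / s < \<theta>" "\<theta> \<le> 1" "a \<in> Hs_coeff_class D l L s N" for s N a
  proof -
    have "0 \<le> (1 - s) / s" using that by simp
    then have "\<not> l \<le> L" using False that by linarith
    moreover have "AE x in lebesgue_on D. l \<le> a x \<and> a x \<le> L" using that by (simp add: Hs_coeff_class_def coeff_class_def)
    ultimately have "AE x in lebesgue_on D. False" by (auto elim: eventually_mono)
    then show False using AE_lebesgue_on_open_False[OF D] by contradiction
  qed
  show ?thesis
    by (rule exI[of _ 1], rule conjI, rule zero_less_one, intro allI impI, elim conjE, rule FalseE, rule contra) assumption+
qed

end
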